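(* Let $\alpha\in(0,1]$, and let $\Phi$ be a Young function which is of lower type $p_0$ and of upper type $p_1$ with $1<p_0\le p_1<\infty$. Let $\varphi_1,\varphi_2$ be positive measurable functions on $\mathbb{R}^n\times(0,\infty)$ such that there is a constant $C$, independent of $x$ and $r$, with $$\int_{r}^{\infty} \Big(\operatorname*{ess\,inf}_{t<s<\infty}\frac{\varphi_1(x,s)}{\Phi^{-1}(s^{-n})}\Big)\, \Phi^{-1}(t^{-n})\,\frac{dt}{t} \le C \, \varphi_2(x,r)\qquad\text{for all }x\in\mathbb{R}^n,\ r>0.$$ Then $G_{\alpha}$ is bounded from $M^{\Phi,\varphi_1}(\mathbb{R}^n)$ to $M^{\Phi,\varphi_2}(\mathbb{R}^n)$, i.e. there is a constant $C'$ such that $\|G_\alpha f\|_{M^{\Phi,\varphi_2}}\le C'\|f\|_{M^{\Phi,\varphi_1}}$ for all $f\in M^{\Phi,\varphi_1}(\mathbb{R}^n)$.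
   Context: A Young function is a convex, left-continuous $\Phi:[0,\infty)\to[0,\infty]$ with $\lim_{r\to+0}\Phi(r)=\Phi(0)=0$ and $\lim_{r\to\infty}\Phi(r)=\infty$. Its generalized inverse is $\Phi^{-1}(s)=\inf\{r\ge 0:\Phi(r)>s\}$ ($\inf\emptyset=+\infty$). $\Phi$ is of upper type $p$ (resp. lower type $p$) if there is a positive constant $C$ such that $\Phi(st)\le Ct^p\Phi(s)$ for all $t\in[1,\infty)$ (resp. $t\in[0,1]$) and all $s\in[0,\infty)$. Luxemburg norm: $\|f\|_{L^{\Phi}}=\inf\{\lambda>0:\int_{\mathbb{R}^n}\Phi(|f(x)|/\lambda)\,dx\le 1\}$. For a ball $B$, $\|f\|_{L^\Phi(B)}=\|f\chi_B\|_{L^\Phi}$. $L^\Phi_{\rm loc}(\mathbb{R}^n)$ is the set of $f$ with $f\chi_B\in L^\Phi(\mathbb{R}^n)$ for every ball $B$, where $L^\Phi(\mathbb{R}^n)$ is the set of locally integrable $f$ with $\int_{\mathbb{R}^n}\Phi(k|f|)<\infty$ for some $k>0$. $B(x,r)$ is the ball of center $x$ and radius $r$. Generalized Orlicz-Morrey space: for a positive measurable $\varphi$ on $\mathbb{R}^n\times(0,\infty)$, $M^{\Phi,\varphi}(\mathbb{R}^n)$ is the set of $f\in L^\Phi_{\rm loc}(\mathbb{R}^n)$ with $\|f\|_{M^{\Phi,\varphi}}=\sup_{x\in\mathbb{R}^n,r>0}\varphi(x,r)^{-1}\Phi^{-1}(r^{-n})\|f\|_{L^\Phi(B(x,r))}<\infty$.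 Intrinsic square function: for $0<\alpha\le1$, $C_\alpha$ is the family of $\phi:\mathbb{R}^n\to\mathbb{R}$ supported in $\{|x|\le1\}$ with $\int\phi\,dx=0$ and $|\phi(x)-\phi(x')|\le|x-x'|^\alpha$ for all $x,x'\in\mathbb{R}^n$. Put $\phi_t(y)=t^{-n}\phi(y/t)$. For $f\in L^1_{\rm loc}(\mathbb{R}^n)$ and $(y,t)\in\mathbb{R}^n\times(0,\infty)$ let $A_\alpha f(t,y)=\sup_{\phi\in C_\alpha}|f*\phi_t(y)|$, and $$G_\alpha f(x)=\Big(\iint_{\Gamma(x)}(A_\alpha f(t,y))^2\frac{dy\,dt}{t^{n+1}}\Big)^{1/2},\quad \Gamma(x)=\{(y,t)\in\mathbb{R}^n\times(0,\infty):|x-y|<t\}.$$ *)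

theory Defs
  imports "HOL-Analysis.Analysis"
begin

(* The space R^n is a type 'a::euclidean_space with n = DIM('a). A function on [0,\<infinity>) is a
   function on real whose values at negative arguments are never used. *)

definition young_function :: "(real \<Rightarrow> ennreal) \<Rightarrow> bool" where
  "young_function \<Phi> \<longleftrightarrow>
     (\<forall>x\<ge>0. \<forall>y\<ge>0. \<forall>u\<in>{0..1}.
        \<Phi> ((1 - u) * x + u * y) \<le> ennreal (1 - u) * \<Phi> x + ennreal u * \<Phi> y) \<and>
     (\<forall>r>0. (\<Phi> \<longlongrightarrow> \<Phi> r) (at_left r)) \<and>
     \<Phi> 0 = 0 \<and> (\<Phi> \<longlongrightarrow> 0) (at_right 0) \<and> (\<Phi> \<longlongrightarrow> \<infinity>) at_top"

definition gen_inverse :: "(real \<Rightarrow> ennreal) \<Rightarrow> real \<Rightarrow> ennreal" where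
  "gen_inverse \<Phi> s = (INF r\<in>{r. 0 \<le> r \<and> ennreal s < \<Phi> r}. ennreal r)"

definition upper_type :: "real \<Rightarrow> (real \<Rightarrow> ennreal) \<Rightarrow> bool" where
  "upper_type p \<Phi> \<longleftrightarrow>
     (\<exists>C>0. \<forall>t\<ge>1. \<forall>s\<ge>0. \<Phi> (s * t) \<le> ennreal (C * t powr p) * \<Phi> s)"

definition lower_type :: "real \<Rightarrow> (real \<Rightarrow> ennreal) \<Rightarrow> bool" where
  "lower_type p \<Phi> \<longleftrightarrow>
     (\<exists>C>0. \<forall>t\<in>{0..1}. \<forall>s\<ge>0. \<Phi> (s * t) \<le> ennreal (C * t powr p) * \<Phi> s)"

definition luxemburg_norm ::
  "(real \<Rightarrow> ennreal) \<Rightarrow> ('a::euclidean_space \<Rightarrow> 'b::{banach, second_countable_topology}) \<Rightarrow> ennreal"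
  where "luxemburg_norm \<Phi> f =
    (INF l\<in>{l. 0 < l \<and> (\<integral>\<^sup>+x. \<Phi> (norm (f x) / l) \<partial>lebesgue) \<le> 1}. ennreal l)"

definition luxemburg_norm_on ::
  "(real \<Rightarrow> ennreal) \<Rightarrow> 'a set \<Rightarrow>
    ('a::euclidean_space \<Rightarrow> 'b::{banach, second_countable_topology}) \<Rightarrow> ennreal"
  where "luxemburg_norm_on \<Phi> B f = luxemburg_norm \<Phi> (\<lambda>x. indicator B x *\<^sub>R f x)"

definition locally_integrable ::
  "('a::euclidean_space \<Rightarrow> 'b::{banach, second_countable_topology}) \<Rightarrow> bool" where
  "locally_integrable f \<longleftrightarrow>
     f \<in> borel_measurable lebesgue \<and> (\<forall>K. compact K \<longrightarrow> set_integrable lebesgue K f)"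

definition orlicz_space ::
  "(real \<Rightarrow> ennreal) \<Rightarrow> ('a::euclidean_space \<Rightarrow> 'b::{banach, second_countable_topology}) set" where
  "orlicz_space \<Phi> =
     {f. locally_integrable f \<and> (\<exists>k>0. (\<integral>\<^sup>+x. \<Phi> (k * norm (f x)) \<partial>lebesgue) < \<infinity>)}"

definition orlicz_space_loc ::
  "(real \<Rightarrow> ennreal) \<Rightarrow> ('a::euclidean_space \<Rightarrow> 'b::{banach, second_countable_topology}) set" where
  "orlicz_space_loc \<Phi> =
     {f. \<forall>x. \<forall>r>0. (\<lambda>y. indicator (ball x r) y *\<^sub>R f y) \<in> orlicz_space \<Phi>}"

definition morrey_norm ::
  "(real \<Rightarrow> ennreal) \<Rightarrow> ('a \<Rightarrow> real \<Rightarrow> real) \<Rightarrow>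
    ('a::euclidean_space \<Rightarrow> 'b::{banach, second_countable_topology}) \<Rightarrow> ennreal"
  where "morrey_norm \<Phi> \<phi> f =
    (SUP x. SUP r\<in>{0<..}. inverse (ennreal (\<phi> x r)) * gen_inverse \<Phi> (1 / r ^ DIM('a))
       * luxemburg_norm_on \<Phi> (ball x r) f)"

definition morrey_space ::
  "(real \<Rightarrow> ennreal) \<Rightarrow> ('a \<Rightarrow> real \<Rightarrow> real) \<Rightarrow>
    ('a::euclidean_space \<Rightarrow> 'b::{banach, second_countable_topology}) set"
  where "morrey_space \<Phi> \<phi> = {f \<in> orlicz_space_loc \<Phi>. morrey_norm \<Phi> \<phi> f < \<infinity>}"

definition weight :: "('a::euclidean_space \<Rightarrow> real \<Rightarrow> real) \<Rightarrow> bool" where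
  "weight \<phi> \<longleftrightarrow>
     (\<forall>x. \<forall>r>0. 0 < \<phi> x r) \<and>
     (\<lambda>(x, r). \<phi> x r) \<in> borel_measurable (lebesgue_on (UNIV \<times> {0<..}))"

(* The counterpart of esssup, i.e. the supremum of all c with c \<le> f almost everywhere. A section
   of a Lebesgue measurable weight need not be measurable, so f is not required to be. *)
definition essinf :: "'a measure \<Rightarrow> ('a \<Rightarrow> ennreal) \<Rightarrow> ennreal" where
  "essinf M f = Liminf (ae_filter M) f"

definition C_class :: "real \<Rightarrow> ('a::euclidean_space \<Rightarrow> real) set" where
  "C_class \<alpha> = {\<phi>. (\<forall>x. 1 < norm x \<longrightarrow> \<phi> x = 0) \<and> (\<integral>x. \<phi> x \<partial>lebesgue) = 0 \<and>
                    (\<forall>x x'. \<bar>\<phi> x - \<phi> x'\<bar> \<le> norm (x - x') powr \<alpha>)}"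

definition dilate :: "real \<Rightarrow> ('a::euclidean_space \<Rightarrow> real) \<Rightarrow> 'a \<Rightarrow> real" where
  "dilate t \<phi> y = \<phi> (y /\<^sub>R t) / t ^ DIM('a)"

definition convol ::
  "('a::euclidean_space \<Rightarrow> 'b::{banach, second_countable_topology}) \<Rightarrow> ('a \<Rightarrow> real) \<Rightarrow> 'a \<Rightarrow> 'b" where
  "convol f g y = (\<integral>z. g (y - z) *\<^sub>R f z \<partial>lebesgue)"

definition A_fun ::
  "real \<Rightarrow> ('a::euclidean_space \<Rightarrow> 'b::{banach, second_countable_topology}) \<Rightarrow> real \<Rightarrow> 'a \<Rightarrow> ennreal"
  where "A_fun \<alpha> f t y = (SUP \<phi>\<in>C_class \<alpha>. ennreal (norm (convol f (dilate t \<phi>) y)))"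

definition cone :: "'a::euclidean_space \<Rightarrow> ('a \<times> real) set" where
  "cone x = {(y, t). 0 < t \<and> norm (x - y) < t}"

definition ennreal_sqrt :: "ennreal \<Rightarrow> ennreal" where
  "ennreal_sqrt c = (if c = \<infinity> then \<infinity> else ennreal (sqrt (enn2real c)))"

definition square_function ::
  "real \<Rightarrow> ('a::euclidean_space \<Rightarrow> 'b::{banach, second_countable_topology}) \<Rightarrow> 'a \<Rightarrow> ennreal"
  where "square_function \<alpha> f x =
    ennreal_sqrt (\<integral>\<^sup>+p\<in>cone x. (case p of (y, t) \<Rightarrow> (A_fun \<alpha> f t y)\<^sup>2 / ennreal (t ^ (DIM('a) + 1))) \<partial>lebesgue)"

end

theory Submission
  imports Defs
begin

text \<open>
  Write \<open>A\<close> for \<open>A_fun\<close> and \<open>n\<close> for the dimension. The \<open>L\<^sup>2\<close> bound of \<open>A\<close> for the measure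
  \<open>dy dt / t\<close> follows from the \<open>T T\<^sup>*\<close> method: after a measurable choice of the test function at
  each \<open>(y, t)\<close>, cancellation and Hoelder continuity bound the kernel of \<open>T T\<^sup>*\<close> by
  \<open>min (t / t') (t' / t) powr \<alpha> / max t t' ^ n\<close> on \<open>|y - y'| < t + t'\<close>, which passes Schur's test.
  Integrating the square of the square function over its own level set, and splitting \<open>(y, t)\<close>
  by the density of that set in \<open>ball y t\<close>, turns this into weak type \<open>(q, q)\<close> for arbitrarily
  large \<open>q\<close>; a Calderon-Zygmund decomposition on Vitali cells gives weak type \<open>(1, 1)\<close>.
  Marcinkiewicz interpolation between \<open>1\<close> and \<open>q\<close> yields the modular inequality
  \<open>\<integral> \<Phi> (G f) \<le> C \<integral> \<Phi> |f|\<close>, as \<open>\<Phi>\<close> has lower type above \<open>1\<close> and upper type below \<open>q\<close>.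

  On \<open>ball x\<^sub>0 r\<close> the part of \<open>f\<close> inside \<open>ball x\<^sub>0 (2 r)\<close> is controlled by the modular inequality and
  the rest by a pointwise estimate, so that \<open>\<Phi>\<^sup>-\<^sup>1(r\<^sup>-\<^sup>n)\<close> times the norm of \<open>G f\<close> on the ball is at most
  a multiple of the integral over \<open>t > r\<close> of the norm of \<open>f\<close> on \<open>ball x\<^sub>0 t\<close> times
  \<open>\<Phi>\<^sup>-\<^sup>1(t\<^sup>-\<^sup>n) / t\<close>. The norm of \<open>f\<close> on \<open>ball x\<^sub>0 t\<close> increases with \<open>t\<close>, hence is at most the Morrey
  norm times the essential infimum in the hypothesis.
\<close>

section \<open>Test functions and the maximal function of their convolutions\<close>

text \<open>The supremum in \<open>A_fun\<close> is taken separately at every \<open>(y, t)\<close>,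
  so the operator is not linear and Plancherel's theorem does not apply. After linearisation the
  kernel has no regularity in \<open>(y, t)\<close>; smoothness and cancellation in the integration
  variable survive, and these are enough because the kernel of \<open>T T\<^sup>*\<close> is an
  integral in that variable alone. The square estimate by itself does not reach
  \<open>\<Phi>\<close>: the exponents \<open>p0\<close> and \<open>p1\<close> may lie anywhere
  between 1 and infinity. Hence one weak estimate at 1 and one beyond \<open>p1\<close>. The result
  is stated for modulars because a modular inequality passes to Luxemburg norms by rescaling
  \<open>f\<close>. A function of a Morrey space is in general integrable only on balls. The basic
  objects are therefore Borel functions with this property (\<open>locint\<close>), for which
  Tonelli's theorem works on \<open>lborel\<close> without completions; a Lebesgue measurable
  \<open>f\<close> is exchanged for a Borel representative at the very end.\<close>

definition locint :: "('a::euclidean_space \<Rightarrow> 'b::euclidean_space) \<Rightarrow> bool" where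
  "locint f \<longleftrightarrow> f \<in> borel_measurable borel \<and>
     (\<forall>c r. integrable lborel (\<lambda>z. indicator (ball c r) z *\<^sub>R f z))"

lemma locint_measurable[measurable_dest]: "locint f \<Longrightarrow> f \<in> borel_measurable borel"
  by (simp add: locint_def)

lemma locint_ball: "locint f \<Longrightarrow> integrable lborel (\<lambda>z. indicator (ball c r) z *\<^sub>R f z)"
  by (simp add: locint_def)

lemma integrable_imp_locint:
  fixes f :: "'a::euclidean_space \<Rightarrow> 'b::euclidean_space"
  assumes "integrable lborel f" shows "locint f"
  unfolding locint_def
proof safe
  show "f \<in> borel_measurable borel" using assms by auto
  fix c r
  show "integrable lborel (\<lambda>z. indicator (ball c r) z *\<^sub>R f z)"
    using integrable_mult_indicator[OF _ assms, of "ball c r"] by simp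
qed

lemma locint_indicator:
  fixes f :: "'a::euclidean_space \<Rightarrow> 'b::euclidean_space"
  assumes "locint f" "E \<in> sets borel" shows "locint (\<lambda>z. indicator E z *\<^sub>R f z)"
  unfolding locint_def
proof safe
  note [measurable] = assms(2) locint_measurable[OF assms(1)]
  show "(\<lambda>z. indicator E z *\<^sub>R f z) \<in> borel_measurable borel" by measurable
  fix c r
  have "integrable lborel (\<lambda>z. indicator E z *\<^sub>R (indicator (ball c r) z *\<^sub>R f z))"
    using integrable_mult_indicator[OF _ locint_ball[OF assms(1)], of E c r] assms(2) by simp
  then show "integrable lborel (\<lambda>z. indicator (ball c r) z *\<^sub>R (indicator E z *\<^sub>R f z))"
    by (simp add: mult.commute)
qed

lemma integrable_ball_bounded_mult:
  fixes f :: "'a::euclidean_space \<Rightarrow> 'b::euclidean_space" and k :: "'a \<Rightarrow> real"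
  assumes f: "locint f" and k: "k \<in> borel_measurable borel"
    and b: "\<And>z. \<bar>k z\<bar> \<le> C * indicator (ball c r) z" 
  shows "integrable lborel (\<lambda>z. k z *\<^sub>R f z)"
proof (rule Bochner_Integration.integrable_bound[of _ "\<lambda>z. C *\<^sub>R (indicator (ball c r) z *\<^sub>R f z)"])
  show "integrable lborel (\<lambda>z. C *\<^sub>R (indicator (ball c r) z *\<^sub>R f z))"
    by (intro integrable_scaleR_right locint_ball[OF f])
  note [measurable] = k locint_measurable[OF f]
  show "(\<lambda>z. k z *\<^sub>R f z) \<in> borel_measurable lborel" by measurable
  have "norm (k z *\<^sub>R f z) \<le> norm (C *\<^sub>R (indicator (ball c r) z *\<^sub>R f z))" for z
  proof -
    have "\<bar>k z\<bar> * norm (f z) \<le> \<bar>C * indicator (ball c r) z\<bar> * norm (f z)"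
      using b[of z] by (intro mult_right_mono) auto
    then show ?thesis by (simp add: abs_mult mult.assoc)
  qed
  then show "AE z in lborel. norm (k z *\<^sub>R f z) \<le> norm (C *\<^sub>R (indicator (ball c r) z *\<^sub>R f z))"
    by simp
qed

section \<open>Size, smoothness and cancellation of the dilated test functions\<close>

lemma C_classD:
  assumes "\<phi> \<in> C_class \<alpha>"
  shows "1 < norm x \<Longrightarrow> \<phi> x = 0" "(\<integral>x. \<phi> x \<partial>lebesgue) = 0"
    "\<bar>\<phi> x - \<phi> x'\<bar> \<le> norm (x - x') powr \<alpha>"
  using assms by (auto simp: C_class_def)

lemma zero_in_C_class: "(\<lambda>x. 0) \<in> C_class \<alpha>"
  by (auto simp: C_class_def)

lemma C_class_continuous:
  fixes \<phi> :: "'a::euclidean_space \<Rightarrow> real"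
  assumes "\<phi> \<in> C_class \<alpha>" "0 < \<alpha>"
  shows "continuous_on UNIV \<phi>"
  unfolding continuous_on_iff
proof (intro ballI allI impI)
  fix x and e :: real assume e: "e > 0"
  show "\<exists>d>0. \<forall>x'\<in>UNIV. dist x' x < d \<longrightarrow> dist (\<phi> x') (\<phi> x) < e"
  proof (intro exI[of _ "e powr (1/\<alpha>)"] conjI ballI impI)
    show "0 < e powr (1/\<alpha>)" using e by simp
    fix x' assume "dist x' x < e powr (1/\<alpha>)"
    then have "norm (x' - x) powr \<alpha> < (e powr (1/\<alpha>)) powr \<alpha>"
      using assms(2) by (intro powr_less_mono2) (auto simp: dist_norm)
    also have "\<dots> = e" using e assms(2) by (simp add: powr_powr)
    finally show "dist (\<phi> x') (\<phi> x) < e"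
      using C_classD(3)[OF assms(1), of x' x] by (simp add: dist_real_def)
  qed
qed

lemma C_class_borel:
  fixes \<phi> :: "'a::euclidean_space \<Rightarrow> real"
  assumes "\<phi> \<in> C_class \<alpha>" "0 < \<alpha>" shows "\<phi> \<in> borel_measurable borel"
  using C_class_continuous[OF assms] by (rule borel_measurable_continuous_onI)

text \<open>The class demands zeros only outside the closed unit ball; continuity extends them to
  the sphere, by approaching \<open>x\<close> along its ray from outside. Hence the supports fit the
  open balls \<open>ball y t\<close>.\<close>

lemma C_class_eq_0:
  fixes \<phi> :: "'a::euclidean_space \<Rightarrow> real"
  assumes "\<phi> \<in> C_class \<alpha>" "0 < \<alpha>" "1 \<le> norm x" shows "\<phi> x = 0"
proof -
  have "closed {y. \<phi> y = 0}"
    using continuous_closed_vimage[of "{0}" \<phi>] C_class_continuous[OF assms(1,2)]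
    by (simp add: continuous_on_eq_continuous_at vimage_def)
  moreover have "(\<lambda>k. (1 + 1 / real (Suc k)) *\<^sub>R x) \<longlonglongrightarrow> (1 + 0) *\<^sub>R x"
    by (intro tendsto_intros LIMSEQ_Suc[OF lim_1_over_n])
  moreover have "\<phi> ((1 + 1 / real (Suc k)) *\<^sub>R x) = 0" for k
  proof (rule C_classD(1)[OF assms(1)])
    have "1 < (1 + 1 / real (Suc k)) * 1" by simp
    also have "\<dots> \<le> (1 + 1 / real (Suc k)) * norm x"
      using assms(3) by (intro mult_left_mono) auto
    finally show "1 < norm ((1 + 1 / real (Suc k)) *\<^sub>R x)" by simp
  qed
  ultimately have "(1 + 0) *\<^sub>R x \<in> {y. \<phi> y = 0}"
    using closed_sequentially[of "{y. \<phi> y = 0}" "\<lambda>k. (1 + 1 / real (Suc k)) *\<^sub>R x"] by simp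
  then show ?thesis by simp
qed

text \<open>Compare \<open>x\<close> with its radial projection \<open>u\<close> to the unit sphere,
  where \<open>\<phi>\<close> vanishes: the distance is at most 1, and the Hoelder condition has
  constant 1. At the origin any unit vector \<open>e\<close> serves.\<close>

lemma C_class_abs_le_1:
  fixes \<phi> :: "'a::euclidean_space \<Rightarrow> real"
  assumes "\<phi> \<in> C_class \<alpha>" "0 < \<alpha>" shows "\<bar>\<phi> x\<bar> \<le> 1"
proof (cases "norm x \<ge> 1")
  case True then show ?thesis using C_class_eq_0[OF assms] by simp
next
  case False
  obtain e :: 'a where e: "norm e = 1" using vector_choose_size[of 1] by auto
  define u where "u = (if x = 0 then e else (1 / norm x) *\<^sub>R x)"
  have u: "norm u = 1" using e by (simp add: u_def)
  have "norm (x - u) \<le> 1"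
  proof (cases "x = 0")
    case True then show ?thesis using e by (simp add: u_def)
  next
    case nz: False
    have "x - u = (1 - 1 / norm x) *\<^sub>R x" using nz by (simp add: u_def scaleR_diff_left)
    then have "norm (x - u) = \<bar>1 - 1 / norm x\<bar> * norm x" by simp
    also have "\<dots> = 1 - norm x" using False nz by (simp add: abs_if field_simps)
    finally show ?thesis by simp
  qed
  then have "norm (x - u) powr \<alpha> \<le> 1 powr \<alpha>" using assms(2) by (intro powr_mono2) auto
  then show ?thesis
    using C_classD(3)[OF assms(1), of x u] C_class_eq_0[OF assms, of u] u by simp
qed

lemma abs_dilate_le:
  fixes \<phi> :: "'a::euclidean_space \<Rightarrow> real"
  assumes "\<phi> \<in> C_class \<alpha>" "0 < \<alpha>" "0 < t"
  shows "\<bar>dilate t \<phi> (y - z)\<bar> \<le> 1 / t ^ DIM('a) * indicator (ball y t) z"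
proof (cases "z \<in> ball y t")
  case True
  then show ?thesis using C_class_abs_le_1[OF assms(1,2), of "(y - z) /\<^sub>R t"] assms(3)
    by (simp add: dilate_def divide_right_mono)
next
  case False
  then have "1 \<le> norm (y - z) / t" using assms(3) by (simp add: dist_norm field_simps)
  then have "1 \<le> norm ((y - z) /\<^sub>R t)" using assms(3) by (simp add: divide_inverse_commute)
  then show ?thesis using C_class_eq_0[OF assms(1,2)] False by (simp add: dilate_def)
qed

lemma dilate_Holder:
  fixes \<phi> :: "'a::euclidean_space \<Rightarrow> real"
  assumes "\<phi> \<in> C_class \<alpha>" "0 < t"
  shows "\<bar>dilate t \<phi> u - dilate t \<phi> v\<bar> \<le> 1 / t ^ DIM('a) * (norm (u - v) / t) powr \<alpha>"
proof -
  have "u /\<^sub>R t - v /\<^sub>R t = (u - v) /\<^sub>R t" by (simp add: scaleR_diff_right)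
  then have "\<bar>\<phi> (u /\<^sub>R t) - \<phi> (v /\<^sub>R t)\<bar> \<le> (norm (u - v) / t) powr \<alpha>"
    using C_classD(3)[OF assms(1), of "u /\<^sub>R t" "v /\<^sub>R t"] assms(2)
    by (simp add: divide_inverse_commute)
  then show ?thesis using assms(2)
    by (simp add: dilate_def diff_divide_distrib[symmetric] divide_right_mono)
qed

lemma dilate_borel:
  fixes \<phi> :: "'a::euclidean_space \<Rightarrow> real"
  assumes "\<phi> \<in> C_class \<alpha>" "0 < \<alpha>"
  shows "(\<lambda>p. dilate (snd (fst p)) \<phi> (fst (fst p) - snd p)) \<in> borel_measurable ((borel \<Otimes>\<^sub>M borel) \<Otimes>\<^sub>M borel)"
proof -
  note [measurable] = C_class_borel[OF assms]
  show ?thesis unfolding dilate_def by measurable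
qed

lemma dilate_borel1:
  fixes \<phi> :: "'a::euclidean_space \<Rightarrow> real"
  assumes "\<phi> \<in> C_class \<alpha>" "0 < \<alpha>"
  shows "(\<lambda>z. dilate t \<phi> (y - z)) \<in> borel_measurable borel"
proof -
  note [measurable] = C_class_borel[OF assms]
  show ?thesis unfolding dilate_def by measurable
qed

lemma integrable_dilate_mult:
  fixes f :: "'a::euclidean_space \<Rightarrow> 'b::euclidean_space"
  assumes "\<phi> \<in> C_class \<alpha>" "0 < \<alpha>" "0 < t" "locint f"
  shows "integrable lborel (\<lambda>z. dilate t \<phi> (y - z) *\<^sub>R f z)"
  by (rule integrable_ball_bounded_mult[OF assms(4) dilate_borel1[OF assms(1,2)] abs_dilate_le[OF assms(1-3)]])

lemma locint_const: "locint (\<lambda>z::'a::euclidean_space. c::'b::euclidean_space)"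
  unfolding locint_def
  using emeasure_lborel_ball_finite
  by (auto intro!: integrable_scaleR_left integrable_real_indicator)

lemma integrable_dilate:
  fixes \<phi> :: "'a::euclidean_space \<Rightarrow> real"
  assumes "\<phi> \<in> C_class \<alpha>" "0 < \<alpha>" "0 < t"
  shows "integrable lborel (\<lambda>z. dilate t \<phi> (y - z))"
  using integrable_dilate_mult[OF assms locint_const[of "1::real"]] by simp

lemma integral_dilate:
  fixes \<phi> :: "'a::euclidean_space \<Rightarrow> real"
  assumes "\<phi> \<in> C_class \<alpha>" "0 < \<alpha>" "0 < t"
  shows "(\<integral>z. dilate t \<phi> (y - z) \<partial>lborel) = 0"
proof -
  note [measurable] = C_class_borel[OF assms(1,2)]
  have 0: "(\<integral>x. \<phi> x \<partial>lborel) = 0"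
    using C_classD(2)[OF assms(1)] integral_completion[of \<phi> lborel] by simp
  \<comment> \<open>The substitution is \<open>x = (y - z) / t\<close>; its Jacobian
    \<open>1 / t ^ n\<close> is exactly the normalising factor in \<open>dilate\<close>.\<close>
  have "(\<integral>x. \<phi> x \<partial>lborel) = (\<integral>x. \<phi> x \<partial>density (distr lborel borel (\<lambda>z. (1/t) *\<^sub>R y + (- (1/t)) *\<^sub>R z)) (\<lambda>_. \<bar>- (1/t)\<bar> ^ DIM('a)))"
    using lborel_affine[of "- (1/t)" "(1/t) *\<^sub>R y"] assms(3) by simp
  also have "\<dots> = (\<integral>x. (\<bar>- (1/t)\<bar> ^ DIM('a)) *\<^sub>R \<phi> x \<partial>distr lborel borel (\<lambda>z. (1/t) *\<^sub>R y + (- (1/t)) *\<^sub>R z))"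
    by (subst integral_density) auto
  also have "\<dots> = (\<integral>z. (\<bar>- (1/t)\<bar> ^ DIM('a)) *\<^sub>R \<phi> ((1/t) *\<^sub>R y + (- (1/t)) *\<^sub>R z) \<partial>lborel)"
    by (subst integral_distr) auto
  also have "\<dots> = (\<integral>z. dilate t \<phi> (y - z) \<partial>lborel)"
    using assms(3)
    by (intro Bochner_Integration.integral_cong) (auto simp: dilate_def divide_inverse power_inverse scaleR_diff_right)
  finally show ?thesis using 0 by simp
qed

section \<open>Convolutions and their supremum\<close>

lemma convol_eq_lborel:
  fixes f :: "'a::euclidean_space \<Rightarrow> 'b::euclidean_space"
  assumes "\<phi> \<in> C_class \<alpha>" "0 < \<alpha>" "f \<in> borel_measurable borel"
  shows "convol f (dilate t \<phi>) y = (\<integral>z. dilate t \<phi> (y - z) *\<^sub>R f z \<partial>lborel)"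
proof -
  note [measurable] = dilate_borel1[OF assms(1,2)] assms(3)
  show ?thesis unfolding convol_def by (rule integral_completion) measurable
qed

lemma norm_convol_le:
  fixes f :: "'a::euclidean_space \<Rightarrow> 'b::euclidean_space"
  assumes "\<phi> \<in> C_class \<alpha>" "0 < \<alpha>" "0 < t" "locint f"
  shows "ennreal (norm (convol f (dilate t \<phi>) y)) \<le>
     ennreal (1 / t ^ DIM('a)) * (\<integral>\<^sup>+z\<in>ball y t. ennreal (norm (f z)) \<partial>lborel)"
proof -
  note [measurable] = locint_measurable[OF assms(4)]
  have "ennreal (norm (convol f (dilate t \<phi>) y)) \<le> (\<integral>\<^sup>+z. norm (dilate t \<phi> (y - z) *\<^sub>R f z) \<partial>lborel)"
    unfolding convol_eq_lborel[OF assms(1,2) locint_measurable[OF assms(4)]]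
    by (rule integral_norm_bound_ennreal[OF integrable_dilate_mult[OF assms]])
  also have "\<dots> \<le> (\<integral>\<^sup>+z. ennreal (1 / t ^ DIM('a)) * (ennreal (norm (f z)) * indicator (ball y t) z) \<partial>lborel)"
  proof (rule nn_integral_mono)
    fix z
    have "norm (dilate t \<phi> (y - z) *\<^sub>R f z) \<le> (1 / t ^ DIM('a) * indicator (ball y t) z) * norm (f z)"
      using mult_right_mono[OF abs_dilate_le[OF assms(1-3), of y z], of "norm (f z)"] by simp
    then have "ennreal (norm (dilate t \<phi> (y - z) *\<^sub>R f z)) \<le> ennreal ((1 / t ^ DIM('a) * indicator (ball y t) z) * norm (f z))"
      by (rule ennreal_leI)
    also have "\<dots> = ennreal (1 / t ^ DIM('a)) * (ennreal (norm (f z)) * indicator (ball y t) z)"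
      using assms(3) by (simp add: indicator_def mult.commute flip: ennreal_mult'')
    finally show "ennreal (norm (dilate t \<phi> (y - z) *\<^sub>R f z)) \<le>
      ennreal (1 / t ^ DIM('a)) * (ennreal (norm (f z)) * indicator (ball y t) z)" .
  qed
  also have "\<dots> = ennreal (1 / t ^ DIM('a)) * (\<integral>\<^sup>+z\<in>ball y t. ennreal (norm (f z)) \<partial>lborel)"
    by (intro nn_integral_cmult borel_measurable_times_ennreal borel_measurable_indicator measurable_compose[OF _ measurable_ennreal] borel_measurable_norm locint_measurable[OF assms(4)]) (auto simp: locint_measurable[OF assms(4)])
  finally show ?thesis .
qed

lemma A_fun_le:
  fixes f :: "'a::euclidean_space \<Rightarrow> 'b::euclidean_space"
  assumes "0 < \<alpha>" "0 < t" "locint f"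
  shows "A_fun \<alpha> f t y \<le> ennreal (1 / t ^ DIM('a)) * (\<integral>\<^sup>+z\<in>ball y t. ennreal (norm (f z)) \<partial>lborel)"
  unfolding A_fun_def using assms by (intro SUP_least norm_convol_le) auto

lemma A_fun_add_le:
  fixes f :: "'a::euclidean_space \<Rightarrow> 'b::euclidean_space"
  assumes "0 < \<alpha>" "0 < t" "locint f" "locint g"
  shows "A_fun \<alpha> (\<lambda>z. f z + g z) t y \<le> A_fun \<alpha> f t y + A_fun \<alpha> g t y"
  unfolding A_fun_def[of _ "\<lambda>z. f z + g z"]
proof (rule SUP_least)
  fix \<phi> :: "'a \<Rightarrow> real" assume \<phi>: "\<phi> \<in> C_class \<alpha>"
  have "convol (\<lambda>z. f z + g z) (dilate t \<phi>) y = convol f (dilate t \<phi>) y + convol g (dilate t \<phi>) y"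
    using locint_measurable[OF assms(3)] locint_measurable[OF assms(4)]
      Bochner_Integration.integral_add[OF integrable_dilate_mult[OF \<phi> assms(1,2,3), of y]
        integrable_dilate_mult[OF \<phi> assms(1,2,4), of y]]
    by (simp add: convol_eq_lborel[OF \<phi> assms(1)] scaleR_add_right)
  then have "ennreal (norm (convol (\<lambda>z. f z + g z) (dilate t \<phi>) y))
      \<le> ennreal (norm (convol f (dilate t \<phi>) y)) + ennreal (norm (convol g (dilate t \<phi>) y))"
    by (simp add: norm_triangle_ineq flip: ennreal_plus)
  also have "\<dots> \<le> A_fun \<alpha> f t y + A_fun \<alpha> g t y"
    unfolding A_fun_def using \<phi> by (intro add_mono SUP_upper)
  finally show "ennreal (norm (convol (\<lambda>z. f z + g z) (dilate t \<phi>) y)) \<le> A_fun \<alpha> f t y + A_fun \<alpha> g t y" .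
qed

text \<open>This locality allows \<open>f\<close> to be cut off to any set containing
  \<open>ball y t\<close>; the splitting by density depends on it.\<close>

lemma A_fun_cong_ball:
  fixes f g :: "'a::euclidean_space \<Rightarrow> 'b::euclidean_space"
  assumes "0 < \<alpha>" "0 < t" "\<And>z. z \<in> ball y t \<Longrightarrow> f z = g z"
  shows "A_fun \<alpha> f t y = A_fun \<alpha> g t y"
  unfolding A_fun_def
proof (rule SUP_cong[OF refl])
  fix \<phi> :: "'a \<Rightarrow> real" assume \<phi>: "\<phi> \<in> C_class \<alpha>"
  have "(\<lambda>z. dilate t \<phi> (y - z) *\<^sub>R f z) = (\<lambda>z. dilate t \<phi> (y - z) *\<^sub>R g z)"
  proof
    fix z show "dilate t \<phi> (y - z) *\<^sub>R f z = dilate t \<phi> (y - z) *\<^sub>R g z"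
      using abs_dilate_le[OF \<phi> assms(1,2), of y z] assms(3)[of z] by (cases "z \<in> ball y t") auto
  qed
  then show "ennreal (norm (convol f (dilate t \<phi>) y)) = ennreal (norm (convol g (dilate t \<phi>) y))"
    unfolding convol_def by (simp only:)
qed

lemma A_fun_scale:
  fixes f :: "'a::euclidean_space \<Rightarrow> 'b::euclidean_space"
  assumes c: "0 < c"
  shows "A_fun \<alpha> (\<lambda>z. c *\<^sub>R f z) t y = ennreal c * A_fun \<alpha> f t y"
proof -
  have "convol (\<lambda>z. c *\<^sub>R f z) (dilate t \<phi>) y = c *\<^sub>R convol f (dilate t \<phi>) y" for \<phi> :: "'a \<Rightarrow> real"
  proof -
    have "convol (\<lambda>z. c *\<^sub>R f z) (dilate t \<phi>) y = (\<integral>z. c *\<^sub>R (dilate t \<phi> (y - z) *\<^sub>R f z) \<partial>lebesgue)"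
      by (simp add: convol_def mult.commute)
    then show ?thesis by (simp only: integral_scaleR_right convol_def)
  qed
  then show ?thesis
    unfolding A_fun_def using c zero_in_C_class
    by (subst SUP_mult_left_ennreal) (simp add: ennreal_mult')
qed

text \<open>Restricted to a countable dense set of points, the class becomes a subset of a countable
  product of lines, which is separable. Convergence on the dense set then spreads to every point
  because all members share one Hoelder modulus.\<close>

lemma C_class_dense_seq:
  assumes \<alpha>: "0 < \<alpha>"
  obtains s :: "nat \<Rightarrow> 'a::euclidean_space \<Rightarrow> real" where "\<And>k. s k \<in> C_class \<alpha>"
    "\<And>\<phi>. \<phi> \<in> C_class \<alpha> \<Longrightarrow> \<exists>j. \<forall>x. (\<lambda>i. s (j i) x) \<longlonglongrightarrow> \<phi> x"
proof -
  obtain D :: "'a set" where D: "countable D" "\<And>X. open X \<Longrightarrow> X \<noteq> {} \<Longrightarrow> \<exists>d\<in>D. d \<in> X"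
    using countable_dense_exists by metis
  have Dne: "D \<noteq> {}" using D(2)[of UNIV] by auto
  define d where "d = from_nat_into D"
  have rd: "range d = D" unfolding d_def using D(1) Dne by (rule range_from_nat_into[rotated])
  define ev :: "('a \<Rightarrow> real) \<Rightarrow> nat \<Rightarrow> real" where "ev \<phi> n = \<phi> (d n)" for \<phi> n
  obtain T where T: "countable T" "T \<subseteq> ev ` C_class \<alpha>" "ev ` C_class \<alpha> \<subseteq> closure T"
    by (rule separable[of "ev ` C_class \<alpha>"])
  have Tne: "T \<noteq> {}"
  proof
    assume "T = {}"
    then show False using subsetD[OF T(3) imageI[OF zero_in_C_class]] by simp
  qed
  define s where "s k = (SOME \<phi>. \<phi> \<in> C_class \<alpha> \<and> ev \<phi> = from_nat_into T k)" for k
  have s: "s k \<in> C_class \<alpha> \<and> ev (s k) = from_nat_into T k" for k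
  proof -
    have "from_nat_into T k \<in> ev ` C_class \<alpha>" using T(2) from_nat_into[OF Tne, of k] by (rule subsetD)
    then have "\<exists>\<phi>. \<phi> \<in> C_class \<alpha> \<and> ev \<phi> = from_nat_into T k" by (metis imageE)
    then show ?thesis unfolding s_def by (rule someI_ex)
  qed
  show ?thesis
  proof
    show "s k \<in> C_class \<alpha>" for k using s by simp
    fix \<phi> :: "'a \<Rightarrow> real" assume \<phi>: "\<phi> \<in> C_class \<alpha>"
    have "ev \<phi> \<in> closure T" using subsetD[OF T(3) imageI[OF \<phi>]] .
    then obtain u where u: "\<And>i. u i \<in> T" "u \<longlonglongrightarrow> ev \<phi>" by (auto simp: closure_sequential)
    have "\<exists>k. from_nat_into T k = u i" for i using u(1) T(1) from_nat_into_surj by metis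
    then obtain j where j: "\<And>i. from_nat_into T (j i) = u i" by metis
    have lim: "(\<lambda>i. s (j i) (d n)) \<longlonglongrightarrow> \<phi> (d n)" for n
    proof -
      have "(\<lambda>i. u i n) \<longlonglongrightarrow> ev \<phi> n"
        by (rule continuous_on_tendsto_compose[OF continuous_on_product_coordinates u(2)]) auto
      moreover have "u i n = s (j i) (d n)" for i
        using s[of "j i"] j[of i] by (metis ev_def)
      ultimately show ?thesis by (simp add: ev_def)
    qed
    show "\<exists>j. \<forall>x. (\<lambda>i. s (j i) x) \<longlonglongrightarrow> \<phi> x"
    proof (intro exI[of _ j] allI)
      fix x
      show "(\<lambda>i. s (j i) x) \<longlonglongrightarrow> \<phi> x"
      proof (rule LIMSEQ_I)
        fix e :: real assume e: "0 < e"
        \<comment> \<open>Chosen so that \<open>r powr \<alpha> = e/3\<close>: moving from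
          \<open>x\<close> to a dense point \<open>y\<close> within \<open>r\<close> costs at most
          \<open>e/3\<close> for \<open>\<phi>\<close> and for each \<open>s (j i)\<close>.\<close>
        define r where "r = (e/3) powr (1/\<alpha>)"
        have "0 < r" using e by (simp add: r_def)
        then obtain y where y: "y \<in> D" "y \<in> ball x r" using D(2)[of "ball x r"] by auto
        then obtain n where n: "y = d n" using rd by blast
        have "norm (x - y) powr \<alpha> \<le> r powr \<alpha>"
          using y \<alpha> by (intro powr_mono2) (auto simp: dist_norm)
        also have "r powr \<alpha> = e/3" using e \<alpha> by (simp add: r_def powr_powr)
        finally have xy: "norm (x - y) powr \<alpha> \<le> e/3" .
        obtain N where N: "\<And>i. i \<ge> N \<Longrightarrow> norm (s (j i) y - \<phi> y) < e/3"
          using LIMSEQ_D[OF lim[of n], of "e/3"] e n by auto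
        show "\<exists>N. \<forall>i\<ge>N. norm (s (j i) x - \<phi> x) < e"
        proof (intro exI[of _ N] allI impI)
          fix i assume "i \<ge> N"
          with N[of i] C_classD(3)[OF \<phi>, of x y] C_classD(3)[of "s (j i)" \<alpha> x y] s[of "j i"] xy
          show "norm (s (j i) x - \<phi> x) < e" by (simp add: abs_if split: if_splits)
        qed
      qed
    qed
  qed
qed

text \<open>Pointwise convergence of test functions suffices, since all kernels at
  \<open>(y, t)\<close> are dominated by \<open>1 / t ^ n\<close> on \<open>ball y t\<close>. The
  sequence is the same for all \<open>f\<close>, \<open>t\<close> and \<open>y\<close>, which gives
  joint measurability and makes the later linearisation possible.\<close>

lemma A_fun_countable:
  assumes \<alpha>: "0 < \<alpha>"
  obtains s :: "nat \<Rightarrow> 'a::euclidean_space \<Rightarrow> real" where "\<And>k. s k \<in> C_class \<alpha>"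
    "\<And>(f :: 'a \<Rightarrow> 'b::euclidean_space) t y. locint f \<Longrightarrow> 0 < t \<Longrightarrow>
       A_fun \<alpha> f t y = (SUP k. ennreal (norm (convol f (dilate t (s k)) y)))"
proof -
  obtain s :: "nat \<Rightarrow> 'a \<Rightarrow> real" where s: "\<And>k. s k \<in> C_class \<alpha>"
    "\<And>\<phi>. \<phi> \<in> C_class \<alpha> \<Longrightarrow> \<exists>j. \<forall>x. (\<lambda>i. s (j i) x) \<longlonglongrightarrow> \<phi> x"
    by (rule C_class_dense_seq[OF \<alpha>]) blast
  show ?thesis
  proof
    show "s k \<in> C_class \<alpha>" for k by (rule s)
    fix f :: "'a \<Rightarrow> 'b" and t :: real and y :: 'a assume f: "locint f" and t: "0 < t"
    note fm[measurable] = locint_measurable[OF f]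
    let ?S = "SUP k. ennreal (norm (convol f (dilate t (s k)) y))"
    show "A_fun \<alpha> f t y = ?S"
    proof (rule antisym)
      show "?S \<le> A_fun \<alpha> f t y" unfolding A_fun_def using s(1) by (auto intro!: SUP_mono)
      show "A_fun \<alpha> f t y \<le> ?S" unfolding A_fun_def
      proof (rule SUP_least)
        fix \<phi> :: "'a \<Rightarrow> real" assume \<phi>: "\<phi> \<in> C_class \<alpha>"
        obtain j where j: "\<And>x. (\<lambda>i. s (j i) x) \<longlonglongrightarrow> \<phi> x" using s(2)[OF \<phi>] by auto
        have "(\<lambda>i. convol f (dilate t (s (j i))) y) \<longlonglongrightarrow> convol f (dilate t \<phi>) y"
          unfolding convol_eq_lborel[OF \<phi> \<alpha> fm] convol_eq_lborel[OF s(1) \<alpha> fm]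
        proof (rule integral_dominated_convergence)
          show "integrable lborel (\<lambda>z. (1 / t ^ DIM('a)) * norm (indicator (ball y t) z *\<^sub>R f z))"
            using locint_ball[OF f] by (intro integrable_mult_right integrable_norm)
          note [measurable] = dilate_borel1[OF \<phi> \<alpha>] dilate_borel1[OF s(1) \<alpha>]
          show "(\<lambda>z. dilate t \<phi> (y - z) *\<^sub>R f z) \<in> borel_measurable lborel" by measurable
          show "(\<lambda>z. dilate t (s (j i)) (y - z) *\<^sub>R f z) \<in> borel_measurable lborel" for i by measurable
          show "AE z in lborel. (\<lambda>i. dilate t (s (j i)) (y - z) *\<^sub>R f z) \<longlonglongrightarrow> dilate t \<phi> (y - z) *\<^sub>R f z"
            unfolding dilate_def using t by (intro always_eventually allI tendsto_intros j) auto
          show "AE z in lborel. norm (dilate t (s (j i)) (y - z) *\<^sub>R f z) \<le> 1 / t ^ DIM('a) * norm (indicator (ball y t) z *\<^sub>R f z)" for i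
          proof (intro always_eventually allI)
            fix z show "norm (dilate t (s (j i)) (y - z) *\<^sub>R f z) \<le> 1 / t ^ DIM('a) * norm (indicator (ball y t) z *\<^sub>R f z)"
              using mult_right_mono[OF abs_dilate_le[OF s(1) \<alpha> t, of "j i" y z], of "norm (f z)"] by (simp add: mult.assoc)
          qed
        qed
        then have lim: "(\<lambda>i. ennreal (norm (convol f (dilate t (s (j i))) y))) \<longlonglongrightarrow> ennreal (norm (convol f (dilate t \<phi>) y))"
          by (intro tendsto_ennrealI tendsto_norm)
        show "ennreal (norm (convol f (dilate t \<phi>) y)) \<le> ?S"
          by (rule LIMSEQ_le_const2[OF lim]) (intro exI allI impI SUP_upper UNIV_I)
      qed
    qed
  qed
qed

lemma convol_borel:
  fixes f :: "'a::euclidean_space \<Rightarrow> 'b::euclidean_space"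
  assumes "\<phi> \<in> C_class \<alpha>" "0 < \<alpha>" "f \<in> borel_measurable borel"
  shows "(\<lambda>p. convol f (dilate (snd p) \<phi>) (fst p)) \<in> borel_measurable (borel \<Otimes>\<^sub>M borel)"
proof -
  note [measurable] = assms(3)
  have dk: "(\<lambda>p. dilate (snd (fst p)) \<phi> (fst (fst p) - snd p)) \<in> borel_measurable ((borel \<Otimes>\<^sub>M borel) \<Otimes>\<^sub>M lborel)"
    using dilate_borel[OF assms(1,2)] by (simp cong: measurable_cong_sets sets_pair_measure_cong)
  show ?thesis unfolding convol_eq_lborel[OF assms]
    unfolding case_prod_beta'
    by (rule lborel.borel_measurable_lebesgue_integral, unfold case_prod_beta')
      (intro borel_measurable_scaleR dk, measurable)
qed

text \<open>The indicator discards \<open>t \<le> 0\<close>, where the countable formula for the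
  supremum has not been established.\<close>

lemma A_fun_borel:
  fixes f :: "'a::euclidean_space \<Rightarrow> 'b::euclidean_space"
  assumes \<alpha>: "0 < \<alpha>" and f: "locint f"
  shows "(\<lambda>p. indicator {0<..} (snd p) * A_fun \<alpha> f (snd p) (fst p)) \<in> borel_measurable (borel \<Otimes>\<^sub>M borel)"
proof -
  obtain s :: "nat \<Rightarrow> 'a \<Rightarrow> real" where s: "\<And>k. s k \<in> C_class \<alpha>"
    "\<And>(f :: 'a \<Rightarrow> 'b) t y. locint f \<Longrightarrow> 0 < t \<Longrightarrow>
       A_fun \<alpha> f t y = (SUP k. ennreal (norm (convol f (dilate t (s k)) y)))"
    by (rule A_fun_countable[OF \<alpha>]) blast
  have eq: "indicator {0<..} (snd p) * A_fun \<alpha> f (snd p) (fst p) =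
    indicator {0<..} (snd p) * (SUP k. ennreal (norm (convol f (dilate (snd p) (s k)) (fst p))))" for p
    using s(2)[OF f] by (auto simp: indicator_def)
  show ?thesis unfolding eq
    by (intro borel_measurable_times_ennreal borel_measurable_SUP measurable_compose[OF _ measurable_ennreal]
      measurable_compose[OF convol_borel[OF s(1) \<alpha> locint_measurable[OF f]] borel_measurable_norm]) measurable
qed

section \<open>Power integrals, Vitali coverings and density\<close>

lemma nn_integral_powr_to_inf:
  fixes a s :: real
  assumes "0 < a" "0 < s"
  shows "(\<integral>\<^sup>+t\<in>{a..}. ennreal (t powr (- s - 1)) \<partial>lborel) = ennreal (a powr (- s) / s)"
proof -
  have "((\<lambda>x. x powr (- s - 1)) has_integral a powr (- s) / s) {a..}"
    using has_integral_powr_to_inf[of "- s - 1" a] assms by simp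
  from nn_integral_has_integral_lebesgue[OF _ this]
  have "integral\<^sup>N lborel (\<lambda>x. ennreal (indicator {a..} x * x powr (- s - 1))) = ennreal (a powr (- s) / s)"
    by simp
  moreover have "ennreal (indicator {a..} x * x powr (- s - 1)) = ennreal (x powr (- s - 1)) * indicator {a..} x" for x
    by (auto simp: indicator_def)
  ultimately show ?thesis by simp
qed

lemma nn_integral_powr_from_0:
  fixes a s :: real
  assumes "0 < a" "0 < s"
  shows "(\<integral>\<^sup>+t\<in>{0..a}. ennreal (t powr (s - 1)) \<partial>lborel) = ennreal (a powr s / s)"
proof -
  have "((\<lambda>x. x powr (s - 1)) has_integral a powr s / s) {0..a}"
    using has_integral_powr_from_0[of "s - 1" a] assms by simp
  from nn_integral_has_integral_lebesgue[OF _ this]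
  have "integral\<^sup>N lborel (\<lambda>x. ennreal (indicator {0..a} x * x powr (s - 1))) = ennreal (a powr s / s)"
    by simp
  moreover have "ennreal (indicator {0..a} x * x powr (s - 1)) = ennreal (x powr (s - 1)) * indicator {0..a} x" for x
    by (auto simp: indicator_def)
  ultimately show ?thesis by simp
qed

lemma borel_fst_snd_ball:
  "(\<lambda>p :: 'a::euclidean_space \<times> real. indicator (cball c (snd p)) (fst p) :: ennreal) \<in> borel_measurable (borel \<Otimes>\<^sub>M borel)"
proof -
  have "(\<lambda>p. indicator (cball c (snd p)) (fst p) :: ennreal) = indicator {p \<in> space (borel \<Otimes>\<^sub>M borel). dist c (fst p) \<le> snd p}"
    by (auto simp: indicator_def space_pair_measure)
  then show ?thesis by simp
qed

text \<open>Polar coordinates are replaced by a layer cake: \<open>d powr (- (n + a))\<close> is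
  \<open>n + a\<close> times the integral of \<open>t powr (- (n + a) - 1)\<close> over
  \<open>t \<ge> d\<close>. Tonelli then leaves volumes of balls of radius
  \<open>t \<ge> R\<close>.\<close>

lemma nn_integral_outside_ball:
  fixes c :: "'a::euclidean_space" and R a :: real
  assumes R: "0 < R" and a: "0 < a"
  shows "(\<integral>\<^sup>+z\<in>- ball c R. ennreal (norm (z - c) powr (- (real DIM('a) + a))) \<partial>lborel)
     \<le> ennreal (unit_ball_vol DIM('a) * (DIM('a) + a) / a * R powr (- a))"
proof -
  define n where "n = real DIM('a)"
  define w where "w = unit_ball_vol n"
  have n: "0 < n" by (simp add: n_def)
  have w: "0 \<le> w" by (simp add: w_def n_def)
  have meas: "(\<lambda>(z, t). ennreal (n + a) * ennreal (t powr (- (n + a) - 1)) * indicator {R..} t * indicator (cball c t) z)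
     \<in> borel_measurable (lborel \<Otimes>\<^sub>M lborel)"
    unfolding case_prod_beta'
    using borel_fst_snd_ball[of c]
    by (intro borel_measurable_times_ennreal) (measurable, simp)
  have "(\<integral>\<^sup>+z\<in>- ball c R. ennreal (norm (z - c) powr (- (n + a))) \<partial>lborel)
     \<le> (\<integral>\<^sup>+z. (\<integral>\<^sup>+t. ennreal (n + a) * ennreal (t powr (- (n + a) - 1)) * indicator {R..} t * indicator (cball c t) z \<partial>lborel) \<partial>lborel)"
  proof (rule nn_integral_mono)
    fix z
    show "ennreal (norm (z - c) powr (- (n + a))) * indicator (- ball c R) z
      \<le> (\<integral>\<^sup>+t. ennreal (n + a) * ennreal (t powr (- (n + a) - 1)) * indicator {R..} t * indicator (cball c t) z \<partial>lborel)"
    proof (cases "z \<in> ball c R")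
      case False
      define d where "d = norm (z - c)"
      have d: "R \<le> d" using False by (simp add: d_def dist_norm norm_minus_commute)
      have "ennreal (d powr (- (n + a))) = ennreal (n + a) * ennreal (d powr (- (n + a)) / (n + a))"
        using n a by (subst ennreal_mult'[symmetric]) auto
      also have "\<dots> = ennreal (n + a) * (\<integral>\<^sup>+t\<in>{d..}. ennreal (t powr (- (n + a) - 1)) \<partial>lborel)"
        using nn_integral_powr_to_inf[of d "n + a"] R d n a by simp
      also have "\<dots> = (\<integral>\<^sup>+t. ennreal (n + a) * (ennreal (t powr (- (n + a) - 1)) * indicator {d..} t) \<partial>lborel)"
        by (rule nn_integral_cmult[symmetric]) measurable
      also have "\<dots> \<le> (\<integral>\<^sup>+t. ennreal (n + a) * ennreal (t powr (- (n + a) - 1)) * indicator {R..} t * indicator (cball c t) z \<partial>lborel)"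
        using d by (intro nn_integral_mono)
          (auto simp: indicator_def d_def dist_norm norm_minus_commute)
      finally show ?thesis using False by (simp add: d_def)
    qed simp
  qed
  also have "\<dots> = (\<integral>\<^sup>+t. (\<integral>\<^sup>+z. ennreal (n + a) * ennreal (t powr (- (n + a) - 1)) * indicator {R..} t * indicator (cball c t) z \<partial>lborel) \<partial>lborel)"
    by (rule lborel_pair.Fubini'[OF meas, symmetric])
  also have "\<dots> = (\<integral>\<^sup>+t. ennreal ((n + a) * w) * (ennreal (t powr (- a - 1)) * indicator {R..} t) \<partial>lborel)"
  proof (rule nn_integral_cong)
    fix t :: real
    show "(\<integral>\<^sup>+z. ennreal (n + a) * ennreal (t powr (- (n + a) - 1)) * indicator {R..} t * indicator (cball c t) z \<partial>lborel)
      = ennreal ((n + a) * w) * (ennreal (t powr (- a - 1)) * indicator {R..} t)"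
    proof (cases "R \<le> t")
      case True
      then have t: "0 < t" using R by simp
      have e: "t powr (- (n + a) - 1) * t ^ DIM('a) = t powr (- a - 1)"
        using t by (simp add: n_def powr_add[symmetric] flip: powr_realpow)
      have "(\<integral>\<^sup>+z. ennreal (n + a) * ennreal (t powr (- (n + a) - 1)) * indicator {R..} t * indicator (cball c t) z \<partial>lborel)
        = ennreal (n + a) * ennreal (t powr (- (n + a) - 1)) * emeasure lborel (cball c t)"
        using True nn_integral_cmult_indicator[of "cball c t" lborel] by simp
      also have "\<dots> = ennreal ((n + a) * w * (t powr (- (n + a) - 1) * t ^ DIM('a)))"
        using t n a w by (simp add: emeasure_cball w_def n_def mult_ac del: ennreal_plus flip: ennreal_mult')
      finally show ?thesis using True n a w unfolding e by (simp add: ennreal_mult')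
    qed simp
  qed
  also have "\<dots> = ennreal ((n + a) * w) * (\<integral>\<^sup>+t\<in>{R..}. ennreal (t powr (- a - 1)) \<partial>lborel)"
    by (rule nn_integral_cmult) measurable
  also have "\<dots> = ennreal ((n + a) * w) * ennreal (R powr (- a) / a)"
    using nn_integral_powr_to_inf[OF R a] by simp
  also have "\<dots> = ennreal (w * (n + a) / a * R powr (- a))"
    using n a w by (simp flip: ennreal_mult' add: mult_ac)
  finally show ?thesis by (simp add: n_def w_def)
qed

section \<open>Vitali cells and maximal functions\<close>

lemma emeasure_ball_scale:
  fixes c :: "'a::euclidean_space"
  assumes "0 \<le> k" "0 \<le> r"
  shows "emeasure lborel (ball c (k * r)) = ennreal (k ^ DIM('a)) * emeasure lborel (ball c r)"
  using assms by (simp add: emeasure_ball power_mult_distrib mult_ac flip: ennreal_mult')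

lemma Vitali_disjoint_cells:
  fixes K :: "('a::euclidean_space \<times> real) set"
  assumes K: "\<And>c r. (c, r) \<in> K \<Longrightarrow> 0 < r \<and> r \<le> B"
  obtains x :: "nat \<Rightarrow> 'a" and r :: "nat \<Rightarrow> real" and Q where
    "\<And>k. Q k \<in> sets borel" "disjoint_family Q" "(\<Union>(c, s)\<in>K. ball c s) \<subseteq> (\<Union>k. Q k)"
    "\<And>k. Q k \<noteq> {} \<Longrightarrow> (x k, r k) \<in> K \<and> ball (x k) (r k) \<subseteq> Q k \<and> Q k \<subseteq> ball (x k) (5 * r k)"
proof -
  have cov: "(\<Union>(c, s)\<in>K. ball c s) \<subseteq> (\<Union>i\<in>K. ball (fst i) (snd i))" by auto
  have rB: "0 < snd i \<and> snd i \<le> B" if "i \<in> K" for i using K[of "fst i" "snd i"] that by simp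
  obtain C where C: "countable C" "C \<subseteq> K"
     "pairwise (\<lambda>i j. disjnt (ball (fst i) (snd i)) (ball (fst j) (snd j))) C"
     "(\<Union>(c, s)\<in>K. ball c s) \<subseteq> (\<Union>i\<in>C. ball (fst i) (5 * snd i))"
    by (rule Vitali_covering_lemma_balls[OF cov rB]) blast+
  \<comment> \<open>The union runs over at most one ball, the one numbered \<open>k\<close>; it is
    empty when no ball has this number.\<close>
  define B1 where "B1 k = (\<Union>i\<in>{i\<in>C. to_nat_on C i = k}. ball (fst i) (snd i))" for k
  define B5 where "B5 k = (\<Union>i\<in>{i\<in>C. to_nat_on C i = k}. ball (fst i) (5 * snd i))" for k
  \<comment> \<open>Each cell keeps its own ball and takes from its dilate whatever lies in no
    selected ball and in no earlier dilate. This gives disjointness without losing any point of the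
    cover.\<close>
  define Q where "Q k = B1 k \<union> (B5 k - (\<Union>j. B1 j) - (\<Union>j<k. B5 j))" for k
  have inj: "i = j" if "i \<in> C" "j \<in> C" "to_nat_on C i = to_nat_on C j" for i j
    using that C(1) by (simp add: inj_on_def to_nat_on_inj)
  have one: "B1 k = ball (fst i) (snd i)" "B5 k = ball (fst i) (5 * snd i)"
    if "i \<in> C" "to_nat_on C i = k" for i k
    using that inj unfolding B1_def B5_def by blast+
  have B15: "B1 k \<subseteq> B5 k" for k
    unfolding B1_def B5_def using C(2) K by force
  have disjB: "B1 j \<inter> B1 k = {}" if "j \<noteq> k" for j k
  proof (rule ccontr)
    assume "B1 j \<inter> B1 k \<noteq> {}"
    then obtain y where "y \<in> B1 j" "y \<in> B1 k" by blast
    then obtain i i' where i: "i \<in> C" "to_nat_on C i = j" "i' \<in> C" "to_nat_on C i' = k"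
      "y \<in> ball (fst i) (snd i)" "y \<in> ball (fst i') (snd i')" unfolding B1_def by blast
    then have "i \<noteq> i'" using \<open>j \<noteq> k\<close> by blast
    then have "disjnt (ball (fst i) (snd i)) (ball (fst i') (snd i'))"
      using pairwiseD[OF C(3)] i by blast
    then show False using i by (auto simp: disjnt_def)
  qed
  show ?thesis
  proof
    show "Q k \<in> sets borel" for k
    proof -
      have [measurable]: "B1 j \<in> sets borel" "B5 j \<in> sets borel" for j
        unfolding B1_def B5_def by (intro borel_open open_UN ballI open_ball)+
      show ?thesis unfolding Q_def by measurable
    qed
    show "disjoint_family Q"
      unfolding disjoint_family_on_def
    proof (intro ballI impI)
      fix j k :: nat assume jk: "j \<noteq> k"
      show "Q j \<inter> Q k = {}"
        using disjB[OF jk] jk unfolding Q_def by (cases j k rule: linorder_cases) blast+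
    qed
    show "(\<Union>(c, s)\<in>K. ball c s) \<subseteq> (\<Union>k. Q k)"
    proof
      fix y assume "y \<in> (\<Union>(c, s)\<in>K. ball c s)"
      then have "y \<in> (\<Union>k. B5 k)" using C(4) unfolding B5_def by blast
      then have ex: "\<exists>k. y \<in> B5 k" by auto
      define k where "k = (LEAST k. y \<in> B5 k)"
      have "y \<in> B5 k" using ex unfolding k_def by (rule LeastI_ex)
      moreover have "y \<notin> B5 j" if "j < k" for j using that not_less_Least unfolding k_def by metis
      ultimately show "y \<in> (\<Union>k. Q k)" unfolding Q_def by blast
    qed
    fix k assume ne: "Q k \<noteq> {}"
    then have "B5 k \<noteq> {}" using B15 unfolding Q_def by blast
    then obtain i where i: "i \<in> C" "to_nat_on C i = k" unfolding B5_def by blast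
    have fk: "from_nat_into C k = i" using i C(1) by auto
    have "B1 k \<subseteq> Q k" "Q k \<subseteq> B5 k" using B15 unfolding Q_def by blast+
    then show "((\<lambda>k. fst (from_nat_into C k)) k, (\<lambda>k. snd (from_nat_into C k)) k) \<in> K \<and>
      ball ((\<lambda>k. fst (from_nat_into C k)) k) ((\<lambda>k. snd (from_nat_into C k)) k) \<subseteq> Q k \<and>
      Q k \<subseteq> ball ((\<lambda>k. fst (from_nat_into C k)) k) (5 * (\<lambda>k. snd (from_nat_into C k)) k)"
      using C(2) i fk one[OF i] by auto
  qed
qed

text \<open>The set where the centred Hardy-Littlewood maximal function of \<open>u\<close> exceeds
  \<open>l\<close>, written without division by the volume.\<close>

definition superlevel :: "('a::euclidean_space \<Rightarrow> ennreal) \<Rightarrow> real \<Rightarrow> 'a set" where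
  "superlevel u l = {x. \<exists>r>0. ennreal l * emeasure lborel (ball x r) < (\<integral>\<^sup>+z\<in>ball x r. u z \<partial>lborel)}"

text \<open>By continuity from below of the measure \<open>u dx\<close>, a concentric ball of
  slightly smaller radius already has enough mass. It is contained in \<open>ball y r\<close> for
  all \<open>y\<close> close to \<open>x\<close>, and \<open>ball y r\<close> has the same volume as
  \<open>ball x r\<close>.\<close>

lemma open_superlevel:
  fixes u :: "'a::euclidean_space \<Rightarrow> ennreal"
  assumes u: "u \<in> borel_measurable borel"
  shows "open (superlevel u l)"
proof (rule openI)
  fix x assume "x \<in> superlevel u l"
  then obtain r where r: "0 < r" "ennreal l * emeasure lborel (ball x r) < (\<integral>\<^sup>+z\<in>ball x r. u z \<partial>lborel)"
    by (auto simp: superlevel_def)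
  define M where "M = density lborel u"
  have eM: "emeasure M A = (\<integral>\<^sup>+z\<in>A. u z \<partial>lborel)" if "A \<in> sets borel" for A
    unfolding M_def using u that by (simp add: emeasure_density)
  define A where "A k = ball x (r - r / real (Suc k))" for k
  have inc: "incseq A"
    unfolding A_def by (intro incseq_SucI subset_ball diff_left_mono divide_left_mono) (use r in auto)
  have "(\<Union>k. A k) = ball x r"
  proof safe
    fix k y assume "y \<in> A k" then show "y \<in> ball x r"
      using r divide_nonneg_nonneg[of r "real (Suc k)"] unfolding A_def mem_ball by linarith
  next
    fix y assume "y \<in> ball x r"
    then have "dist x y < r" by simp
    then have "0 < (r - dist x y) / r" using r by simp
    then obtain k where k: "inverse (real (Suc k)) < (r - dist x y) / r" using reals_Archimedean by metis
    have "r * inverse (real (Suc k)) < r * ((r - dist x y) / r)" using k r(1) by (rule mult_strict_left_mono)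
    also have "r * ((r - dist x y) / r) = r - dist x y" using r(1) by simp
    finally have "r / real (Suc k) < r - dist x y" by (simp add: divide_inverse)
    then have "y \<in> A k" by (simp add: A_def)
    then show "y \<in> (\<Union>k. A k)" by auto
  qed
  moreover have "range A \<subseteq> sets M" by (auto simp: M_def A_def)
  ultimately have "(SUP k. emeasure M (A k)) = emeasure M (ball x r)"
    using SUP_emeasure_incseq[OF _ inc, of M] by simp
  then have "ennreal l * emeasure lborel (ball x r) < (SUP k. emeasure M (A k))"
    using r(2) eM by simp
  then obtain k where k: "ennreal l * emeasure lborel (ball x r) < emeasure M (A k)"
    by (auto simp: less_SUP_iff)
  show "\<exists>e>0. ball x e \<subseteq> superlevel u l"
  proof (intro exI conjI subsetI)
    show "0 < r / real (Suc k)" using r by simp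
    fix y assume y: "y \<in> ball x (r / real (Suc k))"
    have "A k \<subseteq> ball y r"
    proof
      fix z assume "z \<in> A k"
      then show "z \<in> ball y r" using y dist_triangle[of y z x] by (simp add: A_def dist_commute)
    qed
    then have "emeasure M (A k) \<le> emeasure M (ball y r)" by (intro emeasure_mono) (auto simp: M_def)
    moreover have "emeasure lborel (ball y r) = emeasure lborel (ball x r)" using r by (simp add: emeasure_ball)
    ultimately have "ennreal l * emeasure lborel (ball y r) < (\<integral>\<^sup>+z\<in>ball y r. u z \<partial>lborel)"
      using k eM[of "ball y r"] by simp
    then show "y \<in> superlevel u l" using r(1) unfolding superlevel_def by blast
  qed
qed

text \<open>A one-sided Lebesgue differentiation theorem. If the bad points formed a set
  \<open>S\<close> of positive measure, Vitali balls centred in \<open>S\<close> would fill almost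
  all of \<open>S\<close> inside an open set \<open>U\<close> barely larger than \<open>S\<close>.
  Each ball has average at most \<open>l\<close>, while \<open>u \<ge> l + e\<close> on
  \<open>S\<close>, so \<open>(l + e) |S| \<le> l |U|\<close>, which is false for small
  excess.\<close>

lemma AE_le_outside_superlevel:
  fixes u :: "'a::euclidean_space \<Rightarrow> ennreal"
  assumes u: "u \<in> borel_measurable borel" and l: "0 < l"
  shows "AE x in lborel. x \<notin> superlevel u l \<longrightarrow> u x \<le> ennreal l"
proof -
  note [measurable] = u
  have [measurable]: "superlevel u l \<in> sets borel" using open_superlevel[OF u] by auto
  define S where "S R k = {x \<in> ball 0 (real R). ennreal (l + 1 / real (Suc k)) \<le> u x} - superlevel u l" for R k
  have Sm: "S R k \<in> sets borel" for R k unfolding S_def by measurable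
  have null: "emeasure lborel (S R k) = 0" for R k
  proof (rule ccontr)
    assume nz: "emeasure lborel (S R k) \<noteq> 0"
    define e where "e = 1 / real (Suc k)"
    have e: "0 < e" by (simp add: e_def)
    have "emeasure lborel (S R k) \<le> emeasure lborel (ball (0::'a) (real R))"
      by (rule emeasure_mono) (auto simp: S_def)
    then have fin: "emeasure lborel (S R k) < \<infinity>" using emeasure_lborel_ball_finite by (rule order_le_less_trans)
    define s where "s = measure lborel (S R k)"
    have s: "emeasure lborel (S R k) = ennreal s" "0 < s"
      using fin nz unfolding s_def
      by (simp_all add: emeasure_eq_ennreal_measure zero_less_measure_iff) 
    \<comment> \<open>The permitted excess of \<open>U\<close> over the bad set: it makes
      \<open>l * d\<close> half of \<open>e * s\<close>, the gain that comes from
      \<open>u \<ge> l + e\<close>.\<close>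
    define d where "d = e * s / (2 * l)"
    have d: "0 < d" using e s l by (simp add: d_def)
    obtain U where U: "open U" "S R k \<subseteq> U" "emeasure lborel (U - S R k) < ennreal d"
      using outer_regular_lborel[OF Sm d] by metis
    define K where "K = {(x, r). x \<in> S R k \<and> 0 < r \<and> ball x r \<subseteq> U}"
    have fine: "\<exists>i. i \<in> K \<and> x \<in> ball (fst i) (snd i) \<and> snd i < d'" if "x \<in> S R k" "0 < d'" for x d'
    proof -
      have "x \<in> U" using U(2) that(1) by (rule subsetD)
      then obtain r where r: "0 < r" "ball x r \<subseteq> U" using U(1) unfolding open_contains_ball by blast
      have "ball x (min r (d'/2)) \<subseteq> ball x r" by auto
      then have "ball x (min r (d'/2)) \<subseteq> U" using r(2) by blast
      then show ?thesis using that r by (intro exI[of _ "(x, min r (d'/2))"]) (auto simp: K_def)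
    qed
    obtain C where C: "countable C" "C \<subseteq> K"
       "pairwise (\<lambda>i j. disjnt (ball (fst i) (snd i)) (ball (fst j) (snd j))) C"
       "negligible (S R k - (\<Union>i \<in> C. ball (fst i) (snd i)))"
      by (rule Vitali_covering_theorem_balls[OF fine]) blast+
    have disj: "disjoint_family_on (\<lambda>i. ball (fst i) (snd i)) C"
      using C(3) unfolding disjoint_family_on_def pairwise_def disjnt_def by auto
    let ?V = "\<Union>i\<in>C. ball (fst i) (snd i)"
    have Vm: "?V \<in> sets borel" by (intro borel_open open_UN) auto
    have "emeasure lebesgue (S R k - ?V) = 0" using C(4) by (simp add: negligible_iff_null_sets null_setsD1)
    then have n0: "emeasure lborel (S R k - ?V) = 0" using Sm Vm by simp
    have "emeasure lborel (S R k) \<le> emeasure lborel ((S R k \<inter> ?V) \<union> (S R k - ?V))"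
      using Sm Vm by (intro emeasure_mono) auto
    also have "\<dots> \<le> emeasure lborel (S R k \<inter> ?V) + emeasure lborel (S R k - ?V)"
      using Sm Vm by (intro emeasure_subadditive) auto
    finally have le1: "emeasure lborel (S R k) \<le> emeasure lborel (S R k \<inter> ?V)" using n0 by simp
    have "ennreal (l + e) * emeasure lborel (S R k) \<le> ennreal (l + e) * emeasure lborel (S R k \<inter> ?V)"
      using le1 by (rule mult_left_mono) simp
    also have "\<dots> = (\<integral>\<^sup>+z. ennreal (l + e) * indicator (S R k \<inter> ?V) z \<partial>lborel)"
      using Sm Vm by (simp add: nn_integral_cmult)
    also have "\<dots> \<le> (\<integral>\<^sup>+z\<in>?V. u z \<partial>lborel)"
      by (rule nn_integral_mono) (auto simp: indicator_def S_def e_def)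
    also have "\<dots> = emeasure (density lborel u) ?V" using Vm by (simp add: emeasure_density)
    also have "\<dots> = (\<integral>\<^sup>+i. emeasure (density lborel u) (ball (fst i) (snd i)) \<partial>count_space C)"
      by (rule emeasure_UN_countable[OF _ C(1) disj]) simp
    also have "\<dots> \<le> (\<integral>\<^sup>+i. ennreal l * emeasure lborel (ball (fst i) (snd i)) \<partial>count_space C)"
    proof (rule nn_integral_mono)
      fix i assume "i \<in> space (count_space C)"
      then have "fst i \<in> S R k" "0 < snd i" using C(2) by (auto simp: K_def)
      then have "\<not> ennreal l * emeasure lborel (ball (fst i) (snd i)) < (\<integral>\<^sup>+z\<in>ball (fst i) (snd i). u z \<partial>lborel)"
        unfolding S_def superlevel_def by blast
      then show "emeasure (density lborel u) (ball (fst i) (snd i)) \<le> ennreal l * emeasure lborel (ball (fst i) (snd i))"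
        by (simp add: emeasure_density not_less)
    qed
    also have "\<dots> = ennreal l * (\<integral>\<^sup>+i. emeasure lborel (ball (fst i) (snd i)) \<partial>count_space C)"
      by (rule nn_integral_cmult) simp
    also have "(\<integral>\<^sup>+i. emeasure lborel (ball (fst i) (snd i)) \<partial>count_space C) = emeasure lborel ?V"
      by (rule emeasure_UN_countable[OF _ C(1) disj, symmetric]) simp
    also have "emeasure lborel ?V \<le> emeasure lborel U"
    proof (rule emeasure_mono)
      show "?V \<subseteq> U" using C(2) unfolding K_def by fastforce
    qed (use U(1) in auto)
    also have "emeasure lborel U \<le> emeasure lborel (S R k \<union> (U - S R k))"
      using U(1) Sm by (intro emeasure_mono) auto
    also have "\<dots> \<le> emeasure lborel (S R k) + emeasure lborel (U - S R k)"
      using U(1) Sm by (intro emeasure_subadditive) auto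
    also have "\<dots> \<le> ennreal s + ennreal d" using U(3) s by (intro add_mono) auto
    also have "ennreal l * (ennreal s + ennreal d) = ennreal (l * (s + d))"
      using l s d by (simp add: ennreal_mult flip: ennreal_plus)
    finally have "ennreal ((l + e) * s) \<le> ennreal (l * (s + d))" using s l e by (simp add: ennreal_mult mult_left_mono)
    then have "(l + e) * s \<le> l * (s + d)" using l s d by (simp add: ennreal_le_iff)
    then have "e * s \<le> l * d" by (simp add: algebra_simps)
    also have "\<dots> = e * s / 2" using l by (simp add: d_def)
    finally show False using e s by simp
  qed
  have "(\<Union>R k. S R k) \<in> null_sets lborel"
    using Sm null by (intro null_sets_UN) (auto simp: null_sets_def)
  then show ?thesis
  proof (rule AE_I')
    show "{x \<in> space lborel. \<not> (x \<notin> superlevel u l \<longrightarrow> u x \<le> ennreal l)} \<subseteq> (\<Union>R k. S R k)"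
    proof
      fix x assume "x \<in> {x \<in> space lborel. \<not> (x \<notin> superlevel u l \<longrightarrow> u x \<le> ennreal l)}"
      then have x: "x \<notin> superlevel u l" "ennreal l < u x" by auto
      obtain c where c: "ennreal l < ennreal c" "ennreal c \<le> u x" "0 \<le> c"
      proof (cases "u x")
        case (real c) then show ?thesis using that x by auto
      next
        case top then show ?thesis using that[of "l + 1"] l by (simp add: ennreal_less_iff)
      qed
      then have "0 < c - l" using l by (simp add: ennreal_less_iff)
      then obtain k where k: "inverse (real (Suc k)) < c - l" using reals_Archimedean by metis
      have "ennreal (l + 1 / real (Suc k)) \<le> ennreal c" using k by (intro ennreal_leI) (simp add: inverse_eq_divide)
      then have "ennreal (l + 1 / real (Suc k)) \<le> u x" using c by order
      moreover obtain R where "norm x < real R" using reals_Archimedean2 by auto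
      ultimately have "x \<in> S R k" using x by (simp add: S_def)
      then show "x \<in> (\<Union>R k. S R k)" by auto
    qed
  qed
qed

section \<open>The square estimate\<close>

lemma integrable_prod_bound:
  fixes h :: "'p \<Rightarrow> 'q \<Rightarrow> 'c::{banach, second_countable_topology}"
  assumes "finite_measure M" "sigma_finite_measure N"
    and h[measurable]: "case_prod h \<in> borel_measurable (M \<Otimes>\<^sub>M N)"
    and g: "integrable N g" and le: "\<And>p z. p \<in> space M \<Longrightarrow> z \<in> space N \<Longrightarrow> norm (h p z) \<le> g z"
  shows "integrable (M \<Otimes>\<^sub>M N) (case_prod h)"
proof (rule integrableI_bounded)
  interpret M: finite_measure M by fact
  interpret N: sigma_finite_measure N by fact
  interpret pair_sigma_finite M N ..
  show "case_prod h \<in> borel_measurable (M \<Otimes>\<^sub>M N)" by fact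
  have "(\<integral>\<^sup>+ p. ennreal (norm (case_prod h p)) \<partial>(M \<Otimes>\<^sub>M N)) = (\<integral>\<^sup>+p. \<integral>\<^sup>+z. ennreal (norm (h p z)) \<partial>N \<partial>M)"
    by (subst N.nn_integral_fst[symmetric]) auto
  also have "\<dots> \<le> (\<integral>\<^sup>+p. \<integral>\<^sup>+z. ennreal (norm (g z)) \<partial>N \<partial>M)"
    using le by (intro nn_integral_mono ennreal_leI) (auto intro: order_trans[OF _ abs_ge_self])
  also have "\<dots> = (\<integral>\<^sup>+z. ennreal (norm (g z)) \<partial>N) * emeasure M (space M)" by simp
  also have "\<dots> < \<infinity>"
    using g by (auto simp: integrable_iff_bounded ennreal_mult_less_top M.emeasure_eq_measure)
  finally show "(\<integral>\<^sup>+ p. ennreal (norm (case_prod h p)) \<partial>(M \<Otimes>\<^sub>M N)) < \<infinity>" .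
qed

text \<open>A finite measure and a bounded kernel of bounded support make every exchange of
  integrals legitimate. Neither \<open>c\<close> nor \<open>\<rho>\<close> nor the total mass enters
  the final bound of \<open>Schur_TT\<close>, so the truncation can be removed afterwards.\<close>

locale bounded_kernel =
  fixes M :: "'p measure" and k :: "'p \<Rightarrow> 'a::euclidean_space \<Rightarrow> real" and c \<rho> :: real
  assumes finM: "finite_measure M"
    and km[measurable]: "case_prod k \<in> borel_measurable (M \<Otimes>\<^sub>M lborel)"
    and kb: "\<And>p z. p \<in> space M \<Longrightarrow> \<bar>k p z\<bar> \<le> c * indicator (ball 0 \<rho>) z"
begin

sublocale finite_measure M by (rule finM)
sublocale pr: pair_sigma_finite M "lborel :: 'a measure" ..

lemma c_ball: "integrable lborel (\<lambda>z::'a. c * indicator (ball 0 \<rho>) z :: real)"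
  using emeasure_lborel_ball_finite[of 0 \<rho>] by (intro integrable_mult_right integrable_real_indicator) auto

lemma k_le_c: "p \<in> space M \<Longrightarrow> \<bar>k p z\<bar> \<le> \<bar>c\<bar>"
  using kb[of p z] by (cases "z \<in> ball 0 \<rho>") auto

lemma km1[measurable]: "p \<in> space M \<Longrightarrow> k p \<in> borel_measurable lborel"
  using measurable_Pair2[OF km, of p] by simp

text \<open>The adjoint relation between integration of the kernel in \<open>z\<close> and
  integration in \<open>p\<close>. It is used twice, with \<open>g\<close> the given function and
  with \<open>g\<close> the image of \<open>u\<close> under the adjoint.\<close>

lemma pairing:
  fixes u :: "'p \<Rightarrow> 'b::euclidean_space" and g :: "'a \<Rightarrow> 'b"
  assumes u[measurable]: "u \<in> borel_measurable M" and ub: "\<And>p. p \<in> space M \<Longrightarrow> norm (u p) \<le> D"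
    and g: "integrable lborel g"
  shows "(\<integral>p. u p \<bullet> (\<integral>z. k p z *\<^sub>R g z \<partial>lborel) \<partial>M) = (\<integral>z. (\<integral>p. k p z *\<^sub>R u p \<partial>M) \<bullet> g z \<partial>lborel)"
    "integrable lborel (\<lambda>z. (\<integral>p. k p z *\<^sub>R u p \<partial>M) \<bullet> g z)"
proof -
  note [measurable] = borel_measurable_integrable[OF g]
  have gi: "integrable lborel (\<lambda>z. k p z *\<^sub>R g z)" if "p \<in> space M" for p
  proof (rule Bochner_Integration.integrable_bound[of _ "\<lambda>z. c *\<^sub>R g z"])
    show "AE x in lborel. norm (k p x *\<^sub>R g x) \<le> norm (c *\<^sub>R g x)"
      using k_le_c[OF that] by (simp add: mult_right_mono)
  qed (use g that in auto)
  have ui: "integrable M (\<lambda>p. k p z *\<^sub>R u p)" for z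
  proof (rule integrable_const_bound[of _ "\<bar>c\<bar> * D"])
    show "AE x in M. norm (k x z *\<^sub>R u x) \<le> \<bar>c\<bar> * D"
      using k_le_c ub by (intro AE_I2) (auto intro!: mult_mono)
  qed simp
  have int: "integrable (M \<Otimes>\<^sub>M lborel) (\<lambda>(p, z). k p z * (u p \<bullet> g z))"
  proof (rule integrable_prod_bound[OF finM, of lborel _ "\<lambda>z. \<bar>c\<bar> * \<bar>D\<bar> * norm (g z)"])
    show "integrable lborel (\<lambda>z. \<bar>c\<bar> * \<bar>D\<bar> * norm (g z))" using g by simp
    fix p z assume p: "p \<in> space M"
    have "\<bar>u p \<bullet> g z\<bar> \<le> \<bar>D\<bar> * norm (g z)"
      using Cauchy_Schwarz_ineq2[of "u p" "g z"] mult_right_mono[OF ub[OF p], of "norm (g z)"]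
        mult_right_mono[OF abs_ge_self[of D], of "norm (g z)"] by simp
    then show "norm (k p z * (u p \<bullet> g z)) \<le> \<bar>c\<bar> * \<bar>D\<bar> * norm (g z)"
      using mult_mono[OF k_le_c[OF p, of z], of "\<bar>u p \<bullet> g z\<bar>" "\<bar>D\<bar> * norm (g z)"] by (simp add: abs_mult mult.assoc)
  qed (auto intro: lborel.sigma_finite_measure_axioms)
  have "(\<integral>p. u p \<bullet> (\<integral>z. k p z *\<^sub>R g z \<partial>lborel) \<partial>M) = (\<integral>p. (\<integral>z. k p z * (u p \<bullet> g z) \<partial>lborel) \<partial>M)"
    by (intro Bochner_Integration.integral_cong refl)
      (simp add: integral_inner_right[symmetric, OF gi])
  also have "\<dots> = (\<integral>z. (\<integral>p. k p z * (u p \<bullet> g z) \<partial>M) \<partial>lborel)"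
    by (rule pr.Fubini_integral[OF int, symmetric])
  also have "\<dots> = (\<integral>z. (\<integral>p. k p z *\<^sub>R u p \<partial>M) \<bullet> g z \<partial>lborel)"
    by (intro Bochner_Integration.integral_cong refl)
      (simp add: integral_inner_left[symmetric, OF ui])
  finally show "(\<integral>p. u p \<bullet> (\<integral>z. k p z *\<^sub>R g z \<partial>lborel) \<partial>M) = (\<integral>z. (\<integral>p. k p z *\<^sub>R u p \<partial>M) \<bullet> g z \<partial>lborel)" .
  have "integrable lborel (\<lambda>z. \<integral>p. k p z * (u p \<bullet> g z) \<partial>M)"
    using pr.integrable_snd[OF int] by simp
  then show "integrable lborel (\<lambda>z. (\<integral>p. k p z *\<^sub>R u p \<partial>M) \<bullet> g z)"
    by (simp add: integral_inner_left[symmetric, OF ui])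
qed

lemma K_measurable[measurable]:
  "(\<lambda>q. \<integral>z. k (fst q) z * k (snd q) z \<partial>lborel) \<in> borel_measurable (M \<Otimes>\<^sub>M M)"
proof (rule lborel.borel_measurable_lebesgue_integral)
  have 1: "(\<lambda>x. k (fst (fst x)) (snd x)) \<in> borel_measurable ((M \<Otimes>\<^sub>M M) \<Otimes>\<^sub>M lborel)"
    using measurable_compose[OF _ km, of "\<lambda>x. (fst (fst x), snd x)" "(M \<Otimes>\<^sub>M M) \<Otimes>\<^sub>M lborel"] by simp
  have 2: "(\<lambda>x. k (snd (fst x)) (snd x)) \<in> borel_measurable ((M \<Otimes>\<^sub>M M) \<Otimes>\<^sub>M lborel)"
    using measurable_compose[OF _ km, of "\<lambda>x. (snd (fst x), snd x)" "(M \<Otimes>\<^sub>M M) \<Otimes>\<^sub>M lborel"] by simp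
  show "(\<lambda>(x, z). k (fst x) z * k (snd x) z) \<in> borel_measurable ((M \<Otimes>\<^sub>M M) \<Otimes>\<^sub>M lborel)"
    using borel_measurable_times[OF 1 2] by (simp add: case_prod_beta')
qed

text \<open>The \<open>T T\<^sup>*\<close> method: Schur's test is applied to the kernel of \<open>T T\<^sup>*\<close> instead of that of \<open>T\<close>.\<close>

lemma Schur_TT:
  fixes f :: "'a \<Rightarrow> 'b::euclidean_space"
  assumes f: "integrable lborel f" and f2: "integrable lborel (\<lambda>z. (norm (f z))\<^sup>2)" and L: "0 < L"
    and Schur: "\<And>p. p \<in> space M \<Longrightarrow> (\<integral>\<^sup>+p'. ennreal \<bar>\<integral>z. k p z * k p' z \<partial>lborel\<bar> \<partial>M) \<le> ennreal L"
  shows "(\<integral>\<^sup>+p. ennreal ((norm (\<integral>z. k p z *\<^sub>R f z \<partial>lborel))\<^sup>2) \<partial>M) \<le> ennreal (L * (\<integral>z. (norm (f z))\<^sup>2 \<partial>lborel))"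
proof -
  note fm[measurable] = borel_measurable_integrable[OF f]
  define u where "u p = (\<integral>z. k p z *\<^sub>R f z \<partial>lborel)" for p
  define K where "K p p' = (\<integral>z. k p z * k p' z \<partial>lborel)" for p p'
  define D where "D = \<bar>c\<bar> * (\<integral>z. norm (f z) \<partial>lborel)"
  have um[measurable]: "u \<in> borel_measurable M"
    unfolding u_def by (rule lborel.borel_measurable_lebesgue_integral) measurable
  have Km: "(\<lambda>q. K (fst q) (snd q)) \<in> borel_measurable (M \<Otimes>\<^sub>M M)" unfolding K_def by measurable
  have K1[measurable]: "K p \<in> borel_measurable M" if "p \<in> space M" for p
    using measurable_Pair2[OF Km that] by simp
  have ub: "norm (u p) \<le> D" if p: "p \<in> space M" for p
  proof -
    have "norm (u p) \<le> (\<integral>z. \<bar>c\<bar> * norm (f z) \<partial>lborel)"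
      unfolding u_def
    proof (rule Bochner_Integration.integral_norm_bound_integral)
      show "integrable lborel (\<lambda>z. k p z *\<^sub>R f z)"
        by (rule Bochner_Integration.integrable_bound[of _ "\<lambda>z. c *\<^sub>R f z"])
          (use f k_le_c p in \<open>auto intro!: AE_I2 mult_right_mono\<close>)
    qed (use f k_le_c p in \<open>auto intro!: mult_right_mono\<close>)
    then show ?thesis by (simp add: D_def)
  qed
  have D: "0 \<le> D" by (simp add: D_def)
  \<comment> \<open>With \<open>u = T f\<close>, this is the adjoint applied to \<open>T f\<close>.
    The aim is \<open>I = <S, f>\<close> for \<open>I\<close> the squared norm of \<open>u\<close>,
    together with \<open><S, S> \<le> L * I\<close>.\<close>
  define S where "S z = (\<integral>p. k p z *\<^sub>R u p \<partial>M)" for z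
  have Sm[measurable]: "S \<in> borel_measurable lborel"
  proof -
    have "(\<lambda>(z, p). k p z *\<^sub>R u p) \<in> borel_measurable (lborel \<Otimes>\<^sub>M M)"
      using measurable_pair_swap[OF km] by measurable
    then show ?thesis unfolding S_def by (rule borel_measurable_lebesgue_integral)
  qed
  have ki: "integrable M (\<lambda>p. k p z *\<^sub>R u p)" for z
    by (rule integrable_const_bound[of _ "\<bar>c\<bar> * D"])
      (use k_le_c ub in \<open>auto intro!: AE_I2 mult_mono\<close>)
  define m where "m = measure M (space M)"
  have Sb: "norm (S z) \<le> (c * indicator (ball 0 \<rho>) z) * (D * m)" for z
  proof -
    have "norm (S z) \<le> (\<integral>p. norm (k p z *\<^sub>R u p) \<partial>M)"
      unfolding S_def by (rule integral_norm_bound)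
    also have "\<dots> \<le> (\<integral>p. (c * indicator (ball 0 \<rho>) z) * D \<partial>M)"
    proof (rule integral_mono)
      show "integrable M (\<lambda>p. norm (k p z *\<^sub>R u p))" using ki by (rule integrable_norm)
      fix p assume p: "p \<in> space M"
      show "norm (k p z *\<^sub>R u p) \<le> c * indicator (ball 0 \<rho>) z * D"
        using mult_mono[OF kb[OF p, of z] ub[OF p]] order_trans[OF abs_ge_zero kb[OF p, of z]] by simp
    qed simp
    finally show ?thesis by (simp add: m_def mult_ac)
  qed
  have Si: "integrable lborel S"
    by (rule Bochner_Integration.integrable_bound[OF integrable_mult_left[OF c_ball, of "D * m"]])
      (use Sb in \<open>auto intro!: AE_I2 intro: order_trans[OF _ abs_ge_self]\<close>)
  define I where "I = (\<integral>p. (norm (u p))\<^sup>2 \<partial>M)"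
  have u2i: "integrable M (\<lambda>p. (norm (u p))\<^sup>2)"
    by (rule integrable_const_bound[of _ "D\<^sup>2"]) (use ub in \<open>auto intro!: AE_I2 power_mono\<close>)
  have I0: "0 \<le> I" unfolding I_def by simp
  have 1: "I = (\<integral>z. S z \<bullet> f z \<partial>lborel)" and Sfi: "integrable lborel (\<lambda>z. S z \<bullet> f z)"
    using pairing[OF um ub f] unfolding I_def S_def u_def[symmetric] by (simp_all add: power2_norm_eq_inner)
  have 2: "(\<integral>p. u p \<bullet> (\<integral>z. k p z *\<^sub>R S z \<partial>lborel) \<partial>M) = (\<integral>z. S z \<bullet> S z \<partial>lborel)"
    and SSi: "integrable lborel (\<lambda>z. S z \<bullet> S z)"
    using pairing[OF um ub Si] unfolding S_def[symmetric] by simp_all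
  \<comment> \<open>Applying the operator to \<open>S\<close> gives the integral operator with
    kernel \<open>K\<close> applied to \<open>u\<close>; so \<open><S, S>\<close> becomes a double
    integral of \<open>K\<close> against \<open>u\<close>.\<close>
  have v: "(\<integral>z. k p z *\<^sub>R S z \<partial>lborel) = (\<integral>p'. K p p' *\<^sub>R u p' \<partial>M)" if p: "p \<in> space M" for p
  proof -
    note [measurable] = km1[OF p]
    have int: "integrable (M \<Otimes>\<^sub>M lborel) (\<lambda>(p', z). (k p z * k p' z) *\<^sub>R u p')"
    proof (rule integrable_prod_bound[OF finM, of lborel _ "\<lambda>z. (\<bar>c\<bar> * D) * (c * indicator (ball 0 \<rho>) z)"])
      show "integrable lborel (\<lambda>z::'a. (\<bar>c\<bar> * D) * (c * indicator (ball 0 \<rho>) z))"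
        by (intro integrable_mult_right c_ball)
      fix p' z assume p': "p' \<in> space M"
      have "\<bar>k p z\<bar> * \<bar>k p' z\<bar> * norm (u p') \<le> w * \<bar>c\<bar> * D" if "\<bar>k p z\<bar> \<le> w" for w
        using order_trans[OF abs_ge_zero that]
        by (intro mult_mono that k_le_c[OF p'] ub[OF p'] mult_nonneg_nonneg) auto
      from this[OF kb[OF p, of z]] show "norm ((k p z * k p' z) *\<^sub>R u p') \<le> (\<bar>c\<bar> * D) * (c * indicator (ball 0 \<rho>) z)"
        by (simp add: abs_mult mult_ac)
    qed (auto intro: lborel.sigma_finite_measure_axioms)
    have kk: "integrable lborel (\<lambda>z. k p z * k p' z)" if "p' \<in> space M" for p'
    proof (rule Bochner_Integration.integrable_bound[OF integrable_mult_right[OF c_ball, of "\<bar>c\<bar>"]])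
      show "AE z in lborel. norm (k p z * k p' z) \<le> norm (\<bar>c\<bar> * (c * indicat_real (ball 0 \<rho>) z))"
      proof (rule AE_I2)
        fix z
        have "\<bar>k p' z\<bar> * \<bar>k p z\<bar> \<le> \<bar>c\<bar> * (c * indicat_real (ball 0 \<rho>) z)"
          by (intro mult_mono kb[OF p] k_le_c[OF that]) auto
        then show "norm (k p z * k p' z) \<le> norm (\<bar>c\<bar> * (c * indicat_real (ball 0 \<rho>) z))"
          unfolding real_norm_def abs_mult[of "k p z"] mult.commute[of "\<bar>k p z\<bar>"]
          using abs_ge_self order_trans by blast
      qed
    qed (use that p in measurable)
    have "(\<integral>z. k p z *\<^sub>R S z \<partial>lborel) = (\<integral>z. (\<integral>p'. (k p z * k p' z) *\<^sub>R u p' \<partial>M) \<partial>lborel)"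
      unfolding S_def by (simp flip: integral_scaleR_right scaleR_scaleR)
    also have "\<dots> = (\<integral>p'. (\<integral>z. (k p z * k p' z) *\<^sub>R u p' \<partial>lborel) \<partial>M)"
      by (rule pr.Fubini_integral[OF int])
    also have "\<dots> = (\<integral>p'. K p p' *\<^sub>R u p' \<partial>M)"
      unfolding K_def by (intro Bochner_Integration.integral_cong refl integral_scaleR_left) (use kk in auto)
    finally show ?thesis .
  qed
  have sym: "K p p' = K p' p" for p p' unfolding K_def by (simp add: mult.commute)
  have "ennreal (\<integral>z. S z \<bullet> S z \<partial>lborel) = ennreal \<bar>\<integral>p. u p \<bullet> (\<integral>p'. K p p' *\<^sub>R u p' \<partial>M) \<partial>M\<bar>"
  proof -
    have "(\<integral>p. u p \<bullet> (\<integral>p'. K p p' *\<^sub>R u p' \<partial>M) \<partial>M) = (\<integral>z. S z \<bullet> S z \<partial>lborel)"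
      unfolding 2[symmetric] by (intro Bochner_Integration.integral_cong refl) (simp add: v)
    moreover have "0 \<le> (\<integral>z. S z \<bullet> S z \<partial>lborel)" by simp
    ultimately show ?thesis by simp
  qed
  also have "\<dots> \<le> (\<integral>\<^sup>+p. ennreal (norm (u p \<bullet> (\<integral>p'. K p p' *\<^sub>R u p' \<partial>M))) \<partial>M)"
  proof -
    have "integrable M (\<lambda>p. u p \<bullet> (\<integral>z. k p z *\<^sub>R S z \<partial>lborel))"
    proof (rule integrable_const_bound[of _ "D * (\<bar>c\<bar> * (\<integral>z. norm (S z) \<partial>lborel))"])
      show "AE p in M. norm (u p \<bullet> (\<integral>z. k p z *\<^sub>R S z \<partial>lborel)) \<le> D * (\<bar>c\<bar> * (\<integral>z. norm (S z) \<partial>lborel))"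
      proof (rule AE_I2)
        fix p assume p: "p \<in> space M"
        have "norm (\<integral>z. k p z *\<^sub>R S z \<partial>lborel) \<le> (\<integral>z. \<bar>c\<bar> * norm (S z) \<partial>lborel)"
        proof (rule Bochner_Integration.integral_norm_bound_integral)
          show "integrable lborel (\<lambda>z. k p z *\<^sub>R S z)"
            by (rule Bochner_Integration.integrable_bound[of _ "\<lambda>z. c *\<^sub>R S z"])
              (use Si k_le_c p in \<open>auto intro!: AE_I2 mult_right_mono\<close>)
        qed (use Si k_le_c p in \<open>auto intro!: mult_right_mono\<close>)
        then have "norm (u p) * norm (\<integral>z. k p z *\<^sub>R S z \<partial>lborel) \<le> D * (\<bar>c\<bar> * (\<integral>z. norm (S z) \<partial>lborel))"
          using ub[OF p] D by (intro mult_mono) auto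
        then show "norm (u p \<bullet> (\<integral>z. k p z *\<^sub>R S z \<partial>lborel)) \<le> D * (\<bar>c\<bar> * (\<integral>z. norm (S z) \<partial>lborel))"
          using Cauchy_Schwarz_ineq2[of "u p"] by (simp, meson order_trans)
      qed
    qed measurable
    then have "integrable M (\<lambda>p. u p \<bullet> (\<integral>p'. K p p' *\<^sub>R u p' \<partial>M))"
      using v by (simp cong: Bochner_Integration.integrable_cong)
    from integral_norm_bound_ennreal[OF this] show ?thesis by simp
  qed
  also have "\<dots> \<le> (\<integral>\<^sup>+p. \<integral>\<^sup>+p'. ennreal ((norm (u p))\<^sup>2 / 2) * ennreal \<bar>K p p'\<bar> + ennreal ((norm (u p'))\<^sup>2 / 2) * ennreal \<bar>K p p'\<bar> \<partial>M \<partial>M)"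
  proof (rule nn_integral_mono)
    fix p assume p: "p \<in> space M"
    note [measurable] = K1[OF p]
    show "ennreal (norm (u p \<bullet> (\<integral>p'. K p p' *\<^sub>R u p' \<partial>M)))
      \<le> (\<integral>\<^sup>+p'. ennreal ((norm (u p))\<^sup>2 / 2) * ennreal \<bar>K p p'\<bar> + ennreal ((norm (u p'))\<^sup>2 / 2) * ennreal \<bar>K p p'\<bar> \<partial>M)"
    proof (cases "integrable M (\<lambda>p'. K p p' *\<^sub>R u p')")
      case True
      have "ennreal (norm (u p \<bullet> (\<integral>p'. K p p' *\<^sub>R u p' \<partial>M))) = ennreal (norm (\<integral>p'. u p \<bullet> (K p p' *\<^sub>R u p') \<partial>M))"
        using True by (subst integral_inner_right) auto
      also have "\<dots> \<le> (\<integral>\<^sup>+p'. ennreal (norm (u p \<bullet> (K p p' *\<^sub>R u p'))) \<partial>M)"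
        by (rule integral_norm_bound_ennreal[OF integrable_inner_right]) (use True in auto)
      also have "\<dots> \<le> (\<integral>\<^sup>+p'. ennreal ((norm (u p))\<^sup>2 / 2) * ennreal \<bar>K p p'\<bar> + ennreal ((norm (u p'))\<^sup>2 / 2) * ennreal \<bar>K p p'\<bar> \<partial>M)"
      proof (rule nn_integral_mono)
        fix p'
        have "\<bar>u p \<bullet> u p'\<bar> \<le> norm (u p) * norm (u p')" by (rule Cauchy_Schwarz_ineq2)
        also have "\<dots> \<le> (norm (u p))\<^sup>2 / 2 + (norm (u p'))\<^sup>2 / 2"
          using sum_squares_bound[of "norm (u p)" "norm (u p')"] by (simp add: field_simps)
        finally have "norm (u p \<bullet> (K p p' *\<^sub>R u p')) \<le> ((norm (u p))\<^sup>2 / 2 + (norm (u p'))\<^sup>2 / 2) * \<bar>K p p'\<bar>"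
          by (simp add: abs_mult mult.commute[of "\<bar>K p p'\<bar>"] mult_right_mono)
        then have "ennreal (norm (u p \<bullet> (K p p' *\<^sub>R u p'))) \<le> ennreal ((norm (u p))\<^sup>2 / 2 * \<bar>K p p'\<bar> + (norm (u p'))\<^sup>2 / 2 * \<bar>K p p'\<bar>)"
          by (intro ennreal_leI) (simp add: distrib_right)
        also have "\<dots> = ennreal ((norm (u p))\<^sup>2 / 2) * ennreal \<bar>K p p'\<bar> + ennreal ((norm (u p'))\<^sup>2 / 2) * ennreal \<bar>K p p'\<bar>"
          by (simp flip: ennreal_mult ennreal_plus)
        finally show "ennreal (norm (u p \<bullet> (K p p' *\<^sub>R u p'))) \<le> \<dots>" .
      qed
      finally show ?thesis .
    \<comment> \<open>A non-integrable inner integrand has Bochner integral 0, and the bound is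
      trivial.\<close>
    qed (simp add: not_integrable_integral_eq)
  qed
  also have "\<dots> = (\<integral>\<^sup>+p. (\<integral>\<^sup>+p'. ennreal ((norm (u p))\<^sup>2 / 2) * ennreal \<bar>K p p'\<bar> \<partial>M) + (\<integral>\<^sup>+p'. ennreal ((norm (u p'))\<^sup>2 / 2) * ennreal \<bar>K p p'\<bar> \<partial>M) \<partial>M)"
  proof (rule nn_integral_cong)
    fix p assume "p \<in> space M"
    note [measurable] = K1[OF this]
    show "(\<integral>\<^sup>+p'. ennreal ((norm (u p))\<^sup>2 / 2) * ennreal \<bar>K p p'\<bar> + ennreal ((norm (u p'))\<^sup>2 / 2) * ennreal \<bar>K p p'\<bar> \<partial>M)
      = (\<integral>\<^sup>+p'. ennreal ((norm (u p))\<^sup>2 / 2) * ennreal \<bar>K p p'\<bar> \<partial>M) + (\<integral>\<^sup>+p'. ennreal ((norm (u p'))\<^sup>2 / 2) * ennreal \<bar>K p p'\<bar> \<partial>M)"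
      by (rule nn_integral_add) measurable
  qed
  also have "\<dots> = (\<integral>\<^sup>+p. \<integral>\<^sup>+p'. ennreal ((norm (u p))\<^sup>2 / 2) * ennreal \<bar>K p p'\<bar> \<partial>M \<partial>M) + (\<integral>\<^sup>+p. \<integral>\<^sup>+p'. ennreal ((norm (u p'))\<^sup>2 / 2) * ennreal \<bar>K p p'\<bar> \<partial>M \<partial>M)"
    using Km by (intro nn_integral_add borel_measurable_nn_integral; unfold case_prod_beta'; measurable)
  finally have SSJ: "ennreal (\<integral>z. S z \<bullet> S z \<partial>lborel) \<le> \<dots>" .
  \<comment> \<open>Since \<open>K\<close> is symmetric, the two halves produced by
    \<open>2 a b \<le> a^2 + b^2\<close> are equal; a bound on the rows of \<open>K\<close> is then
    sufficient.\<close>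
  have "(\<integral>\<^sup>+p. \<integral>\<^sup>+p'. ennreal ((norm (u p'))\<^sup>2 / 2) * ennreal \<bar>K p p'\<bar> \<partial>M \<partial>M) = (\<integral>\<^sup>+p'. \<integral>\<^sup>+p. ennreal ((norm (u p'))\<^sup>2 / 2) * ennreal \<bar>K p p'\<bar> \<partial>M \<partial>M)"
  proof -
    interpret MM: pair_sigma_finite M M ..
    have "(\<lambda>q. ennreal ((norm (u (snd q)))\<^sup>2 / 2) * ennreal \<bar>K (fst q) (snd q)\<bar>) \<in> borel_measurable (M \<Otimes>\<^sub>M M)"
      using Km by measurable
    from MM.Fubini[OF this] show ?thesis by simp
  qed
  also have "\<dots> = (\<integral>\<^sup>+p. \<integral>\<^sup>+p'. ennreal ((norm (u p))\<^sup>2 / 2) * ennreal \<bar>K p p'\<bar> \<partial>M \<partial>M)"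
    by (intro nn_integral_cong) (simp add: sym)
  finally have JJ: "(\<integral>\<^sup>+p. \<integral>\<^sup>+p'. ennreal ((norm (u p'))\<^sup>2 / 2) * ennreal \<bar>K p p'\<bar> \<partial>M \<partial>M) = (\<integral>\<^sup>+p. \<integral>\<^sup>+p'. ennreal ((norm (u p))\<^sup>2 / 2) * ennreal \<bar>K p p'\<bar> \<partial>M \<partial>M)" .
  have "(\<integral>\<^sup>+p. \<integral>\<^sup>+p'. ennreal ((norm (u p))\<^sup>2 / 2) * ennreal \<bar>K p p'\<bar> \<partial>M \<partial>M) \<le> (\<integral>\<^sup>+p. ennreal ((norm (u p))\<^sup>2) * ennreal (L / 2) \<partial>M)"
  proof (rule nn_integral_mono)
    fix p assume p: "p \<in> space M"
    note [measurable] = K1[OF p]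
    have "(\<integral>\<^sup>+p'. ennreal ((norm (u p))\<^sup>2 / 2) * ennreal \<bar>K p p'\<bar> \<partial>M) = ennreal ((norm (u p))\<^sup>2 / 2) * (\<integral>\<^sup>+p'. ennreal \<bar>K p p'\<bar> \<partial>M)"
      by (rule nn_integral_cmult) measurable
    also have "\<dots> \<le> ennreal ((norm (u p))\<^sup>2 / 2) * ennreal L"
      using Schur[OF p] by (intro mult_left_mono) (auto simp: K_def)
    also have "\<dots> = ennreal ((norm (u p))\<^sup>2) * ennreal (L / 2)"
      using L by (simp flip: ennreal_mult)
    finally show "(\<integral>\<^sup>+p'. ennreal ((norm (u p))\<^sup>2 / 2) * ennreal \<bar>K p p'\<bar> \<partial>M) \<le> ennreal ((norm (u p))\<^sup>2) * ennreal (L / 2)" .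
  qed
  also have "(\<integral>\<^sup>+p. ennreal ((norm (u p))\<^sup>2) * ennreal (L / 2) \<partial>M) = (\<integral>\<^sup>+p. ennreal ((norm (u p))\<^sup>2) \<partial>M) * ennreal (L / 2)"
    by (rule nn_integral_multc) measurable
  also have "(\<integral>\<^sup>+p. ennreal ((norm (u p))\<^sup>2) \<partial>M) = ennreal I"
    unfolding I_def by (rule nn_integral_eq_integral[OF u2i]) simp
  finally have "ennreal (\<integral>z. S z \<bullet> S z \<partial>lborel) \<le> ennreal I * ennreal (L / 2) + ennreal I * ennreal (L / 2)"
    using SSJ unfolding JJ by (meson add_mono order_trans)
  also have "\<dots> = ennreal (L * I)"
    using L I0 by (simp flip: ennreal_plus ennreal_mult)
  finally have SS: "(\<integral>z. S z \<bullet> S z \<partial>lborel) \<le> L * I"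
    using L I0 by (simp add: ennreal_le_iff)
  \<comment> \<open>The weight \<open>L\<close> in the arithmetic-geometric inequality is chosen so
    that the \<open>S\<close> term contributes at most \<open>I / 2\<close>. It can be absorbed on
    the left because \<open>I\<close> is a finite number.\<close>
  have "I \<le> (\<integral>z. L / 2 * (norm (f z))\<^sup>2 + 1 / (2 * L) * (S z \<bullet> S z) \<partial>lborel)"
    unfolding 1
  proof (rule integral_mono)
    show "integrable lborel (\<lambda>z. L / 2 * (norm (f z))\<^sup>2 + 1 / (2 * L) * (S z \<bullet> S z))" using f2 SSi by simp
    fix z
    have "0 \<le> (L *\<^sub>R f z - S z) \<bullet> (L *\<^sub>R f z - S z)" by simp
    then have "2 * L * (S z \<bullet> f z) \<le> L * L * (norm (f z))\<^sup>2 + S z \<bullet> S z"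
      by (simp add: inner_diff_left inner_diff_right power2_norm_eq_inner inner_commute algebra_simps)
    then show "S z \<bullet> f z \<le> L / 2 * (norm (f z))\<^sup>2 + 1 / (2 * L) * (S z \<bullet> S z)"
      using L by (simp add: field_simps)
  qed (rule Sfi)
  also have "\<dots> = L / 2 * (\<integral>z. (norm (f z))\<^sup>2 \<partial>lborel) + 1 / (2 * L) * (\<integral>z. S z \<bullet> S z \<partial>lborel)"
    using f2 SSi by simp
  also have "\<dots> \<le> L / 2 * (\<integral>z. (norm (f z))\<^sup>2 \<partial>lborel) + 1 / (2 * L) * (L * I)"
    using SS L by (intro add_left_mono mult_left_mono) auto
  also have "\<dots> = L / 2 * (\<integral>z. (norm (f z))\<^sup>2 \<partial>lborel) + I / 2" using L by simp
  finally have "I \<le> L * (\<integral>z. (norm (f z))\<^sup>2 \<partial>lborel)" by simp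
  moreover have "(\<integral>\<^sup>+p. ennreal ((norm (u p))\<^sup>2) \<partial>M) = ennreal I"
    unfolding I_def by (rule nn_integral_eq_integral[OF u2i]) simp
  ultimately show ?thesis unfolding u_def by (simp add: ennreal_leI)
qed

end

text \<open>Linearisation of the supremum: a measurable choice, at each \<open>p = (y, t)\<close>, of one of the first
  \<open>N\<close> members of a dense sequence.\<close>

lemma linearised_kernel:
  fixes f :: "'a::euclidean_space \<Rightarrow> 'b::euclidean_space" and s :: "nat \<Rightarrow> 'a \<Rightarrow> real"
  assumes \<alpha>: "0 < \<alpha>" and s: "\<And>i. s i \<in> C_class \<alpha>" and f: "f \<in> borel_measurable borel"
  shows "\<exists>k :: 'a \<times> real \<Rightarrow> 'a \<Rightarrow> real. case_prod k \<in> borel_measurable ((borel \<Otimes>\<^sub>M borel) \<Otimes>\<^sub>M borel)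
    \<and> (\<forall>p. \<exists>\<phi>\<in>C_class \<alpha>. k p = (\<lambda>z. dilate (snd p) \<phi> (fst p - z)))
    \<and> (\<forall>p. \<forall>i\<le>N. norm (convol f (dilate (snd p) (s i)) (fst p)) \<le> norm (\<integral>z. k p z *\<^sub>R f z \<partial>lborel))"
proof (induction N)
  case 0
  show ?case
  proof (intro exI[of _ "\<lambda>p z. dilate (snd p) (s 0) (fst p - z)"] conjI allI impI)
    show "case_prod (\<lambda>p z. dilate (snd p) (s 0) (fst p - z)) \<in> borel_measurable ((borel \<Otimes>\<^sub>M borel) \<Otimes>\<^sub>M borel)"
      using dilate_borel[OF s \<alpha>, of 0] by (simp add: case_prod_beta')
  qed (use s f in \<open>auto simp: convol_eq_lborel[OF s \<alpha> f]\<close>)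
next
  case (Suc N)
  then obtain k :: "'a \<times> real \<Rightarrow> 'a \<Rightarrow> real" where
      km[measurable]: "case_prod k \<in> borel_measurable ((borel \<Otimes>\<^sub>M borel) \<Otimes>\<^sub>M borel)"
    and kc: "\<And>p. \<exists>\<phi>\<in>C_class \<alpha>. k p = (\<lambda>z. dilate (snd p) \<phi> (fst p - z))"
    and kn: "\<And>p i. i \<le> N \<Longrightarrow> norm (convol f (dilate (snd p) (s i)) (fst p)) \<le> norm (\<integral>z. k p z *\<^sub>R f z \<partial>lborel)"
    by blast
  note [measurable] = f
  define u where "u p = norm (\<integral>z. k p z *\<^sub>R f z \<partial>lborel)" for p
  define v where "v p = norm (convol f (dilate (snd p) (s (Suc N))) (fst p))" for p
  have um[measurable]: "u \<in> borel_measurable (borel \<Otimes>\<^sub>M borel)"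
  proof -
    have "(\<lambda>p. \<integral>z. k p z *\<^sub>R f z \<partial>lborel) \<in> borel_measurable (borel \<Otimes>\<^sub>M borel)"
      using km by (intro lborel.borel_measurable_lebesgue_integral) (simp add: case_prod_beta')
    then show ?thesis unfolding u_def by (rule measurable_compose[OF _ borel_measurable_norm])
  qed
  have vm[measurable]: "v \<in> borel_measurable (borel \<Otimes>\<^sub>M borel)"
    unfolding v_def using measurable_compose[OF convol_borel[OF s \<alpha> f] borel_measurable_norm] .
  \<comment> \<open>The kernel switches to the new test function exactly where that one gives the
    larger integral against \<open>f\<close>; the comparison is measurable in \<open>p\<close>,
    hence so is the choice.\<close>
  define k' where "k' p z = (if u p < v p then dilate (snd p) (s (Suc N)) (fst p - z) else k p z)" for p z
  have k': "(\<integral>z. k' p z *\<^sub>R f z \<partial>lborel) = (if u p < v p then convol f (dilate (snd p) (s (Suc N))) (fst p) else (\<integral>z. k p z *\<^sub>R f z \<partial>lborel))" for p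
    unfolding k'_def by (simp add: convol_eq_lborel[OF s \<alpha> f])
  show ?case
  proof (intro exI[of _ k'] conjI allI impI)
    have [measurable]: "(\<lambda>p. dilate (snd (fst p)) (s (Suc N)) (fst (fst p) - snd p)) \<in> borel_measurable ((borel \<Otimes>\<^sub>M borel) \<Otimes>\<^sub>M borel)"
      by (rule dilate_borel[OF s \<alpha>])
    have [measurable]: "(\<lambda>q. k (fst q) (snd q)) \<in> borel_measurable ((borel \<Otimes>\<^sub>M borel) \<Otimes>\<^sub>M borel)"
      using km by (simp add: case_prod_beta')
    show "case_prod k' \<in> borel_measurable ((borel \<Otimes>\<^sub>M borel) \<Otimes>\<^sub>M borel)"
      unfolding k'_def case_prod_beta' by measurable
    show "\<exists>\<phi>\<in>C_class \<alpha>. k' p = (\<lambda>z. dilate (snd p) \<phi> (fst p - z))" for p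
      using kc[of p] s[of "Suc N"] unfolding k'_def by (cases "u p < v p") auto
    fix p i assume "i \<le> Suc N"
    then show "norm (convol f (dilate (snd p) (s i)) (fst p)) \<le> norm (\<integral>z. k' p z *\<^sub>R f z \<partial>lborel)"
      using kn[of i p] unfolding k' by (cases "i = Suc N") (auto simp: u_def v_def)
  qed
qed

text \<open>The wider kernel is Hoelder continuous on the scale where the narrower one has mean zero.\<close>

lemma integral_dilate_mult_le:
  fixes \<phi> \<psi> :: "'a::euclidean_space \<Rightarrow> real"
  assumes \<alpha>: "0 < \<alpha>" and \<phi>: "\<phi> \<in> C_class \<alpha>" and \<psi>: "\<psi> \<in> C_class \<alpha>" and t: "0 < t" "t \<le> t'"
  shows "\<bar>\<integral>z. dilate t \<phi> (y - z) * dilate t' \<psi> (y' - z) \<partial>lborel\<bar>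
    \<le> unit_ball_vol DIM('a) * (1 / t' ^ DIM('a) * (t / t') powr \<alpha>) * indicator (ball y (t + t')) y'"
proof (cases "y' \<in> ball y (t + t')")
  case False
  have "dilate t \<phi> (y - z) * dilate t' \<psi> (y' - z) = 0" for z
  proof -
    have "z \<notin> ball y t \<or> z \<notin> ball y' t'"
      using False dist_triangle[of y y' z] by (auto simp: dist_commute)
    then show ?thesis
      using abs_dilate_le[OF \<phi> \<alpha> t(1), of y z] abs_dilate_le[OF \<psi> \<alpha>, of t' y' z] t by auto
  qed
  then have "(\<lambda>z. dilate t \<phi> (y - z) * dilate t' \<psi> (y' - z)) = (\<lambda>z. 0)" by (rule ext)
  then have "(\<integral>z. dilate t \<phi> (y - z) * dilate t' \<psi> (y' - z) \<partial>lborel) = 0" by (simp only: integral_zero)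
  then show ?thesis using False by simp
next
  case True
  have t': "0 < t'" using t by simp
  let ?c = "1 / t ^ DIM('a) * (1 / t' ^ DIM('a) * (t / t') powr \<alpha>)"
  have i1: "integrable lborel (\<lambda>z. dilate t \<phi> (y - z) * dilate t' \<psi> (y' - z))"
    using integrable_dilate_mult[OF \<phi> \<alpha> t(1) integrable_imp_locint[OF integrable_dilate[OF \<psi> \<alpha> t']], of y y'] by simp
  have i2: "integrable lborel (\<lambda>z. dilate t \<phi> (y - z) * dilate t' \<psi> (y' - y))"
    using integrable_dilate[OF \<phi> \<alpha> t(1)] by simp
  have "(\<integral>z. dilate t \<phi> (y - z) * dilate t' \<psi> (y' - z) \<partial>lborel)
     = (\<integral>z. dilate t \<phi> (y - z) * dilate t' \<psi> (y' - z) \<partial>lborel) - (\<integral>z. dilate t \<phi> (y - z) \<partial>lborel) * dilate t' \<psi> (y' - y)"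
    using integral_dilate[OF \<phi> \<alpha> t(1)] by simp
  also have "\<dots> = (\<integral>z. dilate t \<phi> (y - z) * dilate t' \<psi> (y' - z) - dilate t \<phi> (y - z) * dilate t' \<psi> (y' - y) \<partial>lborel)"
    using i1 i2 by simp
  finally have "\<bar>\<integral>z. dilate t \<phi> (y - z) * dilate t' \<psi> (y' - z) \<partial>lborel\<bar>
    \<le> (\<integral>z. ?c * indicator (ball y t) z \<partial>lborel)"
  proof (simp only:, intro integral_abs_bound_integral)
    show "integrable lborel (\<lambda>z. dilate t \<phi> (y - z) * dilate t' \<psi> (y' - z) - dilate t \<phi> (y - z) * dilate t' \<psi> (y' - y))"
      using i1 i2 by simp
    show "integrable lborel (\<lambda>z. ?c * indicator (ball y t) z :: real)"
      using emeasure_lborel_ball_finite[of y t] by (intro integrable_mult_right integrable_real_indicator) auto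
    fix z
    show "\<bar>dilate t \<phi> (y - z) * dilate t' \<psi> (y' - z) - dilate t \<phi> (y - z) * dilate t' \<psi> (y' - y)\<bar> \<le> ?c * indicator (ball y t) z"
    proof (cases "z \<in> ball y t")
      case True
      have "\<bar>dilate t' \<psi> (y' - z) - dilate t' \<psi> (y' - y)\<bar> \<le> 1 / t' ^ DIM('a) * (norm (y - z) / t') powr \<alpha>"
        using dilate_Holder[OF \<psi> t', of "y' - z" "y' - y"] by simp
      also have "\<dots> \<le> 1 / t' ^ DIM('a) * (t / t') powr \<alpha>"
        using True t t' \<alpha> by (intro mult_left_mono powr_mono2 divide_right_mono) (auto simp: dist_norm)
      finally have "\<bar>dilate t \<phi> (y - z)\<bar> * \<bar>dilate t' \<psi> (y' - z) - dilate t' \<psi> (y' - y)\<bar>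
        \<le> 1 / t ^ DIM('a) * (1 / t' ^ DIM('a) * (t / t') powr \<alpha>)"
        using abs_dilate_le[OF \<phi> \<alpha> t(1), of y z] True t by (intro mult_mono) auto
      then show ?thesis using True by (simp add: abs_mult right_diff_distrib[symmetric])
    next
      case False
      then show ?thesis using abs_dilate_le[OF \<phi> \<alpha> t(1), of y z] by simp
    qed
  qed
  also have "\<dots> = ?c * (unit_ball_vol DIM('a) * t ^ DIM('a))"
    using t(1) content_ball[of t y] by (simp add: measure_def)
  also have "\<dots> = unit_ball_vol DIM('a) * (1 / t' ^ DIM('a) * (t / t') powr \<alpha>)"
    using t(1) by simp
  finally show ?thesis using True by simp
qed

text \<open>The two sides of \<open>t' = t\<close> contribute \<open>1 / \<alpha>\<close> each,
  whatever \<open>t\<close> is. This scale invariance makes the Schur bound uniform.\<close>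

lemma nn_integral_min_powr:
  fixes t \<alpha> :: real
  assumes t: "0 < t" and \<alpha>: "0 < \<alpha>"
  shows "(\<integral>\<^sup>+t'\<in>{0<..}. ennreal ((if t \<le> t' then t / t' else t' / t) powr \<alpha> / t') \<partial>lborel) \<le> ennreal (2 / \<alpha>)"
proof -
  have "(\<integral>\<^sup>+t'\<in>{0<..}. ennreal ((if t \<le> t' then t / t' else t' / t) powr \<alpha> / t') \<partial>lborel)
    \<le> (\<integral>\<^sup>+t'. ennreal (t powr \<alpha>) * (ennreal (t' powr (- \<alpha> - 1)) * indicator {t..} t') +
        ennreal (t powr (- \<alpha>)) * (ennreal (t' powr (\<alpha> - 1)) * indicator {0..t} t') \<partial>lborel)"
  proof (rule nn_integral_mono)
    fix t' :: real
    show "ennreal ((if t \<le> t' then t / t' else t' / t) powr \<alpha> / t') * indicator {0<..} t'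
      \<le> ennreal (t powr \<alpha>) * (ennreal (t' powr (- \<alpha> - 1)) * indicator {t..} t') +
        ennreal (t powr (- \<alpha>)) * (ennreal (t' powr (\<alpha> - 1)) * indicator {0..t} t')"
    proof (cases "0 < t'")
      case pos: True
      show ?thesis
      proof (cases "t \<le> t'")
        case True
        have "(t / t') powr \<alpha> / t' = t powr \<alpha> * t' powr (- \<alpha> - 1)"
          using t pos by (simp add: powr_divide powr_diff powr_minus field_simps)
        then show ?thesis using True pos by (simp add: ennreal_mult)
      next
        case False
        have "(t' / t) powr \<alpha> / t' = t powr (- \<alpha>) * t' powr (\<alpha> - 1)"
          using t pos by (simp add: powr_divide powr_diff powr_minus field_simps)
        then show ?thesis using False pos by (simp add: ennreal_mult)
      qed
    qed simp
  qed
  also have "\<dots> = ennreal (t powr \<alpha>) * (\<integral>\<^sup>+t'\<in>{t..}. ennreal (t' powr (- \<alpha> - 1)) \<partial>lborel) +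
      ennreal (t powr (- \<alpha>)) * (\<integral>\<^sup>+t'\<in>{0..t}. ennreal (t' powr (\<alpha> - 1)) \<partial>lborel)"
    by (simp add: nn_integral_add nn_integral_cmult)
  also have "\<dots> = ennreal (t powr \<alpha>) * ennreal (t powr (- \<alpha>) / \<alpha>) + ennreal (t powr (- \<alpha>)) * ennreal (t powr \<alpha> / \<alpha>)"
    using nn_integral_powr_to_inf[OF t \<alpha>] nn_integral_powr_from_0[OF t \<alpha>] by simp
  also have "\<dots> = ennreal (2 / \<alpha>)"
    using t \<alpha> by (simp add: powr_minus field_simps flip: ennreal_mult ennreal_plus)
  finally show ?thesis .
qed

lemma borel_prod_ball_indicator[measurable]:
  "(\<lambda>p :: 'a::euclidean_space \<times> real. indicator (ball c (a + snd p)) (fst p) :: ennreal) \<in> borel_measurable (borel \<Otimes>\<^sub>M borel)"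
proof -
  have "(\<lambda>p. indicator (ball c (a + snd p)) (fst p) :: ennreal) = indicator {p \<in> space (borel \<Otimes>\<^sub>M borel). dist c (fst p) < a + snd p}"
    by (auto simp: indicator_def space_pair_measure)
  then show ?thesis by simp
qed

text \<open>For fixed \<open>t'\<close> the integral in \<open>y'\<close> contributes the volume of
  \<open>ball y (t + t')\<close>, at most a constant times \<open>max t t' ^ n\<close>. This cancels
  the size of the kernel and leaves the scale integral of
  \<open>nn_integral_min_powr\<close>.\<close>

lemma dilate_Schur:
  fixes y :: "'a::euclidean_space" and k :: "'a \<times> real \<Rightarrow> 'a \<Rightarrow> real"
  assumes \<alpha>: "0 < \<alpha>" and t: "0 < t" and \<phi>: "\<phi> \<in> C_class \<alpha>"
    and k: "\<And>p. \<exists>\<psi>\<in>C_class \<alpha>. k p = (\<lambda>z. dilate (snd p) \<psi> (fst p - z))"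
  shows "(\<integral>\<^sup>+p. ennreal \<bar>\<integral>z. dilate t \<phi> (y - z) * k p z \<partial>lborel\<bar> * (indicator {0<..} (snd p) * ennreal (1 / snd p)) \<partial>(lborel \<Otimes>\<^sub>M lborel))
    \<le> ennreal ((unit_ball_vol DIM('a))\<^sup>2 * 2 ^ DIM('a) * (2 / \<alpha>))"
proof -
  define w where "w = unit_ball_vol DIM('a)"
  have w: "0 \<le> w" by (simp add: w_def)
  define m where "m t' = (if t \<le> t' then t / t' else t' / t) powr \<alpha>" for t'
  have m0: "0 \<le> m t'" for t' by (simp add: m_def)
  have mm[measurable]: "m \<in> borel_measurable borel" unfolding m_def by measurable
  let ?g = "\<lambda>p :: 'a \<times> real. ennreal (w * (1 / (max t (snd p)) ^ DIM('a) * m (snd p)) * (1 / snd p)) * indicator {0<..} (snd p) * indicator (ball y (t + snd p)) (fst p)"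
  have "(\<integral>\<^sup>+p. ennreal \<bar>\<integral>z. dilate t \<phi> (y - z) * k p z \<partial>lborel\<bar> * (indicator {0<..} (snd p) * ennreal (1 / snd p)) \<partial>(lborel \<Otimes>\<^sub>M lborel))
    \<le> (\<integral>\<^sup>+p. ?g p \<partial>(lborel \<Otimes>\<^sub>M lborel))"
  proof (rule nn_integral_mono)
    fix p :: "'a \<times> real"
    obtain y' t' where p: "p = (y', t')" by force
    show "ennreal \<bar>\<integral>z. dilate t \<phi> (y - z) * k p z \<partial>lborel\<bar> * (indicator {0<..} (snd p) * ennreal (1 / snd p)) \<le> ?g p"
    proof (cases "0 < t'")
      case t': True
      obtain \<psi> where \<psi>: "\<psi> \<in> C_class \<alpha>" "k p = (\<lambda>z. dilate t' \<psi> (y' - z))" using k[of p] p by auto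
      have "\<bar>\<integral>z. dilate t \<phi> (y - z) * k p z \<partial>lborel\<bar> \<le> w * (1 / (max t t') ^ DIM('a) * m t') * indicator (ball y (t + t')) y'"
      proof (cases "t \<le> t'")
        case True
        then show ?thesis
          using integral_dilate_mult_le[OF \<alpha> \<phi> \<psi>(1) t True, of y y'] \<psi>(2) by (simp add: w_def m_def)
      next
        case False
        \<comment> \<open>Now \<open>k p\<close> is the narrower kernel, so the two exchange roles;
          the condition on the distance of the centres is symmetric.\<close>
        then have "t' \<le> t" by simp
        have "indicator (ball y' (t' + t)) y = (indicator (ball y (t + t')) y' :: real)"
          by (simp add: indicator_def dist_commute add.commute)
        then show ?thesis
          using integral_dilate_mult_le[OF \<alpha> \<psi>(1) \<phi> t' \<open>t' \<le> t\<close>, of y' y] \<psi>(2) False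
          by (simp add: w_def m_def mult.commute)
      qed
      then have "ennreal (\<bar>\<integral>z. dilate t \<phi> (y - z) * k p z \<partial>lborel\<bar> * (1 / t'))
        \<le> ennreal (w * (1 / (max t t') ^ DIM('a) * m t') * indicator (ball y (t + t')) y' * (1 / t'))"
        using t' by (intro ennreal_leI mult_right_mono) auto
      also have "\<dots> = ?g p" using t' by (simp add: p indicator_def)
      also have "ennreal (\<bar>\<integral>z. dilate t \<phi> (y - z) * k p z \<partial>lborel\<bar> * (1 / t')) =
        ennreal \<bar>\<integral>z. dilate t \<phi> (y - z) * k p z \<partial>lborel\<bar> * (indicator {0<..} t' * ennreal (1 / t'))"
        using t' by (subst ennreal_mult) auto
      finally show ?thesis by (simp only: p snd_conv fst_conv)
    qed (simp add: p)
  qed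
  also have "\<dots> = (\<integral>\<^sup>+t'. \<integral>\<^sup>+y'. ?g (y', t') \<partial>lborel \<partial>lborel)"
  proof (rule lborel_pair.nn_integral_snd[symmetric])
    have "?g \<in> borel_measurable (borel \<Otimes>\<^sub>M borel)" by measurable
    then show "?g \<in> borel_measurable (lborel \<Otimes>\<^sub>M lborel)" by (simp cong: measurable_cong_sets sets_pair_measure_cong)
  qed
  also have "\<dots> \<le> (\<integral>\<^sup>+t'. ennreal (w * w * 2 ^ DIM('a)) * (ennreal (m t' / t') * indicator {0<..} t') \<partial>lborel)"
  proof (rule nn_integral_mono)
    fix t' :: real
    show "(\<integral>\<^sup>+y'. ?g (y', t') \<partial>lborel) \<le> ennreal (w * w * 2 ^ DIM('a)) * (ennreal (m t' / t') * indicator {0<..} t')"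
    proof (cases "0 < t'")
      case True
      let ?c = "w * (1 / (max t t') ^ DIM('a) * m t') * (1 / t')"
      have c0: "0 \<le> ?c" using True w m0[of t'] t by auto
      have "(\<integral>\<^sup>+y'. ?g (y', t') \<partial>lborel) = ennreal ?c * emeasure lborel (ball y (t + t'))"
        using True nn_integral_cmult_indicator[of "ball y (t + t')" lborel "ennreal ?c"] by simp
      also have "emeasure lborel (ball y (t + t')) = ennreal (w * (t + t') ^ DIM('a))"
        using True t by (simp add: emeasure_ball w_def)
      also have "ennreal ?c * ennreal (w * (t + t') ^ DIM('a)) = ennreal (?c * (w * (t + t') ^ DIM('a)))"
        using True t w by (intro ennreal_mult[symmetric] c0) auto
      also have "\<dots> \<le> ennreal (?c * (w * (2 * max t t') ^ DIM('a)))"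
        using c0 w True t by (intro ennreal_leI mult_left_mono power_mono) auto
      also have "?c * (w * (2 * max t t') ^ DIM('a)) = (w * w * 2 ^ DIM('a)) * (m t' / t')"
        using True t by (simp add: power_mult_distrib)
      also have "ennreal ((w * w * 2 ^ DIM('a)) * (m t' / t')) = ennreal (w * w * 2 ^ DIM('a)) * ennreal (m t' / t')"
        using True w m0[of t'] by (intro ennreal_mult) auto
      finally show ?thesis using True by simp
    qed simp
  qed
  also have "\<dots> = ennreal (w * w * 2 ^ DIM('a)) * (\<integral>\<^sup>+t'\<in>{0<..}. ennreal (m t' / t') \<partial>lborel)"
    by (rule nn_integral_cmult) measurable
  also have "\<dots> \<le> ennreal (w * w * 2 ^ DIM('a)) * ennreal (2 / \<alpha>)"
    using nn_integral_min_powr[OF t \<alpha>] by (intro mult_left_mono) (auto simp: m_def)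
  also have "\<dots> = ennreal (w\<^sup>2 * 2 ^ DIM('a) * (2 / \<alpha>))"
    using w \<alpha> by (simp add: power2_eq_square flip: ennreal_mult)
  finally show ?thesis by (simp add: w_def)
qed

text \<open>Extension of the squared \<open>A_fun\<close> by 0 to \<open>t \<le> 0\<close>, so that
  all integrals can run over the whole product space with Lebesgue measure.\<close>

definition Adens :: "real \<Rightarrow> ('a::euclidean_space \<Rightarrow> 'b::euclidean_space) \<Rightarrow> 'a \<times> real \<Rightarrow> ennreal" where
  "Adens \<alpha> f p = indicator {0<..} (snd p) * (A_fun \<alpha> f (snd p) (fst p))\<^sup>2"

lemma Adens_borel:
  assumes "0 < \<alpha>" "locint f"
  shows "Adens \<alpha> f \<in> borel_measurable (borel \<Otimes>\<^sub>M borel)"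
proof -
  have "Adens \<alpha> f = (\<lambda>p. (indicator {0<..} (snd p) * A_fun \<alpha> f (snd p) (fst p))\<^sup>2)"
    by (rule ext) (simp add: Adens_def indicator_def)
  then show ?thesis
    unfolding power2_eq_square
    using borel_measurable_times_ennreal[OF A_fun_borel[OF assms] A_fun_borel[OF assms]] by simp
qed

lemma nn_integral_indicator_norm_finite:
  fixes f :: "'a::euclidean_space \<Rightarrow> 'b::euclidean_space"
  assumes "locint f"
  shows "(\<integral>\<^sup>+z\<in>ball y t. ennreal (norm (f z)) \<partial>lborel) < \<infinity>"
proof -
  have "(\<integral>\<^sup>+z. ennreal (norm (indicator (ball y t) z *\<^sub>R f z)) \<partial>lborel) < \<infinity>"
    using locint_ball[OF assms, of y t] by (simp add: integrable_iff_bounded)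
  moreover have "ennreal (norm (indicator (ball y t) z *\<^sub>R f z)) = ennreal (norm (f z)) * indicator (ball y t) z" for z
    by (simp add: indicator_def)
  ultimately show ?thesis by simp
qed

lemma A_fun_finite:
  fixes f :: "'a::euclidean_space \<Rightarrow> 'b::euclidean_space"
  assumes "0 < \<alpha>" "0 < t" "locint f"
  shows "A_fun \<alpha> f t y < \<infinity>"
  using A_fun_le[OF assms, of y] nn_integral_indicator_norm_finite[OF assms(3), of y t]
  by (auto simp: ennreal_mult_less_top intro: order_le_less_trans)

text \<open>The bound from \<open>dilate_Schur\<close>: one volume factor from the kernel estimate,
  one from the ball of radius \<open>t + t'\<close>, \<open>2 ^ n\<close> from
  \<open>t + t' \<le> 2 * max t t'\<close>, and \<open>2 / \<alpha>\<close> from the scales. The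
  first argument only carries the dimension.\<close>

definition L2const :: "'a::euclidean_space itself \<Rightarrow> real \<Rightarrow> real" where
  "L2const _ \<alpha> = (unit_ball_vol DIM('a))\<^sup>2 * 2 ^ DIM('a) * (2 / \<alpha>)"

lemma L2const_pos: "0 < \<alpha> \<Longrightarrow> 0 < L2const TYPE('a::euclidean_space) \<alpha>"
  unfolding L2const_def by (intro mult_pos_pos zero_less_power divide_pos_pos unit_ball_vol_pos) auto

text \<open>On \<open>\<bar>y\<bar> < R\<close>, \<open>1/R \<le> t \<le> R\<close> the measure
  \<open>dy dt / t\<close> is finite and the kernel is at most \<open>R ^ n\<close> with support in
  \<open>ball 0 (2 * R)\<close>, so \<open>bounded_kernel\<close> applies. What matters is that the
  resulting bound is free of \<open>R\<close>.\<close>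

lemma linearised_L2_bound:
  fixes f :: "'a::euclidean_space \<Rightarrow> 'b::euclidean_space" and k :: "'a \<times> real \<Rightarrow> 'a \<Rightarrow> real"
  assumes \<alpha>: "0 < \<alpha>" and f: "integrable lborel f" and f2: "integrable lborel (\<lambda>z. (norm (f z))\<^sup>2)"
    and km: "case_prod k \<in> borel_measurable ((borel \<Otimes>\<^sub>M borel) \<Otimes>\<^sub>M borel)"
    and kc: "\<And>p. \<exists>\<phi>\<in>C_class \<alpha>. k p = (\<lambda>z. dilate (snd p) \<phi> (fst p - z))"
    and R: "1 \<le> R"
  shows "(\<integral>\<^sup>+p. ennreal ((norm (\<integral>z. k p z *\<^sub>R f z \<partial>lborel))\<^sup>2) * (indicator (ball 0 R \<times> {1/R..R}) p * ennreal (1 / snd p)) \<partial>(lborel \<Otimes>\<^sub>M lborel))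
    \<le> ennreal (L2const TYPE('a) \<alpha> * (\<integral>z. (norm (f z))\<^sup>2 \<partial>lborel))"
proof -
  define P where "P = ball (0::'a) R \<times> {1/R..R}"
  have Pm[measurable]: "P \<in> sets (borel \<Otimes>\<^sub>M borel)" unfolding P_def by measurable
  have Pt: "0 < snd p" if "p \<in> P" for p using that R by (auto simp: P_def intro: less_le_trans[of 0 "1/R"])
  define wt where "wt p = indicator P p * ennreal (1 / snd p)" for p :: "'a \<times> real"
  have wtm[measurable]: "wt \<in> borel_measurable (borel \<Otimes>\<^sub>M borel)" unfolding wt_def by measurable
  have wtm'[measurable]: "wt \<in> borel_measurable (lborel \<Otimes>\<^sub>M lborel)"
    using wtm by (simp cong: measurable_cong_sets sets_pair_measure_cong)
  define M where "M = density (lborel \<Otimes>\<^sub>M lborel) wt"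
  have spM: "space M = UNIV" by (simp add: M_def space_pair_measure)
  have setsM: "sets M = sets (borel \<Otimes>\<^sub>M borel)" by (simp add: M_def cong: sets_pair_measure_cong)
  have fin: "finite_measure M"
  proof (rule finite_measureI)
    have "emeasure M (space M) = (\<integral>\<^sup>+p. wt p \<partial>(lborel \<Otimes>\<^sub>M lborel))"
      unfolding M_def using emeasure_density[OF wtm' sets.top] by (simp add: space_pair_measure)
    also have "\<dots> \<le> (\<integral>\<^sup>+p. ennreal R * indicator P p \<partial>(lborel \<Otimes>\<^sub>M lborel))"
    proof (rule nn_integral_mono)
      fix p :: "'a \<times> real"
      show "wt p \<le> ennreal R * indicator P p"
      proof (cases "p \<in> P")
        case True
        have "1 / R \<le> snd p" using True by (auto simp: P_def)
        then have "1 / snd p \<le> R" using R Pt[OF True] by (simp add: field_simps)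
        then show ?thesis using True by (simp add: wt_def ennreal_leI)
      qed (simp add: wt_def)
    qed
    also have "\<dots> = ennreal R * emeasure (lborel \<Otimes>\<^sub>M lborel) P"
      using Pm by (subst nn_integral_cmult_indicator) (simp_all cong: sets_pair_measure_cong)
    also have "emeasure (lborel \<Otimes>\<^sub>M lborel) P = emeasure lborel (ball (0::'a) R) * emeasure lborel {1/R..R}"
      unfolding P_def by (rule lborel.emeasure_pair_measure_Times) auto
    also have "ennreal R * \<dots> < \<infinity>"
      using emeasure_lborel_ball_finite[of "0::'a" R] by (auto simp: ennreal_mult_less_top emeasure_lborel_Icc_eq)
    finally show "emeasure M (space M) \<noteq> \<infinity>" by simp
  qed
  define k' where "k' p z = indicator P p * k p z" for p z
  have kle: "\<bar>k p z\<bar> \<le> R ^ DIM('a) * indicator (ball 0 (2 * R)) z" if "p \<in> P" for p z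
  proof -
    obtain \<phi> where \<phi>: "\<phi> \<in> C_class \<alpha>" "k p = (\<lambda>z. dilate (snd p) \<phi> (fst p - z))" using kc by blast
    have "\<bar>k p z\<bar> \<le> 1 / snd p ^ DIM('a) * indicator (ball (fst p) (snd p)) z"
      using abs_dilate_le[OF \<phi>(1) \<alpha> Pt[OF that]] \<phi>(2) by simp
    also have "\<dots> \<le> R ^ DIM('a) * indicator (ball 0 (2 * R)) z"
    proof (intro mult_mono)
      have "1 / R \<le> snd p" using that by (auto simp: P_def)
      then have "1 / snd p \<le> R" using R Pt[OF that] by (simp add: field_simps)
      then have "(1 / snd p) ^ DIM('a) \<le> R ^ DIM('a)" using Pt[OF that] by (intro power_mono) auto
      then show "1 / snd p ^ DIM('a) \<le> R ^ DIM('a)" by (simp add: power_divide)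
      have "ball (fst p) (snd p) \<subseteq> ball 0 (2 * R)"
      proof
        fix x assume x: "x \<in> ball (fst p) (snd p)"
        have "norm (fst p) < R" "snd p \<le> R" using that by (auto simp: P_def mem_Times_iff)
        then show "x \<in> ball 0 (2 * R)" using x dist_triangle[of 0 x "fst p"] by simp
      qed
      then show "indicator (ball (fst p) (snd p)) z \<le> (indicator (ball 0 (2 * R)) z :: real)"
        by (auto simp: indicator_def)
    qed (use R in auto)
    finally show ?thesis .
  qed
  interpret bounded_kernel M k' "R ^ DIM('a)" "2 * R"
  proof (rule bounded_kernel.intro)
    show "finite_measure M" by fact
    have [measurable]: "(\<lambda>q. k (fst q) (snd q)) \<in> borel_measurable ((borel \<Otimes>\<^sub>M borel) \<Otimes>\<^sub>M borel)"
      using km by (simp add: case_prod_beta')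
    have "(\<lambda>q. indicator P (fst q) * k (fst q) (snd q)) \<in> borel_measurable ((borel \<Otimes>\<^sub>M borel) \<Otimes>\<^sub>M borel)"
      by measurable
    then show "case_prod k' \<in> borel_measurable (M \<Otimes>\<^sub>M lborel)"
      using setsM by (simp add: k'_def case_prod_beta' cong: measurable_cong_sets sets_pair_measure_cong)
    show "\<bar>k' p z\<bar> \<le> R ^ DIM('a) * indicator (ball 0 (2 * R)) z" for p z
      using kle[of p z] R by (cases "p \<in> P") (auto simp: k'_def)
  qed
  have Km1: "(\<lambda>p'. \<integral>z. k' p z * k' p' z \<partial>lborel) \<in> borel_measurable (lborel \<Otimes>\<^sub>M lborel)" for p
  proof -
    have "(\<lambda>p'. \<integral>z. k' p z * k' p' z \<partial>lborel) \<in> borel_measurable M"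
      using measurable_Pair2[OF K_measurable, of p] spM by simp
    then show ?thesis using setsM by (simp cong: measurable_cong_sets sets_pair_measure_cong)
  qed
  have Schur: "(\<integral>\<^sup>+p'. ennreal \<bar>\<integral>z. k' p z * k' p' z \<partial>lborel\<bar> \<partial>M) \<le> ennreal (L2const TYPE('a) \<alpha>)" for p
  proof (cases "p \<in> P")
    case True
    obtain \<phi> where \<phi>: "\<phi> \<in> C_class \<alpha>" "k p = (\<lambda>z. dilate (snd p) \<phi> (fst p - z))" using kc by blast
    have "(\<integral>\<^sup>+p'. ennreal \<bar>\<integral>z. k' p z * k' p' z \<partial>lborel\<bar> \<partial>M) =
      (\<integral>\<^sup>+p'. wt p' * ennreal \<bar>\<integral>z. k' p z * k' p' z \<partial>lborel\<bar> \<partial>(lborel \<Otimes>\<^sub>M lborel))"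
      unfolding M_def
      by (intro nn_integral_density wtm' measurable_compose[OF _ measurable_ennreal] borel_measurable_abs Km1)
    also have "\<dots> \<le> (\<integral>\<^sup>+p'. ennreal \<bar>\<integral>z. dilate (snd p) \<phi> (fst p - z) * k p' z \<partial>lborel\<bar> * (indicator {0<..} (snd p') * ennreal (1 / snd p')) \<partial>(lborel \<Otimes>\<^sub>M lborel))"
    proof (rule nn_integral_mono)
      fix p'
      show "wt p' * ennreal \<bar>\<integral>z. k' p z * k' p' z \<partial>lborel\<bar> \<le>
        ennreal \<bar>\<integral>z. dilate (snd p) \<phi> (fst p - z) * k p' z \<partial>lborel\<bar> * (indicator {0<..} (snd p') * ennreal (1 / snd p'))"
        using True Pt[of p'] by (cases "p' \<in> P") (simp_all add: wt_def k'_def \<phi>(2) mult.commute)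
    qed
    also have "\<dots> \<le> ennreal (L2const TYPE('a) \<alpha>)"
      unfolding L2const_def by (rule dilate_Schur[OF \<alpha> Pt[OF True] \<phi>(1) kc])
    finally show ?thesis .
  qed (simp add: k'_def)
  have um: "(\<lambda>p. \<integral>z. k' p z *\<^sub>R f z \<partial>lborel) \<in> borel_measurable (lborel \<Otimes>\<^sub>M lborel)"
  proof -
    note [measurable] = borel_measurable_integrable[OF f]
    have "(\<lambda>p. \<integral>z. k' p z *\<^sub>R f z \<partial>lborel) \<in> borel_measurable M"
      by (rule lborel.borel_measurable_lebesgue_integral) measurable
    then show ?thesis using setsM by (simp cong: measurable_cong_sets sets_pair_measure_cong)
  qed
  have "(\<integral>\<^sup>+p. ennreal ((norm (\<integral>z. k p z *\<^sub>R f z \<partial>lborel))\<^sup>2) * wt p \<partial>(lborel \<Otimes>\<^sub>M lborel))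
    = (\<integral>\<^sup>+p. wt p * ennreal ((norm (\<integral>z. k' p z *\<^sub>R f z \<partial>lborel))\<^sup>2) \<partial>(lborel \<Otimes>\<^sub>M lborel))"
    by (rule nn_integral_cong) (auto simp: wt_def k'_def indicator_def mult.commute)
  also have "\<dots> = (\<integral>\<^sup>+p. ennreal ((norm (\<integral>z. k' p z *\<^sub>R f z \<partial>lborel))\<^sup>2) \<partial>M)"
    unfolding M_def
    by (intro nn_integral_density[symmetric] wtm' measurable_compose[OF _ measurable_ennreal]
        borel_measurable_power measurable_compose[OF um borel_measurable_norm])
  also have "\<dots> \<le> ennreal (L2const TYPE('a) \<alpha> * (\<integral>z. (norm (f z))\<^sup>2 \<partial>lborel))"
    by (rule Schur_TT[OF f f2 L2const_pos[OF \<alpha>] Schur])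
  finally show ?thesis by (simp add: wt_def P_def)
qed

text \<open>The linearised bound depends neither on the number of test functions nor on the
  truncation. Both are therefore tied to one index \<open>N\<close>, and Fatou's lemma removes them
  together.\<close>

theorem A_fun_L2:
  fixes f :: "'a::euclidean_space \<Rightarrow> 'b::euclidean_space"
  assumes \<alpha>: "0 < \<alpha>" and f: "integrable lborel f"
  shows "(\<integral>\<^sup>+p. Adens \<alpha> f p * ennreal (1 / snd p) \<partial>(lborel \<Otimes>\<^sub>M lborel))
    \<le> ennreal (L2const TYPE('a) \<alpha>) * (\<integral>\<^sup>+z. ennreal ((norm (f z))\<^sup>2) \<partial>lborel)"
proof (cases "integrable lborel (\<lambda>z. (norm (f z))\<^sup>2)")
  case False
  have "(\<integral>\<^sup>+z. ennreal ((norm (f z))\<^sup>2) \<partial>lborel) = \<infinity>"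
    using False borel_measurable_integrable[OF f] by (simp add: integrable_iff_bounded top.not_eq_extremum[symmetric])
  then show ?thesis using L2const_pos[OF \<alpha>, where 'a='a] by (simp add: ennreal_mult_top)
next
  case f2: True
  note li = integrable_imp_locint[OF f]
  obtain s :: "nat \<Rightarrow> 'a \<Rightarrow> real" where s: "\<And>k. s k \<in> C_class \<alpha>"
    "\<And>(f :: 'a \<Rightarrow> 'b) t y. locint f \<Longrightarrow> 0 < t \<Longrightarrow>
       A_fun \<alpha> f t y = (SUP k. ennreal (norm (convol f (dilate t (s k)) y)))"
    by (rule A_fun_countable[OF \<alpha>]) blast
  define a where "a N p = (SUP i\<in>{..N}. ennreal (norm (convol f (dilate (snd p) (s i)) (fst p))))" for N p
  define F where "F N p = (a N p)\<^sup>2 * (indicator (ball 0 (real (Suc N)) \<times> {1/real (Suc N)..real (Suc N)}) p * ennreal (1 / snd p))" for N p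
  have am: "a N \<in> borel_measurable (borel \<Otimes>\<^sub>M borel)" for N
    unfolding a_def
    by (intro borel_measurable_SUP measurable_compose[OF _ measurable_ennreal]
        measurable_compose[OF convol_borel[OF s(1) \<alpha> locint_measurable[OF li]] borel_measurable_norm]) auto
  have Fm: "F N \<in> borel_measurable (lborel \<Otimes>\<^sub>M lborel)" for N
  proof -
    note [measurable] = am
    have "F N \<in> borel_measurable (borel \<Otimes>\<^sub>M borel)" unfolding F_def by measurable
    then show ?thesis by (simp cong: measurable_cong_sets sets_pair_measure_cong)
  qed
  have FN: "(\<integral>\<^sup>+p. F N p \<partial>(lborel \<Otimes>\<^sub>M lborel)) \<le> ennreal (L2const TYPE('a) \<alpha> * (\<integral>z. (norm (f z))\<^sup>2 \<partial>lborel))" for N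
  proof -
    obtain k :: "'a \<times> real \<Rightarrow> 'a \<Rightarrow> real" where
      k: "case_prod k \<in> borel_measurable ((borel \<Otimes>\<^sub>M borel) \<Otimes>\<^sub>M borel)"
      "\<And>p. \<exists>\<phi>\<in>C_class \<alpha>. k p = (\<lambda>z. dilate (snd p) \<phi> (fst p - z))"
      "\<And>p i. i \<le> N \<Longrightarrow> norm (convol f (dilate (snd p) (s i)) (fst p)) \<le> norm (\<integral>z. k p z *\<^sub>R f z \<partial>lborel)"
      using linearised_kernel[where s = s and N = N, OF \<alpha> s(1) locint_measurable[OF li]] by blast
    have "(a N p)\<^sup>2 \<le> ennreal ((norm (\<integral>z. k p z *\<^sub>R f z \<partial>lborel))\<^sup>2)" for p
    proof -
      have "a N p \<le> ennreal (norm (\<integral>z. k p z *\<^sub>R f z \<partial>lborel))"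
        unfolding a_def using k(3) by (intro SUP_least ennreal_leI) auto
      from power_mono[OF this, of 2] show ?thesis by (simp add: ennreal_power)
    qed
    then have "(\<integral>\<^sup>+p. F N p \<partial>(lborel \<Otimes>\<^sub>M lborel)) \<le>
      (\<integral>\<^sup>+p. ennreal ((norm (\<integral>z. k p z *\<^sub>R f z \<partial>lborel))\<^sup>2) * (indicator (ball 0 (real (Suc N)) \<times> {1/real (Suc N)..real (Suc N)}) p * ennreal (1 / snd p)) \<partial>(lborel \<Otimes>\<^sub>M lborel))"
      unfolding F_def by (intro nn_integral_mono mult_right_mono) auto
    also have "\<dots> \<le> ennreal (L2const TYPE('a) \<alpha> * (\<integral>z. (norm (f z))\<^sup>2 \<partial>lborel))"
      by (rule linearised_L2_bound[OF \<alpha> f f2 k(1,2)]) simp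
    finally show ?thesis .
  qed
  have lim: "Adens \<alpha> f p * ennreal (1 / snd p) \<le> liminf (\<lambda>N. F N p)" for p
  proof (cases "0 < snd p")
    case True
    let ?A = "A_fun \<alpha> f (snd p) (fst p)"
    have inc: "incseq (\<lambda>N. a N p)" unfolding a_def by (intro incseq_SucI SUP_subset_mono) auto
    have "(SUP N. a N p) = ?A"
      unfolding s(2)[OF li True] a_def
    proof (rule antisym)
      show "(SUP N. SUP i\<in>{..N}. ennreal (norm (convol f (dilate (snd p) (s i)) (fst p))))
        \<le> (SUP k. ennreal (norm (convol f (dilate (snd p) (s k)) (fst p))))"
        by (intro SUP_least SUP_upper UNIV_I)
      show "(SUP k. ennreal (norm (convol f (dilate (snd p) (s k)) (fst p))))
        \<le> (SUP N. SUP i\<in>{..N}. ennreal (norm (convol f (dilate (snd p) (s i)) (fst p))))"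
      proof (rule SUP_least)
        fix k :: nat
        show "ennreal (norm (convol f (dilate (snd p) (s k)) (fst p)))
          \<le> (SUP N. SUP i\<in>{..N}. ennreal (norm (convol f (dilate (snd p) (s i)) (fst p))))"
          by (rule SUP_upper2[of k], simp, rule SUP_upper) simp
      qed
    qed
    then have la: "(\<lambda>N. a N p) \<longlonglongrightarrow> ?A" using LIMSEQ_SUP[OF inc] by simp
    have fin: "?A \<noteq> top" using A_fun_finite[OF \<alpha> True li, of "fst p"] by auto
    have l2: "(\<lambda>N. (a N p)\<^sup>2 * ennreal (1 / snd p)) \<longlonglongrightarrow> ?A\<^sup>2 * ennreal (1 / snd p)"
      unfolding power2_eq_square using fin
      by (intro tendsto_mult_ennreal la) (auto simp: ennreal_mult_eq_top_iff)
    obtain N0 where N0: "max (max (norm (fst p)) (snd p)) (1 / snd p) < real N0"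
      using reals_Archimedean2 by blast
    have ev: "F N p = (a N p)\<^sup>2 * ennreal (1 / snd p)" if "N0 \<le> N" for N
    proof -
      have "real N0 \<le> real N" using that by simp
      then have N: "norm (fst p) < real (Suc N)" "snd p \<le> real (Suc N)" "1 / snd p \<le> real (Suc N)"
        using N0 by auto
      have "1 / real (Suc N) \<le> snd p" using N(3) True by (simp add: field_simps)
      then have "p \<in> ball 0 (real (Suc N)) \<times> {1/real (Suc N)..real (Suc N)}"
        using N by (simp add: mem_Times_iff)
      then show ?thesis by (simp add: F_def)
    qed
    have "(\<lambda>N. F N p) \<longlonglongrightarrow> ?A\<^sup>2 * ennreal (1 / snd p)"
      by (rule Lim_transform_eventually[OF l2]) (auto simp: eventually_sequentially ev intro!: exI[of _ N0])
    then have "liminf (\<lambda>N. F N p) = ?A\<^sup>2 * ennreal (1 / snd p)"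
      by (simp add: lim_imp_Liminf)
    then show ?thesis using True by (simp add: Adens_def)
  qed (simp add: Adens_def)
  have "(\<integral>\<^sup>+p. Adens \<alpha> f p * ennreal (1 / snd p) \<partial>(lborel \<Otimes>\<^sub>M lborel)) \<le> (\<integral>\<^sup>+p. liminf (\<lambda>N. F N p) \<partial>(lborel \<Otimes>\<^sub>M lborel))"
    by (rule nn_integral_mono) (rule lim)
  also have "\<dots> \<le> liminf (\<lambda>N. \<integral>\<^sup>+p. F N p \<partial>(lborel \<Otimes>\<^sub>M lborel))"
    by (rule nn_integral_liminf[OF Fm])
  also have "\<dots> \<le> liminf (\<lambda>N::nat. ennreal (L2const TYPE('a) \<alpha> * (\<integral>z. (norm (f z))\<^sup>2 \<partial>lborel)))"
    by (intro Liminf_mono always_eventually allI FN)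
  also have "\<dots> = ennreal (L2const TYPE('a) \<alpha> * (\<integral>z. (norm (f z))\<^sup>2 \<partial>lborel))"
    by (simp add: Liminf_const)
  also have "\<dots> = ennreal (L2const TYPE('a) \<alpha>) * (\<integral>\<^sup>+z. ennreal ((norm (f z))\<^sup>2) \<partial>lborel)"
    using L2const_pos[OF \<alpha>, where 'a='a] nn_integral_eq_integral[OF f2]
    by (simp add: ennreal_mult less_imp_le)
  finally show ?thesis .
qed

section \<open>The square of the square function\<close>

text \<open>Staying with the square keeps the object linear in \<open>Adens\<close>, so that Tonelli
  applies; the cone is read as \<open>y \<in> ball x t\<close>.\<close>

definition Gsq :: "real \<Rightarrow> ('a::euclidean_space \<Rightarrow> 'b::euclidean_space) \<Rightarrow> 'a \<Rightarrow> ennreal" where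
  "Gsq \<alpha> f x = (\<integral>\<^sup>+p. Adens \<alpha> f p * (indicator (ball x (snd p)) (fst p) * ennreal (1 / snd p ^ (DIM('a) + 1))) \<partial>lborel)"

lemma square_function_eq_Gsq:
  fixes f :: "'a::euclidean_space \<Rightarrow> 'b::euclidean_space"
  shows "square_function \<alpha> f x = ennreal_sqrt (Gsq \<alpha> f x)"
  unfolding square_function_def Gsq_def nn_integral_completion
proof (intro arg_cong[where f = ennreal_sqrt] nn_integral_cong)
  fix p :: "'a \<times> real"
  obtain y t where p: "p = (y, t)" by force
  show "(case p of (y, t) \<Rightarrow> (A_fun \<alpha> f t y)\<^sup>2 / ennreal (t ^ (DIM('a) + 1))) * indicator (cone x) p =
    Adens \<alpha> f p * (indicator (ball x (snd p)) (fst p) * ennreal (1 / snd p ^ (DIM('a) + 1)))"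
  proof (cases "p \<in> cone x")
    case True
    then have "0 < t ^ (DIM('a) + 1)" by (simp add: p cone_def)
    then have "inverse (ennreal (t ^ (DIM('a) + 1))) = ennreal (1 / t ^ (DIM('a) + 1))"
      by (subst inverse_ennreal) (auto simp: divide_inverse)
    then show ?thesis using True by (simp add: p cone_def Adens_def dist_norm divide_ennreal_def)
  next
    case False
    then show ?thesis by (auto simp: p cone_def Adens_def dist_norm indicator_def)
  qed
qed

section \<open>Measurability and integration of the cone integral\<close>

lemma borel_measurable_pairI:
  fixes M :: "'a::second_countable_topology measure" and N :: "'b::second_countable_topology measure"
  assumes "f \<in> borel_measurable borel" "sets M = sets borel" "sets N = sets borel"
  shows "f \<in> borel_measurable (M \<Otimes>\<^sub>M N)"
proof -
  have "sets (M \<Otimes>\<^sub>M N) = sets (borel :: ('a \<times> 'b) measure)"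
    unfolding sets_pair_measure_cong[OF assms(2,3)] borel_prod ..
  from assms(1) show ?thesis unfolding measurable_cong_sets[OF \<open>sets (M \<Otimes>\<^sub>M N) = sets borel\<close> refl] .
qed

lemma ball_indicator_borel[measurable]:
  "(\<lambda>q :: 'a::euclidean_space \<times> ('a \<times> real). indicator (ball (fst q) (snd (snd q))) (fst (snd q)) :: ennreal) \<in> borel_measurable borel"
proof -
  have "(\<lambda>q :: 'a \<times> ('a \<times> real). indicator (ball (fst q) (snd (snd q))) (fst (snd q)) :: ennreal) = indicator {q. dist (fst q) (fst (snd q)) < snd (snd q)}"
    by (auto simp: indicator_def)
  moreover have "{q :: 'a \<times> ('a \<times> real). dist (fst q) (fst (snd q)) < snd (snd q)} \<in> sets borel"
    by (intro borel_open open_Collect_less continuous_intros)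
  ultimately show ?thesis by simp
qed

lemma Adens_borel'[measurable]:
  assumes "0 < \<alpha>" "locint (f :: 'a::euclidean_space \<Rightarrow> 'b::euclidean_space)"
  shows "Adens \<alpha> f \<in> borel_measurable borel"
  using Adens_borel[OF assms] by (simp add: borel_prod)

lemma Gsq_integrand_borel:
  assumes "0 < \<alpha>" "locint (f :: 'a::euclidean_space \<Rightarrow> 'b::euclidean_space)"
  shows "(\<lambda>q. Adens \<alpha> f (snd q) * (indicator (ball (fst q) (snd (snd q))) (fst (snd q)) * ennreal (1 / snd (snd q) ^ (DIM('a) + 1))))
     \<in> borel_measurable (borel :: ('a \<times> ('a \<times> real)) measure)"
proof -
  have [measurable]: "(\<lambda>q :: 'a \<times> ('a \<times> real). Adens \<alpha> f (snd q)) \<in> borel_measurable borel"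
    by (rule measurable_compose[OF _ Adens_borel'[OF assms]])
      (intro borel_measurable_continuous_onI continuous_intros)
  have [measurable]: "(\<lambda>q :: 'a \<times> ('a \<times> real). snd (snd q)) \<in> borel_measurable borel"
    by (intro borel_measurable_continuous_onI continuous_intros)
  show ?thesis by measurable
qed

lemma Gsq_borel:
  assumes "0 < \<alpha>" "locint (f :: 'a::euclidean_space \<Rightarrow> 'b::euclidean_space)"
  shows "Gsq \<alpha> f \<in> borel_measurable borel"
proof -
  have "(\<lambda>x. \<integral>\<^sup>+p. Adens \<alpha> f p * (indicator (ball x (snd p)) (fst p) * ennreal (1 / snd p ^ (DIM('a) + 1))) \<partial>lborel) \<in> borel_measurable borel"
    using Gsq_integrand_borel[OF assms]
    by (intro lborel.borel_measurable_nn_integral borel_measurable_pairI) (simp_all add: case_prod_beta')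
  then show ?thesis by (simp add: Gsq_def[abs_def])
qed

text \<open>Tonelli, after reading \<open>y \<in> ball x t\<close> as
  \<open>x \<in> ball y t\<close>. The weight \<open>u\<close> is constant for the square estimate,
  and the indicator of a set for the argument on level sets.\<close>

lemma nn_integral_Gsq:
  fixes f :: "'a::euclidean_space \<Rightarrow> 'b::euclidean_space"
  assumes \<alpha>: "0 < \<alpha>" and f: "locint f" and u[measurable]: "u \<in> borel_measurable borel"
  shows "(\<integral>\<^sup>+x. u x * Gsq \<alpha> f x \<partial>lborel) =
    (\<integral>\<^sup>+p. Adens \<alpha> f p * ennreal (1 / snd p ^ (DIM('a) + 1)) * (\<integral>\<^sup>+x\<in>ball (fst p) (snd p). u x \<partial>lborel) \<partial>lborel)"
proof -
  have um: "(\<lambda>q :: 'a \<times> ('a \<times> real). u (fst q)) \<in> borel_measurable borel"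
    by (rule measurable_compose[OF _ u]) (intro borel_measurable_continuous_onI continuous_intros)
  have m: "(\<lambda>(x, p). u x * (Adens \<alpha> f p * (indicator (ball x (snd p)) (fst p) * ennreal (1 / snd p ^ (DIM('a) + 1))))) \<in> borel_measurable (lborel \<Otimes>\<^sub>M lborel)"
    using borel_measurable_times_ennreal[OF um Gsq_integrand_borel[OF \<alpha> f]]
    by (intro borel_measurable_pairI) (simp_all add: case_prod_beta')
  have cm: "(\<lambda>p. Adens \<alpha> f p * (indicator (ball x (snd p)) (fst p) * ennreal (1 / snd p ^ (DIM('a) + 1)))) \<in> borel_measurable lborel" for x
    using measurable_compose[OF _ Gsq_integrand_borel[OF \<alpha> f], of "\<lambda>p. (x, p)" borel] by (simp add: borel_prod[symmetric])
  have "(\<integral>\<^sup>+x. u x * Gsq \<alpha> f x \<partial>lborel) =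
    (\<integral>\<^sup>+x. (\<integral>\<^sup>+p. u x * (Adens \<alpha> f p * (indicator (ball x (snd p)) (fst p) * ennreal (1 / snd p ^ (DIM('a) + 1)))) \<partial>lborel) \<partial>lborel)"
    unfolding Gsq_def using cm by (simp add: nn_integral_cmult)
  also have "\<dots> = (\<integral>\<^sup>+p. (\<integral>\<^sup>+x. u x * (Adens \<alpha> f p * (indicator (ball x (snd p)) (fst p) * ennreal (1 / snd p ^ (DIM('a) + 1)))) \<partial>lborel) \<partial>lborel)"
    by (rule lborel_pair.Fubini'[OF m, symmetric])
  also have "\<dots> = (\<integral>\<^sup>+p. Adens \<alpha> f p * ennreal (1 / snd p ^ (DIM('a) + 1)) * (\<integral>\<^sup>+x\<in>ball (fst p) (snd p). u x \<partial>lborel) \<partial>lborel)"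
  proof (rule nn_integral_cong)
    fix p :: "'a \<times> real"
    have "(\<integral>\<^sup>+x. u x * (Adens \<alpha> f p * (indicator (ball x (snd p)) (fst p) * ennreal (1 / snd p ^ (DIM('a) + 1)))) \<partial>lborel)
      = (\<integral>\<^sup>+x. (Adens \<alpha> f p * ennreal (1 / snd p ^ (DIM('a) + 1))) * (u x * indicator (ball (fst p) (snd p)) x) \<partial>lborel)"
      by (intro nn_integral_cong) (auto simp: indicator_def dist_commute mult_ac)
    also have "\<dots> = Adens \<alpha> f p * ennreal (1 / snd p ^ (DIM('a) + 1)) * (\<integral>\<^sup>+x\<in>ball (fst p) (snd p). u x \<partial>lborel)"
      by (intro nn_integral_cmult borel_measurable_times_ennreal borel_measurable_indicator) simp_all
    finally show "(\<integral>\<^sup>+x. u x * (Adens \<alpha> f p * (indicator (ball x (snd p)) (fst p) * ennreal (1 / snd p ^ (DIM('a) + 1)))) \<partial>lborel)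
      = Adens \<alpha> f p * ennreal (1 / snd p ^ (DIM('a) + 1)) * (\<integral>\<^sup>+x\<in>ball (fst p) (snd p). u x \<partial>lborel)" .
  qed
  finally show ?thesis .
qed

text \<open>The volume of \<open>ball y t\<close> turns the cone weight
  \<open>1 / t ^ (n + 1)\<close> into the \<open>1 / t\<close> of \<open>A_fun_L2\<close>.\<close>

lemma nn_integral_Gsq_UNIV_le:
  fixes f :: "'a::euclidean_space \<Rightarrow> 'b::euclidean_space"
  assumes \<alpha>: "0 < \<alpha>" and f: "integrable lborel f"
  shows "(\<integral>\<^sup>+x. Gsq \<alpha> f x \<partial>lborel) \<le>
    ennreal (unit_ball_vol DIM('a) * L2const TYPE('a) \<alpha>) * (\<integral>\<^sup>+z. ennreal ((norm (f z))\<^sup>2) \<partial>lborel)"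
proof -
  note li = integrable_imp_locint[OF f]
  have Am: "(\<lambda>p. Adens \<alpha> f p * ennreal (1 / snd p)) \<in> borel_measurable lborel"
  proof -
    note [measurable] = Adens_borel'[OF \<alpha> li]
    have [measurable]: "(\<lambda>p :: 'a \<times> real. snd p) \<in> borel_measurable borel"
      by (intro borel_measurable_continuous_onI continuous_intros)
    show ?thesis by measurable
  qed
  have "(\<integral>\<^sup>+x. Gsq \<alpha> f x \<partial>lborel) = (\<integral>\<^sup>+p. Adens \<alpha> f p * ennreal (1 / snd p ^ (DIM('a) + 1)) * (\<integral>\<^sup>+x\<in>ball (fst p) (snd p). 1 \<partial>lborel) \<partial>lborel)"
    using nn_integral_Gsq[OF \<alpha> li, of "\<lambda>_. 1"] by simp
  also have "\<dots> = (\<integral>\<^sup>+p. ennreal (unit_ball_vol DIM('a)) * (Adens \<alpha> f p * ennreal (1 / snd p)) \<partial>lborel)"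
  proof (rule nn_integral_cong)
    fix p :: "'a \<times> real"
    show "Adens \<alpha> f p * ennreal (1 / snd p ^ (DIM('a) + 1)) * (\<integral>\<^sup>+x\<in>ball (fst p) (snd p). 1 \<partial>lborel) = ennreal (unit_ball_vol DIM('a)) * (Adens \<alpha> f p * ennreal (1 / snd p))"
    proof (cases "0 < snd p")
      case True
      have "ennreal (1 / snd p ^ (DIM('a) + 1)) * ennreal (unit_ball_vol DIM('a) * snd p ^ DIM('a)) = ennreal (1 / snd p ^ (DIM('a) + 1) * (unit_ball_vol DIM('a) * snd p ^ DIM('a)))"
        using True by (intro ennreal_mult[symmetric]) auto
      also have "1 / snd p ^ (DIM('a) + 1) * (unit_ball_vol DIM('a) * snd p ^ DIM('a)) = unit_ball_vol DIM('a) * (1 / snd p)"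
        using True by simp
      also have "ennreal \<dots> = ennreal (unit_ball_vol DIM('a)) * ennreal (1 / snd p)"
        using True by (intro ennreal_mult) auto
      finally show ?thesis using True by (simp only: mult.assoc) (simp add: emeasure_ball mult_ac)
    qed (simp add: Adens_def)
  qed
  also have "\<dots> = ennreal (unit_ball_vol DIM('a)) * (\<integral>\<^sup>+p. Adens \<alpha> f p * ennreal (1 / snd p) \<partial>lborel)"
    by (rule nn_integral_cmult[OF Am])
  also have "\<dots> \<le> ennreal (unit_ball_vol DIM('a)) * (ennreal (L2const TYPE('a) \<alpha>) * (\<integral>\<^sup>+z. ennreal ((norm (f z))\<^sup>2) \<partial>lborel))"
    using A_fun_L2[OF \<alpha> f] by (intro mult_left_mono) (simp_all add: lborel_prod)
  also have "\<dots> = ennreal (unit_ball_vol DIM('a) * L2const TYPE('a) \<alpha>) * (\<integral>\<^sup>+z. ennreal ((norm (f z))\<^sup>2) \<partial>lborel)"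
    using L2const_pos[OF \<alpha>, where 'a='a] by (simp add: ennreal_mult mult.assoc)
  finally show ?thesis .
qed

lemma ennreal_square_add_le: "((a::ennreal) + b)\<^sup>2 \<le> 2 * a\<^sup>2 + 2 * b\<^sup>2"
proof (cases a b rule: ennreal2_cases)
  case (real_real x y)
  have "(x + y)\<^sup>2 \<le> 2 * x\<^sup>2 + 2 * y\<^sup>2" using sum_squares_bound[of x y] by (simp add: power2_sum)
  then have "ennreal ((x + y)\<^sup>2) \<le> ennreal (2 * x\<^sup>2 + 2 * y\<^sup>2)" by (rule ennreal_leI)
  then show ?thesis using real_real
    by (subst (asm) ennreal_plus) (simp_all add: ennreal_power ennreal_mult flip: ennreal_plus)
qed (auto simp: power2_eq_square ennreal_mult_top)

lemma Gsq_add_le: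
  fixes f g :: "'a::euclidean_space \<Rightarrow> 'b::euclidean_space"
  assumes \<alpha>: "0 < \<alpha>" and f: "locint f" and g: "locint g"
  shows "Gsq \<alpha> (\<lambda>z. f z + g z) x \<le> 2 * Gsq \<alpha> f x + 2 * Gsq \<alpha> g x"
proof -
  have cm: "(\<lambda>p. Adens \<alpha> h p * (indicator (ball x (snd p)) (fst p) * ennreal (1 / snd p ^ (DIM('a) + 1)))) \<in> borel_measurable lborel"
    if "locint h" for h :: "'a \<Rightarrow> 'b"
    using measurable_compose[OF _ Gsq_integrand_borel[OF \<alpha> that], of "\<lambda>p. (x, p)" borel] by (simp add: borel_prod[symmetric])
  have "Gsq \<alpha> (\<lambda>z. f z + g z) x \<le> (\<integral>\<^sup>+p. 2 * (Adens \<alpha> f p * (indicator (ball x (snd p)) (fst p) * ennreal (1 / snd p ^ (DIM('a) + 1))))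
      + 2 * (Adens \<alpha> g p * (indicator (ball x (snd p)) (fst p) * ennreal (1 / snd p ^ (DIM('a) + 1)))) \<partial>lborel)"
    unfolding Gsq_def
  proof (rule nn_integral_mono)
    fix p :: "'a \<times> real"
    have "Adens \<alpha> (\<lambda>z. f z + g z) p \<le> 2 * Adens \<alpha> f p + 2 * Adens \<alpha> g p"
    proof (cases "0 < snd p")
      case True
      have "(A_fun \<alpha> (\<lambda>z. f z + g z) (snd p) (fst p))\<^sup>2 \<le> (A_fun \<alpha> f (snd p) (fst p) + A_fun \<alpha> g (snd p) (fst p))\<^sup>2"
        by (intro power_mono A_fun_add_le \<alpha> True f g) simp
      also note ennreal_square_add_le
      finally show ?thesis using True by (simp add: Adens_def)
    qed (simp add: Adens_def)
    from mult_right_mono[OF this, of "indicator (ball x (snd p)) (fst p) * ennreal (1 / snd p ^ (DIM('a) + 1))"]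
    show "Adens \<alpha> (\<lambda>z. f z + g z) p * (indicator (ball x (snd p)) (fst p) * ennreal (1 / snd p ^ (DIM('a) + 1)))
      \<le> 2 * (Adens \<alpha> f p * (indicator (ball x (snd p)) (fst p) * ennreal (1 / snd p ^ (DIM('a) + 1))))
      + 2 * (Adens \<alpha> g p * (indicator (ball x (snd p)) (fst p) * ennreal (1 / snd p ^ (DIM('a) + 1))))"
      by (simp only: distrib_right mult.assoc) simp
  qed
  also have "\<dots> = 2 * Gsq \<alpha> f x + 2 * Gsq \<alpha> g x"
    unfolding Gsq_def using cm[OF f] cm[OF g] by (simp add: nn_integral_add nn_integral_cmult)
  finally show ?thesis .
qed

text \<open>The factors 2 in \<open>Gsq_add_le\<close> are just right: if both terms stayed at or
  below \<open>l^2 / 4\<close>, the sum would be at most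
  \<open>2 * l^2 / 4 + 2 * l^2 / 4 = l^2\<close>.\<close>

lemma Gsq_add_level:
  fixes g h :: "'a::euclidean_space \<Rightarrow> 'b::euclidean_space"
  assumes "0 < \<alpha>" "locint g" "locint h" and lt: "ennreal (l\<^sup>2) < Gsq \<alpha> (\<lambda>z. g z + h z) x"
  shows "ennreal ((l / 2)\<^sup>2) < Gsq \<alpha> g x \<or> ennreal ((l / 2)\<^sup>2) < Gsq \<alpha> h x"
proof (rule ccontr)
  assume "\<not> ?thesis"
  then have "2 * Gsq \<alpha> g x + 2 * Gsq \<alpha> h x \<le> 2 * ennreal ((l / 2)\<^sup>2) + 2 * ennreal ((l / 2)\<^sup>2)"
    by (intro add_mono mult_left_mono) (auto simp: not_less)
  also have "\<dots> = 4 * ennreal ((l / 2)\<^sup>2)" by (simp flip: distrib_right)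
  also have "\<dots> = ennreal (4 * (l / 2)\<^sup>2)" by (subst ennreal_mult) auto
  also have "4 * (l / 2)\<^sup>2 = l\<^sup>2" by (simp add: power_divide)
  finally show False using lt Gsq_add_le[OF assms(1-3), of x] by (meson leD order_trans)
qed

lemma Gsq_scale:
  fixes f :: "'a::euclidean_space \<Rightarrow> 'b::euclidean_space"
  assumes \<alpha>: "0 < \<alpha>" and f: "locint f" and c: "0 < c"
  shows "Gsq \<alpha> (\<lambda>z. c *\<^sub>R f z) x = ennreal (c\<^sup>2) * Gsq \<alpha> f x"
proof -
  have cm: "(\<lambda>p. Adens \<alpha> f p * (indicator (ball x (snd p)) (fst p) * ennreal (1 / snd p ^ (DIM('a) + 1)))) \<in> borel_measurable lborel"
    using measurable_compose[OF _ Gsq_integrand_borel[OF \<alpha> f], of "\<lambda>p. (x, p)" borel] by (simp add: borel_prod[symmetric])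
  have "Adens \<alpha> (\<lambda>z. c *\<^sub>R f z) p = ennreal (c\<^sup>2) * Adens \<alpha> f p" for p
    unfolding Adens_def A_fun_scale[OF c] using c by (simp add: power_mult_distrib ennreal_power mult.left_commute)
  then show ?thesis unfolding Gsq_def using cm by (simp add: nn_integral_cmult mult.assoc)
qed

section \<open>Calderon-Zygmund decomposition\<close>

lemma nn_integral_split_cells:
  fixes Q :: "nat \<Rightarrow> 'a::euclidean_space set"
  assumes Q[measurable]: "\<And>k. Q k \<in> sets borel" and disj: "disjoint_family Q" and h[measurable]: "h \<in> borel_measurable borel"
  shows "(\<integral>\<^sup>+z. h z \<partial>lborel) = (\<integral>\<^sup>+z\<in>- (\<Union>k. Q k). h z \<partial>lborel) + (\<Sum>k. \<integral>\<^sup>+z\<in>Q k. h z \<partial>lborel)"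
proof -
  have "h z = h z * indicator (- (\<Union>k. Q k)) z + (\<Sum>k. h z * indicator (Q k) z)" for z
  proof (cases "\<exists>k. z \<in> Q k")
    case True
    then obtain k where "z \<in> Q k" by auto
    have 1: "(\<Sum>k. h z * indicator (Q k) z) = h z"
      by (rule suminf_cmult_indicator[OF disj \<open>z \<in> Q k\<close>, of "\<lambda>_. h z"])
    have 2: "indicator (- (\<Union>k. Q k)) z = (0 :: ennreal)" using \<open>z \<in> Q k\<close> by (auto simp: indicator_def)
    show ?thesis unfolding 1 2 by simp
  qed auto
  then have "(\<integral>\<^sup>+z. h z \<partial>lborel) = (\<integral>\<^sup>+z. h z * indicator (- (\<Union>k. Q k)) z + (\<Sum>k. h z * indicator (Q k) z) \<partial>lborel)"
    by (intro nn_integral_cong) simp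
  also have "\<dots> = (\<integral>\<^sup>+z\<in>- (\<Union>k. Q k). h z \<partial>lborel) + (\<integral>\<^sup>+z. (\<Sum>k. h z * indicator (Q k) z) \<partial>lborel)"
    by (rule nn_integral_add) measurable
  also have "(\<integral>\<^sup>+z. (\<Sum>k. h z * indicator (Q k) z) \<partial>lborel) = (\<Sum>k. \<integral>\<^sup>+z\<in>Q k. h z \<partial>lborel)"
    by (rule nn_integral_suminf) measurable
  finally show ?thesis .
qed

text \<open>Cells grow from balls whose radius is nearly the largest with average above
  \<open>l\<close>. The ball inside a cell then carries mass, while the fivefold ball around it has
  average at most \<open>l\<close>; this yields the measure bound and the bound on the good part
  \<open>g\<close>, which is the mean of \<open>f\<close> on each cell.\<close>

lemma Calderon_Zygmund_decomposition:
  fixes f :: "'a::euclidean_space \<Rightarrow> 'b::euclidean_space"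
  assumes f: "integrable lborel f" and l: "0 < l"
  obtains Q :: "nat \<Rightarrow> 'a set" and x r g where
    "\<And>k. Q k \<in> sets borel" "disjoint_family Q"
    "\<And>k. Q k \<noteq> {} \<Longrightarrow> 0 < r k \<and> ball (x k) (r k) \<subseteq> Q k \<and> Q k \<subseteq> ball (x k) (5 * r k)"
    "\<And>k. Q k \<noteq> {} \<Longrightarrow> ennreal l * emeasure lborel (ball (x k) (r k)) \<le> (\<integral>\<^sup>+z\<in>Q k. ennreal (norm (f z)) \<partial>lborel)"
    "integrable lborel g" "AE z in lborel. norm (g z) \<le> 5 ^ DIM('a) * l"
    "(\<integral>\<^sup>+z. ennreal (norm (g z)) \<partial>lborel) \<le> (\<integral>\<^sup>+z. ennreal (norm (f z)) \<partial>lborel)"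
    "\<And>z. z \<notin> (\<Union>k. Q k) \<Longrightarrow> g z = f z"
    "\<And>k. (\<integral>z. indicator (Q k) z *\<^sub>R (f z - g z) \<partial>lborel) = 0"
proof -
  note fm[measurable] = borel_measurable_integrable[OF f]
  define u where "u z = ennreal (norm (f z))" for z
  have um[measurable]: "u \<in> borel_measurable borel" unfolding u_def by measurable
  define F where "F = (\<integral>z. norm (f z) \<partial>lborel)"
  have F: "(\<integral>\<^sup>+z. u z \<partial>lborel) = ennreal F" "0 \<le> F"
    unfolding u_def F_def using f by (simp_all add: nn_integral_eq_integral)
  have uA: "(\<integral>\<^sup>+z\<in>A. u z \<partial>lborel) \<le> ennreal F" for A
    unfolding F(1)[symmetric] by (intro nn_integral_mono) (auto simp: indicator_def)
  define w where "w = unit_ball_vol DIM('a)"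
  have w: "0 < w" by (simp add: w_def)
  \<comment> \<open>A stopping condition: the average exceeds \<open>l\<close> on the ball but not
    on its fivefold dilate, the one that contains the Vitali cell.\<close>
  define K where "K = {(x :: 'a, r). 0 < r \<and> ennreal l * emeasure lborel (ball x r) < (\<integral>\<^sup>+z\<in>ball x r. u z \<partial>lborel) \<and>
    (\<integral>\<^sup>+z\<in>ball x (5 * r). u z \<partial>lborel) \<le> ennreal l * emeasure lborel (ball x (5 * r))}"
  \<comment> \<open>A ball with average above \<open>l\<close> satisfies
    \<open>r ^ n \<le> F / (l * w)\<close>. For \<open>r > 1\<close> this bounds \<open>r\<close>,
    because then \<open>r \<le> r ^ n\<close>; smaller radii are covered by 1.\<close>
  define B where "B = max 1 (F / (l * w))"
  have B: "r \<le> B" if "0 < r" "ennreal l * emeasure lborel (ball x r) < (\<integral>\<^sup>+z\<in>ball x r. u z \<partial>lborel)" for x :: 'a and r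
  proof -
    have "ennreal l * emeasure lborel (ball x r) \<le> ennreal F" using that(2) uA[of "ball x r"] by (meson less_imp_le order_trans)
    then have "ennreal (l * (w * r ^ DIM('a))) \<le> ennreal F"
      using that l w by (simp add: emeasure_ball w_def ennreal_mult)
    then have *: "r ^ DIM('a) \<le> F / (l * w)" using F l w by (simp add: ennreal_le_iff field_simps)
    show ?thesis
    proof (cases "r \<le> 1")
      case False
      then have "r \<le> r ^ DIM('a)" by (intro self_le_power) auto
      then show ?thesis using * by (simp add: B_def)
    qed (simp add: B_def)
  qed
  have KB: "0 < r \<and> r \<le> B" if "(x, r) \<in> K" for x r using that B[of r x] by (auto simp: K_def)
  obtain x r Q where Q: "\<And>k. Q k \<in> sets borel" "disjoint_family Q" "(\<Union>(y, t)\<in>K. ball y t) \<subseteq> (\<Union>k. Q k)"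
    "\<And>k::nat. Q k \<noteq> {} \<Longrightarrow> (x k, r k) \<in> K \<and> ball (x k) (r k) \<subseteq> Q k \<and> Q k \<subseteq> ball (x k) (5 * r k)"
    by (rule Vitali_disjoint_cells[OF KB]) blast+
  note [measurable] = Q(1)
  have cover: "superlevel u l \<subseteq> (\<Union>k. Q k)"
  proof
    fix y assume "y \<in> superlevel u l"
    define T where "T = {r. 0 < r \<and> ennreal l * emeasure lborel (ball y r) < (\<integral>\<^sup>+z\<in>ball y r. u z \<partial>lborel)}"
    have Tne: "T \<noteq> {}" using \<open>y \<in> superlevel u l\<close> by (auto simp: T_def superlevel_def)
    have bdd: "bdd_above T" using B by (auto simp: T_def bdd_above_def)
    obtain r0 where r0: "r0 \<in> T" using Tne by auto
    then have S0: "0 < Sup T" using cSup_upper[OF r0 bdd] by (auto simp: T_def)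
    \<comment> \<open>More than half of the supremal radius is enough: \<open>5 * s\<close> then
      lies beyond the supremum, which is the second stopping condition.\<close>
    obtain s where s: "s \<in> T" "Sup T / 2 < s" using less_cSupD[OF Tne, of "Sup T / 2"] S0 by auto
    have "5 * s \<notin> T"
    proof
      assume "5 * s \<in> T"
      then have "5 * s \<le> Sup T" by (rule cSup_upper[OF _ bdd])
      then show False using s S0 by simp
    qed
    then have "(y, s) \<in> K" using s(1) by (auto simp: K_def T_def not_less)
    moreover have "y \<in> ball y s" using s(1) by (simp add: T_def)
    ultimately show "y \<in> (\<Union>k. Q k)" using Q(3) by blast
  qed
  define m where "m k = measure lborel (Q k)" for k
  have Qfin: "emeasure lborel (Q k) < \<infinity>" for k
  proof (cases "Q k = {}")
    case False
    then have "emeasure lborel (Q k) \<le> emeasure lborel (ball (x k) (5 * r k))" using Q(4) by (intro emeasure_mono) auto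
    then show ?thesis using emeasure_lborel_ball_finite by (rule order_le_less_trans)
  qed simp
  have m: "emeasure lborel (Q k) = ennreal (m k)" "0 \<le> m k" for k
    using Qfin[of k] by (simp_all add: m_def emeasure_eq_ennreal_measure)
  have mpos: "0 < m k" "emeasure lborel (ball (x k) (r k)) \<le> ennreal (m k)" if "Q k \<noteq> {}" for k
  proof -
    have r: "0 < r k" using Q(4)[OF that] by (auto simp: K_def)
    show le: "emeasure lborel (ball (x k) (r k)) \<le> ennreal (m k)"
      unfolding m(1)[symmetric] using Q(4)[OF that] by (intro emeasure_mono) auto
    have "0 < w * r k ^ DIM('a)" using w r by simp
    moreover have "ennreal (w * r k ^ DIM('a)) \<le> ennreal (m k)" using le r by (simp add: emeasure_ball w_def)
    ultimately show "0 < m k" using m(2)[of k] by (simp add: ennreal_le_iff)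
  qed
  define a where "a k = (1 / m k) *\<^sub>R (\<integral>z. indicator (Q k) z *\<^sub>R f z \<partial>lborel)" for k
  have fQ: "integrable lborel (\<lambda>z. indicator (Q k) z *\<^sub>R f z)" for k
    using f by (intro integrable_mult_indicator) auto
  have aQ: "ennreal (norm (a k)) * ennreal (m k) \<le> (\<integral>\<^sup>+z\<in>Q k. u z \<partial>lborel)" for k
  proof (cases "Q k = {}")
    case False
    have "ennreal (norm (a k)) * ennreal (m k) = ennreal (norm (a k) * m k)" using m by (simp add: ennreal_mult)
    also have "norm (a k) * m k = norm (\<integral>z. indicator (Q k) z *\<^sub>R f z \<partial>lborel)"
      using mpos[OF False] by (simp add: a_def)
    also have "ennreal \<dots> \<le> (\<integral>\<^sup>+z. ennreal (norm (indicator (Q k) z *\<^sub>R f z)) \<partial>lborel)"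
      by (rule integral_norm_bound_ennreal[OF fQ])
    also have "\<dots> = (\<integral>\<^sup>+z\<in>Q k. u z \<partial>lborel)" by (intro nn_integral_cong) (simp add: u_def indicator_def)
    finally show ?thesis .
  qed (simp add: m_def)
  have ale: "norm (a k) \<le> 5 ^ DIM('a) * l" if "Q k \<noteq> {}" for k
  proof -
    have r: "0 < r k" using Q(4)[OF that] by (auto simp: K_def)
    have "ennreal (norm (a k) * m k) \<le> (\<integral>\<^sup>+z\<in>Q k. u z \<partial>lborel)" using aQ[of k] m by (simp add: ennreal_mult)
    also have "\<dots> \<le> (\<integral>\<^sup>+z\<in>ball (x k) (5 * r k). u z \<partial>lborel)"
      using Q(4)[OF that] by (intro nn_integral_mono) (auto simp: indicator_def)
    also have "\<dots> \<le> ennreal l * emeasure lborel (ball (x k) (5 * r k))" using Q(4)[OF that] by (auto simp: K_def)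
    also have "\<dots> = ennreal (l * 5 ^ DIM('a)) * emeasure lborel (ball (x k) (r k))"
      using r l by (simp add: emeasure_ball_scale ennreal_mult mult.assoc)
    also have "\<dots> \<le> ennreal (l * 5 ^ DIM('a)) * ennreal (m k)" by (intro mult_left_mono mpos(2)[OF that]) simp
    also have "\<dots> = ennreal (l * 5 ^ DIM('a) * m k)" using l m by (intro ennreal_mult[symmetric]) auto
    finally have "norm (a k) * m k \<le> l * 5 ^ DIM('a) * m k" using l m[of k] by (simp add: ennreal_le_iff)
    then show ?thesis using mpos[OF that] by (simp add: mult.commute)
  qed
  \<comment> \<open>By disjointness the least index is the only index of a cell containing
    \<open>z\<close>; the \<open>LEAST\<close> form makes \<open>g\<close> visibly
    measurable.\<close>
  define g where "g z = (if z \<in> (\<Union>k. Q k) then a (LEAST k. z \<in> Q k) else f z)" for z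
  have gQ: "g z = a k" if "z \<in> Q k" for z k
  proof -
    have "(LEAST k. z \<in> Q k) = k"
    proof (rule Least_equality)
      show "z \<in> Q k" by (rule that)
      fix j assume "z \<in> Q j"
      then show "k \<le> j" using that Q(2) by (metis disjoint_family_onD UNIV_I disjoint_iff order_refl)
    qed
    then show ?thesis using that by (auto simp: g_def)
  qed
  have gm[measurable]: "g \<in> borel_measurable borel"
  proof -
    have "(\<lambda>z. LEAST k. z \<in> Q k) \<in> borel \<rightarrow>\<^sub>M count_space UNIV" by measurable
    from measurable_compose[OF this, of a borel] have [measurable]: "(\<lambda>z. a (LEAST k. z \<in> Q k)) \<in> borel_measurable borel" by simp
    show ?thesis unfolding g_def by measurable
  qed
  have gle: "(\<integral>\<^sup>+z. ennreal (norm (g z)) \<partial>lborel) \<le> (\<integral>\<^sup>+z. u z \<partial>lborel)"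
  proof -
    have "(\<integral>\<^sup>+z. ennreal (norm (g z)) \<partial>lborel) = (\<integral>\<^sup>+z\<in>- (\<Union>k. Q k). ennreal (norm (g z)) \<partial>lborel) + (\<Sum>k. \<integral>\<^sup>+z\<in>Q k. ennreal (norm (g z)) \<partial>lborel)"
      by (rule nn_integral_split_cells[OF Q(1,2)]) measurable
    also have "\<dots> \<le> (\<integral>\<^sup>+z\<in>- (\<Union>k. Q k). u z \<partial>lborel) + (\<Sum>k. \<integral>\<^sup>+z\<in>Q k. u z \<partial>lborel)"
    proof (intro add_mono suminf_le allI)
      show "(\<integral>\<^sup>+z\<in>- (\<Union>k. Q k). ennreal (norm (g z)) \<partial>lborel) \<le> (\<integral>\<^sup>+z\<in>- (\<Union>k. Q k). u z \<partial>lborel)"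
        by (intro nn_integral_mono) (auto simp: indicator_def g_def u_def)
      fix k
      have "(\<integral>\<^sup>+z\<in>Q k. ennreal (norm (g z)) \<partial>lborel) = (\<integral>\<^sup>+z\<in>Q k. ennreal (norm (a k)) \<partial>lborel)"
        by (intro nn_integral_cong) (auto simp: indicator_def gQ)
      also have "\<dots> = ennreal (norm (a k)) * ennreal (m k)" by (simp add: nn_integral_cmult_indicator m)
      also note aQ
      finally show "(\<integral>\<^sup>+z\<in>Q k. ennreal (norm (g z)) \<partial>lborel) \<le> (\<integral>\<^sup>+z\<in>Q k. u z \<partial>lborel)" .
    qed auto
    also have "\<dots> = (\<integral>\<^sup>+z. u z \<partial>lborel)" by (rule nn_integral_split_cells[OF Q(1,2) um, symmetric])
    finally show ?thesis .
  qed
  have gi: "integrable lborel g"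
  proof (rule integrableI_bounded)
    show "(\<integral>\<^sup>+z. ennreal (norm (g z)) \<partial>lborel) < \<infinity>" using gle F by (auto intro: order_le_less_trans)
  qed simp
  show thesis
  proof (rule that[of Q r x g])
    show "Q k \<in> sets borel" for k by (rule Q)
    show "disjoint_family Q" by (rule Q)
    show "0 < r k \<and> ball (x k) (r k) \<subseteq> Q k \<and> Q k \<subseteq> ball (x k) (5 * r k)" if "Q k \<noteq> {}" for k
      using Q(4)[OF that] by (auto simp: K_def)
    show "ennreal l * emeasure lborel (ball (x k) (r k)) \<le> (\<integral>\<^sup>+z\<in>Q k. ennreal (norm (f z)) \<partial>lborel)" if "Q k \<noteq> {}" for k
    proof -
      have "ennreal l * emeasure lborel (ball (x k) (r k)) \<le> (\<integral>\<^sup>+z\<in>ball (x k) (r k). u z \<partial>lborel)"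
        using Q(4)[OF that] by (simp add: K_def less_imp_le)
      also have "\<dots> \<le> (\<integral>\<^sup>+z\<in>Q k. u z \<partial>lborel)" using Q(4)[OF that] by (intro nn_integral_mono) (auto simp: indicator_def)
      finally show ?thesis by (simp add: u_def)
    qed
    show "integrable lborel g" by (rule gi)
    \<comment> \<open>On the cells the bound concerns the means \<open>a k\<close>. Off the cells
      the point lies outside the superlevel set, so differentiation gives even
      \<open>norm (f z) \<le> l\<close>.\<close>
    show "AE z in lborel. norm (g z) \<le> 5 ^ DIM('a) * l"
      using AE_le_outside_superlevel[OF um l]
    proof eventually_elim
      case (elim z)
      show ?case
      proof (cases "z \<in> (\<Union>k. Q k)")
        case True
        then obtain k where "z \<in> Q k" by auto
        then show ?thesis using ale[of k] gQ[of z k] by auto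
      next
        case False
        then have "norm (f z) \<le> l" using elim cover l by (auto simp: u_def ennreal_le_iff)
        also have "l \<le> 5 ^ DIM('a) * l" using l by simp
        finally show ?thesis using False by (simp add: g_def)
      qed
    qed
    show "(\<integral>\<^sup>+z. ennreal (norm (g z)) \<partial>lborel) \<le> (\<integral>\<^sup>+z. ennreal (norm (f z)) \<partial>lborel)" using gle by (simp add: u_def)
    show "g z = f z" if "z \<notin> (\<Union>k. Q k)" for z using that by (simp add: g_def)
    show "(\<integral>z. indicator (Q k) z *\<^sub>R (f z - g z) \<partial>lborel) = 0" for k
    proof (cases "Q k = {}")
      case False
      have ia: "integrable lborel (\<lambda>z. indicator (Q k) z *\<^sub>R a k)"
        using Qfin[of k] by (intro integrable_scaleR_left integrable_real_indicator) auto
      have "(\<integral>z. indicator (Q k) z *\<^sub>R (f z - g z) \<partial>lborel) = (\<integral>z. indicator (Q k) z *\<^sub>R f z - indicator (Q k) z *\<^sub>R a k \<partial>lborel)"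
        by (intro Bochner_Integration.integral_cong refl) (auto simp: indicator_def gQ)
      also have "\<dots> = (\<integral>z. indicator (Q k) z *\<^sub>R f z \<partial>lborel) - m k *\<^sub>R a k"
        using fQ[of k] ia Qfin[of k] by (simp add: m_def integral_scaleR_left)
      also have "\<dots> = 0" using mpos(1)[OF False] by (simp add: a_def)
      finally show ?thesis .
    qed simp
  qed
qed

section \<open>The square function of the bad part away from its cells\<close>

lemma ennreal_norm_suminf_le:
  fixes v :: "nat \<Rightarrow> 'b::banach"
  shows "ennreal (norm (suminf v)) \<le> (\<Sum>k. ennreal (norm (v k)))"
proof (cases "(\<Sum>k. ennreal (norm (v k))) = top")
  case False
  then have s: "summable (\<lambda>k. norm (v k))" by (intro summable_suminf_not_top) auto
  have "norm (suminf v) \<le> (\<Sum>k. norm (v k))" by (rule summable_norm[OF s])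
  then have "ennreal (norm (suminf v)) \<le> ennreal (\<Sum>k. norm (v k))" by (rule ennreal_leI)
  also have "\<dots> = (\<Sum>k. ennreal (norm (v k)))" by (rule suminf_ennreal2[symmetric, OF _ s]) simp
  finally show ?thesis .
qed simp

text \<open>Mean zero of \<open>b\<close> on the cell and Hoelder continuity of the kernel give the decay
  \<open>t powr (- n - \<alpha>)\<close>; off the enlarged balls only \<open>t \<ge> |x - c k| / 4\<close> contributes.\<close>

lemma A_fun_cells_le:
  fixes b :: "'a::euclidean_space \<Rightarrow> 'b::euclidean_space" and Q :: "nat \<Rightarrow> 'a set" and c :: "nat \<Rightarrow> 'a"
  assumes \<alpha>: "0 < \<alpha>" and b: "integrable lborel b"
    and Q: "\<And>k. Q k \<in> sets borel" "disjoint_family Q"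
    and sub: "\<And>k. Q k \<noteq> {} \<Longrightarrow> 0 < r k \<and> Q k \<subseteq> ball (c k) (5 * r k)"
    and off: "\<And>z. z \<notin> (\<Union>k. Q k) \<Longrightarrow> b z = 0"
    and cancel: "\<And>k. (\<integral>z. indicator (Q k) z *\<^sub>R b z \<partial>lborel) = 0"
    and x: "\<And>k. Q k \<noteq> {} \<Longrightarrow> 10 * r k \<le> norm (x - c k)"
    and t: "0 < t" "dist x y < t"
  shows "A_fun \<alpha> b t y \<le> (\<Sum>k. (\<integral>\<^sup>+z\<in>Q k. ennreal (norm (b z)) \<partial>lborel) *
    (ennreal ((5 * r k) powr \<alpha> * t powr (- (real DIM('a) + \<alpha>))) * indicator {norm (x - c k) / 4..} t))"
  unfolding A_fun_def
proof (rule SUP_least)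
  fix \<phi> :: "'a \<Rightarrow> real" assume \<phi>: "\<phi> \<in> C_class \<alpha>"
  note li = integrable_imp_locint[OF b]
  note [measurable] = borel_measurable_integrable[OF b] Q(1) dilate_borel1[OF \<phi> \<alpha>]
  have ki: "integrable lborel (\<lambda>z. dilate t \<phi> (y - z) *\<^sub>R b z)" by (rule integrable_dilate_mult[OF \<phi> \<alpha> t(1) li])
  have Qb: "integrable lborel (\<lambda>z. indicator (Q k) z *\<^sub>R b z)" for k
    using b Q by (intro integrable_mult_indicator) auto
  have kQ: "integrable lborel (\<lambda>z. indicator (Q k) z *\<^sub>R (dilate t \<phi> (y - z) *\<^sub>R b z))" for k
    using ki Q by (intro integrable_mult_indicator) auto
  have "convol b (dilate t \<phi>) y = (\<integral>z. dilate t \<phi> (y - z) *\<^sub>R b z \<partial>lborel)"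
    by (rule convol_eq_lborel[OF \<phi> \<alpha> locint_measurable[OF li]])
  also have "\<dots> = (LINT z:(\<Union>k. Q k)|lborel. dilate t \<phi> (y - z) *\<^sub>R b z)"
    unfolding set_lebesgue_integral_def using off
    by (intro Bochner_Integration.integral_cong refl) (auto simp: indicator_def)
  also have "\<dots> = (\<Sum>k. (LINT z:Q k|lborel. dilate t \<phi> (y - z) *\<^sub>R b z))"
  proof (rule lebesgue_integral_countable_add)
    show "set_integrable lborel (\<Union>i. Q i) (\<lambda>z. dilate t \<phi> (y - z) *\<^sub>R b z)"
      unfolding set_integrable_def using ki by (intro integrable_mult_indicator) auto
  qed (use Q in \<open>auto simp: disjoint_family_on_def\<close>)
  finally have "ennreal (norm (convol b (dilate t \<phi>) y)) \<le> (\<Sum>k. ennreal (norm (LINT z:Q k|lborel. dilate t \<phi> (y - z) *\<^sub>R b z)))"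
    using ennreal_norm_suminf_le by simp
  also have "\<dots> \<le> (\<Sum>k. (\<integral>\<^sup>+z\<in>Q k. ennreal (norm (b z)) \<partial>lborel) *
    (ennreal ((5 * r k) powr \<alpha> * t powr (- (real DIM('a) + \<alpha>))) * indicator {norm (x - c k) / 4..} t))"
  proof (intro suminf_le allI)
    fix k
    show "ennreal (norm (LINT z:Q k|lborel. dilate t \<phi> (y - z) *\<^sub>R b z)) \<le> (\<integral>\<^sup>+z\<in>Q k. ennreal (norm (b z)) \<partial>lborel) *
      (ennreal ((5 * r k) powr \<alpha> * t powr (- (real DIM('a) + \<alpha>))) * indicator {norm (x - c k) / 4..} t)"
    proof (cases "Q k \<inter> ball y t = {}")
      case True
      have "indicator (Q k) z *\<^sub>R (dilate t \<phi> (y - z) *\<^sub>R b z) = 0" for z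
        using abs_dilate_le[OF \<phi> \<alpha> t(1), of y z] True by (cases "z \<in> Q k"; cases "z \<in> ball y t") auto
      then have "(\<lambda>z. indicator (Q k) z *\<^sub>R (dilate t \<phi> (y - z) *\<^sub>R b z)) = (\<lambda>z. 0)" by (rule ext)
      then show ?thesis by (simp only: set_lebesgue_integral_def integral_zero) simp
    next
      case False
      then obtain z0 where z0: "z0 \<in> Q k" "z0 \<in> ball y t" by auto
      then have ne: "Q k \<noteq> {}" by auto
      have r: "0 < r k" and Qs: "Q k \<subseteq> ball (c k) (5 * r k)" using sub[OF ne] by auto
      have "dist (c k) z0 < 5 * r k" using Qs z0(1) by auto
      \<comment> \<open>As \<open>x\<close> is off the doubled ball, \<open>5 * r k\<close> is at
        most half of \<open>norm (x - c k)\<close>. Hence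
        \<open>norm (x - c k) / 2 < 2 * t\<close>.\<close>
      then have "norm (x - c k) < 5 * r k + 2 * t"
        using z0(2) t(2) dist_triangle[of x "c k" y] dist_triangle[of y "c k" z0] by (simp add: dist_norm[symmetric] dist_commute)
      then have "norm (x - c k) / 4 \<le> t" using x[OF ne] by simp
      have "(LINT z:Q k|lborel. dilate t \<phi> (y - z) *\<^sub>R b z) =
        (\<integral>z. indicator (Q k) z *\<^sub>R (dilate t \<phi> (y - z) *\<^sub>R b z) \<partial>lborel) - dilate t \<phi> (y - c k) *\<^sub>R (\<integral>z. indicator (Q k) z *\<^sub>R b z \<partial>lborel)"
        using cancel by (simp add: set_lebesgue_integral_def)
      also have "\<dots> = (\<integral>z. indicator (Q k) z *\<^sub>R (dilate t \<phi> (y - z) *\<^sub>R b z) - dilate t \<phi> (y - c k) *\<^sub>R (indicator (Q k) z *\<^sub>R b z) \<partial>lborel)"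
        unfolding Bochner_Integration.integral_diff[OF kQ integrable_scaleR_right[OF Qb]] integral_scaleR_right ..
      finally have "ennreal (norm (LINT z:Q k|lborel. dilate t \<phi> (y - z) *\<^sub>R b z)) \<le>
        (\<integral>\<^sup>+z. ennreal (norm (indicator (Q k) z *\<^sub>R (dilate t \<phi> (y - z) *\<^sub>R b z) - dilate t \<phi> (y - c k) *\<^sub>R (indicator (Q k) z *\<^sub>R b z))) \<partial>lborel)"
        by (simp only:, intro integral_norm_bound_ennreal Bochner_Integration.integrable_diff integrable_scaleR_right kQ Qb)
      also have "\<dots> \<le> (\<integral>\<^sup>+z. ennreal ((5 * r k) powr \<alpha> * t powr (- (real DIM('a) + \<alpha>))) * (ennreal (norm (b z)) * indicator (Q k) z) \<partial>lborel)"
      proof (rule nn_integral_mono)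
        fix z
        show "ennreal (norm (indicator (Q k) z *\<^sub>R (dilate t \<phi> (y - z) *\<^sub>R b z) - dilate t \<phi> (y - c k) *\<^sub>R (indicator (Q k) z *\<^sub>R b z)))
          \<le> ennreal ((5 * r k) powr \<alpha> * t powr (- (real DIM('a) + \<alpha>))) * (ennreal (norm (b z)) * indicator (Q k) z)"
        proof (cases "z \<in> Q k")
          case True
          have "norm (c k - z) \<le> 5 * r k" using Qs True by (auto simp: dist_norm)
          then have "1 / t ^ DIM('a) * (norm (c k - z) / t) powr \<alpha> \<le> 1 / t ^ DIM('a) * (5 * r k / t) powr \<alpha>"
            using t r \<alpha> by (intro mult_left_mono powr_mono2 divide_right_mono) auto
          also have "\<dots> = (5 * r k) powr \<alpha> * t powr (- (real DIM('a) + \<alpha>))"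
            using t r by (simp add: powr_divide powr_diff powr_minus powr_add powr_realpow field_simps)
          finally have "\<bar>dilate t \<phi> (y - z) - dilate t \<phi> (y - c k)\<bar> \<le> (5 * r k) powr \<alpha> * t powr (- (real DIM('a) + \<alpha>))"
            using dilate_Holder[OF \<phi> t(1), of "y - z" "y - c k"] by simp
          then have "\<bar>dilate t \<phi> (y - z) - dilate t \<phi> (y - c k)\<bar> * norm (b z) \<le> (5 * r k) powr \<alpha> * t powr (- (real DIM('a) + \<alpha>)) * norm (b z)"
            by (rule mult_right_mono) simp
          then have "norm (indicator (Q k) z *\<^sub>R (dilate t \<phi> (y - z) *\<^sub>R b z) - dilate t \<phi> (y - c k) *\<^sub>R (indicator (Q k) z *\<^sub>R b z))
            \<le> (5 * r k) powr \<alpha> * t powr (- (real DIM('a) + \<alpha>)) * norm (b z)"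
            using True by (simp flip: scaleR_diff_left)
          from ennreal_leI[OF this] show ?thesis using True by (simp only: ennreal_mult[OF mult_nonneg_nonneg[OF powr_ge_zero powr_ge_zero] norm_ge_zero]) simp
        qed simp
      qed
      also have "\<dots> = ennreal ((5 * r k) powr \<alpha> * t powr (- (real DIM('a) + \<alpha>))) * (\<integral>\<^sup>+z\<in>Q k. ennreal (norm (b z)) \<partial>lborel)"
        by (rule nn_integral_cmult) measurable
      finally show ?thesis using \<open>norm (x - c k) / 4 \<le> t\<close> by (simp add: mult.commute)
    qed
  qed auto
  finally show "ennreal (norm (convol b (dilate t \<phi>) y)) \<le> (\<Sum>k. (\<integral>\<^sup>+z\<in>Q k. ennreal (norm (b z)) \<partial>lborel) *
    (ennreal ((5 * r k) powr \<alpha> * t powr (- (real DIM('a) + \<alpha>))) * indicator {norm (x - c k) / 4..} t))" .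
qed

text \<open>One factor of the square is replaced by the supremum \<open>S\<close>. The remaining
  integral is linear in \<open>H\<close>, so a series for \<open>H\<close> may be integrated term by
  term.\<close>

lemma Gsq_le_of_A_fun_bound:
  fixes b :: "'a::euclidean_space \<Rightarrow> 'b::euclidean_space"
  assumes H[measurable]: "H \<in> borel_measurable borel" and HS: "\<And>t. H t \<le> S"
    and A: "\<And>t y. 0 < t \<Longrightarrow> dist x y < t \<Longrightarrow> A_fun \<alpha> b t y \<le> H t"
  shows "Gsq \<alpha> b x \<le> ennreal (unit_ball_vol DIM('a)) * S * (\<integral>\<^sup>+t\<in>{0<..}. H t * ennreal (1 / t) \<partial>lborel)"
proof -
  let ?g = "\<lambda>p :: 'a \<times> real. H (snd p) * S * ennreal (1 / snd p ^ (DIM('a) + 1)) * indicator {0<..} (snd p) * indicator (ball x (snd p)) (fst p)"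
  have gm: "?g \<in> borel_measurable (lborel \<Otimes>\<^sub>M lborel)"
  proof -
    have [measurable]: "(\<lambda>p :: 'a \<times> real. indicator (ball x (snd p)) (fst p) :: ennreal) \<in> borel_measurable (borel \<Otimes>\<^sub>M borel)"
      using borel_prod_ball_indicator[of x 0] by simp
    have "?g \<in> borel_measurable (borel \<Otimes>\<^sub>M borel)" by measurable
    then show ?thesis by (simp cong: measurable_cong_sets sets_pair_measure_cong)
  qed
  have "Gsq \<alpha> b x \<le> (\<integral>\<^sup>+p. ?g p \<partial>(lborel \<Otimes>\<^sub>M lborel))"
    unfolding Gsq_def lborel_prod
  proof (rule nn_integral_mono)
    fix p :: "'a \<times> real"
    show "Adens \<alpha> b p * (indicator (ball x (snd p)) (fst p) * ennreal (1 / snd p ^ (DIM('a) + 1))) \<le> ?g p"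
    proof (cases "0 < snd p \<and> dist x (fst p) < snd p")
      case True
      then have "A_fun \<alpha> b (snd p) (fst p) \<le> H (snd p)" using A by simp
      then have "(A_fun \<alpha> b (snd p) (fst p))\<^sup>2 \<le> H (snd p) * S"
        unfolding power2_eq_square using HS[of "snd p"] by (intro mult_mono) (auto intro: order_trans)
      then show ?thesis using True by (simp add: Adens_def mult_right_mono)
    qed (auto simp: Adens_def)
  qed
  also have "\<dots> = (\<integral>\<^sup>+t. \<integral>\<^sup>+y. ?g (y, t) \<partial>lborel \<partial>lborel)"
    by (rule lborel_pair.nn_integral_snd[OF gm, symmetric])
  also have "\<dots> = (\<integral>\<^sup>+t. ennreal (unit_ball_vol DIM('a)) * S * (H t * ennreal (1 / t) * indicator {0<..} t) \<partial>lborel)"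
  proof (rule nn_integral_cong)
    fix t :: real
    show "(\<integral>\<^sup>+y. ?g (y, t) \<partial>lborel) = ennreal (unit_ball_vol DIM('a)) * S * (H t * ennreal (1 / t) * indicator {0<..} t)"
    proof (cases "0 < t")
      case True
      have e: "ennreal (1 / t ^ (DIM('a) + 1)) * ennreal (unit_ball_vol DIM('a) * t ^ DIM('a)) = ennreal (unit_ball_vol DIM('a)) * ennreal (1 / t)"
        using True by (simp flip: ennreal_mult)
      have "(\<integral>\<^sup>+y. ?g (y, t) \<partial>lborel) = H t * S * ennreal (1 / t ^ (DIM('a) + 1)) * emeasure lborel (ball x t)"
        using True nn_integral_cmult_indicator[of "ball x t" lborel "H t * S * ennreal (1 / t ^ (DIM('a) + 1))"] by simp
      also have "\<dots> = H t * S * (ennreal (unit_ball_vol DIM('a)) * ennreal (1 / t))"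
        unfolding e[symmetric] using True by (simp only: emeasure_ball[OF less_imp_le[OF True]] mult.assoc)
      finally show ?thesis using True by (simp add: mult_ac)
    qed simp
  qed
  also have "\<dots> = ennreal (unit_ball_vol DIM('a)) * S * (\<integral>\<^sup>+t\<in>{0<..}. H t * ennreal (1 / t) \<partial>lborel)"
    by (rule nn_integral_cmult) measurable
  finally show ?thesis .
qed

text \<open>For \<open>t powr (- s)\<close> on \<open>t \<ge> d\<close>, the supremum is
  \<open>d powr (- s)\<close> and the integral against \<open>dt / t\<close> is
  \<open>d powr (- s) / s\<close>. So both factors of the preceding estimate are multiples of the
  same series, whose square appears.\<close>

lemma Gsq_le_square_of_A_fun_bound:
  fixes b :: "'a::euclidean_space \<Rightarrow> 'b::euclidean_space" and d :: "nat \<Rightarrow> real" and \<beta> :: "nat \<Rightarrow> ennreal"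
  assumes d: "\<And>k. \<beta> k \<noteq> 0 \<Longrightarrow> 0 < d k" and s: "0 < s"
    and A: "\<And>t y. 0 < t \<Longrightarrow> dist x y < t \<Longrightarrow> A_fun \<alpha> b t y \<le> (\<Sum>k. \<beta> k * (ennreal (t powr (- s)) * indicator {d k..} t))"
  shows "Gsq \<alpha> b x \<le> ennreal (unit_ball_vol DIM('a) / s) * (\<Sum>k. \<beta> k * ennreal (d k powr (- s)))\<^sup>2"
proof -
  define S where "S = (\<Sum>k. \<beta> k * ennreal (d k powr (- s)))"
  define H where "H t = (\<Sum>k. \<beta> k * (ennreal (t powr (- s)) * indicator {d k..} t))" for t
  have Hm[measurable]: "H \<in> borel_measurable borel" unfolding H_def by measurable
  have HS: "H t \<le> S" for t
    unfolding H_def S_def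
  proof (intro suminf_le allI)
    fix k
    show "\<beta> k * (ennreal (t powr (- s)) * indicator {d k..} t) \<le> \<beta> k * ennreal (d k powr (- s))"
    proof (cases "\<beta> k = 0 \<or> t < d k")
      case False
      then have "t powr (- s) \<le> d k powr (- s)" using d[of k] s by (intro powr_mono2') auto
      then show ?thesis using False by (intro mult_left_mono) (auto simp: ennreal_leI)
    qed auto
  qed auto
  have "(\<integral>\<^sup>+t\<in>{0<..}. H t * ennreal (1 / t) \<partial>lborel) = (\<integral>\<^sup>+t. (\<Sum>k. \<beta> k * (indicator {0<..} t * (ennreal (t powr (- s - 1)) * indicator {d k..} t))) \<partial>lborel)"
  proof (rule nn_integral_cong)
    fix t :: real
    show "H t * ennreal (1 / t) * indicator {0<..} t = (\<Sum>k. \<beta> k * (indicator {0<..} t * (ennreal (t powr (- s - 1)) * indicator {d k..} t)))"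
    proof (cases "0 < t")
      case True
      have e: "ennreal (t powr (- s)) * ennreal (1 / t) = ennreal (t powr (- s - 1))"
        using True by (simp add: powr_diff flip: ennreal_mult)
      have "H t * ennreal (1 / t) = (\<Sum>k. \<beta> k * (ennreal (t powr (- s)) * indicator {d k..} t) * ennreal (1 / t))"
        unfolding H_def by (rule ennreal_suminf_multc[symmetric])
      then show ?thesis using True by (simp add: mult_ac flip: e)
    qed simp
  qed
  also have "\<dots> = (\<Sum>k. (\<integral>\<^sup>+t. \<beta> k * (indicator {0<..} t * (ennreal (t powr (- s - 1)) * indicator {d k..} t)) \<partial>lborel))"
    by (rule nn_integral_suminf) measurable
  also have "\<dots> \<le> (\<Sum>k. ennreal (1 / s) * (\<beta> k * ennreal (d k powr (- s))))"
  proof (intro suminf_le allI)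
    fix k
    show "(\<integral>\<^sup>+t. \<beta> k * (indicator {0<..} t * (ennreal (t powr (- s - 1)) * indicator {d k..} t)) \<partial>lborel)
      \<le> ennreal (1 / s) * (\<beta> k * ennreal (d k powr (- s)))"
    proof (cases "\<beta> k = 0")
      case False
      have "(\<integral>\<^sup>+t. \<beta> k * (indicator {0<..} t * (ennreal (t powr (- s - 1)) * indicator {d k..} t)) \<partial>lborel)
        \<le> (\<integral>\<^sup>+t. \<beta> k * (ennreal (t powr (- s - 1)) * indicator {d k..} t) \<partial>lborel)"
        by (intro nn_integral_mono mult_left_mono) (auto simp: indicator_def)
      also have "\<dots> = \<beta> k * ennreal (d k powr (- s) / s)"
        using nn_integral_powr_to_inf[OF d[OF False] s] by (simp add: nn_integral_cmult)
      also have "ennreal (d k powr (- s) / s) = ennreal (1 / s) * ennreal (d k powr (- s))"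
        using s by (simp flip: ennreal_mult)
      finally show ?thesis by (simp add: mult_ac)
    qed simp
  qed auto
  also have "\<dots> = ennreal (1 / s) * S" unfolding S_def by (rule ennreal_suminf_cmult)
  finally have I: "(\<integral>\<^sup>+t\<in>{0<..}. H t * ennreal (1 / t) \<partial>lborel) \<le> ennreal (1 / s) * S" .
  have "Gsq \<alpha> b x \<le> ennreal (unit_ball_vol DIM('a)) * S * (\<integral>\<^sup>+t\<in>{0<..}. H t * ennreal (1 / t) \<partial>lborel)"
    by (rule Gsq_le_of_A_fun_bound[OF Hm HS]) (use A in \<open>auto simp: H_def\<close>)
  also have "\<dots> \<le> ennreal (unit_ball_vol DIM('a)) * S * (ennreal (1 / s) * S)"
    by (intro mult_left_mono I) simp
  also have "\<dots> = (ennreal (unit_ball_vol DIM('a)) * ennreal (1 / s)) * S\<^sup>2" by (simp only: power2_eq_square mult_ac)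
  also have "ennreal (unit_ball_vol DIM('a)) * ennreal (1 / s) = ennreal (unit_ball_vol DIM('a) / s)"
    using s by (simp flip: ennreal_mult)
  finally show ?thesis by (simp add: S_def)
qed

section \<open>Weak type estimates\<close>

text \<open>Weak type (1, 1) of the maximal function of an indicator. Each Vitali cell has measure
  at most \<open>5 ^ n / c\<close> times that of its own intersection with \<open>E\<close>, and
  disjointness of the cells lets these local bounds add up to the measure of
  \<open>E\<close>.\<close>

lemma measure_dense_balls_le:
  fixes E :: "'a::euclidean_space set"
  assumes E: "E \<in> sets borel" and fin: "emeasure lborel E < \<infinity>" and c: "0 < c"
  defines "U \<equiv> \<Union>{ball y t | y t. 0 < t \<and> ennreal c * emeasure lborel (ball y t) < emeasure lborel (E \<inter> ball y t)}"
  shows "open U" "emeasure lborel U \<le> ennreal (5 ^ DIM('a) / c) * emeasure lborel E"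
proof -
  show oU: "open U" unfolding U_def by auto
  define K where "K = {(y :: 'a, t). 0 < t \<and> ennreal c * emeasure lborel (ball y t) < emeasure lborel (E \<inter> ball y t)}"
  define w where "w = unit_ball_vol DIM('a)"
  have w: "0 < w" by (simp add: w_def)
  obtain m where m: "emeasure lborel E = ennreal m" "0 \<le> m" using fin by (cases "emeasure lborel E") auto
  have B: "0 < t \<and> t \<le> max 1 (m / (c * w))" if "(y, t) \<in> K" for y t
  proof -
    have t: "0 < t" using that by (simp add: K_def)
    have "ennreal c * emeasure lborel (ball y t) \<le> emeasure lborel (E \<inter> ball y t)" using that by (simp add: K_def less_imp_le)
    also have "\<dots> \<le> ennreal m" unfolding m(1)[symmetric] using E by (intro emeasure_mono) auto
    finally have "ennreal (c * (w * t ^ DIM('a))) \<le> ennreal m"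
      using t c w by (simp add: emeasure_ball w_def ennreal_mult)
    then have *: "t ^ DIM('a) \<le> m / (c * w)" using m c w by (simp add: ennreal_le_iff field_simps)
    show ?thesis
    proof (cases "t \<le> 1")
      case False
      then have "t \<le> t ^ DIM('a)" by (intro self_le_power) auto
      then show ?thesis using * t by simp
    qed (use t in simp)
  qed
  obtain x r Q where Q: "\<And>k. Q k \<in> sets borel" "disjoint_family Q" "(\<Union>(y, t)\<in>K. ball y t) \<subseteq> (\<Union>k. Q k)"
    "\<And>k::nat. Q k \<noteq> {} \<Longrightarrow> (x k, r k) \<in> K \<and> ball (x k) (r k) \<subseteq> Q k \<and> Q k \<subseteq> ball (x k) (5 * r k)"
    by (rule Vitali_disjoint_cells[OF B]) blast+
  have le: "emeasure lborel (Q k) \<le> ennreal (5 ^ DIM('a) / c) * emeasure lborel (E \<inter> Q k)" for k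
  proof (cases "Q k = {}")
    case False
    note q = Q(4)[OF False]
    have r: "0 < r k" using q by (simp add: K_def)
    have "emeasure lborel (Q k) \<le> emeasure lborel (ball (x k) (5 * r k))" using q by (intro emeasure_mono) auto
    also have "\<dots> = ennreal (5 ^ DIM('a) / c) * (ennreal c * emeasure lborel (ball (x k) (r k)))"
      using r c by (simp add: emeasure_ball_scale mult.assoc[symmetric] ennreal_mult[symmetric])
    also have "\<dots> \<le> ennreal (5 ^ DIM('a) / c) * emeasure lborel (E \<inter> ball (x k) (r k))"
      using q by (intro mult_left_mono) (auto simp: K_def)
    also have "\<dots> \<le> ennreal (5 ^ DIM('a) / c) * emeasure lborel (E \<inter> Q k)"
      using q E Q(1) by (intro mult_left_mono emeasure_mono) auto
    finally show ?thesis .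
  qed simp
  have "U = (\<Union>(y, t)\<in>K. ball y t)" unfolding U_def K_def by auto
  then have "emeasure lborel U \<le> emeasure lborel (\<Union>k. Q k)"
    using Q(1,3) by (intro emeasure_mono) auto
  also have "\<dots> = (\<Sum>k. emeasure lborel (Q k))"
    using Q(1,2) by (intro suminf_emeasure[symmetric]) auto
  also have "\<dots> \<le> (\<Sum>k. ennreal (5 ^ DIM('a) / c) * emeasure lborel (E \<inter> Q k))"
    by (intro suminf_le le) auto
  also have "\<dots> = ennreal (5 ^ DIM('a) / c) * (\<Sum>k. emeasure lborel (E \<inter> Q k))"
    by simp
  also have "(\<Sum>k. emeasure lborel (E \<inter> Q k)) = emeasure lborel (\<Union>k. E \<inter> Q k)"
    using Q(1,2) E by (intro suminf_emeasure) (auto simp: disjoint_family_on_def)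
  also have "ennreal (5 ^ DIM('a) / c) * \<dots> \<le> ennreal (5 ^ DIM('a) / c) * emeasure lborel E"
    using E by (intro mult_left_mono emeasure_mono) auto
  finally show "emeasure lborel U \<le> ennreal (5 ^ DIM('a) / c) * emeasure lborel E" .
qed

text \<open>A trade between sets and powers: integrated over \<open>U k\<close>, the first term
  costs measure with a small factor, the second costs the integral of the high power with a large
  one. The parameter \<open>e\<close> will depend on \<open>k\<close>.\<close>

lemma square_le_eps_power:
  fixes a e :: real
  assumes "0 \<le> a" "0 < e"
  shows "a\<^sup>2 \<le> e + a ^ (2 * N + 2) / e ^ N"
proof (cases "a\<^sup>2 \<le> e")
  case True
  then show ?thesis using assms by (simp add: add_increasing2)
next
  case False
  then have "e ^ N \<le> (a\<^sup>2) ^ N" using assms by (intro power_mono) auto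
  then have "a\<^sup>2 * e ^ N \<le> a\<^sup>2 * (a\<^sup>2) ^ N" by (intro mult_left_mono) auto
  also have "\<dots> = a ^ (2 * N + 2)" by (simp add: power_mult power2_eq_square power_add)
  finally have "a\<^sup>2 \<le> a ^ (2 * N + 2) / e ^ N" using assms by (simp add: field_simps)
  then show ?thesis using assms by simp
qed

lemma Adens_eq_dense_cell:
  assumes "0 < \<alpha>" "ball (fst p) (snd p) \<subseteq> U"
  shows "Adens \<alpha> (\<lambda>z. indicator U z *\<^sub>R f z) p = Adens \<alpha> f p"
proof (cases "0 < snd p")
  case True
  have "A_fun \<alpha> (\<lambda>z. indicator U z *\<^sub>R f z) (snd p) (fst p) = A_fun \<alpha> f (snd p) (fst p)"
    using assms(2) by (intro A_fun_cong_ball assms(1) True) auto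
  then show ?thesis by (simp add: Adens_def)
qed (simp add: Adens_def)

text \<open>Split the cone points \<open>(y, t)\<close> by the dyadic density of \<open>E\<close> in \<open>ball y t\<close>: the points of density
  about \<open>2^-k\<close> only see \<open>f\<close> on a set \<open>E\<^sub>k\<close> of measure at most a multiple of \<open>2^k |E|\<close>.\<close>

lemma nn_integral_Gsq_indicator_le:
  fixes f :: "'a::euclidean_space \<Rightarrow> 'b::euclidean_space"
  assumes \<alpha>: "0 < \<alpha>" and f: "integrable lborel f" and E: "E \<in> sets borel" and fin: "emeasure lborel E < \<infinity>"
  obtains U :: "nat \<Rightarrow> 'a set" where "\<And>k. open (U k)"
    "\<And>k. emeasure lborel (U k) \<le> ennreal (2 * 5 ^ DIM('a) * 2 ^ k) * emeasure lborel E"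
    "(\<integral>\<^sup>+x. indicator E x * Gsq \<alpha> f x \<partial>lborel) \<le>
      (\<Sum>k. ennreal (unit_ball_vol DIM('a) * L2const TYPE('a) \<alpha> / 2 ^ k) * (\<integral>\<^sup>+z\<in>U k. ennreal ((norm (f z))\<^sup>2) \<partial>lborel))"
proof
  define w where "w = unit_ball_vol DIM('a)"
  have w: "0 < w" by (simp add: w_def)
  define L where "L = L2const TYPE('a) \<alpha>"
  have L: "0 < L" using L2const_pos[OF \<alpha>] by (simp add: L_def)
  \<comment> \<open>Densities are tested at \<open>2^-(k+1)\<close>, one step below the class
    \<open>2^-k\<close>; this accounts for the factor 2 in the bound for \<open>U k\<close>.\<close>
  define c :: "nat \<Rightarrow> real" where "c k = 1 / 2 ^ Suc k" for k
  have c: "0 < c k" for k by (simp add: c_def)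
  define U where "U k = \<Union>{ball y t | y t. 0 < t \<and> ennreal (c k) * emeasure lborel (ball y t) < emeasure lborel (E \<inter> ball y t)}" for k
  show oU: "open (U k)" for k unfolding U_def by (rule measure_dense_balls_le(1)[OF E fin c])
  show "emeasure lborel (U k) \<le> ennreal (2 * 5 ^ DIM('a) * 2 ^ k) * emeasure lborel E" for k
    using measure_dense_balls_le(2)[OF E fin c, of k] by (simp add: U_def c_def mult_ac)
  define fk where "fk k z = indicator (U k) z *\<^sub>R f z" for k z
  have fki: "integrable lborel (fk k)" for k
    unfolding fk_def using oU f by (intro integrable_mult_indicator) auto
  note li = integrable_imp_locint[OF f] integrable_imp_locint[OF fki]
  have Am: "(\<lambda>p. Adens \<alpha> (fk k) p * ennreal (1 / snd p)) \<in> borel_measurable lborel" for k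
  proof -
    note [measurable] = Adens_borel'[OF \<alpha> li(2)]
    have [measurable]: "(\<lambda>p :: 'a \<times> real. snd p) \<in> borel_measurable borel"
      by (intro borel_measurable_continuous_onI continuous_intros)
    show ?thesis by measurable
  qed
  have "(\<integral>\<^sup>+x. indicator E x * Gsq \<alpha> f x \<partial>lborel) =
    (\<integral>\<^sup>+p. Adens \<alpha> f p * ennreal (1 / snd p ^ (DIM('a) + 1)) * (\<integral>\<^sup>+x\<in>ball (fst p) (snd p). indicator E x \<partial>lborel) \<partial>lborel)"
    using E by (intro nn_integral_Gsq[OF \<alpha> li(1)]) simp
  also have "\<dots> \<le> (\<integral>\<^sup>+p. (\<Sum>k. ennreal (w / 2 ^ k) * (Adens \<alpha> (fk k) p * ennreal (1 / snd p))) \<partial>lborel)"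
  proof (rule nn_integral_mono)
    fix p :: "'a \<times> real"
    obtain y t where p: "p = (y, t)" by force
    have eE: "(\<integral>\<^sup>+x\<in>ball (fst p) (snd p). indicator E x \<partial>lborel) = emeasure lborel (E \<inter> ball y t)"
      using E by (simp add: p indicator_inter_arith[symmetric])
    show "Adens \<alpha> f p * ennreal (1 / snd p ^ (DIM('a) + 1)) * (\<integral>\<^sup>+x\<in>ball (fst p) (snd p). indicator E x \<partial>lborel)
      \<le> (\<Sum>k. ennreal (w / 2 ^ k) * (Adens \<alpha> (fk k) p * ennreal (1 / snd p)))"
    proof (cases "0 < t \<and> emeasure lborel (E \<inter> ball y t) \<noteq> 0")
      case False
      then show ?thesis unfolding eE by (auto simp: Adens_def p)
    next
      case True
      then have t: "0 < t" by simp
      define b where "b = w * t ^ DIM('a)"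
      have b: "emeasure lborel (ball y t) = ennreal b" "0 < b" using t w by (simp_all add: b_def emeasure_ball w_def)
      have le: "emeasure lborel (E \<inter> ball y t) \<le> ennreal b" unfolding b(1)[symmetric] using E by (intro emeasure_mono) auto
      obtain m where m: "emeasure lborel (E \<inter> ball y t) = ennreal m" "0 \<le> m"
        using le by (cases "emeasure lborel (E \<inter> ball y t)") (auto simp: top_unique)
      have m0: "0 < m" using True m by (simp add: order_less_le)
      have mb: "m \<le> b" using le m b by (simp add: ennreal_le_iff)
      have "\<exists>k. c k * b < m"
      proof -
        have "0 < m / b" using m0 b by simp
        then obtain k where "(1/2) ^ k < m / b" using real_arch_pow_inv[of "m / b" "1/2"] by auto
        moreover have "c k \<le> (1/2)^k" by (simp add: c_def power_one_over field_simps)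
        ultimately have "c k < m / b" by simp
        then show ?thesis using b by (auto simp: field_simps)
      qed
      \<comment> \<open>The least such \<open>k\<close> is the density class: failure of the test at
        \<open>k - 1\<close> gives \<open>m \<le> b / 2 ^ k\<close>, and for \<open>k = 0\<close>
        this is the trivial \<open>m \<le> b\<close>.\<close>
      then obtain k where k: "c k * b < m" "\<And>j. j < k \<Longrightarrow> \<not> c j * b < m"
        using exists_least_iff[of "\<lambda>k. c k * b < m"] by blast
      have mk: "m \<le> b / 2 ^ k"
      proof (cases k)
        case 0 then show ?thesis using mb by simp
      next
        case (Suc j)
        then show ?thesis using k(2)[of j] by (simp add: c_def)
      qed
      have "ennreal (c k * b) < ennreal m" using k(1) c[of k] b m0 by (intro ennreal_lessI) auto
      then have "ennreal (c k) * emeasure lborel (ball y t) < emeasure lborel (E \<inter> ball y t)"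
        unfolding m b using c[of k] b by (simp add: ennreal_mult)
      then have "ball (fst p) (snd p) \<subseteq> U k" unfolding U_def p using t by auto
      then have A: "Adens \<alpha> (fk k) p = Adens \<alpha> f p" unfolding fk_def by (rule Adens_eq_dense_cell[OF \<alpha>])
      have "ennreal (1 / t ^ (DIM('a) + 1)) * ennreal m = ennreal (1 / t ^ (DIM('a) + 1) * m)"
        using t m by (intro ennreal_mult[symmetric]) auto
      also have "\<dots> \<le> ennreal (1 / t ^ (DIM('a) + 1) * (b / 2 ^ k))"
        using mk t by (intro ennreal_leI mult_left_mono) auto
      also have "1 / t ^ (DIM('a) + 1) * (b / 2 ^ k) = w / 2 ^ k * (1 / t)" using t by (simp add: b_def)
      also have "ennreal \<dots> = ennreal (w / 2 ^ k) * ennreal (1 / t)" using t w by (intro ennreal_mult) auto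
      finally have "Adens \<alpha> f p * (ennreal (1 / t ^ (DIM('a) + 1)) * ennreal m) \<le> Adens \<alpha> f p * (ennreal (w / 2 ^ k) * ennreal (1 / t))"
        by (rule mult_left_mono) simp
      also have "\<dots> = ennreal (w / 2 ^ k) * (Adens \<alpha> (fk k) p * ennreal (1 / snd p))"
        unfolding A by (simp add: p mult_ac)
      also have "\<dots> \<le> (\<Sum>k. ennreal (w / 2 ^ k) * (Adens \<alpha> (fk k) p * ennreal (1 / snd p)))"
        using sum_le_suminf[of "\<lambda>k. ennreal (w / 2 ^ k) * (Adens \<alpha> (fk k) p * ennreal (1 / snd p))" "{k}"] by simp
      finally show ?thesis unfolding eE m by (simp add: p mult.assoc)
    qed
  qed
  also have "\<dots> = (\<Sum>k. (\<integral>\<^sup>+p. ennreal (w / 2 ^ k) * (Adens \<alpha> (fk k) p * ennreal (1 / snd p)) \<partial>lborel))"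
    using Am by (intro nn_integral_suminf) simp
  also have "\<dots> = (\<Sum>k. ennreal (w / 2 ^ k) * (\<integral>\<^sup>+p. Adens \<alpha> (fk k) p * ennreal (1 / snd p) \<partial>lborel))"
    using nn_integral_cmult[OF Am] by simp
  also have "\<dots> \<le> (\<Sum>k. ennreal (w * L / 2 ^ k) * (\<integral>\<^sup>+z\<in>U k. ennreal ((norm (f z))\<^sup>2) \<partial>lborel))"
  proof (intro suminf_le)
    fix k
    have "ennreal (w / 2 ^ k) * (\<integral>\<^sup>+p. Adens \<alpha> (fk k) p * ennreal (1 / snd p) \<partial>lborel)
      \<le> ennreal (w / 2 ^ k) * (ennreal L * (\<integral>\<^sup>+z. ennreal ((norm (fk k z))\<^sup>2) \<partial>lborel))"
      using A_fun_L2[OF \<alpha> fki[of k]] by (intro mult_left_mono) (simp_all add: lborel_prod L_def)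
    also have "(\<integral>\<^sup>+z. ennreal ((norm (fk k z))\<^sup>2) \<partial>lborel) = (\<integral>\<^sup>+z\<in>U k. ennreal ((norm (f z))\<^sup>2) \<partial>lborel)"
      by (intro nn_integral_cong) (auto simp: fk_def indicator_def)
    also have "ennreal (w / 2 ^ k) * (ennreal L * \<dots>) = ennreal (w * L / 2 ^ k) * \<dots>"
      using w L by (simp add: mult.assoc[symmetric] ennreal_mult[symmetric])
    finally show "ennreal (w / 2 ^ k) * (\<integral>\<^sup>+p. Adens \<alpha> (fk k) p * ennreal (1 / snd p) \<partial>lborel)
      \<le> ennreal (w * L / 2 ^ k) * (\<integral>\<^sup>+z\<in>U k. ennreal ((norm (f z))\<^sup>2) \<partial>lborel)" .
  qed auto
  finally show "(\<integral>\<^sup>+x. indicator E x * Gsq \<alpha> f x \<partial>lborel) \<le>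
      (\<Sum>k. ennreal (unit_ball_vol DIM('a) * L2const TYPE('a) \<alpha> / 2 ^ k) * (\<integral>\<^sup>+z\<in>U k. ennreal ((norm (f z))\<^sup>2) \<partial>lborel))"
    by (simp add: w_def L_def)
qed

text \<open>By Chebyshev, \<open>l^2 |E|\<close> is at most the integral of \<open>Gsq\<close> over
  \<open>E\<close>. The density splitting bounds the latter by a series in \<open>k\<close> in which
  sets of measure about \<open>2 ^ k |E|\<close> appear with weight \<open>2^-k\<close>.
  \<open>square_le_eps_power\<close> with \<open>e = \<epsilon> * r ^ k\<close> makes it converge,
  with a multiple of \<open>|E|\<close> small enough to be absorbed.\<close>

theorem Gsq_weak_type_power:
  assumes \<alpha>: "0 < \<alpha>"
  shows "\<exists>C>0. \<forall>(f :: 'a::euclidean_space \<Rightarrow> 'b::euclidean_space) l. integrable lborel f \<longrightarrow> 0 < l \<longrightarrow>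
    emeasure lborel {x. ennreal (l\<^sup>2) < Gsq \<alpha> f x} \<le> ennreal C * (\<integral>\<^sup>+z. ennreal ((norm (f z) / l) ^ (2 * N + 2)) \<partial>lborel)"
proof -
  define A where "A = unit_ball_vol DIM('a) * L2const TYPE('a) \<alpha>"
  have A: "0 < A" using L2const_pos[OF \<alpha>, where 'a='a] by (simp add: A_def)
  define P :: real where "P = 2 * 5 ^ DIM('a)"
  have P: "0 < P" by (simp add: P_def)
  \<comment> \<open>Chosen with \<open>r ^ (N + 1) = 1/2\<close>. Then the measure term
    \<open>e\<close> and the power term \<open>2^-k / e ^ N\<close> both decay like
    \<open>r ^ k\<close>.\<close>
  define r :: real where "r = 2 powr (- (1 / real (Suc N)))"
  have r: "0 < r" "r < 1" by (simp_all add: r_def powr_less_one)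
  have "r ^ Suc N = r powr real (Suc N)" using r(1) by (rule powr_realpow[symmetric])
  also have "\<dots> = 2 powr (- (1 / real (Suc N)) * real (Suc N))" by (simp only: r_def powr_powr)
  also have "- (1 / real (Suc N)) * real (Suc N) = - 1" by (simp del: of_nat_Suc)
  finally have rN: "r ^ N * r = 1 / 2" by (simp add: powr_minus mult.commute)
  \<comment> \<open>This value makes the final coefficient of \<open>m\<close> equal to
    \<open>1/2\<close>.\<close>
  define \<epsilon> where "\<epsilon> = (1 - r) / (2 * A * P)"
  have \<epsilon>: "0 < \<epsilon>" using r A P by (simp add: \<epsilon>_def)
  define C where "C = 2 * A / (\<epsilon> ^ N * (1 - r))"
  have C: "0 < C" using A \<epsilon> r by (simp add: C_def)
  show ?thesis
  proof (intro exI[of _ C] conjI C allI impI)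
    fix f :: "'a \<Rightarrow> 'b" and l :: real
    assume f: "integrable lborel f" and l: "0 < l"
    note li = integrable_imp_locint[OF f]
    note [measurable] = borel_measurable_integrable[OF f] Gsq_borel[OF \<alpha> li]
    define X where "X = (\<integral>\<^sup>+z. ennreal ((norm (f z) / l) ^ (2 * N + 2)) \<partial>lborel)"
    \<comment> \<open>Intersecting with a ball makes the measure finite, without which nothing can
      be absorbed; the bound is uniform in the radius.\<close>
    define E where "E R = {x. ennreal (l\<^sup>2) < Gsq \<alpha> f x} \<inter> ball 0 (real R)" for R :: nat
    have Em: "E R \<in> sets borel" for R unfolding E_def by measurable
    have main: "emeasure lborel (E R) \<le> ennreal C * X" for R
    proof (cases X)
      case (real x)
      have fin: "emeasure lborel (E R) < \<infinity>"
      proof -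
        have "emeasure lborel (E R) \<le> emeasure lborel (ball (0::'a) (real R))"
          by (rule emeasure_mono) (auto simp: E_def)
        then show ?thesis using emeasure_lborel_ball_finite by (rule order_le_less_trans)
      qed
      then obtain m where m: "emeasure lborel (E R) = ennreal m" "0 \<le> m" by (cases "emeasure lborel (E R)") auto
      obtain U where U: "\<And>k. open (U k)"
        "\<And>k. emeasure lborel (U k) \<le> ennreal (2 * 5 ^ DIM('a) * 2 ^ k) * emeasure lborel (E R)"
        "(\<integral>\<^sup>+x. indicator (E R) x * Gsq \<alpha> f x \<partial>lborel) \<le>
         (\<Sum>k. ennreal (unit_ball_vol DIM('a) * L2const TYPE('a) \<alpha> / 2 ^ k) * (\<integral>\<^sup>+z\<in>U k. ennreal ((norm (f z))\<^sup>2) \<partial>lborel))"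
        by (rule nn_integral_Gsq_indicator_le[OF \<alpha> f Em fin]) blast
      define B where "B = A * (\<epsilon> * P * m + x / \<epsilon> ^ N)"
      have B: "0 \<le> B" using A \<epsilon> P m real by (simp add: B_def)
      have k: "ennreal (A / 2 ^ k) * (\<integral>\<^sup>+z\<in>U k. ennreal ((norm (f z))\<^sup>2) \<partial>lborel) \<le> ennreal (l\<^sup>2 * B * r ^ k)" for k
      proof -
        define e where "e = \<epsilon> * r ^ k"
        have e: "0 < e" using \<epsilon> r by (simp add: e_def)
        have [measurable]: "U k \<in> sets borel" using U(1) by simp
        have "(\<integral>\<^sup>+z\<in>U k. ennreal ((norm (f z))\<^sup>2) \<partial>lborel)
          \<le> (\<integral>\<^sup>+z. ennreal (l\<^sup>2 * e) * indicator (U k) z + ennreal (l\<^sup>2 / e ^ N) * ennreal ((norm (f z) / l) ^ (2 * N + 2)) \<partial>lborel)"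
        proof (rule nn_integral_mono)
          fix z
          have "(norm (f z) / l)\<^sup>2 \<le> e + (norm (f z) / l) ^ (2 * N + 2) / e ^ N"
            using l by (intro square_le_eps_power e) auto
          then have "l\<^sup>2 * (norm (f z) / l)\<^sup>2 \<le> l\<^sup>2 * (e + (norm (f z) / l) ^ (2 * N + 2) / e ^ N)"
            by (rule mult_left_mono) simp
          then have "(norm (f z))\<^sup>2 \<le> l\<^sup>2 * e + l\<^sup>2 / e ^ N * (norm (f z) / l) ^ (2 * N + 2)"
            using l by (simp add: power_divide algebra_simps)
          then have "ennreal ((norm (f z))\<^sup>2) \<le> ennreal (l\<^sup>2 * e + l\<^sup>2 / e ^ N * (norm (f z) / l) ^ (2 * N + 2))"
            by (rule ennreal_leI)
          also have "\<dots> = ennreal (l\<^sup>2 * e) + ennreal (l\<^sup>2 / e ^ N * (norm (f z) / l) ^ (2 * N + 2))"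
            using e l by (intro ennreal_plus) auto
          also have "ennreal (l\<^sup>2 / e ^ N * (norm (f z) / l) ^ (2 * N + 2)) = ennreal (l\<^sup>2 / e ^ N) * ennreal ((norm (f z) / l) ^ (2 * N + 2))"
            using e l by (intro ennreal_mult) auto
          finally show "ennreal ((norm (f z))\<^sup>2) * indicator (U k) z
            \<le> ennreal (l\<^sup>2 * e) * indicator (U k) z + ennreal (l\<^sup>2 / e ^ N) * ennreal ((norm (f z) / l) ^ (2 * N + 2))"
            by (cases "z \<in> U k") simp_all
        qed
        also have "\<dots> = ennreal (l\<^sup>2 * e) * emeasure lborel (U k) + ennreal (l\<^sup>2 / e ^ N) * X"
          unfolding X_def by (simp add: nn_integral_add nn_integral_cmult)
        also have "\<dots> \<le> ennreal (l\<^sup>2 * e) * (ennreal (P * 2 ^ k) * ennreal m) + ennreal (l\<^sup>2 / e ^ N) * ennreal x"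
          using U(2)[of k] unfolding m real by (intro add_mono mult_left_mono) (auto simp: P_def)
        also have "\<dots> = ennreal (l\<^sup>2 * e * (P * 2 ^ k * m) + l\<^sup>2 / e ^ N * x)"
          using P e m real l by (subst ennreal_plus) (auto simp: ennreal_mult[symmetric])
        finally have "ennreal (A / 2 ^ k) * (\<integral>\<^sup>+z\<in>U k. ennreal ((norm (f z))\<^sup>2) \<partial>lborel)
          \<le> ennreal (A / 2 ^ k) * ennreal (l\<^sup>2 * e * (P * 2 ^ k * m) + l\<^sup>2 / e ^ N * x)"
          by (rule mult_left_mono) simp
        also have "\<dots> = ennreal (A / 2 ^ k * (l\<^sup>2 * e * (P * 2 ^ k * m) + l\<^sup>2 / e ^ N * x))"
          using A P e m real by (intro ennreal_mult[symmetric]) auto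
        also have "A / 2 ^ k * (l\<^sup>2 * e * (P * 2 ^ k * m) + l\<^sup>2 / e ^ N * x) = l\<^sup>2 * B * r ^ k"
        proof -
          have "(1/2) ^ k / (r ^ k) ^ N = r ^ k"
          proof -
            have "(1/2) ^ k = r ^ k * (r ^ k) ^ N"
              unfolding rN[symmetric] by (simp add: power_mult_distrib power_mult[symmetric] mult.commute)
            then show ?thesis using r by simp
          qed
          then have "1 / 2 ^ k / e ^ N = r ^ k / \<epsilon> ^ N"
            by (simp add: e_def power_mult_distrib power_one_over divide_simps)
          then have "A / 2 ^ k * (l\<^sup>2 / e ^ N * x) = A * l\<^sup>2 * x * (r ^ k / \<epsilon> ^ N)"
            by (simp only: flip: \<open>1 / 2 ^ k / e ^ N = r ^ k / \<epsilon> ^ N\<close>) simp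
          moreover have "A / 2 ^ k * (l\<^sup>2 * e * (P * 2 ^ k * m)) = A * l\<^sup>2 * \<epsilon> * r ^ k * P * m"
            by (simp add: e_def)
          ultimately show ?thesis unfolding B_def by (simp add: distrib_left distrib_right mult_ac)
        qed
        finally show ?thesis .
      qed
      have "ennreal (l\<^sup>2) * emeasure lborel (E R) = (\<integral>\<^sup>+x. ennreal (l\<^sup>2) * indicator (E R) x \<partial>lborel)"
        using Em by (simp add: nn_integral_cmult)
      also have "\<dots> \<le> (\<integral>\<^sup>+x. indicator (E R) x * Gsq \<alpha> f x \<partial>lborel)"
        by (rule nn_integral_mono) (auto simp: E_def indicator_def)
      also have "\<dots> \<le> (\<Sum>k. ennreal (l\<^sup>2 * B * r ^ k))"
        by (rule order_trans[OF U(3)]) (intro suminf_le, insert k, auto simp: A_def)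
      also have "\<dots> = ennreal (l\<^sup>2 * B * (1 / (1 - r)))"
        using B r by (intro suminf_ennreal_eq sums_mult geometric_sums) auto
      finally have "ennreal (l\<^sup>2 * m) \<le> ennreal (l\<^sup>2 * B * (1 / (1 - r)))"
        using m by (simp add: ennreal_mult)
      then have "l\<^sup>2 * m \<le> l\<^sup>2 * (B / (1 - r))"
        using B r by (subst (asm) ennreal_le_iff) auto
      then have "m \<le> B / (1 - r)" by (rule mult_left_le_imp_le) (use l in simp)
      \<comment> \<open>The first term is \<open>m / 2\<close> and moves to the left; doubling the
        rest produces the constant \<open>C\<close>.\<close>
      also have "\<dots> = A * \<epsilon> * P / (1 - r) * m + A / (\<epsilon> ^ N * (1 - r)) * x"
        unfolding B_def distrib_left add_divide_distrib by simp
      also have "A * \<epsilon> * P / (1 - r) = 1 / 2" using A P r by (simp add: \<epsilon>_def)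
      finally have "m \<le> C * x" by (simp add: C_def)
      then show ?thesis unfolding m real using C real by (simp add: ennreal_mult[symmetric])
    qed (use C in \<open>simp add: ennreal_mult_top\<close>)
    have inc: "incseq E" unfolding E_def by (intro incseq_SucI Int_mono subset_ball) auto
    have "{x. ennreal (l\<^sup>2) < Gsq \<alpha> f x} = (\<Union>R. E R)"
      unfolding E_def using reals_Archimedean2 by auto
    then have "emeasure lborel {x. ennreal (l\<^sup>2) < Gsq \<alpha> f x} = (SUP R. emeasure lborel (E R))"
      using SUP_emeasure_incseq[OF _ inc, of lborel] image_subsetI[of UNIV E, OF Em] by simp
    also have "\<dots> \<le> ennreal C * X" by (intro SUP_least main)
    finally show "emeasure lborel {x. ennreal (l\<^sup>2) < Gsq \<alpha> f x} \<le> ennreal C * (\<integral>\<^sup>+z. ennreal ((norm (f z) / l) ^ (2 * N + 2)) \<partial>lborel)"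
      by (simp add: X_def)
  qed
qed

text \<open>The bound is free of \<open>r\<close>: the smoothness gain
  \<open>(5 * r) powr \<alpha>\<close> is compensated by the tail
  \<open>(10 * r) powr (- \<alpha>)\<close> of the kernel. Each cell thus contributes a fixed
  multiple of the mass of the bad part on it.\<close>

lemma nn_integral_cell_tail_le:
  fixes c :: "'a::euclidean_space"
  assumes \<alpha>: "0 < \<alpha>" and r: "0 < r"
  shows "(\<integral>\<^sup>+x\<in>- ball c (10 * r). ennreal ((5 * r) powr \<alpha>) * ennreal ((norm (x - c) / 4) powr (- (real DIM('a) + \<alpha>))) \<partial>lborel)
    \<le> ennreal (4 powr (real DIM('a) + \<alpha>) * (unit_ball_vol DIM('a) * (real DIM('a) + \<alpha>) / \<alpha>))"
proof -
  define s where "s = real DIM('a) + \<alpha>"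
  have s: "0 < s" using \<alpha> by (simp add: s_def add_nonneg_pos)
  have e: "ennreal ((5 * r) powr \<alpha>) * ennreal ((norm (x - c) / 4) powr (- s)) =
    ennreal ((5 * r) powr \<alpha> * 4 powr s) * ennreal (norm (x - c) powr (- s))" for x
    by (simp add: powr_divide powr_minus field_simps flip: ennreal_mult)
  have "(\<integral>\<^sup>+x\<in>- ball c (10 * r). ennreal ((5 * r) powr \<alpha>) * ennreal ((norm (x - c) / 4) powr (- s)) \<partial>lborel)
    = ennreal ((5 * r) powr \<alpha> * 4 powr s) * (\<integral>\<^sup>+x\<in>- ball c (10 * r). ennreal (norm (x - c) powr (- s)) \<partial>lborel)"
    unfolding e mult.assoc by (rule nn_integral_cmult) measurable
  also have "\<dots> \<le> ennreal ((5 * r) powr \<alpha> * 4 powr s) * ennreal (unit_ball_vol DIM('a) * s / \<alpha> * (10 * r) powr (- \<alpha>))"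
    using nn_integral_outside_ball[of "10 * r" \<alpha> c] \<alpha> r by (intro mult_left_mono) (auto simp: s_def)
  also have "\<dots> = ennreal (((5 * r) powr \<alpha> * (10 * r) powr (- \<alpha>)) * (4 powr s * (unit_ball_vol DIM('a) * s / \<alpha>)))"
    using \<alpha> s by (simp add: mult_ac flip: ennreal_mult)
  also have "\<dots> \<le> ennreal (1 * (4 powr s * (unit_ball_vol DIM('a) * s / \<alpha>)))"
  proof (intro ennreal_leI mult_right_mono)
    have "(5 * r) powr \<alpha> \<le> (10 * r) powr \<alpha>" using \<alpha> r by (intro powr_mono2) auto
    then show "(5 * r) powr \<alpha> * (10 * r) powr (- \<alpha>) \<le> 1" using r by (simp add: powr_minus field_simps)
  qed (use \<alpha> s in auto)
  finally show ?thesis by (simp add: s_def)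
qed

text \<open>The good part is bounded by a multiple of \<open>l\<close>, so its square integral is at
  most \<open>l\<close> times its mass and Chebyshev applies. The enlarged cells \<open>W\<close>
  are small. Off \<open>W\<close> the square function of the bad part is at most
  \<open>\<kappa> * S x\<close> with \<open>S\<close> integrable there, so Chebyshev at the first
  power is enough.\<close>

theorem Gsq_weak_type_one:
  assumes \<alpha>: "0 < \<alpha>"
  shows "\<exists>C>0. \<forall>(f :: 'a::euclidean_space \<Rightarrow> 'b::euclidean_space) l. integrable lborel f \<longrightarrow> 0 < l \<longrightarrow>
    emeasure lborel {x. ennreal (l\<^sup>2) < Gsq \<alpha> f x} \<le> ennreal (C / l) * (\<integral>\<^sup>+z. ennreal (norm (f z)) \<partial>lborel)"
proof -
  define w where "w = unit_ball_vol DIM('a)"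
  have w: "0 < w" by (simp add: w_def)
  define L where "L = w * L2const TYPE('a) \<alpha>"
  have L: "0 < L" using L2const_pos[OF \<alpha>, where 'a='a] w by (simp add: L_def)
  define s where "s = real DIM('a) + \<alpha>"
  have s: "0 < s" using \<alpha> by (simp add: s_def add_nonneg_pos)
  \<comment> \<open>Square root of the constant in \<open>Gsq_le_square_of_A_fun_bound\<close>,
    which bounds \<open>Gsq\<close> and not its root.\<close>
  define \<kappa> where "\<kappa> = sqrt (w / s)"
  have \<kappa>: "0 < \<kappa>" "\<kappa>\<^sup>2 = w / s" using w s by (simp_all add: \<kappa>_def)
  define T where "T = 4 powr s * (w * s / \<alpha>)"
  have T: "0 < T" using w s \<alpha> by (simp add: T_def)
  \<comment> \<open>In order: the good part, the exceptional set \<open>W\<close>, and the bad part.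
    In the last term the 4 is 2 from halving the level times 2 from the mass of \<open>b\<close>
    against that of \<open>f\<close>.\<close>
  define C where "C = 4 * L * 5 ^ DIM('a) + 10 ^ DIM('a) + 4 * \<kappa> * T"
  have C: "0 < C" using L \<kappa> T by (simp add: C_def add_pos_pos)
  show ?thesis
  proof (intro exI[of _ C] conjI C allI impI)
    fix f :: "'a \<Rightarrow> 'b" and l :: real
    assume f: "integrable lborel f" and l: "0 < l"
    define F where "F = (\<integral>\<^sup>+z. ennreal (norm (f z)) \<partial>lborel)"
    obtain Q :: "nat \<Rightarrow> 'a set" and c r g where
      Q: "\<And>k. Q k \<in> sets borel" "disjoint_family Q"
      and Qr: "\<And>k. Q k \<noteq> {} \<Longrightarrow> 0 < r k \<and> ball (c k) (r k) \<subseteq> Q k \<and> Q k \<subseteq> ball (c k) (5 * r k)"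
      and Ql: "\<And>k. Q k \<noteq> {} \<Longrightarrow> ennreal l * emeasure lborel (ball (c k) (r k)) \<le> (\<integral>\<^sup>+z\<in>Q k. ennreal (norm (f z)) \<partial>lborel)"
      and g: "integrable lborel g" and gb: "AE z in lborel. norm (g z) \<le> 5 ^ DIM('a) * l"
      and gF: "(\<integral>\<^sup>+z. ennreal (norm (g z)) \<partial>lborel) \<le> (\<integral>\<^sup>+z. ennreal (norm (f z)) \<partial>lborel)"
      and off: "\<And>z. z \<notin> (\<Union>k. Q k) \<Longrightarrow> g z = f z"
      and cancel: "\<And>k. (\<integral>z. indicator (Q k) z *\<^sub>R (f z - g z) \<partial>lborel) = 0"
      by (rule Calderon_Zygmund_decomposition[OF f l]) blast
    note [measurable] = Q(1) borel_measurable_integrable[OF f] borel_measurable_integrable[OF g]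
    have FQ: "F = (\<integral>\<^sup>+z\<in>- (\<Union>k. Q k). ennreal (norm (f z)) \<partial>lborel) + (\<Sum>k. \<integral>\<^sup>+z\<in>Q k. ennreal (norm (f z)) \<partial>lborel)"
      unfolding F_def by (rule nn_integral_split_cells[OF Q]) measurable
    have sumF: "(\<Sum>k. \<integral>\<^sup>+z\<in>Q k. ennreal (norm (f z)) \<partial>lborel) \<le> F" unfolding FQ by simp
    define b where "b z = f z - g z" for z
    have b: "integrable lborel b" unfolding b_def using f g by simp
    have fgb: "f = (\<lambda>z. g z + b z)" by (simp add: b_def)
    note gl = integrable_imp_locint[OF g] and bl = integrable_imp_locint[OF b]
    note [measurable] = borel_measurable_integrable[OF b] Gsq_borel[OF \<alpha> gl] Gsq_borel[OF \<alpha> bl]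
    define \<beta> where "\<beta> k = (\<integral>\<^sup>+z\<in>Q k. ennreal (norm (b z)) \<partial>lborel)" for k
    have \<beta>0: "\<beta> k = 0" if "Q k = {}" for k using that by (simp add: \<beta>_def)
    have sum\<beta>: "(\<Sum>k. \<beta> k) \<le> 2 * F"
    proof -
      have "(\<Sum>k. \<beta> k) \<le> (\<integral>\<^sup>+z. ennreal (norm (b z)) \<partial>lborel)"
        unfolding \<beta>_def by (subst nn_integral_split_cells[OF Q, of "\<lambda>z. ennreal (norm (b z))"]) simp_all
      also have "\<dots> \<le> (\<integral>\<^sup>+z. ennreal (norm (f z)) + ennreal (norm (g z)) \<partial>lborel)"
        by (intro nn_integral_mono) (simp add: b_def norm_triangle_ineq4 flip: ennreal_plus)
      also have "\<dots> = F + (\<integral>\<^sup>+z. ennreal (norm (g z)) \<partial>lborel)" unfolding F_def by (rule nn_integral_add) measurable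
      also have "\<dots> \<le> F + F" using gF by (simp add: F_def add_left_mono)
      finally show ?thesis by (simp add: mult_2)
    qed
    \<comment> \<open>Twice the radius \<open>5 * r k\<close> of a ball containing the cell: points
      off \<open>W\<close> are then as far away as \<open>A_fun_cells_le\<close> requires.\<close>
    define W where "W = (\<Union>k\<in>{k. Q k \<noteq> {}}. ball (c k) (10 * r k))"
    have oW: "open W" unfolding W_def by auto
    then have [measurable]: "W \<in> sets borel" by simp
    have eW: "emeasure lborel W \<le> ennreal (10 ^ DIM('a) / l) * F"
    proof -
      have "emeasure lborel W \<le> emeasure lborel (\<Union>k. (if Q k = {} then {} else ball (c k) (10 * r k)))"
        by (intro emeasure_mono) (auto simp: W_def)
      also have "\<dots> \<le> (\<Sum>k. emeasure lborel (if Q k = {} then {} else ball (c k) (10 * r k)))"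
        by (rule emeasure_subadditive_countably) auto
      also have "\<dots> \<le> (\<Sum>k. ennreal (10 ^ DIM('a) / l) * (\<integral>\<^sup>+z\<in>Q k. ennreal (norm (f z)) \<partial>lborel))"
      proof (intro suminf_le allI)
        fix k
        show "emeasure lborel (if Q k = {} then {} else ball (c k) (10 * r k)) \<le> ennreal (10 ^ DIM('a) / l) * (\<integral>\<^sup>+z\<in>Q k. ennreal (norm (f z)) \<partial>lborel)"
        proof (cases "Q k = {}")
          case False
          have "emeasure lborel (ball (c k) (10 * r k)) = ennreal (10 ^ DIM('a) / l) * (ennreal l * emeasure lborel (ball (c k) (r k)))"
            using Qr[OF False] l by (simp add: emeasure_ball_scale mult.assoc[symmetric] ennreal_mult[symmetric])
          also have "\<dots> \<le> ennreal (10 ^ DIM('a) / l) * (\<integral>\<^sup>+z\<in>Q k. ennreal (norm (f z)) \<partial>lborel)"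
            by (intro mult_left_mono Ql[OF False]) simp
          finally show ?thesis using False by simp
        qed simp
      qed auto
      also have "\<dots> = ennreal (10 ^ DIM('a) / l) * (\<Sum>k. \<integral>\<^sup>+z\<in>Q k. ennreal (norm (f z)) \<partial>lborel)" by simp
      also have "\<dots> \<le> ennreal (10 ^ DIM('a) / l) * F" by (intro mult_left_mono sumF) simp
      finally show ?thesis .
    qed
    define S where "S x = (\<Sum>k. \<beta> k * (ennreal ((5 * r k) powr \<alpha>) * ennreal ((norm (x - c k) / 4) powr (- s))))" for x
    have Sm[measurable]: "S \<in> borel_measurable borel" unfolding S_def by measurable
    have Gb: "Gsq \<alpha> b x \<le> ennreal (\<kappa>\<^sup>2) * (S x)\<^sup>2" if "x \<notin> W" for x
    proof -
      have far: "10 * r k \<le> norm (x - c k)" if "Q k \<noteq> {}" for k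
        using that \<open>x \<notin> W\<close> by (auto simp: W_def dist_norm norm_minus_commute)
      have "Gsq \<alpha> b x \<le> ennreal (unit_ball_vol DIM('a) / s) *
        (\<Sum>k. (\<beta> k * ennreal ((5 * r k) powr \<alpha>)) * ennreal ((norm (x - c k) / 4) powr (- s)))\<^sup>2"
      proof (rule Gsq_le_square_of_A_fun_bound[OF _ s])
        fix k assume "\<beta> k * ennreal ((5 * r k) powr \<alpha>) \<noteq> 0"
        then have "Q k \<noteq> {}" using \<beta>0 by auto
        then have "10 * r k \<le> norm (x - c k)" "0 < r k" using far[of k] Qr[of k] by auto
        then have "0 < norm (x - c k)" by linarith
        then show "0 < norm (x - c k) / 4" by simp
      next
        fix t y assume t: "0 < t" "dist x y < t"
        have "A_fun \<alpha> b t y \<le> (\<Sum>k. (\<integral>\<^sup>+z\<in>Q k. ennreal (norm (b z)) \<partial>lborel) *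
          (ennreal ((5 * r k) powr \<alpha> * t powr (- (real DIM('a) + \<alpha>))) * indicator {norm (x - c k) / 4..} t))"
          by (rule A_fun_cells_le[OF \<alpha> b Q _ _ _ far t]) (use Qr off cancel in \<open>auto simp: b_def\<close>)
        then show "A_fun \<alpha> b t y \<le> (\<Sum>k. \<beta> k * ennreal ((5 * r k) powr \<alpha>) * (ennreal (t powr (- s)) * indicator {norm (x - c k) / 4..} t))"
          by (simp add: \<beta>_def s_def ennreal_mult mult.assoc)
      qed
      then show ?thesis by (simp add: S_def \<kappa>(2) w_def mult.assoc)
    qed
    have intS: "(\<integral>\<^sup>+x\<in>- W. S x \<partial>lborel) \<le> ennreal (2 * T) * F"
    proof -
      have "(\<integral>\<^sup>+x\<in>- W. S x \<partial>lborel) = (\<integral>\<^sup>+x. (\<Sum>k. \<beta> k * (ennreal ((5 * r k) powr \<alpha>) * ennreal ((norm (x - c k) / 4) powr (- s)) * indicator (- W) x)) \<partial>lborel)"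
        unfolding S_def by (intro nn_integral_cong) (simp flip: ennreal_suminf_multc add: mult.assoc)
      also have "\<dots> = (\<Sum>k. \<integral>\<^sup>+x. \<beta> k * (ennreal ((5 * r k) powr \<alpha>) * ennreal ((norm (x - c k) / 4) powr (- s)) * indicator (- W) x) \<partial>lborel)"
        by (rule nn_integral_suminf) measurable
      also have "\<dots> \<le> (\<Sum>k. \<beta> k * ennreal T)"
      proof (intro suminf_le allI)
        fix k
        show "(\<integral>\<^sup>+x. \<beta> k * (ennreal ((5 * r k) powr \<alpha>) * ennreal ((norm (x - c k) / 4) powr (- s)) * indicator (- W) x) \<partial>lborel) \<le> \<beta> k * ennreal T"
        proof (cases "Q k = {}")
          case False
          have "(\<integral>\<^sup>+x. \<beta> k * (ennreal ((5 * r k) powr \<alpha>) * ennreal ((norm (x - c k) / 4) powr (- s)) * indicator (- W) x) \<partial>lborel)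
            = \<beta> k * (\<integral>\<^sup>+x\<in>- W. ennreal ((5 * r k) powr \<alpha>) * ennreal ((norm (x - c k) / 4) powr (- s)) \<partial>lborel)"
            by (rule nn_integral_cmult) measurable
          also have "\<dots> \<le> \<beta> k * (\<integral>\<^sup>+x\<in>- ball (c k) (10 * r k). ennreal ((5 * r k) powr \<alpha>) * ennreal ((norm (x - c k) / 4) powr (- s)) \<partial>lborel)"
            using False by (intro mult_left_mono nn_integral_mono) (auto simp: W_def indicator_def)
          also have "\<dots> \<le> \<beta> k * ennreal T"
            using nn_integral_cell_tail_le[OF \<alpha>, of "r k" "c k"] Qr[OF False]
            by (intro mult_left_mono) (auto simp: T_def s_def w_def)
          finally show ?thesis .
        qed (simp add: \<beta>0)
      qed auto
      also have "\<dots> = (\<Sum>k. \<beta> k) * ennreal T" by simp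
      also have "\<dots> \<le> 2 * F * ennreal T" by (intro mult_right_mono sum\<beta>) simp
      also have "\<dots> = ennreal (2 * T) * F" using T by (simp add: ennreal_mult mult_ac)
      finally show ?thesis .
    qed
    have Gsqg: "emeasure lborel {x. ennreal (l\<^sup>2 / 4) \<le> Gsq \<alpha> g x} \<le> ennreal (4 * L * 5 ^ DIM('a) / l) * F"
    proof -
      have l4: "1 = ennreal (4 / l\<^sup>2) * ennreal (l\<^sup>2 / 4)" using l by (simp flip: ennreal_mult)
      have "{x. ennreal (l\<^sup>2 / 4) \<le> Gsq \<alpha> g x} \<subseteq> {x \<in> UNIV. 1 \<le> ennreal (4 / l\<^sup>2) * Gsq \<alpha> g x}"
        using mult_left_mono[of "ennreal (l\<^sup>2 / 4)" _ "ennreal (4 / l\<^sup>2)"] by (subst l4) auto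
      then have "emeasure lborel {x. ennreal (l\<^sup>2 / 4) \<le> Gsq \<alpha> g x} \<le> emeasure lborel ({x \<in> space lborel. 1 \<le> ennreal (4 / l\<^sup>2) * Gsq \<alpha> g x} \<inter> UNIV)"
        by (intro emeasure_mono) auto
      also have "\<dots> \<le> ennreal (4 / l\<^sup>2) * (\<integral>\<^sup>+x\<in>UNIV. Gsq \<alpha> g x \<partial>lborel)"
        using nn_integral_Markov_inequality[of "Gsq \<alpha> g" UNIV lborel "ennreal (4 / l\<^sup>2)"] by simp
      also have "\<dots> \<le> ennreal (4 / l\<^sup>2) * (ennreal L * (\<integral>\<^sup>+z. ennreal ((norm (g z))\<^sup>2) \<partial>lborel))"
        using nn_integral_Gsq_UNIV_le[OF \<alpha> g] by (intro mult_left_mono) (auto simp: L_def w_def)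
      also have "(\<integral>\<^sup>+z. ennreal ((norm (g z))\<^sup>2) \<partial>lborel) \<le> (\<integral>\<^sup>+z. ennreal (5 ^ DIM('a) * l) * ennreal (norm (g z)) \<partial>lborel)"
      proof (rule nn_integral_mono_AE)
        show "AE z in lborel. ennreal ((norm (g z))\<^sup>2) \<le> ennreal (5 ^ DIM('a) * l) * ennreal (norm (g z))"
          using gb
        proof eventually_elim
          case (elim z)
          then have "(norm (g z))\<^sup>2 \<le> 5 ^ DIM('a) * l * norm (g z)" unfolding power2_eq_square by (intro mult_right_mono) auto
          from ennreal_leI[OF this] show ?case using l by (simp add: ennreal_mult)
        qed
      qed
      also have "\<dots> = ennreal (5 ^ DIM('a) * l) * (\<integral>\<^sup>+z. ennreal (norm (g z)) \<partial>lborel)" by (rule nn_integral_cmult) measurable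
      also have "\<dots> \<le> ennreal (5 ^ DIM('a) * l) * F" using gF by (intro mult_left_mono) (auto simp: F_def)
      also have "ennreal (4 / l\<^sup>2) * (ennreal L * (ennreal (5 ^ DIM('a) * l) * F)) = ennreal (4 / l\<^sup>2 * (L * (5 ^ DIM('a) * l))) * F"
      proof -
        have "ennreal (4 / l\<^sup>2) * (ennreal L * ennreal (5 ^ DIM('a) * l)) = ennreal (4 / l\<^sup>2 * (L * (5 ^ DIM('a) * l)))"
          using l L by (simp flip: ennreal_mult)
        then show ?thesis by (simp only: flip: mult.assoc)
      qed
      also have "4 / l\<^sup>2 * (L * (5 ^ DIM('a) * l)) = 4 * L * 5 ^ DIM('a) / l" using l by (simp add: power2_eq_square)
      finally show ?thesis by (simp add: mult_left_mono)
    qed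
    have GsqbS: "emeasure lborel ({x. ennreal (l\<^sup>2 / 4) < Gsq \<alpha> b x} - W) \<le> ennreal (4 * \<kappa> * T / l) * F"
    proof -
      have sub: "{x. ennreal (l\<^sup>2 / 4) < Gsq \<alpha> b x} - W \<subseteq> {x \<in> - W. 1 \<le> ennreal (2 * \<kappa> / l) * S x}"
      proof safe
        fix x assume x: "ennreal (l\<^sup>2 / 4) < Gsq \<alpha> b x" "x \<notin> W"
        show "1 \<le> ennreal (2 * \<kappa> / l) * S x"
        proof (rule ccontr)
          assume "\<not> 1 \<le> ennreal (2 * \<kappa> / l) * S x"
          then have n: "ennreal (2 * \<kappa> / l) * S x < 1" by simp
          then have "S x \<noteq> top" using \<kappa> l by (auto simp: ennreal_mult_top)
          then obtain y where y: "S x = ennreal y" "0 \<le> y" by (cases "S x") auto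
          have "2 * \<kappa> / l * y < 1" using n y \<kappa> l by (simp add: ennreal_mult[symmetric] ennreal_less_iff flip: ennreal_1)
          then have "\<kappa> * y < l / 2" using l by (simp add: field_simps)
          then have "(\<kappa> * y)\<^sup>2 \<le> (l / 2)\<^sup>2" using \<kappa> y by (intro power_mono) auto
          then have "ennreal (\<kappa>\<^sup>2) * (S x)\<^sup>2 \<le> ennreal (l\<^sup>2 / 4)"
            using y by (simp add: ennreal_power power_mult_distrib power_divide ennreal_leI flip: ennreal_mult)
          then show False using Gb[OF x(2)] x(1) by (meson leD order_trans)
        qed
      qed
      have "emeasure lborel ({x. ennreal (l\<^sup>2 / 4) < Gsq \<alpha> b x} - W) \<le> emeasure lborel {x \<in> - W. 1 \<le> ennreal (2 * \<kappa> / l) * S x}"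
        by (intro emeasure_mono[OF sub]) measurable
      also have "\<dots> \<le> ennreal (2 * \<kappa> / l) * (\<integral>\<^sup>+x\<in>- W. S x \<partial>lborel)"
        using nn_integral_Markov_inequality[of S "- W" lborel "ennreal (2 * \<kappa> / l)"] by simp
      also have "\<dots> \<le> ennreal (2 * \<kappa> / l) * (ennreal (2 * T) * F)" by (intro mult_left_mono intS) simp
      also have "\<dots> = ennreal (4 * \<kappa> * T / l) * F"
        using \<kappa> l T by (simp add: mult.assoc[symmetric] flip: ennreal_mult)
      finally show ?thesis .
    qed
    have "{x. ennreal (l\<^sup>2) < Gsq \<alpha> f x} \<subseteq> {x. ennreal (l\<^sup>2 / 4) \<le> Gsq \<alpha> g x} \<union> (W \<union> ({x. ennreal (l\<^sup>2 / 4) < Gsq \<alpha> b x} - W))"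
    proof
      fix x assume x: "x \<in> {x. ennreal (l\<^sup>2) < Gsq \<alpha> f x}"
      have "ennreal (l\<^sup>2) < Gsq \<alpha> (\<lambda>z. g z + b z) x" using x unfolding fgb[symmetric] by simp
      from Gsq_add_level[OF \<alpha> gl bl this]
      show "x \<in> {x. ennreal (l\<^sup>2 / 4) \<le> Gsq \<alpha> g x} \<union> (W \<union> ({x. ennreal (l\<^sup>2 / 4) < Gsq \<alpha> b x} - W))"
        by (auto simp: power_divide less_imp_le)
    qed
    then have "emeasure lborel {x. ennreal (l\<^sup>2) < Gsq \<alpha> f x} \<le> emeasure lborel ({x. ennreal (l\<^sup>2 / 4) \<le> Gsq \<alpha> g x} \<union> (W \<union> ({x. ennreal (l\<^sup>2 / 4) < Gsq \<alpha> b x} - W)))"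
      by (intro emeasure_mono) measurable
    also have "\<dots> \<le> emeasure lborel {x. ennreal (l\<^sup>2 / 4) \<le> Gsq \<alpha> g x} + (emeasure lborel W + emeasure lborel ({x. ennreal (l\<^sup>2 / 4) < Gsq \<alpha> b x} - W))"
      by (intro order_trans[OF emeasure_subadditive] add_left_mono emeasure_subadditive) measurable
    also have "\<dots> \<le> ennreal (4 * L * 5 ^ DIM('a) / l) * F + (ennreal (10 ^ DIM('a) / l) * F + ennreal (4 * \<kappa> * T / l) * F)"
      by (intro add_mono Gsqg eW GsqbS)
    also have "\<dots> = ennreal (C / l) * F"
    proof -
      have "ennreal (C / l) = ennreal (4 * L * 5 ^ DIM('a) / l) + (ennreal (10 ^ DIM('a) / l) + ennreal (4 * \<kappa> * T / l))"
        using l L \<kappa> T by (simp add: C_def add_divide_distrib flip: ennreal_plus)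
      then show ?thesis by (simp only: distrib_right)
    qed
    finally show "emeasure lborel {x. ennreal (l\<^sup>2) < Gsq \<alpha> f x} \<le> ennreal (C / l) * (\<integral>\<^sup>+z. ennreal (norm (f z)) \<partial>lborel)"
      by (simp add: F_def)
  qed
qed

section \<open>Young functions and the modular inequality\<close>

text \<open>The value is \<open>0\<close> where \<open>Gsq\<close> is infinite, as for \<open>enn2real \<circ> square_function\<close>.\<close>

definition sqf :: "real \<Rightarrow> ('a::euclidean_space \<Rightarrow> 'b::euclidean_space) \<Rightarrow> 'a \<Rightarrow> real" where
  "sqf \<alpha> f x = sqrt (enn2real (Gsq \<alpha> f x))"

lemma ennreal_regroup:
  "0 \<le> a \<Longrightarrow> 0 \<le> b \<Longrightarrow> 0 \<le> c \<Longrightarrow> ennreal a * x * (ennreal b * ennreal c) = ennreal (a * (b * c)) * x"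
  by (simp add: ennreal_mult mult_ac)

locale young_types =
  fixes \<Phi> :: "real \<Rightarrow> ennreal" and p0 p1 :: real
  assumes young: "young_function \<Phi>" and p0: "1 < p0" and p01: "p0 \<le> p1"
    and lower: "lower_type p0 \<Phi>" and upper: "upper_type p1 \<Phi>"
begin

section \<open>Consequences of convexity and of the two types\<close>

lemma convex: "0 \<le> x \<Longrightarrow> 0 \<le> y \<Longrightarrow> u \<in> {0..1} \<Longrightarrow>
    \<Phi> ((1 - u) * x + u * y) \<le> ennreal (1 - u) * \<Phi> x + ennreal u * \<Phi> y"
  using young by (auto simp: young_function_def)

lemma left_cont: "0 < r \<Longrightarrow> (\<Phi> \<longlongrightarrow> \<Phi> r) (at_left r)"
  using young by (auto simp: young_function_def)

lemma at_0: "\<Phi> 0 = 0" "(\<Phi> \<longlongrightarrow> 0) (at_right 0)"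
  using young by (auto simp: young_function_def)

lemma at_top: "(\<Phi> \<longlongrightarrow> \<infinity>) at_top"
  using young by (auto simp: young_function_def)

lemma scale_le: "0 \<le> s \<Longrightarrow> u \<in> {0..1} \<Longrightarrow> \<Phi> (u * s) \<le> ennreal u * \<Phi> s"
  using convex[of 0 s u] at_0 by simp

lemma mono: assumes "0 \<le> s" "s \<le> t" shows "\<Phi> s \<le> \<Phi> t"
proof (cases "t = 0")
  case False
  then have t: "0 < t" using assms by simp
  have "\<Phi> ((s / t) * t) \<le> ennreal (s / t) * \<Phi> t" using assms t by (intro scale_le) auto
  also have "\<dots> \<le> ennreal 1 * \<Phi> t" using assms t by (intro mult_right_mono ennreal_leI) auto
  finally show ?thesis using t by simp
qed (use assms in auto)

lemma upperE: obtains C where "1 \<le> C" "\<And>t s. 1 \<le> t \<Longrightarrow> 0 \<le> s \<Longrightarrow> \<Phi> (s * t) \<le> ennreal (C * t powr p1) * \<Phi> s"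
proof -
  obtain C where C: "0 < C" "\<forall>t\<ge>1. \<forall>s\<ge>0. \<Phi> (s * t) \<le> ennreal (C * t powr p1) * \<Phi> s"
    using upper by (auto simp: upper_type_def)
  show thesis
  proof (rule that[of "max 1 C"])
    fix t s :: real assume ts: "1 \<le> t" "0 \<le> s"
    have "\<Phi> (s * t) \<le> ennreal (C * t powr p1) * \<Phi> s" using C(2) ts by auto
    also have "\<dots> \<le> ennreal (max 1 C * t powr p1) * \<Phi> s" by (intro mult_right_mono ennreal_leI) auto
    finally show "\<Phi> (s * t) \<le> ennreal (max 1 C * t powr p1) * \<Phi> s" .
  qed simp
qed

lemma lowerE: obtains C where "1 \<le> C" "\<And>t s. 0 \<le> t \<Longrightarrow> t \<le> 1 \<Longrightarrow> 0 \<le> s \<Longrightarrow> \<Phi> (s * t) \<le> ennreal (C * t powr p0) * \<Phi> s"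
proof -
  obtain C where C: "0 < C" "\<forall>t\<in>{0..1}. \<forall>s\<ge>0. \<Phi> (s * t) \<le> ennreal (C * t powr p0) * \<Phi> s"
    using lower by (auto simp: lower_type_def)
  show thesis
  proof (rule that[of "max 1 C"])
    fix t s :: real assume ts: "0 \<le> t" "t \<le> 1" "0 \<le> s"
    have "\<Phi> (s * t) \<le> ennreal (C * t powr p0) * \<Phi> s" using C(2) ts by auto
    also have "\<dots> \<le> ennreal (max 1 C * t powr p0) * \<Phi> s" by (intro mult_right_mono ennreal_leI) auto
    finally show "\<Phi> (s * t) \<le> ennreal (max 1 C * t powr p0) * \<Phi> s" .
  qed simp
qed

text \<open>Near 0 the values are below 1 because of the limit there, and the upper type carries
  finiteness to every larger argument.\<close>

lemma finite: "0 \<le> s \<Longrightarrow> \<Phi> s < \<infinity>"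
proof -
  assume s: "0 \<le> s"
  have "\<forall>\<^sub>F x in at_right 0. \<Phi> x < 1" using at_0(2) by (rule order_tendstoD) simp
  then obtain d where d: "0 < d" "\<And>x. 0 < x \<Longrightarrow> x < d \<Longrightarrow> \<Phi> x < 1" by (auto simp: eventually_at_right_field)
  have fd: "\<Phi> (d / 2) < \<infinity>" using d(2)[of "d / 2"] d(1) by (auto intro: order_less_trans)
  obtain C where C: "1 \<le> C" "\<And>t s. 1 \<le> t \<Longrightarrow> 0 \<le> s \<Longrightarrow> \<Phi> (s * t) \<le> ennreal (C * t powr p1) * \<Phi> s"
    by (rule upperE) blast
  have "\<Phi> s \<le> \<Phi> (d / 2 * (max s (d / 2) / (d / 2)))" using s d(1) by (intro mono) auto
  also have "\<dots> \<le> ennreal (C * (max s (d / 2) / (d / 2)) powr p1) * \<Phi> (d / 2)" using d(1) by (intro C(2)) auto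
  also have "\<dots> < \<infinity>" using fd by (auto simp: ennreal_mult_less_top)
  finally show ?thesis .
qed

lemma pos: assumes s: "0 < s" shows "0 < \<Phi> s"
proof (rule ccontr)
  assume "\<not> 0 < \<Phi> s"
  then have z: "\<Phi> s = 0" by (simp add: zero_less_iff_neq_zero)
  obtain C where C: "1 \<le> C" "\<And>t s. 1 \<le> t \<Longrightarrow> 0 \<le> s \<Longrightarrow> \<Phi> (s * t) \<le> ennreal (C * t powr p1) * \<Phi> s"
    by (rule upperE) blast
  have "\<forall>\<^sub>F x in at_top. 1 < \<Phi> x" using at_top by (rule order_tendstoD) simp
  then obtain x where x: "\<And>y. y \<ge> x \<Longrightarrow> 1 < \<Phi> y" by (auto simp: eventually_at_top_linorder)
  define y where "y = max x s"
  have "\<Phi> y = \<Phi> (s * (y / s))" using s by simp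
  also have "\<dots> \<le> ennreal (C * (y / s) powr p1) * \<Phi> s" using s by (intro C(2)) (auto simp: y_def)
  finally show False using x[of y] z by (simp add: y_def)
qed

text \<open>Values at negative arguments are arbitrary, hence \<open>max 0 x\<close>. Measurability
  comes from monotonicity of the real-valued version, which loses nothing because all relevant
  values are finite.\<close>

lemma borel: "(\<lambda>x. \<Phi> (max 0 x)) \<in> borel_measurable borel"
proof -
  have "mono (\<lambda>x. enn2real (\<Phi> (max 0 x)))"
    by (intro monoI enn2real_mono mono) (use finite in \<open>auto simp: max_def less_top\<close>)
  then have m: "(\<lambda>x. enn2real (\<Phi> (max 0 x))) \<in> borel_measurable borel" by (rule borel_measurable_mono)
  have "(\<lambda>x. \<Phi> (max 0 x)) = (\<lambda>x. ennreal (enn2real (\<Phi> (max 0 x))))"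
    using finite by (auto simp: fun_eq_iff)
  also have "\<dots> \<in> borel_measurable borel" using m by measurable
  finally show ?thesis .
qed

lemma borel_comp:
  assumes "g \<in> borel_measurable M" "\<And>x. x \<in> space M \<Longrightarrow> 0 \<le> g x"
  shows "(\<lambda>x. \<Phi> (g x)) \<in> borel_measurable M"
proof -
  have "(\<lambda>x. \<Phi> (max 0 (g x))) \<in> borel_measurable M" by (rule measurable_compose[OF assms(1) borel])
  then show ?thesis by (rule measurable_cong[THEN iffD1, rotated]) (simp add: assms(2))
qed

text \<open>Layer cake, with \<open>\<Phi> (2 \<tau>)\<close> over \<open>\<tau> \<in> {a/2..a}\<close> in place of the derivative of \<open>\<Phi>\<close>.\<close>

lemma layer_le:
  assumes a: "0 \<le> a"
  shows "\<Phi> a \<le> 2 * (\<integral>\<^sup>+\<tau>\<in>{0<..}. indicator {..<a} \<tau> * (\<Phi> (2 * max 0 \<tau>) * ennreal (1 / \<tau>)) \<partial>lborel)"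
proof (cases "a = 0")
  case False
  then have a: "0 < a" using assms by simp
  have "\<Phi> a = 2 * (\<Phi> a * ennreal (1 / a) * ennreal (a / 2))"
  proof -
    have "ennreal (1 / a) * ennreal (a / 2) = ennreal (1 / 2)" using a by (simp flip: ennreal_mult)
    moreover have "2 * ennreal (1 / 2) = 1" by (subst ennreal_numeral[symmetric], subst ennreal_mult[symmetric]) auto
    ultimately show ?thesis by (simp add: mult.assoc mult.left_commute[of 2])
  qed
  also have "\<Phi> a * ennreal (1 / a) * ennreal (a / 2) = (\<integral>\<^sup>+\<tau>. \<Phi> a * ennreal (1 / a) * indicator {a/2..<a} \<tau> \<partial>lborel)"
    using a by (subst nn_integral_cmult_indicator) simp_all
  also have "\<dots> \<le> (\<integral>\<^sup>+\<tau>\<in>{0<..}. indicator {..<a} \<tau> * (\<Phi> (2 * max 0 \<tau>) * ennreal (1 / \<tau>)) \<partial>lborel)"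
  proof (rule nn_integral_mono)
    fix \<tau> :: real
    show "\<Phi> a * ennreal (1 / a) * indicator {a/2..<a} \<tau> \<le> indicator {..<a} \<tau> * (\<Phi> (2 * max 0 \<tau>) * ennreal (1 / \<tau>)) * indicator {0<..} \<tau>"
    proof (cases "\<tau> \<in> {a/2..<a}")
      case True
      then have "\<Phi> a * ennreal (1 / a) \<le> \<Phi> (2 * max 0 \<tau>) * ennreal (1 / \<tau>)"
        using a by (intro mult_mono mono ennreal_leI divide_left_mono) auto
      then show ?thesis using True a by simp
    qed simp
  qed
  finally show ?thesis by (simp add: mult_left_mono)
qed (simp add: at_0)

lemma nn_integral_layer_le:
  fixes g :: "'a::euclidean_space \<Rightarrow> real"
  assumes g[measurable]: "g \<in> borel_measurable borel" and g0: "\<And>x. 0 \<le> g x"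
  shows "(\<integral>\<^sup>+x. \<Phi> (g x) \<partial>lborel) \<le>
    2 * (\<integral>\<^sup>+\<tau>\<in>{0<..}. \<Phi> (2 * max 0 \<tau>) * ennreal (1 / \<tau>) * emeasure lborel {x. \<tau> < g x} \<partial>lborel)"
proof -
  have Pm[measurable]: "(\<lambda>\<tau>. \<Phi> (2 * max 0 \<tau>)) \<in> borel_measurable borel" by (rule borel_comp) auto
  have im[measurable]: "(\<lambda>q. indicator {..<g (fst q)} (snd q) :: ennreal) \<in> borel_measurable (borel \<Otimes>\<^sub>M borel)"
  proof -
    have "(\<lambda>q. indicator {..<g (fst q)} (snd q) :: ennreal) = indicator {q \<in> space (borel \<Otimes>\<^sub>M borel). snd q < g (fst q)}"
      by (auto simp: indicator_def space_pair_measure)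
    then show ?thesis by simp
  qed
  have "(\<lambda>q. indicator {..<g (fst q)} (snd q) * (\<Phi> (2 * max 0 (snd q)) * ennreal (1 / snd q)) * indicator {0<..} (snd q)) \<in> borel_measurable (borel \<Otimes>\<^sub>M borel)"
    by measurable
  then have m: "(\<lambda>(x, \<tau>). indicator {..<g x} \<tau> * (\<Phi> (2 * max 0 \<tau>) * ennreal (1 / \<tau>)) * indicator {0<..} \<tau>) \<in> borel_measurable (lborel \<Otimes>\<^sub>M lborel)"
    by (simp add: case_prod_beta' cong: measurable_cong_sets sets_pair_measure_cong)
  have m2: "(\<lambda>x. \<integral>\<^sup>+\<tau>\<in>{0<..}. indicator {..<g x} \<tau> * (\<Phi> (2 * max 0 \<tau>) * ennreal (1 / \<tau>)) \<partial>lborel) \<in> borel_measurable lborel"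
    using lborel.borel_measurable_nn_integral[OF m] by simp
  have "(\<integral>\<^sup>+x. \<Phi> (g x) \<partial>lborel) \<le> (\<integral>\<^sup>+x. 2 * (\<integral>\<^sup>+\<tau>\<in>{0<..}. indicator {..<g x} \<tau> * (\<Phi> (2 * max 0 \<tau>) * ennreal (1 / \<tau>)) \<partial>lborel) \<partial>lborel)"
    by (intro nn_integral_mono layer_le g0)
  also have "\<dots> = 2 * (\<integral>\<^sup>+x. (\<integral>\<^sup>+\<tau>\<in>{0<..}. indicator {..<g x} \<tau> * (\<Phi> (2 * max 0 \<tau>) * ennreal (1 / \<tau>)) \<partial>lborel) \<partial>lborel)"
    by (rule nn_integral_cmult[OF m2])
  also have "(\<integral>\<^sup>+x. (\<integral>\<^sup>+\<tau>\<in>{0<..}. indicator {..<g x} \<tau> * (\<Phi> (2 * max 0 \<tau>) * ennreal (1 / \<tau>)) \<partial>lborel) \<partial>lborel)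
    = (\<integral>\<^sup>+\<tau>. (\<integral>\<^sup>+x. indicator {..<g x} \<tau> * (\<Phi> (2 * max 0 \<tau>) * ennreal (1 / \<tau>)) * indicator {0<..} \<tau> \<partial>lborel) \<partial>lborel)"
    by (rule lborel_pair.Fubini'[OF m, symmetric])
  also have "\<dots> = (\<integral>\<^sup>+\<tau>\<in>{0<..}. \<Phi> (2 * max 0 \<tau>) * ennreal (1 / \<tau>) * emeasure lborel {x. \<tau> < g x} \<partial>lborel)"
  proof (rule nn_integral_cong)
    fix \<tau> :: real
    have "(\<integral>\<^sup>+x. indicator {..<g x} \<tau> * (\<Phi> (2 * max 0 \<tau>) * ennreal (1 / \<tau>)) * indicator {0<..} \<tau> \<partial>lborel)
      = (\<integral>\<^sup>+x. (\<Phi> (2 * max 0 \<tau>) * ennreal (1 / \<tau>) * indicator {0<..} \<tau>) * indicator {x. \<tau> < g x} x \<partial>lborel)"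
      by (intro nn_integral_cong) (auto simp: indicator_def)
    also have "\<dots> = (\<Phi> (2 * max 0 \<tau>) * ennreal (1 / \<tau>) * indicator {0<..} \<tau>) * emeasure lborel {x. \<tau> < g x}"
      by (rule nn_integral_cmult_indicator) simp
    finally show "(\<integral>\<^sup>+x. indicator {..<g x} \<tau> * (\<Phi> (2 * max 0 \<tau>) * ennreal (1 / \<tau>)) * indicator {0<..} \<tau> \<partial>lborel)
      = \<Phi> (2 * max 0 \<tau>) * ennreal (1 / \<tau>) * emeasure lborel {x. \<tau> < g x} * indicator {0<..} \<tau>"
      by (simp add: mult_ac)
  qed
  finally show ?thesis .
qed

text \<open>The two halves of Marcinkiewicz interpolation at a single value \<open>a\<close> of \<open>|f|\<close>; they converge since
  \<open>p1 < q\<close> and \<open>1 < p0\<close>.\<close>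

lemma upper_half:
  assumes q: "p1 < q"
  obtains C where "0 < C" "\<And>a. 0 \<le> a \<Longrightarrow> (\<integral>\<^sup>+\<tau>\<in>{0<..}. \<Phi> (2 * max 0 \<tau>) * ennreal (1 / \<tau>) * (ennreal ((a / \<tau>) powr q) * indicator {a..} \<tau>) \<partial>lborel) \<le> ennreal C * \<Phi> a"
proof -
  obtain U where U: "1 \<le> U" "\<And>t s. 1 \<le> t \<Longrightarrow> 0 \<le> s \<Longrightarrow> \<Phi> (s * t) \<le> ennreal (U * t powr p1) * \<Phi> s"
    by (rule upperE) blast
  show thesis
  proof (rule that[of "U * 2 powr p1 / (q - p1)"])
    show "0 < U * 2 powr p1 / (q - p1)" using U q by simp
    fix a :: real assume "0 \<le> a"
    show "(\<integral>\<^sup>+\<tau>\<in>{0<..}. \<Phi> (2 * max 0 \<tau>) * ennreal (1 / \<tau>) * (ennreal ((a / \<tau>) powr q) * indicator {a..} \<tau>) \<partial>lborel) \<le> ennreal (U * 2 powr p1 / (q - p1)) * \<Phi> a"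
    proof (cases "a = 0")
      case False
      then have a: "0 < a" using \<open>0 \<le> a\<close> by simp
      define s where "s = q - p1"
      have s: "0 < s" using q by (simp add: s_def)
      have "(\<integral>\<^sup>+\<tau>\<in>{0<..}. \<Phi> (2 * max 0 \<tau>) * ennreal (1 / \<tau>) * (ennreal ((a / \<tau>) powr q) * indicator {a..} \<tau>) \<partial>lborel)
        \<le> (\<integral>\<^sup>+\<tau>. ennreal (U * 2 powr p1 * a powr s) * \<Phi> a * (ennreal (\<tau> powr (- s - 1)) * indicator {a..} \<tau>) \<partial>lborel)"
      proof (rule nn_integral_mono)
        fix \<tau> :: real
        show "\<Phi> (2 * max 0 \<tau>) * ennreal (1 / \<tau>) * (ennreal ((a / \<tau>) powr q) * indicator {a..} \<tau>) * indicator {0<..} \<tau>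
          \<le> ennreal (U * 2 powr p1 * a powr s) * \<Phi> a * (ennreal (\<tau> powr (- s - 1)) * indicator {a..} \<tau>)"
        proof (cases "a \<le> \<tau>")
          case True
          then have l: "0 < \<tau>" using a by simp
          have "\<Phi> (2 * \<tau>) = \<Phi> (a * (2 * \<tau> / a))" using a by simp
          also have "\<dots> \<le> ennreal (U * (2 * \<tau> / a) powr p1) * \<Phi> a" using True a by (intro U(2)) auto
          finally have "\<Phi> (2 * \<tau>) * (ennreal (1 / \<tau>) * ennreal ((a / \<tau>) powr q)) \<le> ennreal (U * (2 * \<tau> / a) powr p1) * \<Phi> a * (ennreal (1 / \<tau>) * ennreal ((a / \<tau>) powr q))"
            by (rule mult_right_mono) simp
          also have "\<dots> = ennreal (U * (2 * \<tau> / a) powr p1 * (1 / \<tau> * (a / \<tau>) powr q)) * \<Phi> a"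
            by (rule ennreal_regroup) (use l U in auto)
          also have "U * (2 * \<tau> / a) powr p1 * (1 / \<tau> * (a / \<tau>) powr q) = U * 2 powr p1 * a powr s * \<tau> powr (- s - 1)"
            using l a by (simp add: powr_divide powr_mult powr_diff powr_minus powr_add s_def field_simps)
          also have "ennreal \<dots> = ennreal (U * 2 powr p1 * a powr s) * ennreal (\<tau> powr (- s - 1))" using U by (intro ennreal_mult) auto
          finally show ?thesis using True l by (simp add: mult_ac)
        qed simp
      qed
      also have "\<dots> = ennreal (U * 2 powr p1 * a powr s) * \<Phi> a * ennreal (a powr (- s) / s)"
        using nn_integral_powr_to_inf[OF a s] by (subst nn_integral_cmult) auto
      also have "\<dots> = ennreal (U * 2 powr p1 * a powr s) * ennreal (a powr (- s) / s) * \<Phi> a" by (simp only: mult_ac)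
      also have "ennreal (U * 2 powr p1 * a powr s) * ennreal (a powr (- s) / s) = ennreal (U * 2 powr p1 / s)"
        using U a s by (simp add: powr_minus flip: ennreal_mult)
      finally show ?thesis by (simp add: s_def)
    next
      case True
      then show ?thesis by (simp add: at_0)
    qed
  qed
qed

lemma lower_half:
  obtains C where "0 < C" "\<And>a. 0 \<le> a \<Longrightarrow> (\<integral>\<^sup>+\<tau>\<in>{0<..}. \<Phi> (2 * max 0 \<tau>) * ennreal (1 / \<tau>) * (ennreal (a / \<tau>) * indicator {..<a} \<tau>) \<partial>lborel) \<le> ennreal C * \<Phi> a"
proof -
  obtain U where U: "1 \<le> U" "\<And>t s. 1 \<le> t \<Longrightarrow> 0 \<le> s \<Longrightarrow> \<Phi> (s * t) \<le> ennreal (U * t powr p1) * \<Phi> s"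
    by (rule upperE) blast
  obtain D where D: "1 \<le> D" "\<And>t s. 0 \<le> t \<Longrightarrow> t \<le> 1 \<Longrightarrow> 0 \<le> s \<Longrightarrow> \<Phi> (s * t) \<le> ennreal (D * t powr p0) * \<Phi> s"
    by (rule lowerE) blast
  \<comment> \<open>From \<open>2 * \<tau> = (2 * a) * (\<tau> / a)\<close>: the lower type handles
    the ratio \<open>\<tau> / a < 1\<close>, the upper type the doubling from \<open>a\<close> to
    \<open>2 * a\<close>.\<close>
  define V where "V = D * (U * 2 powr p1)"
  have V: "0 < V" using U D by (simp add: V_def)
  show thesis
  proof (rule that[of "V / (p0 - 1)"])
    show "0 < V / (p0 - 1)" using V p0 by simp
    fix a :: real assume "0 \<le> a"
    show "(\<integral>\<^sup>+\<tau>\<in>{0<..}. \<Phi> (2 * max 0 \<tau>) * ennreal (1 / \<tau>) * (ennreal (a / \<tau>) * indicator {..<a} \<tau>) \<partial>lborel) \<le> ennreal (V / (p0 - 1)) * \<Phi> a"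
    proof (cases "a = 0")
      case False
      then have a: "0 < a" using \<open>0 \<le> a\<close> by simp
      define s where "s = p0 - 1"
      have s: "0 < s" using p0 by (simp add: s_def)
      have "(\<integral>\<^sup>+\<tau>\<in>{0<..}. \<Phi> (2 * max 0 \<tau>) * ennreal (1 / \<tau>) * (ennreal (a / \<tau>) * indicator {..<a} \<tau>) \<partial>lborel)
        \<le> (\<integral>\<^sup>+\<tau>. ennreal (V * a powr (- s)) * \<Phi> a * (ennreal (\<tau> powr (s - 1)) * indicator {0..a} \<tau>) \<partial>lborel)"
      proof (rule nn_integral_mono)
        fix \<tau> :: real
        show "\<Phi> (2 * max 0 \<tau>) * ennreal (1 / \<tau>) * (ennreal (a / \<tau>) * indicator {..<a} \<tau>) * indicator {0<..} \<tau>
          \<le> ennreal (V * a powr (- s)) * \<Phi> a * (ennreal (\<tau> powr (s - 1)) * indicator {0..a} \<tau>)"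
        proof (cases "0 < \<tau> \<and> \<tau> < a")
          case True
          have "\<Phi> (2 * \<tau>) = \<Phi> ((a * 2) * (\<tau> / a))" using a by simp
          also have "\<dots> \<le> ennreal (D * (\<tau> / a) powr p0) * \<Phi> (a * 2)" using True a by (intro D(2)) auto
          also have "\<dots> \<le> ennreal (D * (\<tau> / a) powr p0) * (ennreal (U * 2 powr p1) * \<Phi> a)"
            using a by (intro mult_left_mono U(2)) auto
          also have "\<dots> = ennreal (V * (\<tau> / a) powr p0) * \<Phi> a" using U D by (simp add: V_def ennreal_mult mult_ac)
          finally have "\<Phi> (2 * \<tau>) * (ennreal (1 / \<tau>) * ennreal (a / \<tau>)) \<le> ennreal (V * (\<tau> / a) powr p0) * \<Phi> a * (ennreal (1 / \<tau>) * ennreal (a / \<tau>))"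
            by (rule mult_right_mono) simp
          also have "\<dots> = ennreal (V * (\<tau> / a) powr p0 * (1 / \<tau> * (a / \<tau>))) * \<Phi> a"
            by (rule ennreal_regroup) (use True V a in auto)
          also have "V * (\<tau> / a) powr p0 * (1 / \<tau> * (a / \<tau>)) = V * a powr (- s) * \<tau> powr (s - 1)"
            using True a by (simp add: powr_divide powr_diff powr_minus s_def power2_eq_square field_simps)
          also have "ennreal \<dots> = ennreal (V * a powr (- s)) * ennreal (\<tau> powr (s - 1))" using V by (intro ennreal_mult) auto
          finally show ?thesis using True by (simp add: mult_ac)
        qed (auto simp: indicator_def)
      qed
      also have "\<dots> = ennreal (V * a powr (- s)) * \<Phi> a * ennreal (a powr s / s)"
        using nn_integral_powr_from_0[OF a s] by (subst nn_integral_cmult) auto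
      also have "\<dots> = ennreal (V * a powr (- s)) * ennreal (a powr s / s) * \<Phi> a" by (simp only: mult_ac)
      also have "ennreal (V * a powr (- s)) * ennreal (a powr s / s) = ennreal (V / s)"
        using V a s by (simp add: powr_minus flip: ennreal_mult)
      finally show ?thesis by (simp add: s_def)
    next
      case True
      then show ?thesis by (simp add: at_0)
    qed
  qed
qed

text \<open>At height \<open>\<tau>\<close> the function is cut where \<open>|f| = \<tau>\<close>;
  the small part is measured by the weak estimate of order \<open>q > p1\<close>, the large part by
  that of order 1. After Tonelli the integrals in \<open>\<tau>\<close> at each point
  \<open>z\<close> are those of \<open>upper_half\<close> and \<open>lower_half\<close> with
  \<open>a = |f z|\<close>.\<close>

theorem modular_bound:
  assumes \<alpha>: "0 < \<alpha>"
  shows "\<exists>C\<ge>1. \<forall>f :: 'a::euclidean_space \<Rightarrow> 'b::euclidean_space. integrable lborel f \<longrightarrow>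
    (\<integral>\<^sup>+x. \<Phi> (sqf \<alpha> f x) \<partial>lborel) \<le> ennreal C * (\<integral>\<^sup>+x. \<Phi> (norm (f x)) \<partial>lborel)"
proof -
  obtain N :: nat where N: "p1 < real (2 * N + 2)"
    using reals_Archimedean2[of p1] by (metis (no_types, opaque_lifting) less_le_trans of_nat_mono le_add1 le_trans mult_2)
  define q where "q = real (2 * N + 2)"
  obtain Cq where Cq: "0 < Cq" "\<And>(f :: 'a \<Rightarrow> 'b) l. integrable lborel f \<Longrightarrow> 0 < l \<Longrightarrow>
    emeasure lborel {x. ennreal (l\<^sup>2) < Gsq \<alpha> f x} \<le> ennreal Cq * (\<integral>\<^sup>+z. ennreal ((norm (f z) / l) ^ (2 * N + 2)) \<partial>lborel)"
    using Gsq_weak_type_power[OF \<alpha>, of N] by blast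
  obtain C1 where C1: "0 < C1" "\<And>(f :: 'a \<Rightarrow> 'b) l. integrable lborel f \<Longrightarrow> 0 < l \<Longrightarrow>
    emeasure lborel {x. ennreal (l\<^sup>2) < Gsq \<alpha> f x} \<le> ennreal (C1 / l) * (\<integral>\<^sup>+z. ennreal (norm (f z)) \<partial>lborel)"
    using Gsq_weak_type_one[OF \<alpha>] by blast
  obtain Cu where Cu: "0 < Cu" "\<And>a. 0 \<le> a \<Longrightarrow> (\<integral>\<^sup>+\<tau>\<in>{0<..}. \<Phi> (2 * max 0 \<tau>) * ennreal (1 / \<tau>) * (ennreal ((a / \<tau>) powr q) * indicator {a..} \<tau>) \<partial>lborel) \<le> ennreal Cu * \<Phi> a"
    using upper_half[of q] N unfolding q_def by blast
  obtain Cl where Cl: "0 < Cl" "\<And>a. 0 \<le> a \<Longrightarrow> (\<integral>\<^sup>+\<tau>\<in>{0<..}. \<Phi> (2 * max 0 \<tau>) * ennreal (1 / \<tau>) * (ennreal (a / \<tau>) * indicator {..<a} \<tau>) \<partial>lborel) \<le> ennreal Cl * \<Phi> a"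
    by (rule lower_half) blast
  \<comment> \<open>The power of 2 arises because each of the two parts is tested at level
    \<open>\<tau> / 2\<close>; for the large part the same effect gives
    \<open>2 * C1\<close>.\<close>
  define K where "K = Cq * 2 ^ (2 * N + 2)"
  have K: "0 < K" using Cq by (simp add: K_def)
  define C where "C = max 1 (2 * (K * Cu + 2 * C1 * Cl))"
  show ?thesis
  proof (intro exI[of _ C] conjI allI impI)
    show "1 \<le> C" by (simp add: C_def)
    fix f :: "'a \<Rightarrow> 'b" assume f: "integrable lborel f"
    note [measurable] = borel_measurable_integrable[OF f] Gsq_borel[OF \<alpha> integrable_imp_locint[OF f]]
    have gm[measurable]: "sqf \<alpha> f \<in> borel_measurable borel" unfolding sqf_def by measurable
    \<comment> \<open>The integrands of the two weak type bounds, with the cut at height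
      \<open>\<tau>\<close> expressed as a condition on \<open>\<tau>\<close> for given
      \<open>z\<close>; this form is ready for the exchange of integrals.\<close>
    define h where "h \<tau> z = ennreal K * (ennreal ((norm (f z) / \<tau>) powr q) * indicator {norm (f z)..} \<tau>) +
      ennreal (2 * C1) * (ennreal (norm (f z) / \<tau>) * indicator {..<norm (f z)} \<tau>)" for \<tau> z
    have lev: "emeasure lborel {x. \<tau> < sqf \<alpha> f x} \<le> (\<integral>\<^sup>+z. h \<tau> z \<partial>lborel)" if \<tau>: "0 < \<tau>" for \<tau>
    proof -
      define f1 where "f1 z = indicator {z. norm (f z) \<le> \<tau>} z *\<^sub>R f z" for z
      define f2 where "f2 z = indicator {z. \<not> norm (f z) \<le> \<tau>} z *\<^sub>R f z" for z
      have f1: "integrable lborel f1" unfolding f1_def by (intro integrable_mult_indicator f) simp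
      have f2: "integrable lborel f2" unfolding f2_def by (intro integrable_mult_indicator f) simp
      note [measurable] = Gsq_borel[OF \<alpha> integrable_imp_locint[OF f1]] Gsq_borel[OF \<alpha> integrable_imp_locint[OF f2]]
      have ff: "f = (\<lambda>z. f1 z + f2 z)" by (auto simp: f1_def f2_def indicator_def)
      have "{x. \<tau> < sqf \<alpha> f x} \<subseteq> {x. ennreal ((\<tau> / 2)\<^sup>2) < Gsq \<alpha> f1 x} \<union> {x. ennreal ((\<tau> / 2)\<^sup>2) < Gsq \<alpha> f2 x}"
      proof
        fix x assume "x \<in> {x. \<tau> < sqf \<alpha> f x}"
        then have "\<tau> < sqrt (enn2real (Gsq \<alpha> f x))" by (simp add: sqf_def)
        then have "\<tau>\<^sup>2 < enn2real (Gsq \<alpha> f x)" using \<tau> real_le_lsqrt[of \<tau> "enn2real (Gsq \<alpha> f x)"] by (meson not_le less_imp_le)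
        then have "ennreal (\<tau>\<^sup>2) < Gsq \<alpha> f x" by (cases "Gsq \<alpha> f x") (auto simp: ennreal_less_iff)
        also have "Gsq \<alpha> f x = Gsq \<alpha> (\<lambda>z. f1 z + f2 z) x" by (simp flip: ff)
        finally have "ennreal (\<tau>\<^sup>2) < Gsq \<alpha> (\<lambda>z. f1 z + f2 z) x" .
        from Gsq_add_level[OF \<alpha> integrable_imp_locint[OF f1] integrable_imp_locint[OF f2] this]
        show "x \<in> {x. ennreal ((\<tau> / 2)\<^sup>2) < Gsq \<alpha> f1 x} \<union> {x. ennreal ((\<tau> / 2)\<^sup>2) < Gsq \<alpha> f2 x}"
          by auto
      qed
      then have "emeasure lborel {x. \<tau> < sqf \<alpha> f x} \<le> emeasure lborel ({x. ennreal ((\<tau> / 2)\<^sup>2) < Gsq \<alpha> f1 x} \<union> {x. ennreal ((\<tau> / 2)\<^sup>2) < Gsq \<alpha> f2 x})"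
        by (intro emeasure_mono) measurable
      also have "\<dots> \<le> emeasure lborel {x. ennreal ((\<tau> / 2)\<^sup>2) < Gsq \<alpha> f1 x} + emeasure lborel {x. ennreal ((\<tau> / 2)\<^sup>2) < Gsq \<alpha> f2 x}"
        by (intro emeasure_subadditive) measurable
      also have "\<dots> \<le> ennreal Cq * (\<integral>\<^sup>+z. ennreal ((norm (f1 z) / (\<tau> / 2)) ^ (2 * N + 2)) \<partial>lborel) + ennreal (C1 / (\<tau> / 2)) * (\<integral>\<^sup>+z. ennreal (norm (f2 z)) \<partial>lborel)"
        using \<tau> by (intro add_mono Cq(2) C1(2) f1 f2) auto
      also have "\<dots> = (\<integral>\<^sup>+z. ennreal Cq * ennreal ((norm (f1 z) / (\<tau> / 2)) ^ (2 * N + 2)) + ennreal (C1 / (\<tau> / 2)) * ennreal (norm (f2 z)) \<partial>lborel)"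
        using borel_measurable_integrable[OF f1] borel_measurable_integrable[OF f2]
        by (simp add: nn_integral_add nn_integral_cmult)
      also have "\<dots> = (\<integral>\<^sup>+z. h \<tau> z \<partial>lborel)"
      proof (rule nn_integral_cong)
        fix z
        show "ennreal Cq * ennreal ((norm (f1 z) / (\<tau> / 2)) ^ (2 * N + 2)) + ennreal (C1 / (\<tau> / 2)) * ennreal (norm (f2 z)) = h \<tau> z"
        proof (cases "norm (f z) \<le> \<tau>")
          case True
          have "(norm (f z) / (\<tau> / 2)) ^ (2 * N + 2) = 2 ^ (2 * N + 2) * (norm (f z) / \<tau>) ^ (2 * N + 2)"
          proof -
            have "norm (f z) / (\<tau> / 2) = 2 * (norm (f z) / \<tau>)" by simp
            then show ?thesis by (simp only: power_mult_distrib)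
          qed
          also have "(norm (f z) / \<tau>) ^ (2 * N + 2) = (norm (f z) / \<tau>) powr q"
            using \<tau> unfolding q_def by (intro powr_realpow'[symmetric]) auto
          finally have "ennreal Cq * ennreal ((norm (f z) / (\<tau> / 2)) ^ (2 * N + 2)) = ennreal (Cq * (2 ^ (2 * N + 2) * (norm (f z) / \<tau>) powr q))"
            using Cq by (simp only:) (rule ennreal_mult[symmetric], auto)
          also have "\<dots> = ennreal (K * (norm (f z) / \<tau>) powr q)" by (simp only: K_def mult.assoc)
          also have "\<dots> = ennreal K * ennreal ((norm (f z) / \<tau>) powr q)" using K by (intro ennreal_mult) auto
          finally show ?thesis using True by (simp add: h_def f1_def f2_def)
        next
          case False
          have "ennreal (C1 / (\<tau> / 2)) * ennreal (norm (f z)) = ennreal (2 * C1) * ennreal (norm (f z) / \<tau>)"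
            using C1 \<tau> by (simp flip: ennreal_mult)
          then show ?thesis using False by (simp add: h_def f1_def f2_def)
        qed
      qed
      finally show ?thesis .
    qed
    have Pm[measurable]: "(\<lambda>\<tau>. \<Phi> (2 * max 0 \<tau>)) \<in> borel_measurable borel" by (rule borel_comp) auto
    have im[measurable]: "(\<lambda>q. indicator {..<norm (f (snd q))} (fst q) :: ennreal) \<in> borel_measurable (borel \<Otimes>\<^sub>M borel)"
      "(\<lambda>q. indicator {norm (f (snd q))..} (fst q) :: ennreal) \<in> borel_measurable (borel \<Otimes>\<^sub>M borel)"
    proof -
      have "(\<lambda>q. indicator {..<norm (f (snd q))} (fst q) :: ennreal) = indicator {q \<in> space (borel \<Otimes>\<^sub>M borel). fst q < norm (f (snd q))}"
        "(\<lambda>q. indicator {norm (f (snd q))..} (fst q) :: ennreal) = indicator {q \<in> space (borel \<Otimes>\<^sub>M borel). norm (f (snd q)) \<le> fst q}"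
        by (auto simp: indicator_def space_pair_measure)
      then show "(\<lambda>q. indicator {..<norm (f (snd q))} (fst q) :: ennreal) \<in> borel_measurable (borel \<Otimes>\<^sub>M borel)"
        "(\<lambda>q. indicator {norm (f (snd q))..} (fst q) :: ennreal) \<in> borel_measurable (borel \<Otimes>\<^sub>M borel)" by simp_all
    qed
    have hm[measurable]: "(\<lambda>q. h (fst q) (snd q)) \<in> borel_measurable (borel \<Otimes>\<^sub>M borel)"
      unfolding h_def by measurable
    have h1: "h \<tau> \<in> borel_measurable borel" "(\<lambda>\<tau>. h \<tau> z) \<in> borel_measurable borel" for \<tau> z
      using measurable_compose[OF measurable_Pair1'[of \<tau> borel borel] hm] measurable_compose[OF measurable_Pair2'[of z borel borel] hm] by simp_all
    have "(\<lambda>q. \<Phi> (2 * max 0 (fst q)) * ennreal (1 / fst q) * indicator {0<..} (fst q) * h (fst q) (snd q)) \<in> borel_measurable (borel \<Otimes>\<^sub>M borel)"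
      by measurable
    then have m: "(\<lambda>(\<tau>, z). \<Phi> (2 * max 0 \<tau>) * ennreal (1 / \<tau>) * indicator {0<..} \<tau> * h \<tau> z) \<in> borel_measurable (lborel \<Otimes>\<^sub>M lborel)"
      by (simp add: case_prod_beta' cong: measurable_cong_sets sets_pair_measure_cong)
    have "(\<integral>\<^sup>+x. \<Phi> (sqf \<alpha> f x) \<partial>lborel) \<le>
      2 * (\<integral>\<^sup>+\<tau>\<in>{0<..}. \<Phi> (2 * max 0 \<tau>) * ennreal (1 / \<tau>) * emeasure lborel {x. \<tau> < sqf \<alpha> f x} \<partial>lborel)"
      by (rule nn_integral_layer_le[OF gm]) (simp add: sqf_def)
    also have "\<dots> \<le> 2 * (\<integral>\<^sup>+\<tau>. (\<integral>\<^sup>+z. \<Phi> (2 * max 0 \<tau>) * ennreal (1 / \<tau>) * indicator {0<..} \<tau> * h \<tau> z \<partial>lborel) \<partial>lborel)"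
    proof (intro mult_left_mono nn_integral_mono)
      fix \<tau> :: real
      have "\<Phi> (2 * max 0 \<tau>) * ennreal (1 / \<tau>) * emeasure lborel {x. \<tau> < sqf \<alpha> f x} * indicator {0<..} \<tau>
        \<le> \<Phi> (2 * max 0 \<tau>) * ennreal (1 / \<tau>) * indicator {0<..} \<tau> * (\<integral>\<^sup>+z. h \<tau> z \<partial>lborel)"
        using lev[of \<tau>] by (cases "0 < \<tau>") (auto intro: mult_left_mono)
      also have "\<dots> = (\<integral>\<^sup>+z. \<Phi> (2 * max 0 \<tau>) * ennreal (1 / \<tau>) * indicator {0<..} \<tau> * h \<tau> z \<partial>lborel)"
        using h1(1)[of \<tau>] by (intro nn_integral_cmult[symmetric]) simp
      finally show "\<Phi> (2 * max 0 \<tau>) * ennreal (1 / \<tau>) * emeasure lborel {x. \<tau> < sqf \<alpha> f x} * indicator {0<..} \<tau> \<le> \<dots>" .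
    qed simp
    also have "(\<integral>\<^sup>+\<tau>. (\<integral>\<^sup>+z. \<Phi> (2 * max 0 \<tau>) * ennreal (1 / \<tau>) * indicator {0<..} \<tau> * h \<tau> z \<partial>lborel) \<partial>lborel)
      = (\<integral>\<^sup>+z. (\<integral>\<^sup>+\<tau>. \<Phi> (2 * max 0 \<tau>) * ennreal (1 / \<tau>) * indicator {0<..} \<tau> * h \<tau> z \<partial>lborel) \<partial>lborel)"
      by (rule lborel_pair.Fubini'[OF m, symmetric])
    also have "\<dots> \<le> (\<integral>\<^sup>+z. ennreal (K * Cu + 2 * C1 * Cl) * \<Phi> (norm (f z)) \<partial>lborel)"
    proof (rule nn_integral_mono)
      fix z
      let ?a = "norm (f z)"
      have "(\<integral>\<^sup>+\<tau>. \<Phi> (2 * max 0 \<tau>) * ennreal (1 / \<tau>) * indicator {0<..} \<tau> * h \<tau> z \<partial>lborel) =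
        (\<integral>\<^sup>+\<tau>. ennreal K * (\<Phi> (2 * max 0 \<tau>) * ennreal (1 / \<tau>) * (ennreal ((?a / \<tau>) powr q) * indicator {?a..} \<tau>) * indicator {0<..} \<tau>) +
          ennreal (2 * C1) * (\<Phi> (2 * max 0 \<tau>) * ennreal (1 / \<tau>) * (ennreal (?a / \<tau>) * indicator {..<?a} \<tau>) * indicator {0<..} \<tau>) \<partial>lborel)"
        unfolding h_def by (intro nn_integral_cong) (simp only: distrib_left mult_ac)
      also have "\<dots> = ennreal K * (\<integral>\<^sup>+\<tau>\<in>{0<..}. \<Phi> (2 * max 0 \<tau>) * ennreal (1 / \<tau>) * (ennreal ((?a / \<tau>) powr q) * indicator {?a..} \<tau>) \<partial>lborel) +
        ennreal (2 * C1) * (\<integral>\<^sup>+\<tau>\<in>{0<..}. \<Phi> (2 * max 0 \<tau>) * ennreal (1 / \<tau>) * (ennreal (?a / \<tau>) * indicator {..<?a} \<tau>) \<partial>lborel)"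
        by (subst nn_integral_add) (simp_all add: nn_integral_cmult)
      also have "\<dots> \<le> ennreal K * (ennreal Cu * \<Phi> ?a) + ennreal (2 * C1) * (ennreal Cl * \<Phi> ?a)"
        by (intro add_mono mult_left_mono Cu(2) Cl(2)) auto
      also have "\<dots> = ennreal (K * Cu) * \<Phi> ?a + ennreal (2 * C1 * Cl) * \<Phi> ?a"
        using K Cu C1 Cl by (simp add: ennreal_mult mult.assoc)
      also have "\<dots> = ennreal (K * Cu + 2 * C1 * Cl) * \<Phi> ?a"
        using K Cu C1 Cl by (simp add: distrib_right)
      finally show "(\<integral>\<^sup>+\<tau>. \<Phi> (2 * max 0 \<tau>) * ennreal (1 / \<tau>) * indicator {0<..} \<tau> * h \<tau> z \<partial>lborel) \<le> ennreal (K * Cu + 2 * C1 * Cl) * \<Phi> ?a" .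
    qed
    also have "\<dots> = ennreal (K * Cu + 2 * C1 * Cl) * (\<integral>\<^sup>+z. \<Phi> (norm (f z)) \<partial>lborel)"
      by (intro nn_integral_cmult borel_comp) auto
    also have "2 * (ennreal (K * Cu + 2 * C1 * Cl) * (\<integral>\<^sup>+z. \<Phi> (norm (f z)) \<partial>lborel)) = ennreal (2 * (K * Cu + 2 * C1 * Cl)) * (\<integral>\<^sup>+z. \<Phi> (norm (f z)) \<partial>lborel)"
    proof -
      have "0 \<le> K * Cu + 2 * C1 * Cl" using K Cu C1 Cl by simp
      then have "ennreal (2 * (K * Cu + 2 * C1 * Cl)) = 2 * ennreal (K * Cu + 2 * C1 * Cl)"
        by (subst ennreal_mult) (simp_all del: ennreal_plus)
      then show ?thesis by (simp only: mult.assoc)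
    qed
    also have "\<dots> \<le> ennreal C * (\<integral>\<^sup>+z. \<Phi> (norm (f z)) \<partial>lborel)"
      by (intro mult_right_mono ennreal_leI) (auto simp: C_def)
    finally show "(\<integral>\<^sup>+x. \<Phi> (sqf \<alpha> f x) \<partial>lborel) \<le> ennreal C * (\<integral>\<^sup>+x. \<Phi> (norm (f x)) \<partial>lborel)"
      by (simp add: mult_left_mono)
  qed
qed

end

section \<open>Generalised inverse and Luxemburg norm\<close>

lemma mono_ennreal_borel:
  fixes g :: "real \<Rightarrow> ennreal"
  assumes "mono g" shows "g \<in> borel_measurable borel"
proof (rule borel_measurableI_greater)
  fix y
  have "is_interval {x. y < g x}"
    unfolding is_interval_1 using assms by (auto simp: mono_def intro: less_le_trans)
  then show "{x \<in> space borel. y < g x} \<in> sets borel" by (simp add: real_interval_borel_measurable)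
qed

context young_types
begin

definition ginv :: "real \<Rightarrow> real" where "ginv s = enn2real (gen_inverse \<Phi> s)"

lemma gen_inverse_eq: "gen_inverse \<Phi> s = ennreal (ginv s)"
proof -
  have "\<forall>\<^sub>F x in at_top. ennreal s < \<Phi> x" using at_top by (rule order_tendstoD) simp
  then obtain x where x: "\<And>y. y \<ge> x \<Longrightarrow> ennreal s < \<Phi> y" by (auto simp: eventually_at_top_linorder)
  have "gen_inverse \<Phi> s \<le> ennreal (max 0 x)"
    unfolding gen_inverse_def using x by (intro INF_lower) auto
  then have "gen_inverse \<Phi> s < top" by (rule order_le_less_trans) simp
  then show ?thesis by (simp add: ginv_def)
qed

lemma inv_nonneg [simp]: "0 \<le> ginv s"
  by (simp add: ginv_def)

lemma inv_le: "0 \<le> r \<Longrightarrow> ennreal s < \<Phi> r \<Longrightarrow> ginv s \<le> r"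
proof -
  assume r: "0 \<le> r" "ennreal s < \<Phi> r"
  have "gen_inverse \<Phi> s \<le> ennreal r" unfolding gen_inverse_def using r by (intro INF_lower) auto
  then show "ginv s \<le> r" using r by (simp add: gen_inverse_eq ennreal_le_iff)
qed

lemma less_inv: assumes "0 \<le> r" "r < ginv s" shows "\<Phi> r \<le> ennreal s"
  using inv_le[OF assms(1), of s] assms(2) by (cases "\<Phi> r \<le> ennreal s") (auto simp: not_le)

lemma inv_less: assumes "ginv s < r" shows "ennreal s < \<Phi> r"
proof -
  have "gen_inverse \<Phi> s < ennreal r" using assms by (simp add: gen_inverse_eq ennreal_lessI order_le_less_trans[OF inv_nonneg])
  then obtain r' where "0 \<le> r'" "ennreal s < \<Phi> r'" "ennreal r' < ennreal r"
    unfolding gen_inverse_def by (auto simp: INF_less_iff)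
  then show ?thesis using mono[of r' r] by (auto simp: ennreal_less_iff intro: less_le_trans)
qed

lemma inv_geI:
  assumes "\<And>r. 0 \<le> r \<Longrightarrow> ennreal s < \<Phi> r \<Longrightarrow> c \<le> r" shows "c \<le> ginv s"
proof (rule ccontr)
  assume "\<not> c \<le> ginv s"
  have "ginv s < (c + ginv s) / 2" "(c + ginv s) / 2 < c" using \<open>\<not> c \<le> ginv s\<close> by auto
  moreover from this have "c \<le> (c + ginv s) / 2"
    by (intro assms inv_less) (use inv_nonneg[of s] in linarith)+
  ultimately show False by simp
qed

lemma inv_pos: assumes "0 < s" shows "0 < ginv s"
proof -
  have "\<forall>\<^sub>F x in at_right 0. \<Phi> x < ennreal s" by (intro order_tendstoD(2)[OF at_0(2)]) (use assms in \<open>simp add: ennreal_less_iff flip: ennreal_0\<close>)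
  then obtain d where d: "0 < d" "\<And>x. 0 < x \<Longrightarrow> x < d \<Longrightarrow> \<Phi> x < ennreal s" by (auto simp: eventually_at_right_field)
  have "d / 2 \<le> ginv s"
  proof (rule inv_geI)
    fix r assume "0 \<le> r" "ennreal s < \<Phi> r"
    then show "d / 2 \<le> r" using mono[of r "d / 2"] d(1) d(2)[of "d / 2"] by (cases "r < d / 2") auto
  qed
  then show ?thesis using d by simp
qed

lemma inv_mono: assumes "s \<le> s'" shows "ginv s \<le> ginv s'"
  by (rule inv_geI, rule inv_le) (use ennreal_leI[OF assms] in \<open>auto intro: le_less_trans\<close>)

text \<open>Convexity with \<open>\<Phi> 0 = 0\<close>, transferred to the inverse, which therefore
  shrinks at most linearly. The doubling of \<open>R\<close> and the comparison of normalisations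
  both come from here.\<close>

lemma inv_scale: assumes "0 < \<theta>" "\<theta> \<le> 1" "0 \<le> s" shows "\<theta> * ginv s \<le> ginv (\<theta> * s)"
proof (rule inv_geI)
  fix r assume r: "0 \<le> r" "ennreal (\<theta> * s) < \<Phi> r"
  have "\<Phi> r = \<Phi> (\<theta> * (r / \<theta>))" using assms by simp
  also have "\<dots> \<le> ennreal \<theta> * \<Phi> (r / \<theta>)" using assms r by (intro scale_le) auto
  finally have "ennreal \<theta> * ennreal s < ennreal \<theta> * \<Phi> (r / \<theta>)"
    using r(2) assms by (simp add: ennreal_mult less_le_trans)
  then have "ennreal s < \<Phi> (r / \<theta>)" by (meson mult_left_mono not_le zero_le)
  then have "ginv s \<le> r / \<theta>" using r assms by (intro inv_le) auto
  then show "\<theta> * ginv s \<le> r" using assms by (simp add: field_simps)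
qed

text \<open>All values to the left of \<open>ginv s\<close> are at most \<open>s\<close>, and
  left-continuity passes this to the point itself.\<close>

lemma Phi_inv_le: assumes "0 < s" shows "\<Phi> (ginv s) \<le> ennreal s"
proof (rule tendsto_upperbound[OF left_cont[OF inv_pos[OF assms]]])
  show "\<forall>\<^sub>F x in at_left (ginv s). \<Phi> x \<le> ennreal s"
    unfolding eventually_at_left_field using inv_pos[OF assms] less_inv[of _ s]
    by (intro exI[of _ 0]) auto
qed simp

lemma inv_borel: "ginv \<in> borel_measurable borel"
  by (rule borel_measurable_mono) (simp add: mono_def inv_mono)

text \<open>For \<open>r > 0\<close> this is the inverse at \<open>r^-n\<close>: up to constants the
  reciprocal of the Luxemburg norm of the indicator of a ball of radius \<open>r\<close>.\<close>

abbreviation R :: "'a::euclidean_space itself \<Rightarrow> real \<Rightarrow> real" where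
  "R _ r \<equiv> ginv (1 / r ^ DIM('a))"

lemma R_pos: "0 < r \<Longrightarrow> 0 < R TYPE('a::euclidean_space) r"
  by (rule inv_pos) simp

lemma R_antimono: "0 < r \<Longrightarrow> r \<le> s \<Longrightarrow> R TYPE('a::euclidean_space) s \<le> R TYPE('a) r"
  by (intro inv_mono divide_left_mono power_mono) auto

lemma R_doubling: "0 < r \<Longrightarrow> R TYPE('a::euclidean_space) r \<le> 4 ^ DIM('a) * R TYPE('a) (4 * r)"
  using inv_scale[of "1 / 4 ^ DIM('a)" "1 / r ^ DIM('a)"] by (simp add: power_mult_distrib field_simps)

text \<open>Estimates over a ball involve the inverse at \<open>1 / |B|\<close>, whereas the Morrey
  norm uses it at \<open>1 / r ^ n\<close>. The two arguments differ by the fixed factor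
  \<open>w\<close>, and by \<open>inv_scale\<close> so do the values up to a constant.\<close>

lemma inv_volume_compare:
  assumes w: "0 < w" and s: "0 < s"
  shows "ginv (1 / (w * s)) \<le> max 1 (1 / w) * ginv (1 / s)" "ginv (1 / s) \<le> max 1 w * ginv (1 / (w * s))"
proof -
  show "ginv (1 / (w * s)) \<le> max 1 (1 / w) * ginv (1 / s)"
  proof (cases "1 \<le> w")
    case True
    then have "ginv (1 / (w * s)) \<le> ginv (1 / s)" using s by (intro inv_mono) (simp add: field_simps)
    then show ?thesis using True w by simp
  next
    case False
    then show ?thesis using inv_scale[of w "1 / (w * s)"] w s by (simp add: max_def field_simps)
  qed
  show "ginv (1 / s) \<le> max 1 w * ginv (1 / (w * s))"
  proof (cases "w \<le> 1")
    case True
    then have "ginv (1 / s) \<le> ginv (1 / (w * s))" using s w by (intro inv_mono) (simp add: field_simps)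
    then show ?thesis using True w by simp
  next
    case False
    then show ?thesis using inv_scale[of "1 / w" "1 / s"] w s by (simp add: max_def field_simps)
  qed
qed

section \<open>Luxemburg norms and integrals over balls\<close>

lemma luxemburg_le:
  assumes "0 < l" "(\<integral>\<^sup>+x. \<Phi> (norm (f x) / l) \<partial>lborel) \<le> 1"
  shows "luxemburg_norm \<Phi> f \<le> ennreal l"
  unfolding luxemburg_norm_def nn_integral_completion using assms by (intro INF_lower) auto

text \<open>It suffices to test admissible \<open>l\<close>. Dividing by \<open>K\<close> first
  permits a direct appeal to the infimum, also when no \<open>l\<close> is admissible and the norm
  is infinite.\<close>

lemma le_luxemburg:
  assumes K: "0 < K" and le: "\<And>l. 0 < l \<Longrightarrow> (\<integral>\<^sup>+x. \<Phi> (norm (f x) / l) \<partial>lborel) \<le> 1 \<Longrightarrow> X \<le> ennreal (K * l)"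
  shows "X \<le> ennreal K * luxemburg_norm \<Phi> f"
proof -
  have "ennreal (1 / K) * X \<le> luxemburg_norm \<Phi> f"
    unfolding luxemburg_norm_def nn_integral_completion
  proof (rule INF_greatest)
    fix l assume l: "l \<in> {l. 0 < l \<and> (\<integral>\<^sup>+x. \<Phi> (norm (f x) / l) \<partial>lborel) \<le> 1}"
    then have "ennreal (1 / K) * X \<le> ennreal (1 / K) * ennreal (K * l)" by (intro mult_left_mono le) auto
    also have "\<dots> = ennreal l" using K l by (simp flip: ennreal_mult)
    finally show "ennreal (1 / K) * X \<le> ennreal l" .
  qed
  then have "ennreal K * (ennreal (1 / K) * X) \<le> ennreal K * luxemburg_norm \<Phi> f" by (rule mult_left_mono) simp
  moreover have "ennreal K * (ennreal (1 / K) * X) = X" using K by (simp flip: mult.assoc ennreal_mult)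
  ultimately show ?thesis by simp
qed

lemma luxemburg_on_mono:
  fixes f :: "'a::euclidean_space \<Rightarrow> 'b::{banach, second_countable_topology}"
  assumes "S \<subseteq> T"
  shows "luxemburg_norm_on \<Phi> S f \<le> luxemburg_norm_on \<Phi> T f"
proof -
  have "luxemburg_norm \<Phi> (\<lambda>x. indicator S x *\<^sub>R f x) \<le> ennreal 1 * luxemburg_norm \<Phi> (\<lambda>x. indicator T x *\<^sub>R f x)"
  proof (rule le_luxemburg)
    fix l :: real assume l: "0 < l" "(\<integral>\<^sup>+x. \<Phi> (norm (indicator T x *\<^sub>R f x) / l) \<partial>lborel) \<le> 1"
    have le: "(\<integral>\<^sup>+x. \<Phi> (norm (indicator S x *\<^sub>R f x) / l) \<partial>lborel) \<le> (\<integral>\<^sup>+x. \<Phi> (norm (indicator T x *\<^sub>R f x) / l) \<partial>lborel)"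
      using assms l by (intro nn_integral_mono mono) (auto simp: indicator_def)
    show "luxemburg_norm \<Phi> (\<lambda>x. indicator S x *\<^sub>R f x) \<le> ennreal (1 * l)"
      using luxemburg_le[OF l(1) order_trans[OF le l(2)]] by simp
  qed simp
  then show ?thesis by (simp add: luxemburg_norm_on_def)
qed

text \<open>Integrate the pointwise inequality
  \<open>a \<le> 2 \<rho> + 2 \<rho> |B| \<Phi> a\<close> with \<open>\<rho>\<close> the generalised inverse at \<open>1 / |B|\<close>.\<close>

lemma nn_integral_ball_le_luxemburg:
  fixes f :: "'a::euclidean_space \<Rightarrow> 'b::euclidean_space"
  assumes f[measurable]: "f \<in> borel_measurable borel" and r: "0 < r"
  shows "(\<integral>\<^sup>+z\<in>ball x r. ennreal (norm (f z)) \<partial>lborel) \<le>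
    ennreal (4 * (unit_ball_vol DIM('a) * r ^ DIM('a)) * ginv (1 / (unit_ball_vol DIM('a) * r ^ DIM('a)))) * luxemburg_norm_on \<Phi> (ball x r) f"
proof -
  define v where "v = unit_ball_vol DIM('a) * r ^ DIM('a)"
  have v: "0 < v" "emeasure lborel (ball x r) = ennreal v" using r by (simp_all add: v_def emeasure_ball)
  define \<rho> where "\<rho> = ginv (1 / v)"
  have \<rho>: "0 < \<rho>" using v by (simp add: \<rho>_def inv_pos)
  have pt: "ennreal a \<le> ennreal (2 * \<rho>) + ennreal (2 * \<rho> * v) * \<Phi> a" if "0 \<le> a" for a
  proof (cases "a \<le> 2 * \<rho>")
    case True
    then show ?thesis by (intro add_increasing2 ennreal_leI) auto
  next
    case False
    then have a: "0 < a" using \<rho> by simp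
    \<comment> \<open>The point \<open>2 * \<rho>\<close> lies strictly above the generalised
      inverse, so \<open>\<Phi>\<close> exceeds \<open>1 / v\<close> there; convexity then compares
      \<open>2 * \<rho>\<close> with the larger \<open>a\<close>.\<close>
    have "ennreal (1 / v) \<le> \<Phi> (2 * \<rho>)" using inv_less[of "1 / v" "2 * \<rho>"] \<rho> by (simp add: \<rho>_def)
    also have "\<dots> = \<Phi> (2 * \<rho> / a * a)" using a by simp
    also have "\<dots> \<le> ennreal (2 * \<rho> / a) * \<Phi> a" using False a \<rho> by (intro scale_le) auto
    finally have "ennreal (v * a) * ennreal (1 / v) \<le> ennreal (v * a) * (ennreal (2 * \<rho> / a) * \<Phi> a)" by (rule mult_left_mono) simp
    moreover have "ennreal (v * a) * ennreal (1 / v) = ennreal a" using v a by (simp flip: ennreal_mult)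
    moreover have "ennreal (v * a) * (ennreal (2 * \<rho> / a) * \<Phi> a) = ennreal (2 * \<rho> * v) * \<Phi> a"
    proof -
      have "ennreal (v * a) * ennreal (2 * \<rho> / a) = ennreal (2 * \<rho> * v)" using v a \<rho> by (simp add: mult_ac flip: ennreal_mult)
      then show ?thesis by (simp only: mult.assoc[symmetric])
    qed
    ultimately show ?thesis by (simp add: add_increasing)
  qed
  have "(\<integral>\<^sup>+z\<in>ball x r. ennreal (norm (f z)) \<partial>lborel) \<le> ennreal (4 * v * \<rho>) * luxemburg_norm \<Phi> (\<lambda>z. indicator (ball x r) z *\<^sub>R f z)"
  proof (rule le_luxemburg)
    show "0 < 4 * v * \<rho>" using v \<rho> by simp
    fix l :: real assume l: "0 < l" "(\<integral>\<^sup>+z. \<Phi> (norm (indicator (ball x r) z *\<^sub>R f z) / l) \<partial>lborel) \<le> 1"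
    have m: "(\<lambda>z. \<Phi> (norm (indicator (ball x r) z *\<^sub>R f z) / l)) \<in> borel_measurable lborel"
      using l by (intro borel_comp borel_measurable_divide measurable_compose[OF _ borel_measurable_norm] borel_measurable_scaleR borel_measurable_indicator) auto
    have "(\<integral>\<^sup>+z\<in>ball x r. ennreal (norm (f z)) \<partial>lborel) \<le>
      (\<integral>\<^sup>+z. ennreal l * (ennreal (2 * \<rho>) * indicator (ball x r) z + ennreal (2 * \<rho> * v) * \<Phi> (norm (indicator (ball x r) z *\<^sub>R f z) / l)) \<partial>lborel)"
    proof (rule nn_integral_mono)
      fix z
      show "ennreal (norm (f z)) * indicator (ball x r) z \<le>
        ennreal l * (ennreal (2 * \<rho>) * indicator (ball x r) z + ennreal (2 * \<rho> * v) * \<Phi> (norm (indicator (ball x r) z *\<^sub>R f z) / l))"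
      proof (cases "z \<in> ball x r")
        case True
        have "ennreal (norm (f z)) = ennreal l * ennreal (norm (f z) / l)" using l by (simp flip: ennreal_mult)
        also have "\<dots> \<le> ennreal l * (ennreal (2 * \<rho>) + ennreal (2 * \<rho> * v) * \<Phi> (norm (f z) / l))"
          using l by (intro mult_left_mono pt) auto
        finally show ?thesis using True by simp
      qed simp
    qed
    also have "\<dots> = ennreal l * (ennreal (2 * \<rho>) * ennreal v + ennreal (2 * \<rho> * v) * (\<integral>\<^sup>+z. \<Phi> (norm (indicator (ball x r) z *\<^sub>R f z) / l) \<partial>lborel))"
    proof -
      have i: "(\<lambda>z. ennreal (2 * \<rho>) * indicator (ball x r) z) \<in> borel_measurable lborel"
        by (intro borel_measurable_times_ennreal borel_measurable_indicator) auto
      have "(\<integral>\<^sup>+z. ennreal (2 * \<rho>) * indicator (ball x r) z \<partial>lborel) = ennreal (2 * \<rho>) * ennreal v"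
        unfolding v(2)[symmetric] by (rule nn_integral_cmult_indicator) simp
      then show ?thesis using i m by (simp add: nn_integral_cmult nn_integral_add)
    qed
    also have "\<dots> \<le> ennreal l * (ennreal (2 * \<rho>) * ennreal v + ennreal (2 * \<rho> * v) * 1)"
      by (intro mult_left_mono add_left_mono l(2)) auto
    also have "\<dots> = ennreal (4 * v * \<rho> * l)" using v \<rho> l by (simp add: algebra_simps flip: ennreal_mult ennreal_plus)
    finally show "(\<integral>\<^sup>+z\<in>ball x r. ennreal (norm (f z)) \<partial>lborel) \<le> ennreal (4 * v * \<rho> * l)" .
  qed
  then show ?thesis by (simp add: v_def \<rho>_def luxemburg_norm_on_def)
qed

lemma nn_integral_ball_le_R:
  fixes f :: "'a::euclidean_space \<Rightarrow> 'b::euclidean_space"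
  assumes f: "f \<in> borel_measurable borel" and r: "0 < r"
  shows "(\<integral>\<^sup>+z\<in>ball x r. ennreal (norm (f z)) \<partial>lborel) \<le>
    ennreal (4 * max 1 (unit_ball_vol DIM('a)) * r ^ DIM('a) * R TYPE('a) r) * luxemburg_norm_on \<Phi> (ball x r) f"
proof (rule order_trans[OF nn_integral_ball_le_luxemburg[OF f r]], intro mult_right_mono ennreal_leI)
  define w where "w = unit_ball_vol DIM('a)"
  have w: "0 < w" by (simp add: w_def)
  have "4 * (w * r ^ DIM('a)) * ginv (1 / (w * r ^ DIM('a))) \<le> 4 * (w * r ^ DIM('a)) * (max 1 (1 / w) * R TYPE('a) r)"
    using w r by (intro mult_left_mono inv_volume_compare(1)) auto
  also have "\<dots> = 4 * (w * max 1 (1 / w)) * r ^ DIM('a) * R TYPE('a) r" by (simp only: mult_ac)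
  also have "w * max 1 (1 / w) = max 1 w" using w by (simp add: max_def field_simps)
  finally show "4 * (unit_ball_vol DIM('a) * r ^ DIM('a)) * ginv (1 / (unit_ball_vol DIM('a) * r ^ DIM('a)))
    \<le> 4 * max 1 (unit_ball_vol DIM('a)) * r ^ DIM('a) * R TYPE('a) r" by (simp add: w_def)
qed simp

end

section \<open>Local estimates\<close>

text \<open>A ball \<open>ball y t\<close> with \<open>|x - y| < t\<close> reaches beyond
  \<open>ball x0 (2 * r)\<close> only if \<open>t > r / 2\<close>, and is then inside
  \<open>ball x0 (4 * t)\<close>. So \<open>A_fun\<close> is at most \<open>t^-n\<close> times the
  mass of \<open>f\<close> on \<open>ball x0 (4 * t)\<close>, a function of \<open>t\<close> alone.
  The substitution \<open>s = 4 * t\<close> maps \<open>t \<ge> r / 2\<close> to the range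
  \<open>s \<ge> 2 * r\<close> of \<open>I\<close>.\<close>

lemma Gsq_far_le:
  fixes f :: "'a::euclidean_space \<Rightarrow> 'b::euclidean_space"
  assumes \<alpha>: "0 < \<alpha>" and f: "locint f" and x: "x \<in> ball x0 r" and r: "0 < r"
  defines "I \<equiv> \<integral>\<^sup>+s\<in>{2 * r..}. (\<integral>\<^sup>+z\<in>ball x0 s. ennreal (norm (f z)) \<partial>lborel) * ennreal (1 / s ^ (DIM('a) + 1)) \<partial>lborel"
  shows "Gsq \<alpha> (\<lambda>z. indicator (- ball x0 (2 * r)) z *\<^sub>R f z) x \<le>
    ennreal (unit_ball_vol DIM('a) * (2 * 8 ^ DIM('a) * 4 ^ DIM('a))) * I\<^sup>2"
proof -
  define h where "h s = (\<integral>\<^sup>+z\<in>ball x0 s. ennreal (norm (f z)) \<partial>lborel)" for s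
  have hmono: "mono h"
    unfolding h_def by (intro monoI nn_integral_mono mult_left_mono) (auto simp: indicator_def)
  have [measurable]: "h \<in> borel_measurable borel" by (rule mono_ennreal_borel[OF hmono])
  define F where "F s = h s * ennreal (1 / s ^ (DIM('a) + 1)) * indicator {2 * r..} s" for s
  have Fm[measurable]: "F \<in> borel_measurable borel" unfolding F_def by measurable
  have I: "I = (\<integral>\<^sup>+s. F s \<partial>lborel)" by (simp add: I_def F_def h_def)
  define H where "H t = indicator {r/2..} t * (ennreal (1 / t ^ DIM('a)) * h (4 * t))" for t
  have Hm: "H \<in> borel_measurable borel" unfolding H_def by measurable
  \<comment> \<open>As the mass \<open>h\<close> increases, its value at \<open>4 * t\<close> is
    controlled by the part of \<open>I\<close> over the interval from \<open>4 * t\<close> to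
    \<open>8 * t\<close>, which lies in the range of integration.\<close>
  have HS: "H t \<le> ennreal (2 * 8 ^ DIM('a)) * I" for t
  proof (cases "r / 2 \<le> t")
    case True
    then have t: "0 < t" using r by simp
    have "ennreal (1 / t ^ DIM('a)) * h (4 * t) = ennreal (2 * 8 ^ DIM('a)) * (h (4 * t) * ennreal (1 / (8 * t) ^ (DIM('a) + 1)) * ennreal (4 * t))"
    proof -
      have "ennreal (2 * 8 ^ DIM('a)) * (ennreal (1 / (8 * t) ^ (DIM('a) + 1)) * ennreal (4 * t)) = ennreal (2 * 8 ^ DIM('a) * (1 / (8 * t) ^ (DIM('a) + 1) * (4 * t)))"
        using t by (simp del: power_Suc flip: ennreal_mult)
      also have "2 * 8 ^ DIM('a) * (1 / (8 * t) ^ (DIM('a) + 1) * (4 * t)) = 1 / t ^ DIM('a)"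
        using t by (simp add: power_mult_distrib)
      finally have e: "ennreal (2 * 8 ^ DIM('a)) * (ennreal (1 / (8 * t) ^ (DIM('a) + 1)) * ennreal (4 * t)) = ennreal (1 / t ^ DIM('a))" .
      show ?thesis unfolding e[symmetric] by (simp only: mult_ac)
    qed
    also have "h (4 * t) * ennreal (1 / (8 * t) ^ (DIM('a) + 1)) * ennreal (4 * t) = (\<integral>\<^sup>+s. h (4 * t) * ennreal (1 / (8 * t) ^ (DIM('a) + 1)) * indicator {4 * t..8 * t} s \<partial>lborel)"
      using t by (subst nn_integral_cmult_indicator) simp_all
    also have "\<dots> \<le> I"
      unfolding I
    proof (rule nn_integral_mono)
      fix s
      show "h (4 * t) * ennreal (1 / (8 * t) ^ (DIM('a) + 1)) * indicator {4 * t..8 * t} s \<le> F s"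
      proof (cases "s \<in> {4 * t..8 * t}")
        case s: True
        then have "h (4 * t) * ennreal (1 / (8 * t) ^ (DIM('a) + 1)) \<le> h s * ennreal (1 / s ^ (DIM('a) + 1))"
          using t hmono by (intro mult_mono ennreal_leI divide_left_mono power_mono) (auto simp: mono_def)
        then show ?thesis using s True by (simp add: F_def)
      qed simp
    qed
    finally show ?thesis using True by (simp add: H_def mult_left_mono)
  qed (simp add: H_def)
  have A: "A_fun \<alpha> (\<lambda>z. indicator (- ball x0 (2 * r)) z *\<^sub>R f z) t y \<le> H t" if t: "0 < t" "dist x y < t" for t y
  proof -
    have a1: "A_fun \<alpha> (\<lambda>z. indicator (- ball x0 (2 * r)) z *\<^sub>R f z) t y \<le> ennreal (1 / t ^ DIM('a)) *
      (\<integral>\<^sup>+z\<in>ball y t. ennreal (norm (indicator (- ball x0 (2 * r)) z *\<^sub>R f z)) \<partial>lborel)"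
      by (intro A_fun_le \<alpha> t locint_indicator f) auto
    have "(\<integral>\<^sup>+z\<in>ball y t. ennreal (norm (indicator (- ball x0 (2 * r)) z *\<^sub>R f z)) \<partial>lborel) \<le> (\<integral>\<^sup>+z. indicator {r/2..} t * (ennreal (norm (f z)) * indicator (ball x0 (4 * t)) z) \<partial>lborel)"
    proof (rule nn_integral_mono)
      fix z
      show "ennreal (norm (indicator (- ball x0 (2 * r)) z *\<^sub>R f z)) * indicator (ball y t) z \<le> indicator {r/2..} t * (ennreal (norm (f z)) * indicator (ball x0 (4 * t)) z)"
      proof (cases "z \<in> ball y t \<and> z \<notin> ball x0 (2 * r)")
        case True
        have "dist x0 z \<le> dist x0 x + dist x y + dist y z"
          using dist_triangle[of x0 z x] dist_triangle[of x z y] by simp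
        then have "dist x0 z < r + 2 * t" using x t True by simp
        then have "r / 2 \<le> t" "z \<in> ball x0 (4 * t)" using True by auto
        then show ?thesis using True by simp
      qed auto
    qed
    also have "\<dots> = indicator {r/2..} t * h (4 * t)"
      unfolding h_def using locint_measurable[OF f] by (cases "t \<in> {r/2..}") simp_all
    finally have a2: "(\<integral>\<^sup>+z\<in>ball y t. ennreal (norm (indicator (- ball x0 (2 * r)) z *\<^sub>R f z)) \<partial>lborel) \<le> indicator {r/2..} t * h (4 * t)" .
    have "H t = ennreal (1 / t ^ DIM('a)) * (indicator {r/2..} t * h (4 * t))" by (simp only: H_def mult_ac)
    then show ?thesis using order_trans[OF a1 mult_left_mono[OF a2 zero_le]] by simp
  qed
  have "(\<integral>\<^sup>+t\<in>{0<..}. H t * ennreal (1 / t) \<partial>lborel) \<le> (\<integral>\<^sup>+t. ennreal (4 ^ DIM('a)) * (4 * F (0 + 4 * t)) \<partial>lborel)"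
  proof (rule nn_integral_mono)
    fix t :: real
    show "H t * ennreal (1 / t) * indicator {0<..} t \<le> ennreal (4 ^ DIM('a)) * (4 * F (0 + 4 * t))"
    proof (cases "r / 2 \<le> t")
      case True
      then have t: "0 < t" using r by simp
      have "ennreal (4 ^ DIM('a)) * (4 * ennreal (1 / (4 * t) ^ (DIM('a) + 1))) = ennreal (4 ^ DIM('a) * (4 * (1 / (4 * t) ^ (DIM('a) + 1))))"
      proof -
        have "ennreal (4 * y) = 4 * ennreal y" "ennreal (4 ^ DIM('a) * y) = ennreal (4 ^ DIM('a)) * ennreal y" if "0 \<le> y" for y
          using that by (simp_all add: ennreal_mult)
        note e = this
        have y: "0 \<le> 1 / (4 * t) ^ (DIM('a) + 1)" using t by simp
        then have "0 \<le> 4 * (1 / (4 * t) ^ (DIM('a) + 1))" by (rule mult_nonneg_nonneg[rotated]) simp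
        from e(2)[OF this] show ?thesis unfolding e(1)[OF y] ..
      qed
      also have "4 ^ DIM('a) * (4 * (1 / (4 * t) ^ (DIM('a) + 1))) = 1 / t ^ DIM('a) * (1 / t)"
        using t by (simp add: power_mult_distrib)
      also have "ennreal \<dots> = ennreal (1 / t ^ DIM('a)) * ennreal (1 / t)" using t by (intro ennreal_mult) auto
      finally have e: "ennreal (1 / t ^ DIM('a)) * ennreal (1 / t) = ennreal (4 ^ DIM('a)) * (4 * ennreal (1 / (4 * t) ^ (DIM('a) + 1)))" ..
      have "H t * ennreal (1 / t) = h (4 * t) * (ennreal (1 / t ^ DIM('a)) * ennreal (1 / t))" using True by (simp add: H_def mult_ac)
      also have "\<dots> = ennreal (4 ^ DIM('a)) * (4 * F (0 + 4 * t))" unfolding e using True by (simp add: F_def mult_ac)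
      finally show ?thesis using t by simp
    qed (simp add: H_def)
  qed
  also have "\<dots> = ennreal (4 ^ DIM('a)) * (4 * (\<integral>\<^sup>+t. F (0 + 4 * t) \<partial>lborel))"
    by (simp add: nn_integral_cmult)
  also have "4 * (\<integral>\<^sup>+t. F (0 + 4 * t) \<partial>lborel) = I"
    unfolding I using nn_integral_real_affine[OF Fm, of 4 0] by simp
  finally have HI: "(\<integral>\<^sup>+t\<in>{0<..}. H t * ennreal (1 / t) \<partial>lborel) \<le> ennreal (4 ^ DIM('a)) * I" .
  have "Gsq \<alpha> (\<lambda>z. indicator (- ball x0 (2 * r)) z *\<^sub>R f z) x \<le>
    ennreal (unit_ball_vol DIM('a)) * (ennreal (2 * 8 ^ DIM('a)) * I) * (\<integral>\<^sup>+t\<in>{0<..}. H t * ennreal (1 / t) \<partial>lborel)"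
    by (rule Gsq_le_of_A_fun_bound[OF Hm HS A])
  also have "\<dots> \<le> ennreal (unit_ball_vol DIM('a)) * (ennreal (2 * 8 ^ DIM('a)) * I) * (ennreal (4 ^ DIM('a)) * I)"
    by (intro mult_left_mono HI) simp
  also have "\<dots> = (ennreal (unit_ball_vol DIM('a)) * (ennreal (2 * 8 ^ DIM('a)) * ennreal (4 ^ DIM('a)))) * I\<^sup>2"
    by (simp only: power2_eq_square mult_ac)
  also have "ennreal (unit_ball_vol DIM('a)) * (ennreal (2 * 8 ^ DIM('a)) * ennreal (4 ^ DIM('a))) = ennreal (unit_ball_vol DIM('a) * (2 * 8 ^ DIM('a) * 4 ^ DIM('a)))"
    by (subst ennreal_mult[symmetric], simp, simp, subst ennreal_mult[symmetric], auto)
  finally show ?thesis .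
qed

text \<open>The condition \<open>fin\<close> guards against the convention that
  \<open>enn2real\<close> sends infinity to 0: otherwise \<open>sqf \<alpha> g x\<close> could
  vanish while \<open>Gsq \<alpha> g x\<close> is infinite.\<close>

lemma sqf_add_le:
  fixes g h :: "'a::euclidean_space \<Rightarrow> 'b::euclidean_space"
  assumes \<alpha>: "0 < \<alpha>" and g: "locint g" and h: "locint h" and fin: "Gsq \<alpha> g x < \<infinity>"
    and c: "Gsq \<alpha> h x \<le> ennreal (c\<^sup>2)" "0 \<le> c"
  shows "Gsq \<alpha> (\<lambda>z. g z + h z) x < \<infinity>" "sqf \<alpha> (\<lambda>z. g z + h z) x \<le> 2 * sqf \<alpha> g x + 2 * c"
proof -
  obtain a where a: "Gsq \<alpha> g x = ennreal a" "0 \<le> a" using fin by (cases "Gsq \<alpha> g x") auto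
  have "Gsq \<alpha> (\<lambda>z. g z + h z) x \<le> 2 * Gsq \<alpha> g x + 2 * Gsq \<alpha> h x" by (rule Gsq_add_le[OF \<alpha> g h])
  also have "\<dots> \<le> 2 * ennreal a + 2 * ennreal (c\<^sup>2)" unfolding a using c by (intro add_mono mult_left_mono) auto
  also have "\<dots> = ennreal (2 * a + 2 * c\<^sup>2)" using a by (simp add: ennreal_mult)
  finally have le: "Gsq \<alpha> (\<lambda>z. g z + h z) x \<le> ennreal (2 * a + 2 * c\<^sup>2)" .
  then show "Gsq \<alpha> (\<lambda>z. g z + h z) x < \<infinity>" by (simp add: order_le_less_trans)
  have "enn2real (Gsq \<alpha> (\<lambda>z. g z + h z) x) \<le> 2 * a + 2 * c\<^sup>2"
    using enn2real_mono[OF le] a by (simp del: ennreal_plus)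
  also have "\<dots> \<le> (2 * sqrt a + 2 * c)\<^sup>2"
  proof -
    have "0 \<le> sqrt a * c" using a c by simp
    then show ?thesis using a by (simp add: power2_sum power_mult_distrib)
  qed
  finally have "sqrt (enn2real (Gsq \<alpha> (\<lambda>z. g z + h z) x)) \<le> sqrt ((2 * sqrt a + 2 * c)\<^sup>2)" by (rule real_sqrt_le_mono)
  then show "sqf \<alpha> (\<lambda>z. g z + h z) x \<le> 2 * sqf \<alpha> g x + 2 * c" using a c by (simp add: sqf_def)
qed

text \<open>Let the level tend to infinity in the weak type (1, 1) estimate.\<close>

lemma AE_Gsq_finite:
  fixes f :: "'a::euclidean_space \<Rightarrow> 'b::euclidean_space"
  assumes \<alpha>: "0 < \<alpha>" and f: "integrable lborel f"
  shows "AE x in lborel. Gsq \<alpha> f x < \<infinity>"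
proof -
  obtain C1 where C1: "0 < C1" "\<And>(f :: 'a \<Rightarrow> 'b) l. integrable lborel f \<Longrightarrow> 0 < l \<Longrightarrow>
    emeasure lborel {x. ennreal (l\<^sup>2) < Gsq \<alpha> f x} \<le> ennreal (C1 / l) * (\<integral>\<^sup>+z. ennreal (norm (f z)) \<partial>lborel)"
    using Gsq_weak_type_one[OF \<alpha>] by blast
  note [measurable] = Gsq_borel[OF \<alpha> integrable_imp_locint[OF f]]
  obtain F where F: "(\<integral>\<^sup>+z. ennreal (norm (f z)) \<partial>lborel) = ennreal F" "0 \<le> F"
    using f by (cases "\<integral>\<^sup>+z. ennreal (norm (f z)) \<partial>lborel") (auto simp: integrable_iff_bounded)
  have "emeasure lborel {x. Gsq \<alpha> f x = \<infinity>} \<le> 0"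
  proof (rule ennreal_le_epsilon)
    fix e :: real assume e: "0 < e"
    \<comment> \<open>\<open>F + 1\<close> in place of \<open>F\<close> keeps the level positive
      when \<open>f\<close> vanishes almost everywhere.\<close>
    define l where "l = C1 * (F + 1) / e"
    have l: "0 < l" using C1 F e by (simp add: l_def)
    have "emeasure lborel {x. Gsq \<alpha> f x = \<infinity>} \<le> emeasure lborel {x. ennreal (l\<^sup>2) < Gsq \<alpha> f x}"
      by (intro emeasure_mono) auto
    also have "\<dots> \<le> ennreal (C1 / l) * ennreal F" using C1(2)[OF f l] by (simp add: F)
    also have "\<dots> = ennreal (C1 / l * F)" using C1 l F by (simp flip: ennreal_mult)
    also have "\<dots> \<le> ennreal e"
    proof (rule ennreal_leI)
      have "C1 / l = e / (F + 1)" using C1 F e by (simp add: l_def)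
      then have "C1 / l * F = e * (F / (F + 1))" by simp
      also have "\<dots> \<le> e * 1" using F e by (intro mult_left_mono) auto
      finally show "C1 / l * F \<le> e" by simp
    qed
    finally show "emeasure lborel {x. Gsq \<alpha> f x = \<infinity>} \<le> 0 + ennreal e" by simp
  qed
  then have "{x. Gsq \<alpha> f x = \<infinity>} \<in> null_sets lborel" by (auto simp: null_sets_def)
  from AE_not_in[OF this] show ?thesis by eventually_elim (simp add: less_top)
qed

lemma sqf_scale:
  fixes f :: "'a::euclidean_space \<Rightarrow> 'b::euclidean_space"
  assumes "0 < \<alpha>" "locint f" "0 < c"
  shows "sqf \<alpha> (\<lambda>z. c *\<^sub>R f z) x = c * sqf \<alpha> f x"
  unfolding sqf_def Gsq_scale[OF assms] using assms(3) by (simp add: enn2real_mult real_sqrt_mult)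

lemma sqf_nonneg [simp]: "0 \<le> sqf \<alpha> f x" by (simp add: sqf_def)

lemma sqf_borel:
  assumes "0 < \<alpha>" "locint (f :: 'a::euclidean_space \<Rightarrow> 'b::euclidean_space)"
  shows "sqf \<alpha> f \<in> borel_measurable borel"
  unfolding sqf_def using Gsq_borel[OF assms] by measurable

context young_types
begin

text \<open>A Hardy type integral of the local norms; it dominates both the part of \<open>f\<close>
  near the ball and the part far from it.\<close>

definition J :: "('a::euclidean_space \<Rightarrow> 'b::euclidean_space) \<Rightarrow> 'a \<Rightarrow> real \<Rightarrow> ennreal" where
  "J f x0 r = (\<integral>\<^sup>+t\<in>{r<..}. luxemburg_norm_on \<Phi> (ball x0 t) f * ennreal (R TYPE('a) t / t) \<partial>lborel)"

lemma luxemburg_ball_borel[measurable]: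
  fixes f :: "'a::euclidean_space \<Rightarrow> 'b::euclidean_space"
  shows "(\<lambda>t. luxemburg_norm_on \<Phi> (ball x0 t) f) \<in> borel_measurable borel"
  by (intro mono_ennreal_borel monoI luxemburg_on_mono subset_ball)

lemma R_borel[measurable]: "R TYPE('a::euclidean_space) \<in> borel_measurable borel"
  by (rule measurable_compose[OF _ inv_borel]) measurable

text \<open>The stretch from \<open>2 * r\<close> to \<open>4 * r\<close> is enough: there the local
  norm is at least that over \<open>ball x0 (2 * r)\<close>, and \<open>R t / t\<close> is at least
  its value at \<open>4 * r\<close>. Doubling returns from \<open>4 * r\<close> to
  \<open>r\<close>.\<close>

lemma luxemburg_le_J:
  fixes f :: "'a::euclidean_space \<Rightarrow> 'b::euclidean_space"
  assumes r: "0 < r"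
  shows "ennreal (R TYPE('a) r) * luxemburg_norm_on \<Phi> (ball x0 (2 * r)) f \<le> ennreal (2 * 4 ^ DIM('a)) * J f x0 r"
proof -
  let ?N = "luxemburg_norm_on \<Phi> (ball x0 (2 * r)) f" and ?R = "R TYPE('a)"
  have "ennreal (?R (4 * r) / (4 * r)) * ennreal (2 * r) = ennreal (?R (4 * r) / 2)"
    using r R_pos[of "4 * r", where 'a='a] by (simp flip: ennreal_mult)
  then have "?N * ennreal (?R (4 * r) / 2) = ?N * ennreal (?R (4 * r) / (4 * r)) * ennreal (2 * r)" by (simp only: mult.assoc)
  also have "\<dots> = (\<integral>\<^sup>+t. ?N * ennreal (?R (4 * r) / (4 * r)) * indicator {2 * r..4 * r} t \<partial>lborel)"
    using r by (subst nn_integral_cmult_indicator) simp_all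
  also have "\<dots> \<le> J f x0 r"
    unfolding J_def
  proof (rule nn_integral_mono)
    fix t
    show "?N * ennreal (?R (4 * r) / (4 * r)) * indicator {2 * r..4 * r} t
      \<le> luxemburg_norm_on \<Phi> (ball x0 t) f * ennreal (?R t / t) * indicator {r<..} t"
    proof (cases "t \<in> {2 * r..4 * r}")
      case True
      have "?N * ennreal (?R (4 * r) / (4 * r)) \<le> luxemburg_norm_on \<Phi> (ball x0 t) f * ennreal (?R t / t)"
        using True r by (intro mult_mono luxemburg_on_mono subset_ball ennreal_leI frac_le R_antimono) auto
      then show ?thesis using True r by simp
    qed simp
  qed
  finally have le: "?N * ennreal (?R (4 * r) / 2) \<le> J f x0 r" .
  have "ennreal (?R r) * ?N \<le> ennreal (4 ^ DIM('a) * ?R (4 * r)) * ?N"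
    by (intro mult_right_mono ennreal_leI R_doubling r) simp
  also have "ennreal (4 ^ DIM('a) * ?R (4 * r)) = ennreal (2 * 4 ^ DIM('a)) * ennreal (?R (4 * r) / 2)"
    by (simp flip: ennreal_mult)
  also have "\<dots> * ?N = ennreal (2 * 4 ^ DIM('a)) * (?N * ennreal (?R (4 * r) / 2))" by (simp only: mult_ac)
  also have "\<dots> \<le> ennreal (2 * 4 ^ DIM('a)) * J f x0 r" by (intro mult_left_mono le) simp
  finally show ?thesis .
qed

text \<open>\<open>nn_integral_ball_le_R\<close> trades the mass of \<open>f\<close> on
  \<open>ball x0 s\<close> for \<open>s ^ n * R s\<close> times the local norm; against
  \<open>1 / s ^ (n + 1)\<close> this is the weight \<open>R s / s\<close> of
  \<open>J\<close>.\<close>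

lemma far_integral_le_J:
  fixes f :: "'a::euclidean_space \<Rightarrow> 'b::euclidean_space"
  assumes f: "f \<in> borel_measurable borel" and r: "0 < r"
  shows "(\<integral>\<^sup>+s\<in>{2 * r..}. (\<integral>\<^sup>+z\<in>ball x0 s. ennreal (norm (f z)) \<partial>lborel) * ennreal (1 / s ^ (DIM('a) + 1)) \<partial>lborel)
    \<le> ennreal (4 * max 1 (unit_ball_vol DIM('a))) * J f x0 r"
proof -
  define K where "K = 4 * max 1 (unit_ball_vol DIM('a))"
  have K: "0 < K" by (simp add: K_def max_def)
  have "(\<integral>\<^sup>+s\<in>{2 * r..}. (\<integral>\<^sup>+z\<in>ball x0 s. ennreal (norm (f z)) \<partial>lborel) * ennreal (1 / s ^ (DIM('a) + 1)) \<partial>lborel)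
    \<le> (\<integral>\<^sup>+s. ennreal K * (luxemburg_norm_on \<Phi> (ball x0 s) f * ennreal (R TYPE('a) s / s) * indicator {r<..} s) \<partial>lborel)"
  proof (rule nn_integral_mono)
    fix s :: real
    show "(\<integral>\<^sup>+z\<in>ball x0 s. ennreal (norm (f z)) \<partial>lborel) * ennreal (1 / s ^ (DIM('a) + 1)) * indicator {2 * r..} s
      \<le> ennreal K * (luxemburg_norm_on \<Phi> (ball x0 s) f * ennreal (R TYPE('a) s / s) * indicator {r<..} s)"
    proof (cases "2 * r \<le> s")
      case True
      then have s: "0 < s" "r < s" using r by auto
      have "(\<integral>\<^sup>+z\<in>ball x0 s. ennreal (norm (f z)) \<partial>lborel) * ennreal (1 / s ^ (DIM('a) + 1))
        \<le> ennreal (K * s ^ DIM('a) * R TYPE('a) s) * luxemburg_norm_on \<Phi> (ball x0 s) f * ennreal (1 / s ^ (DIM('a) + 1))"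
        unfolding K_def by (intro mult_right_mono nn_integral_ball_le_R f s) simp
      also have "\<dots> = (ennreal (K * s ^ DIM('a) * R TYPE('a) s) * ennreal (1 / s ^ (DIM('a) + 1))) * luxemburg_norm_on \<Phi> (ball x0 s) f"
        by (simp only: mult_ac)
      also have "ennreal (K * s ^ DIM('a) * R TYPE('a) s) * ennreal (1 / s ^ (DIM('a) + 1)) = ennreal (K * s ^ DIM('a) * R TYPE('a) s * (1 / s ^ (DIM('a) + 1)))"
        using s K by (intro ennreal_mult[symmetric]) auto
      also have "K * s ^ DIM('a) * R TYPE('a) s * (1 / s ^ (DIM('a) + 1)) = K * (R TYPE('a) s / s)"
        using s by simp
      also have "ennreal \<dots> = ennreal K * ennreal (R TYPE('a) s / s)" using s K by (intro ennreal_mult) auto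
      finally show ?thesis using True s by (simp add: mult_ac)
    qed simp
  qed
  also have "\<dots> = ennreal K * J f x0 r"
    unfolding J_def by (rule nn_integral_cmult) measurable
  finally show ?thesis by (simp add: K_def)
qed

end

context young_types
begin

lemma le_luxemburg_add:
  assumes K: "0 < K" and le: "\<And>l. 0 < l \<Longrightarrow> (\<integral>\<^sup>+x. \<Phi> (norm (f x) / l) \<partial>lborel) \<le> 1 \<Longrightarrow> X \<le> ennreal (K * l) + Y"
  shows "X \<le> ennreal K * luxemburg_norm \<Phi> f + Y"
proof (cases "Y = top")
  case False
  have "X - Y \<le> ennreal K * luxemburg_norm \<Phi> f"
  proof (rule le_luxemburg[OF K])
    fix l :: real assume "0 < l" "(\<integral>\<^sup>+x. \<Phi> (norm (f x) / l) \<partial>lborel) \<le> 1"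
    from le[OF this] show "X - Y \<le> ennreal (K * l)" using False by (simp add: ennreal_minus_le_iff add.commute)
  qed
  then show ?thesis using False by (simp add: ennreal_minus_le_iff add.commute)
qed simp

lemma luxemburg_finiteE:
  assumes "luxemburg_norm \<Phi> f < \<infinity>"
  obtains l where "0 < l" "(\<integral>\<^sup>+x. \<Phi> (norm (f x) / l) \<partial>lborel) \<le> 1"
  using assms unfolding luxemburg_norm_def nn_integral_completion by (auto simp: INF_less_iff)

text \<open>On the ball the square function is at most twice that of the near part plus a constant
  \<open>2 * c\<close>. The triangle inequality is carried out by hand as a convex combination
  inside \<open>\<Phi>\<close>: one argument is treated by the modular bound, the other is the
  constant \<open>\<rho>\<close>, for which \<open>\<Phi> \<rho> \<le> 1 / |B|\<close>.\<close>

theorem luxemburg_local_estimate: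
  assumes \<alpha>: "0 < \<alpha>"
  shows "\<exists>C>0. \<forall>(f :: 'a::euclidean_space \<Rightarrow> 'b::euclidean_space) x0 r. locint f \<longrightarrow> 0 < r \<longrightarrow> J f x0 r < \<infinity> \<longrightarrow>
    (AE x in lborel. x \<in> ball x0 r \<longrightarrow> Gsq \<alpha> f x < \<infinity>) \<and>
    ennreal (R TYPE('a) r) * luxemburg_norm_on \<Phi> (ball x0 r) (sqf \<alpha> f) \<le> ennreal C * J f x0 r"
proof -
  obtain Cm where Cm: "1 \<le> Cm" "\<And>f :: 'a \<Rightarrow> 'b. integrable lborel f \<Longrightarrow>
    (\<integral>\<^sup>+x. \<Phi> (sqf \<alpha> f x) \<partial>lborel) \<le> ennreal Cm * (\<integral>\<^sup>+x. \<Phi> (norm (f x)) \<partial>lborel)"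
    using modular_bound[OF \<alpha>] by blast
  define w where "w = unit_ball_vol DIM('a)"
  have w: "0 < w" by (simp add: w_def)
  \<comment> \<open>Square root of the constant in \<open>Gsq_far_le\<close>, times the constant in
    \<open>far_integral_le_J\<close>.\<close>
  define k where "k = sqrt (w * (2 * 8 ^ DIM('a) * 4 ^ DIM('a))) * (4 * max 1 w)"
  have k: "0 < k" using w by (simp add: k_def max_def)
  define C where "C = 2 * (Cm + 1) * (2 * 4 ^ DIM('a)) + 2 * k * max 1 w"
  have C: "0 < C" using Cm k by (simp add: C_def add_pos_pos max_def)
  show ?thesis
  proof (intro exI[of _ C] conjI C allI impI)
    fix f :: "'a \<Rightarrow> 'b" and x0 and r :: real
    assume f: "locint f" and r: "0 < r" and fin: "J f x0 r < \<infinity>"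
    define B where "B = ball x0 r"
    define f1 where "f1 z = indicator (ball x0 (2 * r)) z *\<^sub>R f z" for z
    define f2 where "f2 z = indicator (- ball x0 (2 * r)) z *\<^sub>R f z" for z
    have f1: "integrable lborel f1" unfolding f1_def by (rule locint_ball[OF f])
    note l1 = integrable_imp_locint[OF f1]
    have l2: "locint f2" unfolding f2_def by (intro locint_indicator f) auto
    have ff: "f = (\<lambda>z. f1 z + f2 z)" by (auto simp: f1_def f2_def indicator_def)
    obtain j where j: "J f x0 r = ennreal j" "0 \<le> j" using fin by (cases "J f x0 r") auto
    define c where "c = k * j"
    have c: "0 \<le> c" using k j by (simp add: c_def)
    have far: "Gsq \<alpha> f2 x \<le> ennreal (c\<^sup>2)" if "x \<in> B" for x
    proof -
      have "Gsq \<alpha> f2 x \<le> ennreal (w * (2 * 8 ^ DIM('a) * 4 ^ DIM('a))) * (ennreal (4 * max 1 w) * ennreal j)\<^sup>2"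
        unfolding f2_def w_def using far_integral_le_J[OF locint_measurable[OF f] r, of x0] that
        by (intro order_trans[OF Gsq_far_le[OF \<alpha> f _ r]] mult_left_mono power_mono) (auto simp: B_def j)
      also have "ennreal (4 * max 1 w) * ennreal j = ennreal (4 * max 1 w * j)"
        using j by (intro ennreal_mult[symmetric]) (auto simp: max_def)
      also have "\<dots>\<^sup>2 = ennreal ((4 * max 1 w * j)\<^sup>2)" using j by (intro ennreal_power) (auto simp: max_def)
      also have "ennreal (w * (2 * 8 ^ DIM('a) * 4 ^ DIM('a))) * ennreal ((4 * max 1 w * j)\<^sup>2) = ennreal (w * (2 * 8 ^ DIM('a) * 4 ^ DIM('a)) * (4 * max 1 w * j)\<^sup>2)"
        using w by (intro ennreal_mult[symmetric]) auto
      also have "w * (2 * 8 ^ DIM('a) * 4 ^ DIM('a)) * (4 * max 1 w * j)\<^sup>2 = c\<^sup>2"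
        using w by (simp add: c_def k_def power_mult_distrib)
      finally show ?thesis .
    qed
    have near: "AE x in lborel. Gsq \<alpha> f1 x < \<infinity>" by (rule AE_Gsq_finite[OF \<alpha> f1])
    then have main: "AE x in lborel. x \<in> B \<longrightarrow> Gsq \<alpha> f x < \<infinity> \<and> sqf \<alpha> f x \<le> 2 * sqf \<alpha> f1 x + 2 * c"
    proof eventually_elim
      case (elim x)
      show ?case
      proof
        assume "x \<in> B"
        from sqf_add_le[OF \<alpha> l1 l2 elim far[OF this] c]
        show "Gsq \<alpha> f x < \<infinity> \<and> sqf \<alpha> f x \<le> 2 * sqf \<alpha> f1 x + 2 * c" unfolding ff[symmetric] by blast
      qed
    qed
    then show "AE x in lborel. x \<in> ball x0 r \<longrightarrow> Gsq \<alpha> f x < \<infinity>" by eventually_elim (simp add: B_def)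
    define v where "v = w * r ^ DIM('a)"
    have v: "0 < v" "emeasure lborel B = ennreal v" using w r by (simp_all add: v_def B_def emeasure_ball w_def)
    define \<rho> where "\<rho> = ginv (1 / v)"
    have \<rho>: "0 < \<rho>" using v by (simp add: \<rho>_def inv_pos)
    have R\<rho>: "R TYPE('a) r \<le> max 1 w * \<rho>"
      using inv_volume_compare(2)[OF w, of "r ^ DIM('a)"] r by (simp add: \<rho>_def v_def)
    have lux: "luxemburg_norm_on \<Phi> B (sqf \<alpha> f) \<le> ennreal (2 * (Cm + 1) * l) + ennreal (2 * c / \<rho>)"
      if l: "0 < l" "(\<integral>\<^sup>+x. \<Phi> (norm (f1 x) / l) \<partial>lborel) \<le> 1" for l
    proof -
      define L1 where "L1 = 2 * Cm * l"
      \<comment> \<open>The summand \<open>l * \<rho>\<close> keeps \<open>L2\<close> positive when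
        \<open>c = 0\<close>; it only adds \<open>2 * l\<close> to the bound.\<close>
      define L2 where "L2 = 2 * (c + l * \<rho>) / \<rho>"
      have L: "0 < L1" "0 < L2" using Cm l c \<rho> by (simp_all add: L1_def L2_def add_nonneg_pos)
      \<comment> \<open>With these weights the near argument is \<open>a / (Cm * l)\<close>, where
        convexity gains the factor \<open>1 / Cm\<close> that cancels the modular constant, and the
        far argument is at most \<open>\<rho>\<close>. Both modulars are then at most 1.\<close>
      define \<theta> where "\<theta> = L2 / (L1 + L2)"
      have \<theta>: "\<theta> \<in> {0..1}" "1 - \<theta> = L1 / (L1 + L2)" using L by (auto simp: \<theta>_def field_simps)
      have pt: "\<Phi> ((2 * a + 2 * c) / (L1 + L2)) \<le> ennreal (1 - \<theta>) * (ennreal (1 / Cm) * \<Phi> (a / l)) + ennreal \<theta> * ennreal (1 / v)"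
        if a: "0 \<le> a" for a
      proof -
        have "(2 * a + 2 * c) / (L1 + L2) \<le> (1 - \<theta>) * (1 / Cm * (a / l)) + \<theta> * \<rho>"
        proof -
          have "(1 - \<theta>) * (1 / Cm * (a / l)) = 2 * a / (L1 + L2)" unfolding \<theta>(2) L1_def using Cm l by (simp add: field_simps)
          moreover have "\<theta> * \<rho> = 2 * (c + l * \<rho>) / (L1 + L2)" using \<rho> by (simp add: \<theta>_def L2_def)
          moreover have "2 * c / (L1 + L2) \<le> 2 * (c + l * \<rho>) / (L1 + L2)" using L l \<rho> by (intro divide_right_mono) auto
          ultimately show ?thesis by (simp add: add_divide_distrib)
        qed
        then have "\<Phi> ((2 * a + 2 * c) / (L1 + L2)) \<le> \<Phi> ((1 - \<theta>) * (1 / Cm * (a / l)) + \<theta> * \<rho>)"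
          using a c L by (intro mono) auto
        also have "\<dots> \<le> ennreal (1 - \<theta>) * \<Phi> (1 / Cm * (a / l)) + ennreal \<theta> * \<Phi> \<rho>"
          using a l \<rho> Cm \<theta>(1) by (intro convex) auto
        also have "\<dots> \<le> ennreal (1 - \<theta>) * (ennreal (1 / Cm) * \<Phi> (a / l)) + ennreal \<theta> * ennreal (1 / v)"
          using a l Cm v Phi_inv_le[of "1 / v"] unfolding \<rho>_def by (intro add_mono mult_left_mono scale_le) auto
        finally show ?thesis .
      qed
      have mS: "(\<lambda>x. \<Phi> (sqf \<alpha> f1 x / l)) \<in> borel_measurable lborel"
        using l sqf_borel[OF \<alpha> l1] by (intro borel_comp borel_measurable_divide) auto
      have S1: "(\<integral>\<^sup>+x. \<Phi> (sqf \<alpha> f1 x / l) \<partial>lborel) \<le> ennreal Cm"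
      proof -
        have "(\<integral>\<^sup>+x. \<Phi> (sqf \<alpha> f1 x / l) \<partial>lborel) = (\<integral>\<^sup>+x. \<Phi> (sqf \<alpha> (\<lambda>z. (1 / l) *\<^sub>R f1 z) x) \<partial>lborel)"
          using l by (subst sqf_scale[OF \<alpha> l1]) auto
        also have "\<dots> \<le> ennreal Cm * (\<integral>\<^sup>+x. \<Phi> (norm ((1 / l) *\<^sub>R f1 x)) \<partial>lborel)"
          by (intro Cm(2) integrable_scaleR_right f1)
        also have "\<dots> \<le> ennreal Cm * 1" using l by (intro mult_left_mono) simp_all
        finally show ?thesis by simp
      qed
      have "(\<integral>\<^sup>+x. \<Phi> (norm (indicator B x *\<^sub>R sqf \<alpha> f x) / (L1 + L2)) \<partial>lborel)
        \<le> (\<integral>\<^sup>+x. ennreal ((1 - \<theta>) / Cm) * \<Phi> (sqf \<alpha> f1 x / l) + ennreal (\<theta> / v) * indicator B x \<partial>lborel)"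
      proof (rule nn_integral_mono_AE)
        show "AE x in lborel. \<Phi> (norm (indicator B x *\<^sub>R sqf \<alpha> f x) / (L1 + L2)) \<le> ennreal ((1 - \<theta>) / Cm) * \<Phi> (sqf \<alpha> f1 x / l) + ennreal (\<theta> / v) * indicator B x"
          using main
        proof eventually_elim
          case (elim x)
          show ?case
          proof (cases "x \<in> B")
            case True
            then have "\<Phi> (norm (indicator B x *\<^sub>R sqf \<alpha> f x) / (L1 + L2)) \<le> \<Phi> ((2 * sqf \<alpha> f1 x + 2 * c) / (L1 + L2))"
              using elim L by (intro mono divide_right_mono) auto
            also note pt[of "sqf \<alpha> f1 x"]
            also have "ennreal (1 - \<theta>) * (ennreal (1 / Cm) * \<Phi> (sqf \<alpha> f1 x / l)) + ennreal \<theta> * ennreal (1 / v) =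
              ennreal ((1 - \<theta>) / Cm) * \<Phi> (sqf \<alpha> f1 x / l) + ennreal (\<theta> / v) * indicator B x"
            proof -
              have "ennreal ((1 - \<theta>) / Cm) = ennreal (1 - \<theta>) * ennreal (1 / Cm)" using \<theta>(1) Cm by (simp flip: ennreal_mult)
              moreover have "ennreal (\<theta> / v) = ennreal \<theta> * ennreal (1 / v)" using \<theta>(1) v by (simp flip: ennreal_mult)
              ultimately show ?thesis using True by (simp add: mult.assoc)
            qed
            finally show ?thesis by simp
          qed (simp add: at_0)
        qed
      qed
      also have "\<dots> = ennreal ((1 - \<theta>) / Cm) * (\<integral>\<^sup>+x. \<Phi> (sqf \<alpha> f1 x / l) \<partial>lborel) + ennreal (\<theta> / v) * ennreal v"
      proof -
        have [measurable]: "B \<in> sets borel" by (simp add: B_def)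
        have "(\<lambda>x. ennreal (\<theta> / v) * indicator B x) \<in> borel_measurable lborel" by measurable
        then show ?thesis using mS v by (simp add: nn_integral_add nn_integral_cmult nn_integral_cmult_indicator)
      qed
      also have "\<dots> \<le> ennreal ((1 - \<theta>) / Cm) * ennreal Cm + ennreal (\<theta> / v) * ennreal v"
        by (intro add_mono mult_left_mono S1) auto
      also have "\<dots> = ennreal (1 - \<theta>) + ennreal \<theta>" using \<theta>(1) Cm v by (simp flip: ennreal_mult)
      also have "\<dots> = 1" using \<theta>(1) by (simp flip: ennreal_plus)
      finally have "luxemburg_norm \<Phi> (\<lambda>x. indicator B x *\<^sub>R sqf \<alpha> f x) \<le> ennreal (L1 + L2)"
        using L by (intro luxemburg_le) auto
      also have "L1 + L2 = 2 * (Cm + 1) * l + 2 * c / \<rho>" using \<rho> by (simp add: L1_def L2_def field_simps)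
      also have "ennreal \<dots> = ennreal (2 * (Cm + 1) * l) + ennreal (2 * c / \<rho>)" using Cm l c \<rho> by (intro ennreal_plus) auto
      finally show ?thesis by (simp add: luxemburg_norm_on_def)
    qed
    have "luxemburg_norm_on \<Phi> B (sqf \<alpha> f) \<le> ennreal (2 * (Cm + 1)) * luxemburg_norm \<Phi> f1 + ennreal (2 * c / \<rho>)"
      by (rule le_luxemburg_add[OF _ lux]) (use Cm in auto)
    then have "ennreal (R TYPE('a) r) * luxemburg_norm_on \<Phi> B (sqf \<alpha> f) \<le>
      ennreal (R TYPE('a) r) * (ennreal (2 * (Cm + 1)) * luxemburg_norm \<Phi> f1 + ennreal (2 * c / \<rho>))"
      by (rule mult_left_mono) simp
    also have "\<dots> = ennreal (2 * (Cm + 1)) * (ennreal (R TYPE('a) r) * luxemburg_norm_on \<Phi> (ball x0 (2 * r)) f) + ennreal (R TYPE('a) r) * ennreal (2 * c / \<rho>)"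
      unfolding luxemburg_norm_on_def f1_def distrib_left by (simp only: mult_ac)
    also have "\<dots> \<le> ennreal (2 * (Cm + 1)) * (ennreal (2 * 4 ^ DIM('a)) * ennreal j) + ennreal (2 * k * max 1 w) * ennreal j"
    proof (intro add_mono mult_left_mono)
      show "ennreal (R TYPE('a) r) * luxemburg_norm_on \<Phi> (ball x0 (2 * r)) f \<le> ennreal (2 * 4 ^ DIM('a)) * ennreal j"
        using luxemburg_le_J[OF r] unfolding j(1)[symmetric] .
      have "ennreal (R TYPE('a) r) * ennreal (2 * c / \<rho>) = ennreal (R TYPE('a) r * (2 * c / \<rho>))"
        using c \<rho> by (intro ennreal_mult[symmetric]) auto
      also have "\<dots> \<le> ennreal (max 1 w * \<rho> * (2 * c / \<rho>))" using c \<rho> by (intro ennreal_leI mult_right_mono R\<rho>) auto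
      also have "max 1 w * \<rho> * (2 * c / \<rho>) = 2 * k * max 1 w * j" using \<rho> by (simp add: c_def)
      also have "ennreal \<dots> = ennreal (2 * k * max 1 w) * ennreal j" using k j w by (intro ennreal_mult) (auto simp: max_def)
      finally show "ennreal (R TYPE('a) r) * ennreal (2 * c / \<rho>) \<le> ennreal (2 * k * max 1 w) * ennreal j" .
    qed auto
    also have "\<dots> = (ennreal (2 * (Cm + 1)) * ennreal (2 * 4 ^ DIM('a)) + ennreal (2 * k * max 1 w)) * ennreal j"
      by (simp only: distrib_right mult.assoc)
    also have "ennreal (2 * (Cm + 1)) * ennreal (2 * 4 ^ DIM('a)) + ennreal (2 * k * max 1 w) = ennreal C"
      unfolding C_def using Cm k by (subst ennreal_mult[symmetric], simp, simp, subst ennreal_plus[symmetric]) (auto simp: max_def)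
    finally show "ennreal (R TYPE('a) r) * luxemburg_norm_on \<Phi> (ball x0 r) (sqf \<alpha> f) \<le> ennreal C * J f x0 r"
      by (simp add: B_def j)
  qed
qed

end

section \<open>Morrey spaces\<close>

lemma lebesgue_measurable_AE_eq_borel:
  fixes f :: "'a::euclidean_space \<Rightarrow> 'b::euclidean_space"
  assumes f: "f \<in> borel_measurable lebesgue"
  obtains f' where "f' \<in> borel_measurable borel" "AE x in lborel. f x = f' x"
proof -
  have "\<exists>g\<in>borel_measurable lborel. AE x in lborel. f x \<bullet> b = g x" for b
    using f by (intro completion_ex_borel_measurable_real) simp
  then obtain g :: "'b \<Rightarrow> 'a \<Rightarrow> real" where g: "\<And>b. g b \<in> borel_measurable lborel" "\<And>b. AE x in lborel. f x \<bullet> b = g b x" by metis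
  show thesis
  proof (rule that)
    show "(\<lambda>x. \<Sum>b\<in>Basis. g b x *\<^sub>R b) \<in> borel_measurable borel" using g(1) by simp
    have "AE x in lborel. \<forall>b\<in>Basis. f x \<bullet> b = g b x" using g(2) by (intro AE_finite_allI) auto
    then show "AE x in lborel. f x = (\<Sum>b\<in>Basis. g b x *\<^sub>R b)"
    proof eventually_elim
      case (elim x)
      have "f x = (\<Sum>b\<in>Basis. (f x \<bullet> b) *\<^sub>R b)" by (rule euclidean_representation[symmetric])
      then show ?case using elim by simp
    qed
  qed
qed

lemma orlicz_space_locD:
  fixes f :: "'a::euclidean_space \<Rightarrow> 'b::euclidean_space"
  assumes "f \<in> orlicz_space_loc \<Phi>"
  shows "f \<in> borel_measurable lebesgue" "integrable lebesgue (\<lambda>z. indicator (ball c r) z *\<^sub>R f z)"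
proof -
  have li: "locally_integrable (\<lambda>y. indicator (ball x r) y *\<^sub>R f y)" if "0 < r" for x r
    using assms that by (auto simp: orlicz_space_loc_def orlicz_space_def)
  show "f \<in> borel_measurable lebesgue"
  proof (rule borel_measurable_LIMSEQ_metric)
    show "(\<lambda>y. indicator (ball 0 (real (Suc k))) y *\<^sub>R f y) \<in> borel_measurable lebesgue" for k
      using li[of "real (Suc k)" 0] by (simp add: locally_integrable_def)
    fix x :: 'a
    obtain k0 where k0: "norm x < real k0" using reals_Archimedean2 by auto
    show "(\<lambda>k. indicator (ball 0 (real (Suc k))) x *\<^sub>R f x) \<longlonglongrightarrow> f x"
      by (rule tendsto_eventually, rule eventually_sequentiallyI[of k0]) (use k0 in auto)
  qed
  show "integrable lebesgue (\<lambda>z. indicator (ball c r) z *\<^sub>R f z)"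
  proof (cases "0 < r")
    case True
    have "set_integrable lebesgue (cball c r) (\<lambda>y. indicator (ball c r) y *\<^sub>R f y)"
      using li[OF True, of c] by (simp add: locally_integrable_def)
    moreover have "indicator (cball c r) z *\<^sub>R indicator (ball c r) z *\<^sub>R f z = indicator (ball c r) z *\<^sub>R f z" for z
      by (auto simp: indicator_def)
    ultimately show ?thesis by (simp only: set_integrable_def)
  qed (simp add: ball_empty)
qed

lemma locint_of_orlicz_space_loc:
  fixes f :: "'a::euclidean_space \<Rightarrow> 'b::euclidean_space"
  assumes f: "f \<in> orlicz_space_loc \<Phi>" and f': "f' \<in> borel_measurable borel" and ae: "AE x in lborel. f x = f' x"
  shows "locint f'"
  unfolding locint_def
proof (intro conjI allI)
  show "f' \<in> borel_measurable borel" by fact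
  fix c r
  note [measurable] = f'
  have m: "(\<lambda>z. indicator (ball c r) z *\<^sub>R f' z) \<in> borel_measurable lborel"
    using f' by (intro borel_measurable_scaleR borel_measurable_indicator) auto
  have "integrable lebesgue (\<lambda>z. indicator (ball c r) z *\<^sub>R f' z)"
  proof (rule integrable_cong_AE_imp[OF orlicz_space_locD(2)[OF f, of c r]])
    show "(\<lambda>z. indicator (ball c r) z *\<^sub>R f' z) \<in> borel_measurable lebesgue"
      by (rule measurable_completion[OF m])
    show "AE z in lebesgue. indicator (ball c r) z *\<^sub>R f z = indicator (ball c r) z *\<^sub>R f' z"
      using AE_completion[OF ae] by eventually_elim simp
  qed
  then show "integrable lborel (\<lambda>z. indicator (ball c r) z *\<^sub>R f' z)"
    using integrable_completion[OF m] by simp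
qed

text \<open>\<open>A_fun\<close> sees \<open>f\<close> only through integrals, so a change on a null
  set leaves the square function the same at every point.\<close>

lemma square_function_cong_AE:
  fixes f :: "'a::euclidean_space \<Rightarrow> 'b::euclidean_space"
  assumes \<alpha>: "0 < \<alpha>" and f: "f \<in> borel_measurable lebesgue" and f': "f' \<in> borel_measurable borel"
    and ae: "AE x in lborel. f x = f' x"
  shows "square_function \<alpha> f = square_function \<alpha> f'"
proof -
  have "A_fun \<alpha> f t y = A_fun \<alpha> f' t y" for t y
    unfolding A_fun_def
  proof (rule SUP_cong[OF refl])
    fix \<phi> :: "'a \<Rightarrow> real" assume \<phi>: "\<phi> \<in> C_class \<alpha>"
    have k: "(\<lambda>z. dilate t \<phi> (y - z)) \<in> borel_measurable lebesgue"
      by (rule measurable_completion) (use dilate_borel1[OF \<phi> \<alpha>] in simp)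
    have m: "f' \<in> borel_measurable lebesgue" by (rule measurable_completion) (use f' in simp)
    have "convol f (dilate t \<phi>) y = convol f' (dilate t \<phi>) y"
      unfolding convol_def
      by (rule integral_cong_AE) (use k f m AE_completion[OF ae] in \<open>auto elim: eventually_mono\<close>)
    then show "ennreal (norm (convol f (dilate t \<phi>) y)) = ennreal (norm (convol f' (dilate t \<phi>) y))" by simp
  qed
  then show ?thesis by (simp add: square_function_def[abs_def])
qed

lemma luxemburg_norm_on_cong_AE:
  fixes f f' :: "'a::euclidean_space \<Rightarrow> 'b::{banach, second_countable_topology}"
  assumes ae: "AE x in lborel. f x = f' x"
  shows "luxemburg_norm_on \<Phi> S f = luxemburg_norm_on \<Phi> S f'"
proof -
  have "(\<integral>\<^sup>+x. \<Phi> (norm (indicator S x *\<^sub>R f x) / l) \<partial>lborel) = (\<integral>\<^sup>+x. \<Phi> (norm (indicator S x *\<^sub>R f' x) / l) \<partial>lborel)" for l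
    using ae by (intro nn_integral_cong_AE) (auto elim: eventually_mono)
  then show ?thesis by (simp add: luxemburg_norm_on_def luxemburg_norm_def nn_integral_completion)
qed

lemma enn2real_square_function:
  fixes f :: "'a::euclidean_space \<Rightarrow> 'b::euclidean_space"
  shows "(\<lambda>x. enn2real (square_function \<alpha> f x)) = sqf \<alpha> f"
  by (auto simp: fun_eq_iff square_function_eq_Gsq ennreal_sqrt_def sqf_def)

context young_types
begin

text \<open>Since \<open>luxemburg_norm_on\<close> increases with the ball, the essential infimum of \<open>\<phi>\<close> over \<open>{t<..}\<close>
  already controls the norm over the ball of radius \<open>t\<close>.\<close>

lemma J_le_morrey_norm:
  fixes f :: "'a::euclidean_space \<Rightarrow> 'b::euclidean_space"
  assumes \<phi>1: "\<And>x r. 0 < r \<Longrightarrow> 0 < \<phi>1 x r" and fin: "morrey_norm \<Phi> \<phi>1 f < \<infinity>" and r: "0 < r" and c: "0 < c"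
    and le: "(\<integral>\<^sup>+t\<in>{r<..}.
              (essinf (lebesgue_on {t<..})
                 (\<lambda>s. ennreal (\<phi>1 x s) / gen_inverse \<Phi> (1 / s ^ DIM('a)))
               * gen_inverse \<Phi> (1 / t ^ DIM('a)) * ennreal (1 / t)) \<partial>lebesgue) \<le> ennreal c"
  shows "J f x r \<le> ennreal c * morrey_norm \<Phi> \<phi>1 f"
proof -
  define D where "D = morrey_norm \<Phi> \<phi>1 f"
  obtain d where d: "D = ennreal d" "0 \<le> d" using fin by (cases D) (auto simp: D_def)
  define N where "N s = luxemburg_norm_on \<Phi> (ball x s) f" for s
  have N: "N s \<le> ennreal (\<phi>1 x s / R TYPE('a) s) * D" if s: "0 < s" for s
  proof -
    have "inverse (ennreal (\<phi>1 x s)) * gen_inverse \<Phi> (1 / s ^ DIM('a)) * N s \<le> D"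
      unfolding D_def morrey_norm_def N_def using s by (intro SUP_upper2[of x] SUP_upper2[of s]) auto
    moreover have "inverse (ennreal (\<phi>1 x s)) = ennreal (1 / \<phi>1 x s)"
      using \<phi>1[OF s] by (subst inverse_ennreal) (auto simp: divide_inverse)
    ultimately have "ennreal (1 / \<phi>1 x s) * ennreal (R TYPE('a) s) * N s \<le> D" by (simp add: gen_inverse_eq)
    then have "ennreal (\<phi>1 x s / R TYPE('a) s) * (ennreal (1 / \<phi>1 x s) * ennreal (R TYPE('a) s) * N s) \<le> ennreal (\<phi>1 x s / R TYPE('a) s) * D"
      by (rule mult_left_mono) simp
    moreover have "ennreal (\<phi>1 x s / R TYPE('a) s) * (ennreal (1 / \<phi>1 x s) * ennreal (R TYPE('a) s)) = 1"
      using \<phi>1[OF s, of x] R_pos[OF s, where 'a='a] by (simp flip: ennreal_mult)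
    then have "ennreal (\<phi>1 x s / R TYPE('a) s) * (ennreal (1 / \<phi>1 x s) * ennreal (R TYPE('a) s) * N s) = N s"
      by (simp add: mult.assoc[symmetric])
    ultimately show ?thesis by simp
  qed
  show ?thesis
  \<comment> \<open>The general case divides by \<open>d\<close>. When the Morrey norm is 0, all
    local norms vanish and so does \<open>J\<close>.\<close>
  proof (cases "d = 0")
    case True
    then have "N s = 0" if "0 < s" for s using N[OF that] d by simp
    then have "J f x r = (\<integral>\<^sup>+t. 0 \<partial>(lborel :: real measure))"
      unfolding J_def N_def[symmetric] using r by (intro nn_integral_cong) (auto simp: indicator_def)
    then show ?thesis by simp
  next
    case False
    then have d0: "0 < d" using d by simp
    have "ennreal (1 / d) * J f x r = (\<integral>\<^sup>+t. ennreal (1 / d) * (N t * ennreal (R TYPE('a) t / t) * indicator {r<..} t) \<partial>lborel)"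
      unfolding J_def N_def by (rule nn_integral_cmult[symmetric]) measurable
    also have "\<dots> \<le> (\<integral>\<^sup>+t\<in>{r<..}.
              (essinf (lebesgue_on {t<..})
                 (\<lambda>s. ennreal (\<phi>1 x s) / gen_inverse \<Phi> (1 / s ^ DIM('a)))
               * gen_inverse \<Phi> (1 / t ^ DIM('a)) * ennreal (1 / t)) \<partial>lborel)"
    proof (rule nn_integral_mono)
      fix t :: real
      let ?e = "essinf (lebesgue_on {t<..}) (\<lambda>s. ennreal (\<phi>1 x s) / gen_inverse \<Phi> (1 / s ^ DIM('a)))"
      show "ennreal (1 / d) * (N t * ennreal (R TYPE('a) t / t) * indicator {r<..} t)
        \<le> ?e * gen_inverse \<Phi> (1 / t ^ DIM('a)) * ennreal (1 / t) * indicator {r<..} t"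
      proof (cases "r < t")
        case True
        then have t: "0 < t" using r by simp
        have "ennreal (1 / d) * N t \<le> ?e"
          unfolding essinf_def
        proof (rule Liminf_bounded, rule AE_I2)
          fix s assume "s \<in> space (lebesgue_on {t<..})"
          then have s: "t < s" "0 < s" using t by auto
          have "N t \<le> N s" unfolding N_def using s by (intro luxemburg_on_mono subset_ball) auto
          also have "N s \<le> ennreal (\<phi>1 x s / R TYPE('a) s) * ennreal d" using N[OF s(2)] d by simp
          finally have "ennreal (1 / d) * N t \<le> ennreal (1 / d) * (ennreal (\<phi>1 x s / R TYPE('a) s) * ennreal d)"
            by (rule mult_left_mono) simp
          also have "\<dots> = ennreal (\<phi>1 x s / R TYPE('a) s)"
            using d0 \<phi>1[OF s(2), of x] R_pos[OF s(2), where 'a='a] by (simp flip: ennreal_mult)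
          also have "\<dots> = ennreal (\<phi>1 x s) / gen_inverse \<Phi> (1 / s ^ DIM('a))"
            using \<phi>1[OF s(2), of x] R_pos[OF s(2), where 'a='a] by (simp add: gen_inverse_eq divide_ennreal)
          finally show "ennreal (1 / d) * N t \<le> ennreal (\<phi>1 x s) / gen_inverse \<Phi> (1 / s ^ DIM('a))" .
        qed
        then have "ennreal (1 / d) * N t * ennreal (R TYPE('a) t / t) \<le> ?e * ennreal (R TYPE('a) t / t)"
          by (rule mult_right_mono) simp
        moreover have "ennreal (R TYPE('a) t / t) = ennreal (R TYPE('a) t) * ennreal (1 / t)"
          using t by (simp flip: ennreal_mult)
        ultimately show ?thesis using True by (simp add: gen_inverse_eq mult.assoc)
      qed simp
    qed
    also have "\<dots> \<le> ennreal c" using le by (simp only: nn_integral_completion)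
    finally have "ennreal d * (ennreal (1 / d) * J f x r) \<le> ennreal d * ennreal c" by (rule mult_left_mono) simp
    moreover have "ennreal d * (ennreal (1 / d) * J f x r) = J f x r"
      using d0 by (simp flip: mult.assoc ennreal_mult)
    ultimately show ?thesis using d by (simp add: D_def[symmetric] mult.commute)
  qed
qed

end

theorem theorem3p5:
  fixes \<alpha> p0 p1 :: real
    and \<Phi> :: "real \<Rightarrow> ennreal"
    and \<phi>1 \<phi>2 :: "'a::euclidean_space \<Rightarrow> real \<Rightarrow> real"
  assumes "0 < \<alpha>" and "\<alpha> \<le> 1"
    and "young_function \<Phi>"
    and "1 < p0" and "p0 \<le> p1"
    and "lower_type p0 \<Phi>" and "upper_type p1 \<Phi>"
    and "weight \<phi>1" and "weight \<phi>2"
    and "\<exists>C>0. \<forall>x. \<forall>r>0.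
           (\<integral>\<^sup>+t\<in>{r<..}.
              (essinf (lebesgue_on {t<..})
                 (\<lambda>s. ennreal (\<phi>1 x s) / gen_inverse \<Phi> (1 / s ^ DIM('a)))
               * gen_inverse \<Phi> (1 / t ^ DIM('a)) * ennreal (1 / t)) \<partial>lebesgue)
           \<le> ennreal (C * \<phi>2 x r)"
  shows "\<exists>C'>0. \<forall>f :: 'a \<Rightarrow> 'b::{real_normed_field, euclidean_space}.
           f \<in> morrey_space \<Phi> \<phi>1 \<longrightarrow>
             (AE x in lebesgue. square_function \<alpha> f x < \<infinity>) \<and>
             (\<lambda>x. enn2real (square_function \<alpha> f x)) \<in> morrey_space \<Phi> \<phi>2 \<and>
             morrey_norm \<Phi> \<phi>2 (\<lambda>x. enn2real (square_function \<alpha> f x))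
               \<le> ennreal C' * morrey_norm \<Phi> \<phi>1 f"
proof -
  interpret young_types \<Phi> p0 p1 using assms by unfold_locales
  note \<alpha> = \<open>0 < \<alpha>\<close>
  have \<phi>1: "0 < \<phi>1 x r" and \<phi>2: "0 < \<phi>2 x r" if "0 < r" for x r
    using assms(8,9) that by (auto simp: weight_def)
  obtain C where C: "0 < C" and hyp: "\<And>x r. 0 < r \<Longrightarrow> (\<integral>\<^sup>+t\<in>{r<..}.
              (essinf (lebesgue_on {t<..})
                 (\<lambda>s. ennreal (\<phi>1 x s) / gen_inverse \<Phi> (1 / s ^ DIM('a)))
               * gen_inverse \<Phi> (1 / t ^ DIM('a)) * ennreal (1 / t)) \<partial>lebesgue)
           \<le> ennreal (C * \<phi>2 x r)"
    using assms(10) by auto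
  obtain E where E: "0 < E" and loc: "\<And>(f :: 'a \<Rightarrow> 'b) x0 r. locint f \<Longrightarrow> 0 < r \<Longrightarrow> J f x0 r < \<infinity> \<Longrightarrow>
    (AE x in lborel. x \<in> ball x0 r \<longrightarrow> Gsq \<alpha> f x < \<infinity>) \<and>
    ennreal (R TYPE('a) r) * luxemburg_norm_on \<Phi> (ball x0 r) (sqf \<alpha> f) \<le> ennreal E * J f x0 r"
    using luxemburg_local_estimate[OF \<alpha>] by blast
  show ?thesis
  proof (intro exI[of _ "E * C"] conjI allI impI)
    show "0 < E * C" using E C by simp
    fix f :: "'a \<Rightarrow> 'b" assume "f \<in> morrey_space \<Phi> \<phi>1"
    then have fo: "f \<in> orlicz_space_loc \<Phi>" and fm: "morrey_norm \<Phi> \<phi>1 f < \<infinity>" by (auto simp: morrey_space_def)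
    \<comment> \<open>From here on the Borel representative is used; square function, local norms
      and Morrey norm are those of \<open>f\<close>.\<close>
    obtain f' where f': "f' \<in> borel_measurable borel" "AE x in lborel. f x = f' x"
      by (rule lebesgue_measurable_AE_eq_borel[OF orlicz_space_locD(1)[OF fo]])
    have li: "locint f'" by (rule locint_of_orlicz_space_loc[OF fo f'])
    have sq: "square_function \<alpha> f = square_function \<alpha> f'"
      by (rule square_function_cong_AE[OF \<alpha> orlicz_space_locD(1)[OF fo] f'])
    have G: "(\<lambda>x. enn2real (square_function \<alpha> f x)) = sqf \<alpha> f'" unfolding sq by (rule enn2real_square_function)
    have mn: "morrey_norm \<Phi> \<phi>1 f = morrey_norm \<Phi> \<phi>1 f'"
      unfolding morrey_norm_def luxemburg_norm_on_cong_AE[OF f'(2)] ..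
    define D where "D = morrey_norm \<Phi> \<phi>1 f'"
    have D: "D < \<infinity>" using fm by (simp add: D_def mn)
    have JD: "J f' x r \<le> ennreal (C * \<phi>2 x r) * D" if "0 < r" for x r
      unfolding D_def using that C \<phi>2 D by (intro J_le_morrey_norm hyp) (auto simp: \<phi>1 D_def)
    have J: "J f' x r < \<infinity>" if "0 < r" for x r
      using order_le_less_trans[OF JD[OF that]] D by (auto simp: ennreal_mult_less_top)
    have lux: "ennreal (R TYPE('a) r) * luxemburg_norm_on \<Phi> (ball x r) (sqf \<alpha> f') \<le> ennreal E * J f' x r" if "0 < r" for x r
      using loc[OF li that J[OF that]] by blast
    have luxfin: "luxemburg_norm_on \<Phi> (ball x r) (sqf \<alpha> f') < \<infinity>" if "0 < r" for x r
    proof -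
      have "ennreal E * J f' x r < \<infinity>" using J[OF that] by (auto simp: ennreal_mult_less_top)
      from order_le_less_trans[OF lux[OF that] this] show ?thesis using R_pos[OF that, where 'a='a] by (auto simp: ennreal_mult_less_top)
    qed
    \<comment> \<open>The local estimate gives finiteness almost everywhere on one ball; countably
      many balls of integer radius exhaust the space.\<close>
    have "AE x in lborel. x \<in> ball 0 (real (Suc k)) \<longrightarrow> Gsq \<alpha> f' x < \<infinity>" for k
    proof -
      have k: "0 < real (Suc k)" by simp
      show ?thesis using loc[OF li k J[OF k]] by blast
    qed
    then have "AE x in lborel. \<forall>k. x \<in> ball 0 (real (Suc k)) \<longrightarrow> Gsq \<alpha> f' x < \<infinity>"
      unfolding AE_all_countable by blast
    then have "AE x in lborel. square_function \<alpha> f x < \<infinity>"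
    proof eventually_elim
      case (elim x)
      obtain k where "norm x < real k" using reals_Archimedean2 by auto
      then have "x \<in> ball 0 (real (Suc k))" by simp
      then show ?case using elim unfolding sq square_function_eq_Gsq by (auto simp: ennreal_sqrt_def)
    qed
    then show "AE x in lebesgue. square_function \<alpha> f x < \<infinity>" by (rule AE_completion)
    have bound: "morrey_norm \<Phi> \<phi>2 (sqf \<alpha> f') \<le> ennreal (E * C) * D"
      unfolding morrey_norm_def
    proof (intro SUP_least)
      fix x :: 'a and r :: real assume "r \<in> {0<..}"
      then have r: "0 < r" by simp
      have inv: "inverse (ennreal (\<phi>2 x r)) = ennreal (1 / \<phi>2 x r)"
        using \<phi>2[OF r] by (subst inverse_ennreal) (auto simp: divide_inverse)
      have "inverse (ennreal (\<phi>2 x r)) * gen_inverse \<Phi> (1 / r ^ DIM('a)) * luxemburg_norm_on \<Phi> (ball x r) (sqf \<alpha> f')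
        \<le> ennreal (1 / \<phi>2 x r) * (ennreal E * (ennreal (C * \<phi>2 x r) * D))"
        unfolding inv gen_inverse_eq mult.assoc
        by (intro mult_left_mono order_trans[OF lux[OF r]] JD r) auto
      also have "\<dots> = (ennreal (1 / \<phi>2 x r) * (ennreal E * ennreal (C * \<phi>2 x r))) * D" by (simp only: mult.assoc)
      also have "ennreal (1 / \<phi>2 x r) * (ennreal E * ennreal (C * \<phi>2 x r)) = ennreal (E * C)"
        using E C \<phi>2[OF r, of x] by (simp flip: ennreal_mult)
      finally show "inverse (ennreal (\<phi>2 x r)) * gen_inverse \<Phi> (1 / r ^ DIM('a)) * luxemburg_norm_on \<Phi> (ball x r) (sqf \<alpha> f') \<le> ennreal (E * C) * D" .
    qed
    then show "morrey_norm \<Phi> \<phi>2 (\<lambda>x. enn2real (square_function \<alpha> f x)) \<le> ennreal (E * C) * morrey_norm \<Phi> \<phi>1 f"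
      unfolding G by (simp add: D_def mn)
    show "(\<lambda>x. enn2real (square_function \<alpha> f x)) \<in> morrey_space \<Phi> \<phi>2"
      unfolding G morrey_space_def orlicz_space_loc_def
    proof (intro CollectI conjI allI impI)
      show "morrey_norm \<Phi> \<phi>2 (sqf \<alpha> f') < \<infinity>"
        by (rule order_le_less_trans[OF bound]) (use D in \<open>auto simp: ennreal_mult_less_top\<close>)
      fix x :: 'a and r :: real assume r: "0 < r"
      let ?u = "\<lambda>y. indicator (ball x r) y *\<^sub>R sqf \<alpha> f' y"
      have sm: "sqf \<alpha> f' \<in> borel_measurable borel" by (rule sqf_borel[OF \<alpha> li])
      have um: "?u \<in> borel_measurable lborel"
        using sm by (intro borel_measurable_scaleR borel_measurable_indicator) auto
      \<comment> \<open>The estimate of means by Luxemburg norms is now applied to the square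
        function itself: its finite norm on the ball makes it integrable there.\<close>
      have ui: "integrable lborel ?u"
      proof (rule integrableI_bounded[OF um])
        have "(\<integral>\<^sup>+y. ennreal (norm (?u y)) \<partial>lborel) = (\<integral>\<^sup>+y\<in>ball x r. ennreal (norm (sqf \<alpha> f' y)) \<partial>lborel)"
          by (intro nn_integral_cong) (simp add: indicator_def)
        also have "\<dots> < \<infinity>"
          by (rule order_le_less_trans[OF nn_integral_ball_le_R[OF sm r]])
            (use luxfin[OF r] in \<open>auto simp: ennreal_mult_less_top\<close>)
        finally show "(\<integral>\<^sup>+y. ennreal (norm (?u y)) \<partial>lborel) < \<infinity>" .
      qed
      have uil: "integrable lebesgue ?u" using ui integrable_completion[OF um] by simp
      have "locally_integrable ?u"
        unfolding locally_integrable_def set_integrable_def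
      proof (intro conjI allI impI)
        show "?u \<in> borel_measurable lebesgue" using uil by (rule borel_measurable_integrable)
        fix K :: "'a set" assume "compact K"
        then have "K \<in> sets borel" by (intro borel_closed compact_imp_closed)
        then have K: "K \<in> sets lebesgue" by simp
        show "integrable lebesgue (\<lambda>y. indicator K y *\<^sub>R ?u y)" by (rule integrable_mult_indicator[OF K uil])
      qed
      moreover obtain l where l: "0 < l" "(\<integral>\<^sup>+y. \<Phi> (norm (?u y) / l) \<partial>lborel) \<le> 1"
        using luxemburg_finiteE[of ?u] luxfin[OF r, of x] unfolding luxemburg_norm_on_def by blast
      \<comment> \<open>An admissible \<open>l\<close> for the finite Luxemburg norm provides the
        scaling \<open>1 / l\<close> required by \<open>orlicz_space\<close>.\<close>
      have "(\<integral>\<^sup>+y. \<Phi> (1 / l * norm (?u y)) \<partial>lebesgue) < \<infinity>"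
        unfolding nn_integral_completion using order_le_less_trans[OF l(2), of top] by simp
      then have "\<exists>k>0. (\<integral>\<^sup>+y. \<Phi> (k * norm (?u y)) \<partial>lebesgue) < \<infinity>"
        using l(1) by (intro exI[of _ "1 / l"]) simp
      ultimately show "?u \<in> orlicz_space \<Phi>" by (simp add: orlicz_space_def)
    qed
  qed
qed

end
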